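(* Let $d=2$, $\omega\ge 0$ and $t>0$, and let $\mathbf L_\omega=L_\omega-\omega$, where $L_\omega$ is the self-adjoint operator $\Delta_{S^2}+\omega^2r^2$ on $L^2(S^2,dV_{S^2};\mathbb R)$ defined in the context (its ground state energy is $\omega$). Then $$\operatorname{tr}\big(e^{-t\mathbf L_\omega}\big)=\sum_{m,n\ge 0}\mathbf m(m,n)\,e^{-t(\lambda_{m,n}-\omega)}=e^{t(\omega+\frac12)^2}\sum_{m,n\ge0}\mathbf m(m,n)\,e^{-t\left(m+\frac{n+1+\sqrt{n^2+4\omega^2}}{2}\right)^2},$$ where the sums are over integers $m,n\ge 0$, $$\lambda_{m,n}=\Big(m+\tfrac12\big(n+1+\sqrt{n^2+4\omega^2}\big)\Big)^2-\omega^2-\tfrac14,$$ and $\mathbf m(m,n)=1$ when $n=0$, $\mathbf m(m,n)=2$ when $n>0$.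
   Context: Identify the sphere $S^2$ minus a point with $\mathbb R^2$ by stereographic projection $(x_1,x_2,y)\mapsto x=(x_1,x_2)/(1-y)$, and let $r=|x|$. Let $dV_{S^2}$ be the area form and $\Delta_{S^2}$ the nonnegative Laplace–Beltrami operator of the round metric, which in these coordinates is $\frac{4}{(1+r^2)^2}$ times the Euclidean metric. The operator $L_\omega=\Delta_{S^2}+\omega^2r^2$ is realized as a self-adjoint operator as follows. Let $H=L^2(S^2,dV_{S^2};\mathbb R)$ and $$Q_\omega(f,g)=\int_{S^2}\big(df\wedge *dg+\omega^2r^2fg\,dV_{S^2}\big),$$ where $*$ is the Hodge star of the round metric, defined for $f,g$ in the dense subspace $E\subset H$ of functions $f$ on $S^2$ (with weak differential $df$) for which $Q_\omega(f,f)<\infty$. Then $D(L_\omega)$ is the set of $g\in E$ for which $f\mapsto Q_\omega(f,g)$ is continuous on $E$ in the norm of $H$, and $L_\omega g$ is determined by $Q_\omega(f,g)=\langle f,L_\omega g\rangle_H$ for all $f\in E$. The ground state energy is the smallest eigenvalue. *)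

theory Defs
  imports "HOL-Analysis.Analysis"
begin

section \<open>The round sphere in stereographic coordinates\<close>

text \<open>Points of the ambient space \<open>R^3\<close> are written \<open>(x, y)\<close> with \<open>x\<close> in \<open>R^2\<close>.\<close>

type_synonym point3 = "(real^2) \<times> real"

definition S2 :: "point3 set" where
  "S2 = sphere 0 1"

text \<open>\<open>stereo\<close> and \<open>stereo'\<close> are the projections from the poles \<open>(0, 1)\<close> and \<open>(0, -1)\<close>;
  \<open>unstereo\<close> and \<open>unstereo'\<close> are their inverses, defined on all of \<open>R^2\<close>.\<close>

definition stereo :: "point3 \<Rightarrow> real^2" where
  "stereo p = (1 / (1 - snd p)) *\<^sub>R fst p"

definition stereo' :: "point3 \<Rightarrow> real^2" where
  "stereo' p = (1 / (1 + snd p)) *\<^sub>R fst p"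

definition unstereo :: "real^2 \<Rightarrow> point3" where
  "unstereo x = ((2 / (1 + (norm x)\<^sup>2)) *\<^sub>R x, ((norm x)\<^sup>2 - 1) / (1 + (norm x)\<^sup>2))"

definition unstereo' :: "real^2 \<Rightarrow> point3" where
  "unstereo' x = ((2 / (1 + (norm x)\<^sup>2)) *\<^sub>R x, (1 - (norm x)\<^sup>2) / (1 + (norm x)\<^sup>2))"

lemma one_plus_norm_sq_pos: "1 + (norm (x::'a::real_normed_vector))\<^sup>2 > 0"
  by (simp add: add_pos_nonneg)

lemma one_plus_norm_sq_ne: "1 + (norm (x::'a::real_normed_vector))\<^sup>2 \<noteq> 0"
  using one_plus_norm_sq_pos[of x] by linarith

lemma unstereo_in_S2: "unstereo x \<in> S2"
proof -
  let ?s = "(norm x)\<^sup>2"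
  have s: "1 + ?s > 0" by (rule one_plus_norm_sq_pos)
  have "(norm (unstereo x))\<^sup>2 = (2 / (1 + ?s))\<^sup>2 * ?s + ((?s - 1) / (1 + ?s))\<^sup>2"
    by (simp add: unstereo_def norm_Pair power_mult_distrib power_divide)
  also have "\<dots> = (4 * ?s + (?s - 1)\<^sup>2) / (1 + ?s)\<^sup>2"
    by (simp add: power_divide add_divide_distrib)
  also have "4 * ?s + (?s - 1)\<^sup>2 = (1 + ?s)\<^sup>2"
    by (simp add: power2_eq_square algebra_simps)
  finally have "(norm (unstereo x))\<^sup>2 = 1" using s by simp
  then have "norm (unstereo x) = 1"
    using norm_ge_zero[of "unstereo x"] by (simp add: power2_eq_1_iff)
  then show ?thesis by (simp add: S2_def)
qed

lemma scaleR_inverse_cancel: "c > 0 \<Longrightarrow> (1 / (2 / c)) *\<^sub>R (2 / c) *\<^sub>R x = x" for x :: "'a::real_vector"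
  by simp

lemma stereo_unstereo: "stereo (unstereo x) = x"
proof -
  have "1 + (norm x)\<^sup>2 > 0" by (rule one_plus_norm_sq_pos)
  then have "1 - ((norm x)\<^sup>2 - 1) / (1 + (norm x)\<^sup>2) = 2 / (1 + (norm x)\<^sup>2)"
    by (simp add: divide_simps)
  then show ?thesis
    by (simp only: stereo_def unstereo_def fst_conv snd_conv scaleR_inverse_cancel[OF one_plus_norm_sq_pos])
qed

lemma stereo'_unstereo': "stereo' (unstereo' x) = x"
proof -
  have "1 + (norm x)\<^sup>2 > 0" by (rule one_plus_norm_sq_pos)
  then have "1 + (1 - (norm x)\<^sup>2) / (1 + (norm x)\<^sup>2) = 2 / (1 + (norm x)\<^sup>2)"
    by (simp add: divide_simps)
  then show ?thesis
    by (simp only: stereo'_def unstereo'_def fst_conv snd_conv scaleR_inverse_cancel[OF one_plus_norm_sq_pos])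
qed

text \<open>The round metric is \<open>conf x\<close> times the Euclidean metric in either chart. In dimension two
  the area density is therefore \<open>conf x\<close>, and the metric on covectors is the Euclidean one
  divided by \<open>conf x\<close>.\<close>

definition conf :: "real^2 \<Rightarrow> real" where
  "conf x = 4 / (1 + (norm x)\<^sup>2)\<^sup>2"

text \<open>The pole \<open>(0, 1)\<close>, which is not in the image of \<open>unstereo\<close>, is a null set.\<close>

definition dV :: "point3 measure" where
  "dV = distr (density lborel (\<lambda>x. ennreal (conf x))) (restrict_space borel S2) unstereo"

lemma unstereo_measurable:
  "unstereo \<in> density lborel (\<lambda>x. ennreal (conf x)) \<rightarrow>\<^sub>M restrict_space borel S2"
proof (rule measurable_restrict_space2)
  have "continuous_on UNIV unstereo"
    unfolding unstereo_def by (intro continuous_intros) (auto simp: one_plus_norm_sq_ne)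
  then show "unstereo \<in> density lborel (\<lambda>x. ennreal (conf x)) \<rightarrow>\<^sub>M borel"
    by (simp add: borel_measurable_continuous_onI)
qed (simp add: unstereo_in_S2)

section \<open>The Hilbert space of square-integrable functions\<close>

text \<open>Elements of the type are classes modulo equality almost everywhere.\<close>

definition sq_integrable :: "(point3 \<Rightarrow> real) \<Rightarrow> bool" where
  "sq_integrable u \<longleftrightarrow> u \<in> borel_measurable dV \<and> integrable dV (\<lambda>p. (u p)\<^sup>2)"

definition l2_eq :: "(point3 \<Rightarrow> real) \<Rightarrow> (point3 \<Rightarrow> real) \<Rightarrow> bool" where
  "l2_eq u v \<longleftrightarrow> sq_integrable u \<and> sq_integrable v \<and> (AE p in dV. u p = v p)"

lemma sq_integrable_measurable [measurable_dest]:
  "sq_integrable u \<Longrightarrow> u \<in> borel_measurable dV"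
  by (simp add: sq_integrable_def)

lemma sq_integrable_mult:
  assumes "sq_integrable u" "sq_integrable v"
  shows "integrable dV (\<lambda>p. u p * v p)"
proof (rule Bochner_Integration.integrable_bound)
  show "integrable dV (\<lambda>p. (u p)\<^sup>2 + (v p)\<^sup>2)"
    using assms by (simp add: sq_integrable_def)
  show "(\<lambda>p. u p * v p) \<in> borel_measurable dV"
    using assms by (intro borel_measurable_times) (auto simp: sq_integrable_def)
  have "\<bar>a * b\<bar> \<le> a\<^sup>2 + b\<^sup>2" for a b :: real
  proof -
    have "0 \<le> (\<bar>a\<bar> - \<bar>b\<bar>)\<^sup>2" by simp
    then have "2 * (\<bar>a\<bar> * \<bar>b\<bar>) \<le> a\<^sup>2 + b\<^sup>2"
      by (simp add: power2_diff)
    moreover have "0 \<le> \<bar>a\<bar> * \<bar>b\<bar>" by simp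
    ultimately show ?thesis unfolding abs_mult by linarith
  qed
  then show "AE p in dV. norm (u p * v p) \<le> norm ((u p)\<^sup>2 + (v p)\<^sup>2)"
    by (intro always_eventually allI) (simp add: order_trans[OF _ abs_ge_self])
qed

lemma sq_integrable_zero: "sq_integrable (\<lambda>_. 0)"
  by (simp add: sq_integrable_def)

lemma sq_integrable_scale: "sq_integrable u \<Longrightarrow> sq_integrable (\<lambda>p. c * u p)"
  by (auto simp: sq_integrable_def power_mult_distrib intro!: borel_measurable_times)

lemma sq_integrable_add:
  assumes "sq_integrable u" "sq_integrable v"
  shows "sq_integrable (\<lambda>p. u p + v p)"
proof -
  have "integrable dV (\<lambda>p. (u p)\<^sup>2 + (v p)\<^sup>2 + 2 * (u p * v p))"
    using assms sq_integrable_mult[OF assms]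
    by (auto simp: sq_integrable_def simp del: mult_2 mult_2_right)
  moreover have "(\<lambda>p. (u p)\<^sup>2 + (v p)\<^sup>2 + 2 * (u p * v p)) = (\<lambda>p. (u p + v p)\<^sup>2)"
    by (auto simp: power2_sum)
  ultimately show ?thesis
    using assms by (auto simp: sq_integrable_def intro!: borel_measurable_add)
qed

lemma sq_integrable_diff:
  assumes "sq_integrable u" "sq_integrable v"
  shows "sq_integrable (\<lambda>p. u p - v p)"
  using sq_integrable_add[OF assms(1) sq_integrable_scale[OF assms(2), of "-1"]] by simp

lemma l2_eq_refl_iff: "l2_eq u u \<longleftrightarrow> sq_integrable u"
  by (simp add: l2_eq_def)

quotient_type L2_S2 = "point3 \<Rightarrow> real" / partial: l2_eq
proof (rule part_equivpI)
  show "\<exists>u. l2_eq u u"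
    using sq_integrable_zero by (auto simp: l2_eq_refl_iff)
  show "symp l2_eq"
    by (auto simp: symp_def l2_eq_def elim: AE_mp)
  show "transp l2_eq"
  proof (rule transpI)
    fix u v w assume "l2_eq u v" "l2_eq v w"
    moreover from this have "AE p in dV. u p = w p"
      unfolding l2_eq_def by (auto elim: AE_mp)
    ultimately show "l2_eq u w" by (simp add: l2_eq_def)
  qed
qed

instantiation L2_S2 :: real_inner
begin

lift_definition zero_L2_S2 :: L2_S2 is "\<lambda>_. 0"
  by (simp add: l2_eq_def sq_integrable_zero)

lift_definition plus_L2_S2 :: "L2_S2 \<Rightarrow> L2_S2 \<Rightarrow> L2_S2" is "\<lambda>u v p. u p + v p"
  by (auto simp: l2_eq_def sq_integrable_add elim!: AE_mp)

lift_definition minus_L2_S2 :: "L2_S2 \<Rightarrow> L2_S2 \<Rightarrow> L2_S2" is "\<lambda>u v p. u p - v p"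
  by (auto simp: l2_eq_def sq_integrable_diff elim!: AE_mp)

lift_definition uminus_L2_S2 :: "L2_S2 \<Rightarrow> L2_S2" is "\<lambda>u p. - u p"
  by (auto simp: l2_eq_def sq_integrable_def elim!: AE_mp)

lift_definition scaleR_L2_S2 :: "real \<Rightarrow> L2_S2 \<Rightarrow> L2_S2" is "\<lambda>c u p. c * u p"
  by (auto simp: l2_eq_def sq_integrable_scale elim!: AE_mp)

lift_definition inner_L2_S2 :: "L2_S2 \<Rightarrow> L2_S2 \<Rightarrow> real" is "\<lambda>u v. \<integral>p. u p * v p \<partial>dV"
proof -
  fix u u' v v' assume "l2_eq u u'" "l2_eq v v'"
  then have [measurable]: "u \<in> borel_measurable dV" "u' \<in> borel_measurable dV"
      "v \<in> borel_measurable dV" "v' \<in> borel_measurable dV"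
    and "AE p in dV. u p * v p = u' p * v' p"
    by (auto simp: l2_eq_def sq_integrable_def elim!: AE_mp)
  then show "(\<integral>p. u p * v p \<partial>dV) = (\<integral>p. u' p * v' p \<partial>dV)"
    by (intro integral_cong_AE) auto
qed

definition norm_L2_S2 :: "L2_S2 \<Rightarrow> real" where
  "norm_L2_S2 f = sqrt (inner f f)"

definition dist_L2_S2 :: "L2_S2 \<Rightarrow> L2_S2 \<Rightarrow> real" where
  "dist_L2_S2 f g = norm (f - g)"

definition sgn_L2_S2 :: "L2_S2 \<Rightarrow> L2_S2" where
  "sgn_L2_S2 f = inverse (norm f) *\<^sub>R f"

definition uniformity_L2_S2 :: "(L2_S2 \<times> L2_S2) filter" where
  "uniformity_L2_S2 = (INF e\<in>{0<..}. principal {(f, g). dist f g < e})"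

definition open_L2_S2 :: "L2_S2 set \<Rightarrow> bool" where
  "open_L2_S2 U \<longleftrightarrow> (\<forall>f\<in>U. \<forall>\<^sub>F (f', g) in uniformity. f' = f \<longrightarrow> g \<in> U)"

instance
proof
  fix f g h :: L2_S2 and a b :: real
  show "f + g + h = f + (g + h)"
    by transfer (auto simp: l2_eq_def sq_integrable_add add.assoc)
  show "f + g = g + f"
    by transfer (auto simp: l2_eq_def sq_integrable_add add.commute)
  show "0 + f = f"
    by transfer (auto simp: l2_eq_def)
  show "- f + f = 0"
    by transfer (auto simp: l2_eq_def sq_integrable_zero)
  show "f - g = f + - g"
    by transfer (auto simp: l2_eq_def sq_integrable_diff)
  show "a *\<^sub>R (f + g) = a *\<^sub>R f + a *\<^sub>R g"
    by transfer (auto simp: l2_eq_def sq_integrable_add sq_integrable_scale distrib_left)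
  show "(a + b) *\<^sub>R f = a *\<^sub>R f + b *\<^sub>R f"
    by transfer (auto simp: l2_eq_def sq_integrable_add sq_integrable_scale distrib_right)
  show "a *\<^sub>R b *\<^sub>R f = (a * b) *\<^sub>R f"
    by transfer (auto simp: l2_eq_def sq_integrable_scale mult.assoc)
  show "1 *\<^sub>R f = f"
    by transfer (auto simp: l2_eq_def)
  show "sgn f = inverse (norm f) *\<^sub>R f"
    by (rule sgn_L2_S2_def)
  show "dist f g = norm (f - g)"
    by (rule dist_L2_S2_def)
  show "(uniformity :: (L2_S2 \<times> L2_S2) filter)
      = (INF e\<in>{0<..}. principal {(f, g). dist f g < e})"
    by (rule uniformity_L2_S2_def)
  show "open U \<longleftrightarrow> (\<forall>f\<in>U. \<forall>\<^sub>F (f', g) in uniformity. f' = f \<longrightarrow> g \<in> U)" for U :: "L2_S2 set"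
    by (rule open_L2_S2_def)
  show "inner f g = inner g f"
    by transfer (simp add: mult.commute)
  show "inner (f + g) h = inner f h + inner g h"
    by transfer (simp add: l2_eq_refl_iff distrib_right sq_integrable_mult)
  show "inner (a *\<^sub>R f) g = a * inner f g"
    by transfer (simp add: mult.assoc)
  show "0 \<le> inner f f"
    by transfer (simp add: integral_nonneg_AE)
  show "inner f f = 0 \<longleftrightarrow> f = 0"
  proof transfer
    fix u :: "point3 \<Rightarrow> real" assume "l2_eq u u"
    then have u: "sq_integrable u" by (simp add: l2_eq_refl_iff)
    then have "(\<integral>p. u p * u p \<partial>dV) = 0 \<longleftrightarrow> (AE p in dV. u p * u p = 0)"
      by (intro integral_nonneg_eq_0_iff_AE sq_integrable_mult) auto
    with u show "(\<integral>p. u p * u p \<partial>dV) = 0 \<longleftrightarrow> l2_eq u (\<lambda>_. 0)"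
      by (simp add: l2_eq_def sq_integrable_zero)
  qed
  show "norm f = sqrt (inner f f)"
    by (rule norm_L2_S2_def)
qed

end

section \<open>Weak differentials\<close>

text \<open>\<open>C_diff k \<phi>\<close>: all partial derivatives of order at most \<open>k\<close> exist and are continuous.\<close>

primrec C_diff :: "nat \<Rightarrow> (real^2 \<Rightarrow> real) \<Rightarrow> bool" where
  "C_diff 0 \<phi> \<longleftrightarrow> continuous_on UNIV \<phi>"
| "C_diff (Suc k) \<phi> \<longleftrightarrow> (\<forall>x. \<phi> differentiable (at x)) \<and>
     (\<forall>e\<in>Basis. C_diff k (\<lambda>x. frechet_derivative \<phi> (at x) e))"

definition test_function :: "(real^2 \<Rightarrow> real) \<Rightarrow> bool" where
  "test_function \<phi> \<longleftrightarrow> (\<forall>k. C_diff k \<phi>) \<and> compact (closure {x. \<phi> x \<noteq> 0})"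

definition locally_integrable :: "(real^2 \<Rightarrow> 'b::{banach, second_countable_topology}) \<Rightarrow> bool" where
  "locally_integrable u \<longleftrightarrow> (\<forall>K. compact K \<longrightarrow> set_integrable lborel K u)"

definition weak_gradient :: "(real^2 \<Rightarrow> real) \<Rightarrow> (real^2 \<Rightarrow> real^2) \<Rightarrow> bool" where
  "weak_gradient u v \<longleftrightarrow> locally_integrable u \<and> locally_integrable v \<and>
     (\<forall>\<phi> e. test_function \<phi> \<longrightarrow> e \<in> Basis \<longrightarrow>
        (\<integral>x. u x * frechet_derivative \<phi> (at x) e \<partial>lborel) = - (\<integral>x. (v x \<bullet> e) * \<phi> x \<partial>lborel))"

text \<open>Weak differentiability is local and the two charts cover the sphere; the second chart is
  what makes this a condition near the pole \<open>(0, 1)\<close> as well.\<close>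

definition weakly_differentiable :: "(point3 \<Rightarrow> real) \<Rightarrow> bool" where
  "weakly_differentiable u \<longleftrightarrow>
     (\<exists>v. weak_gradient (u \<circ> unstereo) v) \<and> (\<exists>v. weak_gradient (u \<circ> unstereo') v)"

text \<open>The components of \<open>du\<close> in the coordinates \<open>x = stereo p\<close>; they are unique almost
  everywhere.\<close>

definition differential :: "(point3 \<Rightarrow> real) \<Rightarrow> point3 \<Rightarrow> real^2" where
  "differential u p = (SOME v. weak_gradient (u \<circ> unstereo) v) (stereo p)"

section \<open>The form and the operator\<close>

text \<open>\<open>energy_density \<omega> u v\<close> is the density with respect to \<open>dV\<close> of the integrand of the form:
  \<open>du \<and> *dv\<close> equals \<open>dV\<close> times the inner product of \<open>du\<close> and \<open>dv\<close> in the metric on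
  covectors.\<close>

definition energy_density ::
  "real \<Rightarrow> (point3 \<Rightarrow> real) \<Rightarrow> (point3 \<Rightarrow> real) \<Rightarrow> point3 \<Rightarrow> real" where
  "energy_density \<omega> u v p =
     (differential u p \<bullet> differential v p) / conf (stereo p)
     + \<omega>\<^sup>2 * (norm (stereo p))\<^sup>2 * u p * v p"

text \<open>\<open>rep_L2_S2 f\<close> is some representative of the class \<open>f\<close>; the notions below do not depend on
  the choice. Since \<open>energy_density \<omega> u u\<close> is nonnegative, its integrability expresses that the
  form is finite.\<close>

definition form_domain :: "real \<Rightarrow> L2_S2 set" where
  "form_domain \<omega> = {f. weakly_differentiable (rep_L2_S2 f) \<and>
     integrable dV (energy_density \<omega> (rep_L2_S2 f) (rep_L2_S2 f))}"

definition form_Q :: "real \<Rightarrow> L2_S2 \<Rightarrow> L2_S2 \<Rightarrow> real" where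
  "form_Q \<omega> f g = (\<integral>p. energy_density \<omega> (rep_L2_S2 f) (rep_L2_S2 g) p \<partial>dV)"

definition L_domain :: "real \<Rightarrow> L2_S2 set" where
  "L_domain \<omega> = {g \<in> form_domain \<omega>. continuous_on (form_domain \<omega>) (\<lambda>f. form_Q \<omega> f g)}"

definition L_op :: "real \<Rightarrow> L2_S2 \<Rightarrow> L2_S2" where
  "L_op \<omega> g = (THE h. \<forall>f\<in>form_domain \<omega>. form_Q \<omega> f g = f \<bullet> h)"

section \<open>Eigenvalues, functional calculus and trace\<close>

text \<open>An unbounded operator is given by its domain \<open>D\<close> and a map \<open>A\<close>, of which only the values
  on \<open>D\<close> matter.\<close>

definition is_eigenvalue :: "'h::real_inner set \<Rightarrow> ('h \<Rightarrow> 'h) \<Rightarrow> real \<Rightarrow> bool" where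
  "is_eigenvalue D A \<mu> \<longleftrightarrow> (\<exists>f\<in>D. f \<noteq> 0 \<and> A f = \<mu> *\<^sub>R f)"

definition is_ground_state_energy :: "'h::real_inner set \<Rightarrow> ('h \<Rightarrow> 'h) \<Rightarrow> real \<Rightarrow> bool" where
  "is_ground_state_energy D A \<mu> \<longleftrightarrow>
     is_eigenvalue D A \<mu> \<and> (\<forall>\<nu>. is_eigenvalue D A \<nu> \<longrightarrow> \<mu> \<le> \<nu>)"

definition projection_valued_measure ::
  "(real set \<Rightarrow> ('h::real_inner \<Rightarrow>\<^sub>L 'h)) \<Rightarrow> bool" where
  "projection_valued_measure P \<longleftrightarrow>
     (\<forall>B\<in>sets borel. \<forall>f g. P B f \<bullet> g = f \<bullet> P B g) \<and>
     (\<forall>B\<in>sets borel. \<forall>C\<in>sets borel. \<forall>f. P (B \<inter> C) f = P B (P C f)) \<and>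
     (\<forall>f. P UNIV f = f) \<and>
     (\<forall>B. range B \<subseteq> sets borel \<longrightarrow> disjoint_family B \<longrightarrow>
        (\<forall>f. (\<lambda>n::nat. P (B n) f) sums P (\<Union>n. B n) f))"

definition scalar_measure ::
  "(real set \<Rightarrow> ('h::real_inner \<Rightarrow>\<^sub>L 'h)) \<Rightarrow> 'h \<Rightarrow> real measure" where
  "scalar_measure P f = measure_of UNIV (sets borel) (\<lambda>B. ennreal (f \<bullet> P B f))"

text \<open>\<open>A\<close> with domain \<open>D\<close> is the spectral integral of \<open>\<phi>\<close> against \<open>P\<close>. The integral against the
  signed measure \<open>B \<mapsto> g \<bullet> P B f\<close> is written by polarization; \<open>D\<close> is dense, so it determines
  \<open>A f\<close>.\<close>

definition is_spectral_integral ::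
  "(real set \<Rightarrow> ('h::real_inner \<Rightarrow>\<^sub>L 'h)) \<Rightarrow> (real \<Rightarrow> real) \<Rightarrow> 'h set \<Rightarrow> ('h \<Rightarrow> 'h) \<Rightarrow> bool" where
  "is_spectral_integral P \<phi> D A \<longleftrightarrow>
     D = {f. integrable (scalar_measure P f) (\<lambda>s. (\<phi> s)\<^sup>2)} \<and>
     (\<forall>f\<in>D. \<forall>g\<in>D. g \<bullet> A f =
        ((\<integral>s. \<phi> s \<partial>scalar_measure P (g + f)) - (\<integral>s. \<phi> s \<partial>scalar_measure P (g - f))) / 4)"

text \<open>\<open>T\<close> is the everywhere defined bounded operator \<open>\<phi>(A)\<close>, where \<open>A\<close> is self-adjoint with
  domain \<open>D\<close> and \<open>P\<close> is its spectral measure.\<close>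

definition is_function_of_operator ::
  "'h::real_inner set \<Rightarrow> ('h \<Rightarrow> 'h) \<Rightarrow> (real \<Rightarrow> real) \<Rightarrow> ('h \<Rightarrow>\<^sub>L 'h) \<Rightarrow> bool" where
  "is_function_of_operator D A \<phi> T \<longleftrightarrow>
     (\<exists>P. projection_valued_measure P \<and> is_spectral_integral P (\<lambda>s. s) D A \<and>
          is_spectral_integral P \<phi> UNIV (blinfun_apply T))"

definition orthonormal_basis :: "'h::real_inner set \<Rightarrow> bool" where
  "orthonormal_basis B \<longleftrightarrow>
     pairwise orthogonal B \<and> (\<forall>e\<in>B. norm e = 1) \<and> closure (span B) = UNIV"

text \<open>For a nonnegative self-adjoint operator, finiteness of the diagonal sum is the trace class
  property.\<close>

definition has_trace :: "('h::real_inner \<Rightarrow>\<^sub>L 'h) \<Rightarrow> real \<Rightarrow> bool" where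
  "has_trace T \<tau> \<longleftrightarrow>
     (\<forall>f g. T f \<bullet> g = f \<bullet> T g) \<and> (\<forall>f. 0 \<le> f \<bullet> T f) \<and>
     (\<exists>B::'h set. orthonormal_basis B) \<and>
     (\<forall>B. orthonormal_basis B \<longrightarrow> ((\<lambda>e. e \<bullet> T e) has_sum \<tau>) B)"

section \<open>Eigenvalue data\<close>

definition eigval :: "real \<Rightarrow> nat \<Rightarrow> nat \<Rightarrow> real" where
  "eigval \<omega> m n =
     (real m + (real n + 1 + sqrt ((real n)\<^sup>2 + 4 * \<omega>\<^sup>2)) / 2)\<^sup>2 - \<omega>\<^sup>2 - 1 / 4"

definition eigmult :: "nat \<Rightarrow> nat \<Rightarrow> real" where
  "eigmult m n = (if n = 0 then 1 else 2)"

end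

theory Submission
  imports Defs
begin

text \<open>In the chart \<open>x = stereo p\<close> the eigenvalue equation reads \<open>- \<Delta> u + \<omega>\<^sup>2 \<bar>x\<bar>\<^sup>2 c u = \<lambda> c u\<close>, where \<open>c\<close>
  is the conformal factor. Take \<open>u\<close> to be the real or imaginary part of \<open>(x\<^sub>1 + i x\<^sub>2)^n\<close> times a
  combination of the powers \<open>(1 + \<bar>x\<bar>\<^sup>2) powr - (a + k)\<close> with \<open>k \<le> m\<close>, where
  \<open>2 a = n + sqrt (n\<^sup>2 + 4 \<omega>\<^sup>2)\<close>, that is \<open>a\<^sup>2 - n a = \<omega>\<^sup>2\<close>. The equation then becomes a two-term
  recursion for the coefficients, which terminates exactly for \<open>\<lambda> = (a + m) (a + m + 1) - \<omega>\<^sup>2\<close>.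

  A logarithmic cutoff, available because a point of the sphere has capacity zero, approximates these
  functions by test functions in the form norm, so that the equation holds weakly against the whole
  form domain; this also gives orthogonality for different \<open>m\<close>, while for different angular parts
  it follows from the invariance of the measure under rotations. A function orthogonal to all of
  them is, by the Weierstrass theorem in the variable \<open>1 / (1 + \<bar>x\<bar>\<^sup>2)\<close> and a limit
  turning the exponent \<open>a\<close> into \<open>n\<close>, orthogonal to all polynomials on the sphere, and therefore zero.
  Since the form is closed, the operator is diagonal in the resulting orthonormal basis, hence so are
  its functions, whatever spectral measure is used to form them.\<close>

section \<open>Calculus of smooth functions on the plane\<close>

text \<open>In dimension two the Dirichlet integral is conformally invariant, so the form is that of
  the plane except for the weight \<open>conf\<close> on the terms of order zero, and the second
  chart enters only through the inversion. Near the excluded pole the potential grows like the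
  inverse square of the distance. Such a potential is critical: it changes the decay exponent of the
  eigenfunctions instead of being a small perturbation. Hence the exponent \<open>a\<close> need not
  be an integer, and completeness cannot be read off directly from that of the polynomials.

  The form domain asks for a weak gradient in each chart without relating the two. The predicate
  \<open>nice\<close> adds the relation given by the inversion. It survives limits in the energy
  norm and holds for test functions, hence for eigenfunctions and their linear combinations, along
  which closedness is applied. The weak eigenvalue equation, in contrast, must hold against every
  function of the form domain, bounded or not, which is why the decay of the gradients of the
  eigenfunctions is tracked.\<close>

definition pd :: "2 \<Rightarrow> (real^2 \<Rightarrow> real) \<Rightarrow> real^2 \<Rightarrow> real" where
  "pd i f x = frechet_derivative f (at x) (axis i 1)"

definition grad :: "(real^2 \<Rightarrow> real) \<Rightarrow> real^2 \<Rightarrow> real^2" where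
  "grad f x = (\<chi> i. pd i f x)"

definition smooth :: "(real^2 \<Rightarrow> real) \<Rightarrow> bool" where
  "smooth f \<longleftrightarrow> (\<forall>k. C_diff k f)"

lemma Basis_real2_iff: "e \<in> (Basis :: (real^2) set) \<longleftrightarrow> (\<exists>i. e = axis i 1)"
  by (auto simp: Basis_vec_def)

text \<open>From here on partial derivatives are addressed by an index of type \<open>2\<close>
  instead of a basis vector; the defining equation, which quantifies over \<open>Basis\<close>, is
  taken out of the simplifier below.\<close>

lemma C_diff_Suc_pd:
  "C_diff (Suc k) f \<longleftrightarrow> (\<forall>x. f differentiable (at x)) \<and> (\<forall>i. C_diff k (pd i f))"
proof -
  have "(\<forall>e\<in>Basis. P e) \<longleftrightarrow> (\<forall>i. P (axis i 1))" for P :: "real^2 \<Rightarrow> bool"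
    by (metis Basis_real2_iff)
  then show ?thesis
    by (simp add: pd_def [abs_def])
qed

declare C_diff.simps(2) [simp del]

lemma pd_eqI: "(f has_derivative f') (at x) \<Longrightarrow> pd i f x = f' (axis i 1)"
  by (metis frechet_derivative_at pd_def)

lemma C_diff_imp_continuous: "C_diff k f \<Longrightarrow> continuous_on UNIV f"
  by (cases k) (auto simp: C_diff_Suc_pd intro!: continuous_at_imp_continuous_on
      differentiable_imp_continuous_within)

lemma C_diff_Suc_imp: "C_diff (Suc k) f \<Longrightarrow> C_diff k f"
proof (induction k arbitrary: f)
  case 0
  then show ?case using C_diff_imp_continuous by fastforce
next
  case (Suc k)
  then show ?case by (metis C_diff_Suc_pd)
qed

lemma has_derivative_grad:
  assumes "f differentiable (at x)"
  shows "(f has_derivative (\<lambda>h. grad f x \<bullet> h)) (at x)"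
proof -
  have d: "(f has_derivative frechet_derivative f (at x)) (at x)"
    using assms frechet_derivative_works by blast
  then have "linear (frechet_derivative f (at x))"
    by (simp add: has_derivative_linear)
  moreover have h: "h = (\<Sum>i\<in>UNIV. (h $ i) *\<^sub>R axis i 1)" for h :: "real^2"
    by (simp add: vec_eq_iff axis_def if_distrib [of "\<lambda>t. _ * t"] cong: if_cong)
  ultimately have "frechet_derivative f (at x) h = (\<Sum>i\<in>UNIV. (h $ i) * pd i f x)" for h
  proof -
    assume l: "linear (frechet_derivative f (at x))"
    have "frechet_derivative f (at x) h = frechet_derivative f (at x) (\<Sum>i\<in>UNIV. (h $ i) *\<^sub>R axis i 1)"
      by (rule arg_cong [OF h])
    then show ?thesis
      by (simp only: linear_sum [OF l] linear_scale [OF l] real_scaleR_def pd_def)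
  qed
  then have "frechet_derivative f (at x) = (\<lambda>h. grad f x \<bullet> h)"
    by (simp add: fun_eq_iff inner_vec_def grad_def mult.commute)
  with d show ?thesis by simp
qed

lemma pd_const [simp]: "pd i (\<lambda>x. c) = (\<lambda>x. 0)"
  by (simp add: pd_def fun_eq_iff)

lemma pd_add_at:
  assumes "f differentiable (at x)" "g differentiable (at x)"
  shows "pd i (\<lambda>x. f x + g x) x = pd i f x + pd i g x"
  using pd_eqI [OF has_derivative_add [OF has_derivative_grad [OF assms(1)]
        has_derivative_grad [OF assms(2)]]]
  by (simp add: inner_axis grad_def)

lemma pd_mult_at:
  assumes "f differentiable (at x)" "g differentiable (at x)"
  shows "pd i (\<lambda>x. f x * g x) x = f x * pd i g x + pd i f x * g x"
  using pd_eqI [OF has_derivative_mult [OF has_derivative_grad [OF assms(1)]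
        has_derivative_grad [OF assms(2)]]]
  by (simp add: inner_axis grad_def)

lemma pd_compose_at:
  assumes "f differentiable (at x)" "(h has_real_derivative h') (at (f x))"
  shows "pd i (\<lambda>x. h (f x)) x = h' * pd i f x"
  using pd_eqI [OF has_derivative_compose [OF has_derivative_grad [OF assms(1)]
        assms(2) [unfolded has_field_derivative_def]]]
  by (simp add: inner_axis grad_def)

lemma differentiable_compose_real:
  fixes f :: "real^2 \<Rightarrow> real"
  assumes "f differentiable (at x)" "(h has_real_derivative h') (at (f x))"
  shows "(\<lambda>x. h (f x)) differentiable (at x)"
  using differentiableI [OF has_derivative_compose [OF has_derivative_grad [OF assms(1)]
        assms(2) [unfolded has_field_derivative_def]]] .

section \<open>Closure properties of smooth functions\<close>

lemma C_diff_const: "C_diff k (\<lambda>x. c)"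
  by (induction k arbitrary: c) (auto simp: C_diff_Suc_pd)

lemma C_diff_add: "C_diff k f \<Longrightarrow> C_diff k g \<Longrightarrow> C_diff k (\<lambda>x. f x + g x)"
proof (induction k arbitrary: f g)
  case (Suc k)
  then have "pd i (\<lambda>x. f x + g x) = (\<lambda>x. pd i f x + pd i g x)" for i
    by (auto simp: fun_eq_iff C_diff_Suc_pd pd_add_at)
  with Suc show ?case
    by (auto simp: C_diff_Suc_pd)
qed (auto intro: continuous_intros)

lemma C_diff_mult: "C_diff k f \<Longrightarrow> C_diff k g \<Longrightarrow> C_diff k (\<lambda>x. f x * g x)"
proof (induction k arbitrary: f g)
  case (Suc k)
  then have "pd i (\<lambda>x. f x * g x) = (\<lambda>x. f x * pd i g x + pd i f x * g x)" for i
    by (auto simp: fun_eq_iff C_diff_Suc_pd pd_mult_at)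
  moreover have "C_diff k f" "C_diff k g"
    using Suc.prems by (auto intro: C_diff_Suc_imp)
  ultimately show ?case
    using Suc by (auto simp: C_diff_Suc_pd intro!: C_diff_add)
qed (auto intro: continuous_intros)

lemma C_diff_coord: "C_diff k (\<lambda>x. x $ i)"
proof (cases k)
  case (Suc j)
  have d: "((\<lambda>x::real^2. x $ i) has_derivative (\<lambda>h. h $ i)) (at x)" for x
    by (rule bounded_linear_imp_has_derivative [OF bounded_linear_vec_nth])
  have "pd l (\<lambda>x. x $ i) = (\<lambda>x. axis l 1 $ i)" for l
    using pd_eqI [OF d] by (simp add: fun_eq_iff)
  with Suc d show ?thesis
    by (auto simp: C_diff_Suc_pd C_diff_const differentiable_def)
qed (auto intro: continuous_intros)

lemma pd_coord: "pd l (\<lambda>x. x $ i) (x :: real^2) = (if l = i then 1 else 0)"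
  using pd_eqI [OF bounded_linear_imp_has_derivative [OF bounded_linear_vec_nth], of l i x]
  by (simp add: axis_def)

text \<open>The whole sequence \<open>hs\<close> of successive derivatives of the outer function is
  carried along: differentiating \<open>hs j (u x)\<close> produces \<open>hs (Suc j) (u x)\<close>,
  so the induction on \<open>k\<close> has to range over all \<open>j\<close>. The set
  \<open>S\<close> is where the outer function is differentiable, for instance the positive
  half-line for logarithms and powers.\<close>

lemma C_diff_compose:
  assumes "\<And>j y. y \<in> S \<Longrightarrow> (hs j has_real_derivative hs (Suc j) y) (at y)" "\<And>x. u x \<in> S"
  shows "C_diff k u \<Longrightarrow> C_diff k (\<lambda>x. hs j (u x))"
proof (induction k arbitrary: j)
  case 0
  have "continuous_on S (hs j)"
    using assms(1) by (meson DERIV_isCont continuous_at_imp_continuous_on)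
  then show ?case
    using 0 assms(2) by (auto intro: continuous_on_compose2)
next
  case (Suc k)
  then have "u differentiable (at x)" for x by (simp add: C_diff_Suc_pd)
  then have "pd i (\<lambda>x. hs j (u x)) = (\<lambda>x. hs (Suc j) (u x) * pd i u x)"
      "(\<lambda>x. hs j (u x)) differentiable (at x)" for i x
    using pd_compose_at [of u _ "hs j", OF _ assms(1) [OF assms(2)]]
      differentiable_compose_real [of u _ "hs j", OF _ assms(1) [OF assms(2)]]
    by (simp_all add: fun_eq_iff)
  moreover have "C_diff k u" using Suc.prems by (rule C_diff_Suc_imp)
  ultimately show ?case
    using Suc by (auto simp: C_diff_Suc_pd intro!: C_diff_mult)
qed

lemma smooth_const [intro, simp]: "smooth (\<lambda>x. c)"
  and smooth_add [intro]: "smooth f \<Longrightarrow> smooth g \<Longrightarrow> smooth (\<lambda>x. f x + g x)"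
  and smooth_mult [intro]: "smooth f \<Longrightarrow> smooth g \<Longrightarrow> smooth (\<lambda>x. f x * g x)"
  and smooth_coord [intro, simp]: "smooth (\<lambda>x. x $ i)"
  by (auto simp: smooth_def C_diff_const C_diff_add C_diff_mult C_diff_coord)

lemma smooth_diff [intro]: "smooth f \<Longrightarrow> smooth g \<Longrightarrow> smooth (\<lambda>x. f x - g x)"
  using smooth_add [OF _ smooth_mult [OF smooth_const [of "-1"]]] by simp

lemma smooth_sum [intro]: "(\<And>j. j \<in> J \<Longrightarrow> smooth (f j)) \<Longrightarrow> smooth (\<lambda>x. \<Sum>j\<in>J. f j x)"
  by (induction J rule: infinite_finite_induct) auto

lemma smooth_prod [intro]: "(\<And>j. j \<in> J \<Longrightarrow> smooth (f j)) \<Longrightarrow> smooth (\<lambda>x. \<Prod>j\<in>J. f j x)"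
  by (induction J rule: infinite_finite_induct) auto

lemma smooth_power [intro]: "smooth f \<Longrightarrow> smooth (\<lambda>x. f x ^ n)"
  by (induction n) auto

lemma smooth_compose:
  assumes "\<And>j y. y \<in> S \<Longrightarrow> (hs j has_real_derivative hs (Suc j) y) (at y)" "\<And>x. u x \<in> S"
    "smooth u"
  shows "smooth (\<lambda>x. hs j (u x))"
  using C_diff_compose [where hs = hs and u = u and S = S and j = j] assms
  by (simp add: smooth_def)

lemma smooth_imp_differentiable: "smooth f \<Longrightarrow> f differentiable (at x)"
  unfolding smooth_def using C_diff_Suc_pd by blast

lemma smooth_imp_continuous: "smooth f \<Longrightarrow> continuous_on S f"
  using C_diff_imp_continuous continuous_on_subset by (fastforce simp: smooth_def)

lemma smooth_pd [intro]: "smooth f \<Longrightarrow> smooth (pd i f)"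
  unfolding smooth_def by (meson C_diff_Suc_pd)

lemma pd_add: "smooth f \<Longrightarrow> smooth g \<Longrightarrow> pd i (\<lambda>x. f x + g x) x = pd i f x + pd i g x"
  by (simp add: pd_add_at smooth_imp_differentiable)

lemma pd_mult: "smooth f \<Longrightarrow> smooth g \<Longrightarrow> pd i (\<lambda>x. f x * g x) x = f x * pd i g x + pd i f x * g x"
  by (simp add: pd_mult_at smooth_imp_differentiable)

lemma pd_cmult: "smooth g \<Longrightarrow> pd i (\<lambda>x. c * g x) x = c * pd i g x"
  using pd_mult [of "\<lambda>x. c" g i x] by simp

lemma smooth_ln:
  assumes "smooth u" "\<And>x. u x > 0"
  shows "smooth (\<lambda>x. ln (u x))"
proof -
  define hs where "hs = (\<lambda>j::nat. case j of 0 \<Rightarrow> ln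
    | Suc i \<Rightarrow> (\<lambda>y::real. (-1) ^ i * fact i * inverse y ^ Suc i))"
  have "(hs j has_real_derivative hs (Suc j) y) (at y)" if "y \<in> {0<..}" for j y
  proof (cases j)
    case 0
    with that show ?thesis
      using DERIV_ln [of y] by (simp add: hs_def)
  next
    case (Suc i)
    have "((\<lambda>y. inverse y ^ Suc i) has_real_derivative
        real (Suc i) * (- (inverse y ^ 2) * inverse y ^ i)) (at y)"
      using DERIV_power [OF DERIV_inverse, of y "Suc i"] that
      by (simp add: numeral_2_eq_2 mult.assoc)
    from DERIV_cmult [OF this, of "(-1) ^ i * fact i"] Suc show ?thesis
      by (simp add: hs_def algebra_simps power2_eq_square)
  qed
  from smooth_compose [of "{0<..}" hs, OF this, of u 0] assms show ?thesis
    by (simp add: hs_def)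
qed

lemma smooth_powr:
  assumes "smooth u" "\<And>x. u x > 0"
  shows "smooth (\<lambda>x. u x powr b)"
proof -
  define hs where "hs = (\<lambda>(j::nat) (y::real). (\<Prod>i<j. b - real i) * y powr (b - real j))"
  have "(hs j has_real_derivative hs (Suc j) y) (at y)" if "y \<in> {0<..}" for j y
    using DERIV_cmult [OF has_real_derivative_powr [of y "b - real j"], of "\<Prod>i<j. b - real i"] that
    by (simp add: hs_def algebra_simps)
  from smooth_compose [of "{0<..}" hs, OF this, of u 0] assms show ?thesis
    by (simp add: hs_def)
qed

subsection \<open>A flat function\<close>

text \<open>The classical function exp (-1/s), extended by zero, with a polynomial factor in 1/s.
  The factor makes the class closed under differentiation, with \<open>flat_next\<close> giving the
  polynomial of the derivative, so one computation yields derivatives of all orders.\<close>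

definition flat :: "real poly \<Rightarrow> real \<Rightarrow> real" where
  "flat q s = (if s > 0 then poly q (1 / s) * exp (- (1 / s)) else 0)"

definition flat_next :: "real poly \<Rightarrow> real poly" where
  "flat_next q = monom 1 2 * (q - pderiv q)"

lemma poly_exp_tendsto_0: "((\<lambda>y. poly q y * exp (- y)) \<longlongrightarrow> (0::real)) at_top"
proof -
  have "((\<lambda>y. \<Sum>i\<le>degree q. coeff q i * (y ^ i / exp y)) \<longlongrightarrow> (\<Sum>i\<le>degree q. coeff q i * 0)) at_top"
    by (intro tendsto_intros tendsto_power_div_exp_0)
  then show ?thesis
    by (simp add: poly_altdef exp_minus sum_distrib_right divide_inverse mult.assoc)
qed

lemma flat_has_derivative: "(flat q has_real_derivative flat (flat_next q) s) (at s)"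
proof -
  consider "s > 0" | "s < 0" | "s = 0" by linarith
  then show ?thesis
  proof cases
    case 1
    have "((\<lambda>s. poly q (1 / s) * exp (- (1 / s))) has_real_derivative flat (flat_next q) s) (at s)"
    proof -
      have i: "((\<lambda>s. 1 / s) has_real_derivative - (1 / s)\<^sup>2) (at s)"
        using DERIV_inverse [of s] 1 by (simp add: divide_inverse power2_eq_square)
      have "((\<lambda>s. poly q (1 / s)) has_real_derivative poly (pderiv q) (1 / s) * (- (1 / s)\<^sup>2)) (at s)"
        by (rule DERIV_chain2 [OF poly_DERIV i])
      moreover have "((\<lambda>s. exp (- (1 / s))) has_real_derivative exp (- (1 / s)) * (1 / s)\<^sup>2) (at s)"
        using DERIV_fun_exp [OF DERIV_minus [OF i]] by simp
      ultimately have "((\<lambda>s. poly q (1 / s) * exp (- (1 / s))) has_real_derivative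
          poly (pderiv q) (1 / s) * (- (1 / s)\<^sup>2) * exp (- (1 / s)) +
          exp (- (1 / s)) * (1 / s)\<^sup>2 * poly q (1 / s)) (at s)"
        by (rule DERIV_mult)
      then show ?thesis
        using 1 by (simp add: flat_def flat_next_def poly_monom algebra_simps del: power_one_over)
    qed
    moreover have "eventually (\<lambda>t. t \<in> {0<..}) (nhds s)"
      by (rule eventually_nhds_in_open) (use 1 in auto)
    then have "\<forall>\<^sub>F t in nhds s. flat q t = poly q (1 / t) * exp (- (1 / t))"
      by eventually_elim (simp add: flat_def)
    ultimately show ?thesis by (simp add: DERIV_cong_ev)
  next
    case 2
    have "eventually (\<lambda>t. t \<in> {..<0}) (nhds s)"
      by (rule eventually_nhds_in_open) (use 2 in auto)
    then have "\<forall>\<^sub>F t in nhds s. flat q t = 0"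
      by eventually_elim (simp add: flat_def)
    then show ?thesis
      using 2 by (simp add: DERIV_cong_ev [OF refl _ refl] flat_def)
  next
    case 3
    \<comment> \<open>\<open>pCons 0 q\<close> is the polynomial y q(y). With y = 1/s this
      expression is the difference quotient of \<open>flat q\<close> at 0 from the right.\<close>
    have "((\<lambda>y. poly (pCons 0 q) y * exp (- y)) \<longlongrightarrow> 0) at_top"
      by (rule poly_exp_tendsto_0)
    then have "((\<lambda>y. poly (pCons 0 q) (inverse y) * exp (- inverse y)) \<longlongrightarrow> 0) (at_right 0)"
      by (rule filterlim_compose) (rule filterlim_inverse_at_top_right)
    moreover have "\<forall>\<^sub>F y in at_right 0.
        poly (pCons 0 q) (inverse y) * exp (- inverse y) = (flat q y - flat q 0) / (y - 0)"
      using eventually_at_right_less [of "0::real"]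
      by eventually_elim (simp add: flat_def field_simps)
    ultimately have "((\<lambda>y. (flat q y - flat q 0) / (y - 0)) \<longlongrightarrow> 0) (at_right 0)"
      by (rule Lim_transform_eventually)
    moreover have "\<forall>\<^sub>F y in at_left 0. (flat q y - flat q 0) / (y - 0) = 0"
      by (auto simp: eventually_at_filter flat_def)
    then have "((\<lambda>y. (flat q y - flat q 0) / (y - 0)) \<longlongrightarrow> 0) (at_left 0)"
      by (rule tendsto_eventually)
    ultimately show ?thesis
      unfolding has_field_derivative_iff using 3
      by (simp add: filterlim_split_at flat_def)
  qed
qed

definition bump :: "real \<Rightarrow> real" where
  "bump = flat 1"

definition bump' :: "real \<Rightarrow> real" where
  "bump' = flat (flat_next 1)"

lemma bump_has_derivative: "(bump has_real_derivative bump' s) (at s)"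
  unfolding bump_def bump'_def by (rule flat_has_derivative)

lemma smooth_bump:
  assumes "smooth u"
  shows "smooth (\<lambda>x. bump (u x))"
  using smooth_compose [of UNIV "\<lambda>j. flat ((flat_next ^^ j) 1)" u 0] assms flat_has_derivative
  by (simp add: bump_def)

lemma bump_nonneg: "0 \<le> bump s" and bump_le_1: "bump s \<le> 1"
  and bump_eq_0: "s \<le> 0 \<Longrightarrow> bump s = 0" and bump'_eq_0: "s \<le> 0 \<Longrightarrow> bump' s = 0"
  by (auto simp: bump_def bump'_def flat_def)

lemma bump_1: "bump 1 = exp (- 1)"
  by (simp add: bump_def flat_def)

lemma bump_mono: "s \<le> t \<Longrightarrow> bump s \<le> bump t"
  by (auto simp: bump_def flat_def frac_le)

text \<open>The cutoff below evaluates \<open>bump'\<close> only at arguments at most 1, where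
  compactness of {0..1} gives the bound.\<close>

lemma bump'_bounded: "\<exists>C\<ge>0. \<forall>s\<le>1. \<bar>bump' s\<bar> \<le> C"
proof -
  have "continuous_on {0..1} bump'"
    unfolding bump'_def by (meson DERIV_isCont flat_has_derivative continuous_at_imp_continuous_on)
  then have "bounded (bump' ` {0..1})"
    using compact_continuous_image compact_imp_bounded by blast
  then obtain C where "\<And>s. s \<in> {0..1} \<Longrightarrow> \<bar>bump' s\<bar> \<le> C"
    unfolding bounded_iff by (metis imageI real_norm_def)
  then have "\<bar>bump' s\<bar> \<le> max C 0" if "s \<le> 1" for s
    using that bump'_eq_0 [of s] by (cases "s \<le> 0") (auto intro: order_trans [of _ C])
  then show ?thesis by (metis max.cobounded2)
qed

text \<open>Since \<open>bump\<close> tends to 1 at infinity and vanishes on the negative axis,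
  rescaling gives smooth approximations from below to the indicator of the positive
  half-line.\<close>

lemma bump_scaled_tendsto: "(\<lambda>n. bump (real n * s)) \<longlonglongrightarrow> (if s > 0 then 1 else 0)"
proof (cases "s > 0")
  case True
  have "(\<lambda>n. exp (- ((1 / s) * inverse (real n)))) \<longlonglongrightarrow> exp (- ((1 / s) * 0))"
    by (intro tendsto_intros lim_inverse_n)
  moreover have "\<forall>\<^sub>F n in sequentially. exp (- ((1 / s) * inverse (real n))) = bump (real n * s)"
    using eventually_gt_at_top [of 0]
    by eventually_elim (use True in \<open>simp add: bump_def flat_def field_simps\<close>)
  ultimately show ?thesis
    using True Lim_transform_eventually by fastforce
next
  case False
  then have "bump (real n * s) = 0" for n
    by (intro bump_eq_0) (simp add: mult_nonneg_nonpos)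
  with False show ?thesis by simp
qed

subsection \<open>Test functions\<close>

text \<open>Compact support in a form that passes through products and derivatives without handling
  closures.\<close>

definition bsupp :: "('a::real_normed_vector \<Rightarrow> 'b::zero) \<Rightarrow> bool" where
  "bsupp f \<longleftrightarrow> (\<exists>R. \<forall>x. norm x > R \<longrightarrow> f x = 0)"

lemma bsupp_iff_compact: "bsupp f \<longleftrightarrow> compact (closure {x. f x \<noteq> (0::real)})"
  for f :: "real^2 \<Rightarrow> real"
proof -
  have "bsupp f \<longleftrightarrow> bounded {x. f x \<noteq> 0}"
    unfolding bsupp_def bounded_iff by (metis (mono_tags, lifting) mem_Collect_eq not_le)
  then show ?thesis by (simp add: compact_closure)
qed

lemma test_function_iff: "test_function \<phi> \<longleftrightarrow> smooth \<phi> \<and> bsupp \<phi>"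
  by (simp add: test_function_def smooth_def bsupp_iff_compact)

lemma bsupp_mult_left: "bsupp f \<Longrightarrow> bsupp (\<lambda>x. g x * f x)" for f g :: "'a::real_normed_vector \<Rightarrow> real"
  unfolding bsupp_def by (metis mult_zero_right)

lemma bsupp_mult_right: "bsupp f \<Longrightarrow> bsupp (\<lambda>x. f x * g x)" for f g :: "'a::real_normed_vector \<Rightarrow> real"
  unfolding bsupp_def by (metis mult_zero_left)

lemma bsupp_pd: "bsupp f \<Longrightarrow> bsupp (pd i f)"
proof -
  assume "bsupp f"
  then obtain R where R: "\<And>x. norm x > R \<Longrightarrow> f x = 0" unfolding bsupp_def by blast
  have "pd i f x = 0" if "norm x > R" for x
  proof -
    have "((\<lambda>x. 0) has_derivative (\<lambda>h. 0)) (at x)" by simp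
    moreover have "open {x::real^2. norm x > R}"
      by (intro open_Collect_less continuous_intros)
    ultimately have "(f has_derivative (\<lambda>h. 0)) (at x)"
      by (rule has_derivative_transform_within_open) (use that R in auto)
    then show ?thesis using pd_eqI by fastforce
  qed
  then show ?thesis unfolding bsupp_def by blast
qed

lemma test_function_mult: "smooth f \<Longrightarrow> test_function \<phi> \<Longrightarrow> test_function (\<lambda>x. f x * \<phi> x)"
  by (auto simp: test_function_iff bsupp_mult_left)

lemma integrable_bsupp:
  fixes f :: "real^2 \<Rightarrow> real"
  assumes "continuous_on UNIV f" "bsupp f"
  shows "integrable lborel f"
proof -
  obtain R where R: "\<And>x. norm x > R \<Longrightarrow> f x = 0" using assms(2) unfolding bsupp_def by blast
  have "integrable lborel (\<lambda>x. indicator (cball 0 R) x *\<^sub>R f x)"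
    by (rule borel_integrable_compact) (use assms(1) continuous_on_subset in auto)
  moreover have "(\<lambda>x. indicator (cball 0 R) x *\<^sub>R f x) = f"
    using R by (fastforce simp: indicator_def)
  ultimately show ?thesis by simp
qed

lemma bounded_bsupp:
  fixes f :: "real^2 \<Rightarrow> real"
  assumes "continuous_on UNIV f" "bsupp f"
  obtains B where "B \<ge> 0" "\<And>x. \<bar>f x\<bar> \<le> B"
proof -
  obtain R where R: "\<And>x. norm x > R \<Longrightarrow> f x = 0" using assms(2) unfolding bsupp_def by blast
  have "compact (f ` cball 0 R)"
    using assms(1) by (intro compact_continuous_image) (auto intro: continuous_on_subset)
  then obtain B where "\<forall>y\<in>f ` cball 0 R. norm y \<le> B"
    using compact_imp_bounded bounded_iff by metis
  then have "\<bar>f x\<bar> \<le> max B 0" for x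
    using R [of x] by (cases "norm x \<le> R") (auto simp: le_max_iff_disj)
  then show ?thesis using that [of "max B 0"] by auto
qed

text \<open>The partial derivative is the limit of difference quotients, and each of these
  integrates to zero because Lebesgue measure is invariant under translations. The mean value
  theorem bounds the quotients by \<open>B\<close>, and steps of length at most 1 keep their
  supports in the ball of radius \<open>R + 1\<close>, so dominated convergence applies.\<close>

lemma integral_pd_eq_0:
  assumes f: "C_diff (Suc 0) f" and s: "bsupp f"
  shows "integral\<^sup>L lborel (pd i f) = 0"
proof -
  obtain R where R: "\<And>x. norm x > R \<Longrightarrow> f x = 0" using s unfolding bsupp_def by blast
  have df: "f differentiable (at x)" for x using f by (simp add: C_diff_Suc_pd)
  have cf: "continuous_on UNIV f" using C_diff_imp_continuous [OF f] .
  have cp: "continuous_on UNIV (pd i f)" using f by (simp add: C_diff_Suc_pd)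
  obtain B where B: "B \<ge> 0" "\<And>x. \<bar>pd i f x\<bar> \<le> B"
    using bounded_bsupp [OF cp bsupp_pd [OF s]] by blast
  define h where "h n = inverse (real (Suc n))" for n
  have h: "h n > 0" "h n \<le> 1" for n by (auto simp: h_def inverse_le_1_iff)
  define e :: "real^2" where "e = axis i 1"
  define q where "q n x = (f (x + h n *\<^sub>R e) - f x) / h n" for n x
  have der: "((\<lambda>t. f (x + t *\<^sub>R e)) has_real_derivative pd i f (x + t *\<^sub>R e)) (at t)" for x t
  proof -
    have "((\<lambda>t. f (x + t *\<^sub>R e)) has_derivative (\<lambda>k. grad f (x + t *\<^sub>R e) \<bullet> (k *\<^sub>R e))) (at t)"
      by (rule has_derivative_compose [OF _ has_derivative_grad [OF df]])
        (auto intro!: derivative_eq_intros)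
    moreover have "(\<lambda>k. grad f (x + t *\<^sub>R e) \<bullet> (k *\<^sub>R e)) = (*) (pd i f (x + t *\<^sub>R e))"
      by (simp add: fun_eq_iff e_def inner_axis grad_def)
    ultimately show ?thesis
      by (simp only: has_field_derivative_def)
  qed
  have qB: "\<bar>q n x\<bar> \<le> B" for n x
  proof -
    have "\<exists>z. z > 0 \<and> z < h n \<and> f (x + h n *\<^sub>R e) - f (x + 0 *\<^sub>R e) = (h n - 0) * pd i f (x + z *\<^sub>R e)"
      by (rule MVT2) (use h der in auto)
    then show ?thesis
      using h(1) [of n] B(2) by (auto simp: q_def abs_mult)
  qed
  have fi: "integrable lborel f" by (rule integrable_bsupp [OF cf s])
  have fs: "integrable lborel (\<lambda>x. f (x + c))" "(\<integral>x. f (x + c) \<partial>lborel) = integral\<^sup>L lborel f" for c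
  proof -
    have m: "f \<in> borel_measurable borel" using cf by (rule borel_measurable_continuous_onI)
    have *: "distr lborel borel ((+) c) = lborel" by (rule lborel_distr_plus)
    show "integrable lborel (\<lambda>x. f (x + c))"
      using fi integrable_distr_eq [of "(+) c" lborel borel f] m * by (simp add: add.commute)
    show "(\<integral>x. f (x + c) \<partial>lborel) = integral\<^sup>L lborel f"
      using integral_distr [of "(+) c" lborel borel f] m * by (simp add: add.commute)
  qed
  have q0: "integral\<^sup>L lborel (q n) = 0" for n
    using fi fs by (simp add: q_def [abs_def])
  have "(\<lambda>n. integral\<^sup>L lborel (q n)) \<longlonglongrightarrow> integral\<^sup>L lborel (pd i f)"
  proof (rule integral_dominated_convergence [where w = "\<lambda>x. indicator (cball 0 (R + 1)) x *\<^sub>R B"])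
    show "pd i f \<in> borel_measurable lborel"
      using cp by (simp add: borel_measurable_continuous_onI)
    show "q n \<in> borel_measurable lborel" for n
      using fi fs unfolding q_def [abs_def] by (intro borel_measurable_integrable) auto
    show "integrable lborel (\<lambda>x. indicator (cball 0 (R + 1)) x *\<^sub>R B)"
      by (rule borel_integrable_compact) auto
    show "AE x in lborel. (\<lambda>n. q n x) \<longlonglongrightarrow> pd i f x"
    proof (rule AE_I2)
      fix x
      have "((\<lambda>t. (f (x + t *\<^sub>R e) - f (x + 0 *\<^sub>R e)) / (t - 0)) \<longlongrightarrow> pd i f (x + 0 *\<^sub>R e)) (at 0)"
        using der [of x 0] unfolding has_field_derivative_iff .
      moreover have "filterlim h (at 0) sequentially"
        unfolding h_def [abs_def] filterlim_at using LIMSEQ_inverse_real_of_nat by auto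
      ultimately show "(\<lambda>n. q n x) \<longlonglongrightarrow> pd i f x"
        unfolding q_def using filterlim_compose by fastforce
    qed
    show "AE x in lborel. norm (q n x) \<le> indicator (cball 0 (R + 1)) x *\<^sub>R B" for n
    proof (rule AE_I2)
      fix x
      show "norm (q n x) \<le> indicator (cball 0 (R + 1)) x *\<^sub>R B"
      proof (cases "norm x \<le> R + 1")
        case False
        have "norm (h n *\<^sub>R e) \<le> 1" using h(1,2) [of n] by (simp add: e_def)
        moreover have "norm x \<le> norm (x + h n *\<^sub>R e) + norm (h n *\<^sub>R e)"
          using norm_triangle_ineq4 [of "x + h n *\<^sub>R e" "h n *\<^sub>R e"] by simp
        ultimately have "norm (x + h n *\<^sub>R e) > R" "norm x > R" using False by linarith+
        then show ?thesis using R B(1) by (simp add: q_def indicator_def)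
      qed (use qB B in auto)
    qed
  qed
  with q0 show ?thesis by (simp add: LIMSEQ_const_iff)
qed

lemma integral_by_parts:
  assumes "C_diff (Suc 0) w" "test_function \<phi>"
  shows "integrable lborel (\<lambda>x. w x * pd i \<phi> x)" "integrable lborel (\<lambda>x. pd i w x * \<phi> x)"
    and "(\<integral>x. w x * pd i \<phi> x \<partial>lborel) = - (\<integral>x. pd i w x * \<phi> x \<partial>lborel)"
proof -
  have p: "C_diff (Suc 0) \<phi>" "bsupp \<phi>" "smooth \<phi>"
    using assms(2) by (auto simp: test_function_iff smooth_def)
  have cw: "continuous_on UNIV w" by (rule C_diff_imp_continuous [OF assms(1)])
  show 1: "integrable lborel (\<lambda>x. w x * pd i \<phi> x)"
    using p by (intro integrable_bsupp bsupp_mult_left bsupp_pd continuous_on_mult cw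
        smooth_imp_continuous smooth_pd)
  have cp: "continuous_on UNIV (pd i w)" using assms(1) by (simp add: C_diff_Suc_pd)
  show 2: "integrable lborel (\<lambda>x. pd i w x * \<phi> x)"
    using p by (intro integrable_bsupp bsupp_mult_left continuous_on_mult cp smooth_imp_continuous)
  have "pd i (\<lambda>x. w x * \<phi> x) x = w x * pd i \<phi> x + pd i w x * \<phi> x" for x
    using assms(1) p(1) by (intro pd_mult_at) (auto simp: C_diff_Suc_pd)
  with integral_pd_eq_0 [OF C_diff_mult [OF assms(1) p(1)] bsupp_mult_left [OF p(2)], of i] 1 2
  show "(\<integral>x. w x * pd i \<phi> x \<partial>lborel) = - (\<integral>x. pd i w x * \<phi> x \<partial>lborel)"
    by (simp cong: Bochner_Integration.integral_cong)
qed

section \<open>Locally integrable functions and weak gradients\<close>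

lemma locally_integrable_continuous:
  fixes f :: "real^2 \<Rightarrow> 'b::{banach, second_countable_topology}"
  assumes "continuous_on UNIV f"
  shows "locally_integrable f"
  unfolding locally_integrable_def set_integrable_def
  using assms by (auto intro!: borel_integrable_compact intro: continuous_on_subset)

lemma weak_gradientD:
  assumes "weak_gradient u v" "test_function \<phi>"
  shows "(\<integral>x. u x * pd i \<phi> x \<partial>lborel) = - (\<integral>x. v x $ i * \<phi> x \<partial>lborel)"
proof -
  have "axis i 1 \<in> (Basis :: (real^2) set)" by (auto simp: Basis_real2_iff)
  then show ?thesis
    using assms unfolding weak_gradient_def by (simp add: pd_def cart_eq_inner_axis)
qed

lemma weak_gradientI:
  assumes "locally_integrable u" "locally_integrable v"
    "\<And>\<phi> i. test_function \<phi> \<Longrightarrow> (\<integral>x. u x * pd i \<phi> x \<partial>lborel) = - (\<integral>x. v x $ i * \<phi> x \<partial>lborel)"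
  shows "weak_gradient u v"
  using assms unfolding weak_gradient_def Basis_real2_iff
  by (auto simp: pd_def [symmetric] cart_eq_inner_axis [symmetric])

lemma weak_gradient_C1:
  assumes "C_diff (Suc 0) w"
  shows "weak_gradient w (grad w)"
proof (rule weak_gradientI)
  show "locally_integrable w"
    using C_diff_imp_continuous [OF assms] by (rule locally_integrable_continuous)
  have "continuous_on UNIV (grad w)"
    unfolding grad_def using assms by (auto simp: C_diff_Suc_pd intro!: continuous_intros)
  then show "locally_integrable (grad w)" by (rule locally_integrable_continuous)
qed (use integral_by_parts(3) [OF assms] in \<open>simp add: grad_def\<close>)

lemma locally_integrable_measurable:
  fixes u :: "real^2 \<Rightarrow> 'b::{banach, second_countable_topology}"
  assumes "locally_integrable u"
  shows "u \<in> borel_measurable borel"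
proof (rule borel_measurable_LIMSEQ_metric)
  fix n :: nat
  show "(\<lambda>x. indicator (cball 0 (real n)) x *\<^sub>R u x) \<in> borel_measurable borel"
  proof -
    have "integrable lborel (\<lambda>x. indicator (cball 0 (real n)) x *\<^sub>R u x)"
      using assms by (simp add: locally_integrable_def set_integrable_def)
    then show ?thesis by (simp add: borel_measurable_integrable)
  qed
next
  fix x :: "real^2"
  have "\<forall>\<^sub>F n in sequentially. real n \<ge> norm x"
    by (metis eventually_at_top_linorder nat_ceiling_le_eq)
  then have "\<forall>\<^sub>F n in sequentially. indicator (cball 0 (real n)) x *\<^sub>R u x = u x"
    by eventually_elim (simp add: indicator_def)
  then show "(\<lambda>n. indicator (cball 0 (real n)) x *\<^sub>R u x) \<longlonglongrightarrow> u x"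
    by (rule tendsto_eventually)
qed

lemma locally_integrable_mult_bsupp:
  fixes u :: "real^2 \<Rightarrow> real"
  assumes "locally_integrable u" "continuous_on UNIV \<phi>" "bsupp \<phi>"
  shows "integrable lborel (\<lambda>x. u x * \<phi> x)"
proof -
  obtain R where R: "\<And>x. norm x > R \<Longrightarrow> \<phi> x = 0" using assms(3) unfolding bsupp_def by blast
  obtain B where B: "B \<ge> 0" "\<And>x. \<bar>\<phi> x\<bar> \<le> B" using bounded_bsupp [OF assms(2,3)] by blast
  show ?thesis
  proof (rule Bochner_Integration.integrable_bound)
    show "integrable lborel (\<lambda>x. B * (indicator (cball 0 R) x *\<^sub>R u x))"
      using assms(1) unfolding locally_integrable_def set_integrable_def by auto
    show "(\<lambda>x. u x * \<phi> x) \<in> borel_measurable lborel"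
      using locally_integrable_measurable [OF assms(1)] borel_measurable_continuous_onI [OF assms(2)]
      by simp
    have "\<bar>u x * \<phi> x\<bar> \<le> \<bar>B * (indicator (cball 0 R) x * u x)\<bar>" for x
      using B R [of x] mult_right_mono [of "\<bar>\<phi> x\<bar>" B "\<bar>u x\<bar>"]
      by (cases "norm x \<le> R") (auto simp: abs_mult mult.commute)
    then show "AE x in lborel. norm (u x * \<phi> x) \<le> norm (B * (indicator (cball 0 R) x *\<^sub>R u x))"
      by simp
  qed
qed

subsection \<open>Functions with vanishing integrals\<close>

text \<open>The measurable sets over which \<open>f\<close> integrates to zero form a Dynkin system:
  the vanishing total integral takes care of complements, and countable additivity of disjoint
  unions. It is applied to the boxes and to the compact sets.\<close>

lemma AE_zero_if_integrals_zero:
  fixes f :: "'a \<Rightarrow> real"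
  assumes f: "integrable M f"
    and E: "sets M = sigma_sets (space M) E" "Int_stable E" "E \<subseteq> Pow (space M)"
    and 0: "\<And>A. A \<in> E \<Longrightarrow> (\<integral>x. indicator A x * f x \<partial>M) = 0" "integral\<^sup>L M f = 0"
  shows "AE x in M. f x = 0"
proof (rule density_unique_real [OF f])
  show "integrable M (\<lambda>_. 0)" by simp
  fix A assume "A \<in> sets M"
  then have "A \<in> sigma_sets (space M) E" by (simp add: E)
  with E(2,3) have "(\<integral>x. indicator A x * f x \<partial>M) = 0"
  proof (induction A rule: sigma_sets_induct_disjoint)
    case (basic A)
    then show ?case by (rule 0)
  next
    case empty
    then show ?case by simp
  next
    case (compl A)
    then have A: "A \<in> sets M" by (simp add: E)
    have "integrable M (\<lambda>x. indicator A x * f x)"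
      using integrable_mult_indicator [OF A f] by simp
    then have "(\<integral>x. f x - indicator A x * f x \<partial>M) = 0"
      using compl f 0(2) by simp
    moreover have "(\<integral>x. indicator (space M - A) x * f x \<partial>M) = (\<integral>x. f x - indicator A x * f x \<partial>M)"
      by (rule Bochner_Integration.integral_cong) (auto simp: indicator_def)
    ultimately show ?case by simp
  next
    case (union A)
    then have A: "A i \<in> sets M" for i by (auto simp: E)
    have "(\<Union>i. A i) \<in> sets M" using A by blast
    then have "set_integrable M (\<Union>i. A i) f"
      unfolding set_integrable_def by (rule integrable_mult_indicator [OF _ f])
    with A have "(LINT x:(\<Union>i. A i)|M. f x) = (\<Sum>i. (LINT x:(A i)|M. f x))"
      using union.hyps(1)
      by (intro lebesgue_integral_countable_add) (simp_all add: disjoint_family_on_def)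
    then show ?case
      using union.IH by (simp add: set_lebesgue_integral_def)
  qed
  then show "(LINT x:A|M. f x) = (LINT x:A|M. 0)"
    by (simp add: set_lebesgue_integral_def)
qed

text \<open>A product of rescaled bumps, one for each face of the box, is a test function with
  values between 0 and 1 that vanishes off the open box and tends to its indicator.\<close>

lemma integral_box_eq_0:
  assumes g: "locally_integrable g"
    and 0: "\<And>\<phi>. test_function \<phi> \<Longrightarrow> (\<integral>x. g x * \<phi> x \<partial>lborel) = 0"
  shows "(\<integral>x. indicator (box a b) x * g x \<partial>lborel) = 0"
proof -
  define \<phi> where "\<phi> n x = (\<Prod>i\<in>UNIV. bump (real n * (x $ i - a $ i)) * bump (real n * (b $ i - x $ i)))"
    for n and x :: "real^2"
  have sm: "smooth (\<phi> n)" for n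
    unfolding \<phi>_def by (intro smooth_prod smooth_mult smooth_bump smooth_diff smooth_const smooth_coord)
  have out: "\<phi> n x = 0" if nx: "x \<notin> box a b" for n x
  proof -
    obtain i where "x $ i \<le> a $ i \<or> b $ i \<le> x $ i"
      using nx unfolding mem_box_cart by (meson not_le)
    then have "bump (real n * (x $ i - a $ i)) * bump (real n * (b $ i - x $ i)) = 0"
      using bump_eq_0 by (auto simp: mult_nonneg_nonpos)
    then show ?thesis unfolding \<phi>_def by (auto simp: prod_zero_iff)
  qed
  obtain R where R: "\<And>x. x \<in> box a b \<Longrightarrow> norm x \<le> R"
    using bounded_box [of a b] unfolding bounded_iff by blast
  then have "bsupp (\<phi> n)" for n
    unfolding bsupp_def using out by (metis not_le)
  then have test: "test_function (\<phi> n)" for n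
    using sm by (simp add: test_function_iff)
  have b01: "0 \<le> \<phi> n x" "\<phi> n x \<le> 1" for n x
    unfolding \<phi>_def
    by (auto intro!: prod_nonneg prod_le_1 mult_le_one simp: bump_nonneg bump_le_1)
  have lim: "(\<lambda>n. \<phi> n x) \<longlonglongrightarrow> indicator (box a b) x" for x
  proof -
    have "(\<lambda>n. \<phi> n x) \<longlonglongrightarrow>
        (\<Prod>i\<in>UNIV. (if x $ i - a $ i > 0 then 1 else 0) * (if b $ i - x $ i > 0 then 1 else 0))"
      unfolding \<phi>_def by (intro tendsto_prod tendsto_mult bump_scaled_tendsto)
    moreover have "(\<Prod>i\<in>UNIV. (if x $ i - a $ i > 0 then 1 else 0) * (if b $ i - x $ i > 0 then 1 else 0))
        = (indicator (box a b) x :: real)"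
    proof (cases "x \<in> box a b")
      case False
      then obtain i where "x $ i \<le> a $ i \<or> b $ i \<le> x $ i"
        unfolding mem_box_cart by (meson not_le)
      then have "\<exists>i. (if x $ i - a $ i > 0 then 1 else 0) * (if b $ i - x $ i > 0 then 1 else 0) = (0::real)"
        by (intro exI [of _ i]) auto
      then show ?thesis using False by (subst prod_zero) auto
    qed (simp add: mem_box_cart)
    ultimately show ?thesis by simp
  qed
  have gm [measurable]: "g \<in> borel_measurable borel" by (rule locally_integrable_measurable [OF g])
  have [measurable]: "\<phi> n \<in> borel_measurable borel" for n
    using smooth_imp_continuous [OF sm] by (rule borel_measurable_continuous_onI)
  have "(\<lambda>n. \<integral>x. g x * \<phi> n x \<partial>lborel) \<longlonglongrightarrow> (\<integral>x. g x * indicator (box a b) x \<partial>lborel)"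
  proof (rule integral_dominated_convergence [where w = "\<lambda>x. norm (indicator (cball 0 R) x *\<^sub>R g x)"])
    show "integrable lborel (\<lambda>x. norm (indicator (cball 0 R) x *\<^sub>R g x))"
      using g unfolding locally_integrable_def set_integrable_def by auto
    show "AE x in lborel. (\<lambda>n. g x * \<phi> n x) \<longlonglongrightarrow> g x * indicator (box a b) x"
      by (intro AE_I2 tendsto_intros lim)
    have "\<bar>g x * \<phi> n x\<bar> \<le> \<bar>indicator (cball 0 R) x * g x\<bar>" for n x
      using R [of x] out [of x n] b01 [of n x] mult_left_le [of "\<phi> n x" "\<bar>g x\<bar>"]
      by (cases "x \<in> box a b") (auto simp: abs_mult)
    then show "AE x in lborel. norm (g x * \<phi> n x) \<le> norm (indicator (cball 0 R) x *\<^sub>R g x)" for n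
      by simp
  qed auto
  with 0 [OF test] show ?thesis by (simp add: LIMSEQ_const_iff mult.commute)
qed

text \<open>As \<open>g\<close> is only locally integrable, it is truncated to the cubes
  \<open>Q N\<close>. Boxes generate the Borel sets and meet a cube in a box again, so each
  truncation vanishes almost everywhere; the cubes exhaust the plane.\<close>

lemma fundamental_lemma:
  assumes g: "locally_integrable g"
    and 0: "\<And>\<phi>. test_function \<phi> \<Longrightarrow> (\<integral>x. g x * \<phi> x \<partial>lborel) = 0"
  shows "AE x in lborel. g x = 0"
proof -
  define Q :: "nat \<Rightarrow> (real^2) set" where "Q N = box (\<chi> i. - real N) (\<chi> i. real N)" for N
  have "AE x in lborel. indicator (Q N) x * g x = 0" for N
  proof (rule AE_zero_if_integrals_zero)
    have gm [measurable]: "g \<in> borel_measurable borel" by (rule locally_integrable_measurable [OF g])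
    have "integrable lborel (\<lambda>x. indicator (closure (Q N)) x *\<^sub>R g x)"
      using g unfolding locally_integrable_def set_integrable_def Q_def
      by (auto simp: compact_closure bounded_box)
    then show "integrable lborel (\<lambda>x. indicator (Q N) x * g x)"
      by (rule Bochner_Integration.integrable_bound)
        (auto simp: Q_def indicator_def dest: subsetD [OF closure_subset])
    show "sets lborel = sigma_sets (space lborel) (range (\<lambda>(a, b). box a (b :: real^2)))"
      by (simp add: borel_eq_box)
    show "Int_stable (range (\<lambda>(a, b). box a (b :: real^2)))"
      unfolding Int_stable_def by (auto simp: box_Int_box)
    show "range (\<lambda>(a, b). box a b) \<subseteq> Pow (space lborel)" by simp
    show "(\<integral>x. indicator A x * (indicator (Q N) x * g x) \<partial>lborel) = 0"
      if A: "A \<in> range (\<lambda>(a, b). box a b)" for A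
    proof -
      obtain c d where "A \<inter> Q N = box c d"
        using A by (auto simp: Q_def box_Int_box)
      moreover have "(\<lambda>x. indicator A x * (indicator (Q N) x * g x)) = (\<lambda>x. indicator (A \<inter> Q N) x * g x)"
        by (simp add: indicator_inter_arith mult.assoc)
      ultimately show ?thesis using integral_box_eq_0 [OF g 0] by simp
    qed
    show "(\<integral>x. indicator (Q N) x * g x \<partial>lborel) = 0"
      unfolding Q_def using integral_box_eq_0 [OF g 0] .
  qed
  then have "AE x in lborel. \<forall>N. indicator (Q N) x * g x = 0"
    by (subst AE_all_countable) blast
  then show ?thesis
  proof eventually_elim
    case (elim x)
    obtain N where N: "real N > norm x" using reals_Archimedean2 by blast
    have "- real N < x $ i" "x $ i < real N" for i
      using component_le_norm_cart [of x i] N by linarith+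
    then have "x \<in> Q N" by (simp add: Q_def mem_box_cart)
    then show ?case using elim by (metis indicator_simps(1) mult_1)
  qed
qed

section \<open>Uniqueness and linearity of weak gradients\<close>

lemma locally_integrable_add:
  "locally_integrable u \<Longrightarrow> locally_integrable v \<Longrightarrow> locally_integrable (\<lambda>x. u x + v x)"
  unfolding locally_integrable_def by (auto intro: set_integral_add)

lemma locally_integrable_scaleR:
  "locally_integrable u \<Longrightarrow> locally_integrable (\<lambda>x. c *\<^sub>R u x)"
  unfolding locally_integrable_def by (auto simp: set_integrable_scaleR_right)

lemma locally_integrable_nth:
  "locally_integrable v \<Longrightarrow> locally_integrable (\<lambda>x. v x $ i)" for v :: "real^2 \<Rightarrow> real^2"
  unfolding locally_integrable_def set_integrable_def
  using integrable_bounded_linear [OF bounded_linear_vec_nth [of i]] by fastforce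

lemma weak_gradient_unique:
  assumes "weak_gradient u v" "weak_gradient u w"
  shows "AE x in lborel. v x = w x"
proof -
  have "AE x in lborel. v x $ i + - 1 *\<^sub>R (w x $ i) = 0" for i
  proof (rule fundamental_lemma)
    have l: "locally_integrable (\<lambda>x. v x $ i)" "locally_integrable (\<lambda>x. w x $ i)"
      using assms by (auto simp: weak_gradient_def intro: locally_integrable_nth)
    then show "locally_integrable (\<lambda>x. v x $ i + - 1 *\<^sub>R (w x $ i))"
      by (intro locally_integrable_add locally_integrable_scaleR)
    fix \<phi> assume t: "test_function \<phi>"
    have "integrable lborel (\<lambda>x. v x $ i * \<phi> x)" "integrable lborel (\<lambda>x. w x $ i * \<phi> x)"
      using l t by (auto simp: test_function_iff smooth_imp_continuous intro!: locally_integrable_mult_bsupp)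
    then show "(\<integral>x. (v x $ i + - 1 *\<^sub>R (w x $ i)) * \<phi> x \<partial>lborel) = 0"
      using weak_gradientD [OF assms(1) t, of i] weak_gradientD [OF assms(2) t, of i]
      by (simp add: algebra_simps)
  qed
  then have "AE x in lborel. \<forall>i. v x $ i + - 1 *\<^sub>R (w x $ i) = 0"
    by (simp add: AE_all_countable)
  then show ?thesis by eventually_elim (simp add: vec_eq_iff)
qed

lemma weak_gradient_lincomb:
  assumes "weak_gradient u v" "weak_gradient u' v'"
  shows "weak_gradient (\<lambda>x. a * u x + b * u' x) (\<lambda>x. a *\<^sub>R v x + b *\<^sub>R v' x)"
proof (rule weak_gradientI)
  have l: "locally_integrable u" "locally_integrable u'" "locally_integrable v" "locally_integrable v'"
    using assms by (auto simp: weak_gradient_def)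
  show "locally_integrable (\<lambda>x. a * u x + b * u' x)"
    using locally_integrable_add [OF locally_integrable_scaleR locally_integrable_scaleR, OF l(1,2)]
    by simp
  show "locally_integrable (\<lambda>x. a *\<^sub>R v x + b *\<^sub>R v' x)"
    using l by (intro locally_integrable_add locally_integrable_scaleR)
  fix \<phi> i assume t: "test_function \<phi>"
  have "integrable lborel (\<lambda>x. v x $ i * \<phi> x)" "integrable lborel (\<lambda>x. v' x $ i * \<phi> x)"
    "integrable lborel (\<lambda>x. u x * pd i \<phi> x)" "integrable lborel (\<lambda>x. u' x * pd i \<phi> x)"
    using l t by (auto simp: test_function_iff intro!: locally_integrable_mult_bsupp
        locally_integrable_nth smooth_imp_continuous smooth_pd bsupp_pd)
  then show "(\<integral>x. (a * u x + b * u' x) * pd i \<phi> x \<partial>lborel)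
      = - (\<integral>x. (a *\<^sub>R v x + b *\<^sub>R v' x) $ i * \<phi> x \<partial>lborel)"
    using weak_gradientD [OF assms(1) t, of i] weak_gradientD [OF assms(2) t, of i]
    by (simp add: ring_distribs mult.assoc)
qed

lemma weak_gradient_cong_AE:
  assumes "weak_gradient u v" "AE x in lborel. u x = u' x" "u' \<in> borel_measurable borel"
  shows "weak_gradient u' v"
proof (rule weak_gradientI)
  have l: "locally_integrable u" using assms(1) by (simp add: weak_gradient_def)
  have [measurable]: "u \<in> borel_measurable borel" "u' \<in> borel_measurable borel"
    using locally_integrable_measurable [OF l] assms(3) by auto
  show "locally_integrable u'"
    unfolding locally_integrable_def set_integrable_def
  proof (intro allI impI)
    fix K :: "(real^2) set" assume K: "compact K"
    then have "K \<in> sets borel" by (simp add: borel_compact)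
    moreover have "AE x in lborel. indicator K x *\<^sub>R u x = indicator K x *\<^sub>R u' x"
      using assms(2) by eventually_elim simp
    moreover have "integrable lborel (\<lambda>x. indicator K x *\<^sub>R u x)"
      using l K by (auto simp: locally_integrable_def set_integrable_def)
    ultimately show "integrable lborel (\<lambda>x. indicator K x *\<^sub>R u' x)"
      by (subst integrable_cong_AE [where g = "\<lambda>x. indicator K x *\<^sub>R u x"]) auto
  qed
  show "locally_integrable v" using assms(1) by (simp add: weak_gradient_def)
  fix \<phi> i assume t: "test_function \<phi>"
  then have [measurable]: "pd i \<phi> \<in> borel_measurable borel"
    by (auto simp: test_function_iff intro!: borel_measurable_continuous_onI smooth_imp_continuous)
  have "(\<integral>x. u' x * pd i \<phi> x \<partial>lborel) = (\<integral>x. u x * pd i \<phi> x \<partial>lborel)"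
    by (rule integral_cong_AE) (use assms(2) in auto)
  with weak_gradientD [OF assms(1) t] show "(\<integral>x. u' x * pd i \<phi> x \<partial>lborel) = - (\<integral>x. v x $ i * \<phi> x \<partial>lborel)"
    by simp
qed

section \<open>Integrals over the plane\<close>

text \<open>This takes the place of polar coordinates: the disc on which the squared norm is at most
  a has area pi a, so the squared norm transports plane Lebesgue measure to pi times Lebesgue
  measure on the half-line.\<close>

lemma distr_norm_sq:
  "distr lborel borel (\<lambda>x::real^2. (norm x)\<^sup>2) = density lborel (\<lambda>t. ennreal (pi * indicator {0..} t))"
    (is "?M = ?N")
proof (rule measure_eqI_generator_eq [where E = "range atMost" and \<Omega> = UNIV and A = "\<lambda>n. {..real n}"])
  show "Int_stable (range (atMost :: real \<Rightarrow> real set))"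
    by (auto simp: Int_stable_def)
  have "emeasure ?M {..a} = ennreal (if a < 0 then 0 else pi * a)" for a
  proof -
    have "emeasure ?M {..a} = emeasure lborel {x::real^2. (norm x)\<^sup>2 \<le> a}"
      by (subst emeasure_distr) (auto simp: vimage_def)
    also have "{x::real^2. (norm x)\<^sup>2 \<le> a} = (if a < 0 then {} else cball 0 (sqrt a))"
      by (auto simp: real_le_rsqrt power2_nonneg_ge_1_iff intro: sqrt_ge_absD
          dest: order_trans [OF zero_le_power2])
    finally show ?thesis
      by (simp add: emeasure_cball unit_ball_vol_2)
  qed
  moreover have "emeasure ?N {..a} = ennreal (if a < 0 then 0 else pi * a)" for a
  proof -
    have "emeasure ?N {..a} = (\<integral>\<^sup>+ t. ennreal pi * indicator {0..a} t \<partial>lborel)"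
      by (subst emeasure_density) (auto intro!: nn_integral_cong simp: indicator_def)
    also have "\<dots> = ennreal pi * emeasure lborel {0..a}"
      by (simp add: nn_integral_cmult_indicator)
    finally show ?thesis by (simp add: ennreal_mult)
  qed
  ultimately show "emeasure ?M X = emeasure ?N X" if "X \<in> range atMost" for X
    using that by auto
  show "sets ?M = sigma_sets UNIV (range atMost)" "sets ?N = sigma_sets UNIV (range atMost)"
    by (simp_all add: borel_eq_atMost)
  show "emeasure ?M {..real n} \<noteq> \<infinity>" for n
    using \<open>\<And>a. emeasure ?M {..a} = _\<close> by simp
  show "(\<Union>n. {..real n}) = UNIV" using real_arch_simple by auto
qed auto

lemma nn_integral_radial:
  assumes [measurable]: "g \<in> borel_measurable borel"
  shows "(\<integral>\<^sup>+ x. g ((norm (x::real^2))\<^sup>2) \<partial>lborel) = ennreal pi * (\<integral>\<^sup>+ t. g t * indicator {0..} t \<partial>lborel)"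
proof -
  have "(\<integral>\<^sup>+ x. g ((norm (x::real^2))\<^sup>2) \<partial>lborel) = integral\<^sup>N (distr lborel borel (\<lambda>x::real^2. (norm x)\<^sup>2)) g"
    by (simp add: nn_integral_distr)
  also have "\<dots> = (\<integral>\<^sup>+ t. ennreal (pi * indicator {0..} t) * g t \<partial>lborel)"
    unfolding distr_norm_sq by (simp add: nn_integral_density)
  also have "\<dots> = (\<integral>\<^sup>+ t. ennreal pi * (g t * indicator {0..} t) \<partial>lborel)"
    by (intro nn_integral_cong) (auto simp: indicator_def mult.commute)
  finally show ?thesis by (simp add: nn_integral_cmult)
qed

lemma integrable_radial_powr:
  assumes "q > 1"
  shows "integrable lborel (\<lambda>x::real^2. (1 + (norm x)\<^sup>2) powr - q)"
proof (rule integrableI_bounded)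
  have "(\<integral>\<^sup>+ t. ennreal ((1 + t) powr - q) * indicator {0..} t \<partial>lborel) = ennreal (0 - (1 + 0) powr (1 - q) / (1 - q))"
  proof (rule nn_integral_FTC_atLeast)
    fix t :: real assume "0 \<le> t"
    then show "((\<lambda>t. (1 + t) powr (1 - q) / (1 - q)) has_real_derivative (1 + t) powr - q) (at t)"
      using assms by (auto intro!: derivative_eq_intros)
  next
    have "((\<lambda>t. (1 + t) powr (1 - q)) \<longlongrightarrow> 0) at_top"
      using assms by (intro tendsto_neg_powr filterlim_tendsto_add_at_top [OF tendsto_const] filterlim_ident) auto
    then show "((\<lambda>t. (1 + t) powr (1 - q) / (1 - q)) \<longlongrightarrow> 0) at_top"
      using assms by (auto intro: tendsto_divide_zero)
  qed auto
  then have "(\<integral>\<^sup>+ x. ennreal ((1 + (norm (x::real^2))\<^sup>2) powr - q) \<partial>lborel) < \<infinity>"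
    by (subst nn_integral_radial) (auto simp: ennreal_mult_less_top)
  then show "(\<integral>\<^sup>+ x. ennreal (norm ((1 + (norm (x::real^2))\<^sup>2) powr - q)) \<partial>lborel) < \<infinity>" by simp
qed simp

text \<open>The growth is only linear in the logarithmic radius \<open>r\<close>. The gradient of a
  cutoff over this range has squared size of order 1/r^2 times this integrand, so its energy is of
  order 1/r.\<close>

lemma nn_integral_log_annulus:
  assumes "r \<ge> 0"
  shows "(\<integral>\<^sup>+ x. ennreal (indicator {x::real^2. ln (1 + (norm x)\<^sup>2) \<le> r} x / (1 + (norm x)\<^sup>2)) \<partial>lborel)
    = ennreal (pi * r)"
proof -
  define g where "g t = ennreal (indicator {..exp r - 1} t / (1 + t))" for t
  have [measurable]: "g \<in> borel_measurable borel" unfolding g_def by measurable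
  have "ennreal (indicator {x::real^2. ln (1 + (norm x)\<^sup>2) \<le> r} x / (1 + (norm x)\<^sup>2)) = g ((norm x)\<^sup>2)" for x
  proof -
    have "ln (1 + (norm x)\<^sup>2) \<le> r \<longleftrightarrow> (norm x)\<^sup>2 \<le> exp r - 1"
      using ln_le_cancel_iff [of "1 + (norm x)\<^sup>2" "exp r"] one_plus_norm_sq_pos [of x] by auto
    then show ?thesis by (simp add: g_def indicator_def)
  qed
  then have "(\<integral>\<^sup>+ x. ennreal (indicator {x::real^2. ln (1 + (norm x)\<^sup>2) \<le> r} x / (1 + (norm x)\<^sup>2)) \<partial>lborel)
      = ennreal pi * (\<integral>\<^sup>+ t. g t * indicator {0..} t \<partial>lborel)"
    by (simp add: nn_integral_radial)
  also have "(\<integral>\<^sup>+ t. g t * indicator {0..} t \<partial>lborel)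
      = (\<integral>\<^sup>+ t. ennreal (1 / (1 + t)) * indicator {0..exp r - 1} t \<partial>lborel)"
    by (intro nn_integral_cong) (auto simp: g_def indicator_def)
  also have "\<dots> = ennreal (ln (1 + (exp r - 1)) - ln (1 + 0))"
    by (rule nn_integral_FTC_Icc) (use assms in \<open>auto intro!: derivative_eq_intros\<close>)
  finally show ?thesis using assms by (simp add: ennreal_mult)
qed

subsection \<open>Change of variables\<close>

lemma change_of_variables_lborel:
  fixes f :: "real^2 \<Rightarrow> real" and g :: "real^2 \<Rightarrow> real^2"
  assumes S: "S \<in> sets borel" "g ` S \<in> sets borel"
    and der: "\<And>x. x \<in> S \<Longrightarrow> (g has_derivative g' x) (at x)" and inj: "inj_on g S"
    and j: "\<And>x. x \<in> S \<Longrightarrow> \<bar>det (matrix (g' x))\<bar> = j x"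
    and [measurable]: "g \<in> borel_measurable borel" "j \<in> borel_measurable borel" "f \<in> borel_measurable borel"
    and f: "integrable lborel (\<lambda>x. indicator (g ` S) x * f x)"
  shows "integrable lborel (\<lambda>x. indicator S x * (j x * f (g x)))"
    and "(\<integral>x. indicator S x * (j x * f (g x)) \<partial>lborel) = (\<integral>x. indicator (g ` S) x * f x \<partial>lborel)"
proof -
  \<comment> \<open>The change of variables theorem speaks of functions with values in a coordinate
    space, so \<open>f\<close> is wrapped into \<open>real^1\<close>.\<close>
  define F where "F x = (\<chi> i. f x :: real^1)" for x
  note [measurable] = S
  have f': "f absolutely_integrable_on (g ` S)"
    unfolding set_integrable_def using f by (subst integrable_completion) auto
  then have "F absolutely_integrable_on (g ` S)"
    by (simp add: absolutely_integrable_on_1_iff F_def)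
  then have "(\<lambda>x. \<bar>det (matrix (g' x))\<bar> *\<^sub>R F (g x)) absolutely_integrable_on S \<and>
      integral S (\<lambda>x. \<bar>det (matrix (g' x))\<bar> *\<^sub>R F (g x)) = integral (g ` S) F"
    using S der inj by (subst has_absolute_integral_change_of_variables) (auto intro: has_derivative_at_withinI)
  moreover have "(\<lambda>x. \<bar>det (matrix (g' x))\<bar> *\<^sub>R F (g x)) absolutely_integrable_on S \<longleftrightarrow>
      (\<lambda>x. j x *\<^sub>R F (g x)) absolutely_integrable_on S"
    by (rule set_integrable_cong) (simp_all add: j)
  moreover have "integral S (\<lambda>x. \<bar>det (matrix (g' x))\<bar> *\<^sub>R F (g x)) = integral S (\<lambda>x. j x *\<^sub>R F (g x))"
    by (rule integral_cong) (simp add: j)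
  ultimately have A: "(\<lambda>x. j x *\<^sub>R F (g x)) absolutely_integrable_on S"
    and B: "integral S (\<lambda>x. j x *\<^sub>R F (g x)) = integral (g ` S) F" by simp_all
  from A have A': "(\<lambda>x. j x * f (g x)) absolutely_integrable_on S"
    by (simp add: absolutely_integrable_on_1_iff F_def)
  show "integrable lborel (\<lambda>x. indicator S x * (j x * f (g x)))"
    using A' unfolding set_integrable_def by (subst (asm) integrable_completion) auto
  have "integral S (\<lambda>x. (j x *\<^sub>R F (g x)) $ 1) = integral (g ` S) (\<lambda>x. F x $ 1)"
    using A B \<open>F absolutely_integrable_on (g ` S)\<close>
    by (simp only: integral_component_eq_cart set_lebesgue_integral_eq_integral(1))
  then have *: "integral S (\<lambda>x. j x * f (g x)) = integral (g ` S) f"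
    by (simp add: F_def)
  have "(\<integral>x. indicator S x * (j x * f (g x)) \<partial>lborel) = (\<integral>x. indicator S x *\<^sub>R (j x * f (g x)) \<partial>lebesgue)"
    by (subst integral_completion) auto
  also have "\<dots> = integral S (\<lambda>x. j x * f (g x))"
    using set_lebesgue_integral_eq_integral(2) [OF A'] by (simp add: set_lebesgue_integral_def)
  also have "\<dots> = (\<integral>x. indicator (g ` S) x *\<^sub>R f x \<partial>lebesgue)"
    using set_lebesgue_integral_eq_integral(2) [OF f'] * by (simp add: set_lebesgue_integral_def)
  also have "\<dots> = (\<integral>x. indicator (g ` S) x * f x \<partial>lborel)"
    by (subst integral_completion) auto
  finally show "(\<integral>x. indicator S x * (j x * f (g x)) \<partial>lborel) = (\<integral>x. indicator (g ` S) x * f x \<partial>lborel)" .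
qed

lemma integral_linear_isometry:
  fixes f :: "real^2 \<Rightarrow> real" and T :: "real^2 \<Rightarrow> real^2"
  assumes T: "linear T" "inj T" "\<bar>det (matrix T)\<bar> = 1"
    and f: "f \<in> borel_measurable borel" "integrable lborel f"
  shows "(\<integral>x. f (T x) \<partial>lborel) = integral\<^sup>L lborel f"
proof -
  have s: "T ` UNIV = UNIV" using linear_inj_imp_surj [OF T(1,2)] by auto
  have b: "bounded_linear T" using T(1) by (simp add: linear_conv_bounded_linear)
  have m: "T \<in> borel_measurable borel"
    using b by (intro borel_measurable_continuous_onI linear_continuous_on)
  have "(\<integral>x. indicator UNIV x * (1 * f (T x)) \<partial>lborel) = (\<integral>x. indicator (T ` UNIV) x * f x \<partial>lborel)"
    by (rule change_of_variables_lborel [where g' = "\<lambda>_. T"])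
      (use T f b m s in \<open>auto intro: bounded_linear_imp_has_derivative\<close>)
  then show ?thesis using s by simp
qed

text \<open>The transition map between the two charts. Division by zero sends the origin to itself,
  which makes the map an involution of the whole plane; the origin is a null set.\<close>

definition inversion :: "real^2 \<Rightarrow> real^2" where
  "inversion x = (1 / (norm x)\<^sup>2) *\<^sub>R x"

text \<open>The derivative of the inversion at \<open>x\<close>: the reflection in the line
  orthogonal to \<open>x\<close>, scaled by the inverse square of its norm. Hence it is symmetric,
  divides norms by \<open>(norm x)\<^sup>2\<close>, and has determinant of absolute value
  \<open>1 / norm x ^ 4\<close>.\<close>

definition inversion' :: "real^2 \<Rightarrow> real^2 \<Rightarrow> real^2" where
  "inversion' x h = (1 / (norm x)\<^sup>2) *\<^sub>R h - (2 * (x \<bullet> h) / (norm x) ^ 4) *\<^sub>R x"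

lemma inversion_involution [simp]: "inversion (inversion x) = x"
  by (cases "x = 0") (simp_all add: inversion_def power2_eq_square)

lemma norm_inversion: "norm (inversion x) = 1 / norm x"
  by (cases "x = 0") (simp_all add: inversion_def power2_eq_square)

lemma inversion_eq_0_iff [simp]: "inversion x = 0 \<longleftrightarrow> x = 0"
  by (simp add: inversion_def)

lemma inversion_image: "inversion ` (- {0}) = - {0}"
proof
  show "- {0} \<subseteq> inversion ` (- {0})"
  proof
    fix x :: "real^2" assume "x \<in> - {0}"
    then show "x \<in> inversion ` (- {0})" by (intro image_eqI [of _ _ "inversion x"]) auto
  qed
qed auto

lemma inversion_has_derivative:
  assumes "x \<noteq> 0"
  shows "(inversion has_derivative inversion' x) (at x)"
proof -
  have "((\<lambda>x::real^2. (1 / (x \<bullet> x)) *\<^sub>R x) has_derivative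
      (\<lambda>h. (1 / (x \<bullet> x)) *\<^sub>R h - (2 * (x \<bullet> h) / (x \<bullet> x)\<^sup>2) *\<^sub>R x)) (at x)"
    using assms
    by (auto intro!: derivative_eq_intros simp: fun_eq_iff inner_commute power2_eq_square divide_simps)
  then show ?thesis
    by (simp add: inversion_def [abs_def] inversion'_def [abs_def] power2_norm_eq_inner [symmetric]
        power2_eq_square power4_eq_xxxx mult.assoc)
qed

lemma inversion'_axis:
  "inversion' x (axis j 1) $ i = (if i = j then 1 / (norm x)\<^sup>2 else 0) - 2 * x $ j * x $ i / norm x ^ 4"
  unfolding inversion'_def vector_minus_component vector_scaleR_component inner_axis
  by (simp add: axis_def)

lemma det_inversion':
  assumes "x \<noteq> 0"
  shows "\<bar>det (matrix (inversion' x))\<bar> = 1 / norm x ^ 4"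
proof -
  define r where "r = (norm x)\<^sup>2"
  have "r > 0" using assms by (simp add: r_def)
  moreover have "r = (x $ 1)\<^sup>2 + (x $ 2)\<^sup>2"
    unfolding r_def power2_norm_eq_inner inner_vec_def sum_2 by (simp add: power2_eq_square)
  ultimately have r: "r = (x $ 1)\<^sup>2 + (x $ 2)\<^sup>2" "r > 0" by simp_all
  have r4: "norm x ^ 4 = r\<^sup>2" by (simp add: r_def flip: power_mult)
  have "det (matrix (inversion' x)) =
      (1 / r - 2 * (x $ 1)\<^sup>2 / r\<^sup>2) * (1 / r - 2 * (x $ 2)\<^sup>2 / r\<^sup>2) - (2 * x $ 1 * x $ 2 / r\<^sup>2)\<^sup>2"
    unfolding det_2 matrix_def by (simp add: inversion'_axis r4 flip: r_def)
      (simp add: power2_eq_square power4_eq_xxxx mult_ac)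
  also have "\<dots> = 1 / r\<^sup>2 - 2 * ((x $ 1)\<^sup>2 + (x $ 2)\<^sup>2) / r ^ 3"
    using r(2) by (simp add: field_simps power2_eq_square power3_eq_cube)
  also have "\<dots> = - (1 / r\<^sup>2)"
    unfolding r(1) [symmetric] using r(2) by (simp add: field_simps power2_eq_square power3_eq_cube)
  finally show ?thesis by (simp add: r4)
qed

lemma inversion_measurable [measurable]: "inversion \<in> borel_measurable borel"
  unfolding inversion_def [abs_def] by measurable

lemma
  fixes f :: "real^2 \<Rightarrow> real"
  assumes m: "f \<in> borel_measurable borel" and f: "integrable lborel f"
  shows integrable_inversion: "integrable lborel (\<lambda>x. f (inversion x) / norm x ^ 4)"
    and integral_inversion: "(\<integral>x. f (inversion x) / norm x ^ 4 \<partial>lborel) = integral\<^sup>L lborel f"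
proof -
  have S: "- {0} \<in> sets (borel :: (real^2) measure)" by simp
  have i: "integrable lborel (\<lambda>x. indicator (inversion ` (- {0})) x * f x)"
    unfolding inversion_image using integrable_mult_indicator [OF _ f, of "- {0}"] by simp
  have inj: "inj_on inversion (- {0})" by (metis inj_onI inversion_involution)
  note cv = change_of_variables_lborel [OF S _ inversion_has_derivative inj det_inversion' _ _ m i]
  have e: "indicator (- {0}) x * (1 / norm x ^ 4 * f (inversion x)) = f (inversion x) / norm x ^ 4" for x
    by (cases "x = 0") auto
  show "integrable lborel (\<lambda>x. f (inversion x) / norm x ^ 4)"
  proof -
    have "integrable lborel (\<lambda>x. indicator (- {0}) x * (1 / norm x ^ 4 * f (inversion x)))"
      by (rule cv(1)) (simp_all add: inversion_image)
    then show ?thesis by (simp only: e)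
  qed
  have "(\<integral>x. f (inversion x) / norm x ^ 4 \<partial>lborel) = (\<integral>x. indicator (- {0}) x * f x \<partial>lborel)"
  proof -
    have "(\<integral>x. indicator (- {0}) x * (1 / norm x ^ 4 * f (inversion x)) \<partial>lborel)
        = (\<integral>x. indicator (inversion ` (- {0})) x * f x \<partial>lborel)"
      by (rule cv(2)) (simp_all add: inversion_image)
    then show ?thesis by (simp only: e inversion_image)
  qed
  also have "\<dots> = integral\<^sup>L lborel f"
  proof (rule integral_cong_AE)
    have "AE x::real^2 in lborel. x \<noteq> 0" by (rule AE_lborel_singleton)
    then show "AE x in lborel. indicator (- {0}) x * f x = f x" by eventually_elim simp
  qed (use m in auto)
  finally show "(\<integral>x. f (inversion x) / norm x ^ 4 \<partial>lborel) = integral\<^sup>L lborel f" .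
qed

lemma AE_inversion:
  assumes P: "AE x in lborel. P (x::real^2)" and [measurable]: "Measurable.pred borel P"
  shows "AE x in lborel. P (inversion x)"
proof -
  \<comment> \<open>Any positive value off \<open>P\<close> would do. The function is zero almost
    everywhere, so the transformed integral of a nonnegative function vanishes, and that function is
    positive wherever \<open>P (inversion x)\<close> fails and \<open>x\<close> is nonzero.\<close>
  define f where "f x = (if P x then 0 else exp (- 1) :: real)" for x
  have [measurable]: "f \<in> borel_measurable borel" unfolding f_def by measurable
  have 0: "AE x in lborel. f x = 0" using P by eventually_elim (simp add: f_def)
  then have i: "integrable lborel f" "integral\<^sup>L lborel f = 0"
    by (subst integrable_cong_AE [where g = "\<lambda>_. 0"]; simp)
      (subst integral_cong_AE [where g = "\<lambda>_. 0"]; use 0 in simp)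
  then have "(\<integral>x. f (inversion x) / norm x ^ 4 \<partial>lborel) = 0"
    "integrable lborel (\<lambda>x. f (inversion x) / norm x ^ 4)"
    by (simp_all add: integral_inversion integrable_inversion)
  then have "AE x in lborel. f (inversion x) / norm x ^ 4 = 0"
    by (subst (asm) integral_nonneg_eq_0_iff_AE) (auto simp: f_def)
  moreover have "AE x::real^2 in lborel. x \<noteq> 0" by (rule AE_lborel_singleton)
  ultimately show ?thesis
    by eventually_elim (auto simp: f_def split: if_splits)
qed

section \<open>Completeness of spaces of square-integrable functions\<close>

lemma tendsto_ennreal_0I:
  fixes f :: "'a \<Rightarrow> ennreal"
  assumes "\<And>\<epsilon>. \<epsilon> > 0 \<Longrightarrow> \<forall>\<^sub>F n in F. f n \<le> ennreal \<epsilon>"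
  shows "(f \<longlongrightarrow> 0) F"
proof (rule order_tendstoI)
  fix a :: ennreal assume "0 < a"
  then obtain b where b: "0 < b" "b < a" using dense by blast
  then obtain e where "b = ennreal e" "e \<ge> 0" by (cases b) auto
  with b have e: "e > 0" "ennreal e < a" by auto
  from assms [OF e(1)] show "\<forall>\<^sub>F n in F. f n < a"
    by eventually_elim (use e(2) in \<open>simp add: le_less_trans\<close>)
qed simp

text \<open>Along a subsequence whose steps \<open>d\<^sub>k\<close> have squared norm at most \<open>8^(-k)\<close>, the series
  of \<open>2^k \<bar>d\<^sub>k\<bar>\<^sup>2\<close> is integrable, hence finite almost everywhere, which makes the subsequence
  converge almost everywhere.\<close>

lemma riesz_fischer_L2:
  fixes f :: "nat \<Rightarrow> 'a \<Rightarrow> 'b::{banach, second_countable_topology}"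
  assumes m [measurable]: "\<And>n. f n \<in> borel_measurable M"
    and cau: "\<And>\<epsilon>. \<epsilon> > 0 \<Longrightarrow> \<exists>N. \<forall>m\<ge>N. \<forall>n\<ge>N.
        (\<integral>\<^sup>+ x. ennreal ((norm (f m x - f n x))\<^sup>2) \<partial>M) \<le> ennreal \<epsilon>"
  obtains g r where "g \<in> borel_measurable M" "strict_mono r"
    "AE x in M. (\<lambda>k. f (r k) x) \<longlonglongrightarrow> g x"
    "(\<lambda>n. \<integral>\<^sup>+ x. ennreal ((norm (f n x - g x))\<^sup>2) \<partial>M) \<longlonglongrightarrow> 0"
proof -
  let ?I = "\<lambda>m n. \<integral>\<^sup>+ x. ennreal ((norm (f m x - f n x))\<^sup>2) \<partial>M"
  have "\<exists>N. \<forall>m\<ge>N. \<forall>n\<ge>N. ?I m n \<le> ennreal ((1/8) ^ k)" for k :: nat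
    by (rule cau) simp
  then obtain N where N: "\<And>k m n. m \<ge> N k \<Longrightarrow> n \<ge> N k \<Longrightarrow> ?I m n \<le> ennreal ((1/8) ^ k)" by metis
  \<comment> \<open>Adding up the thresholds makes \<open>r\<close> strictly increasing and keeps
    \<open>r k\<close> at least \<open>N k\<close>.\<close>
  define r where "r k = (\<Sum>j\<le>k. Suc (N j))" for k
  have rm: "strict_mono r" unfolding strict_mono_Suc_iff r_def by simp
  have rN: "N k \<le> r k" for k
    unfolding r_def using member_le_sum [of k "{..k}" "\<lambda>j. Suc (N j)"] by simp
  have rN': "N k \<le> r (Suc k)" for k
    using rN [of k] rm by (metis le_trans lessI less_imp_le strict_mono_less_eq)
  define d where "d k x = f (r (Suc k)) x - f (r k) x" for k x
  have [measurable]: "d k \<in> borel_measurable M" for k unfolding d_def by measurable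
  have dI: "(\<integral>\<^sup>+ x. ennreal ((norm (d k x))\<^sup>2) \<partial>M) \<le> ennreal ((1/8) ^ k)" for k
    unfolding d_def by (rule N [OF rN' rN])
  have "(\<integral>\<^sup>+ x. (\<Sum>k. ennreal (2 ^ k) * ennreal ((norm (d k x))\<^sup>2)) \<partial>M)
      = (\<Sum>k. \<integral>\<^sup>+ x. ennreal (2 ^ k) * ennreal ((norm (d k x))\<^sup>2) \<partial>M)"
    by (rule nn_integral_suminf) measurable
  also have "\<dots> \<le> (\<Sum>k. ennreal ((1/4) ^ k))"
  proof (rule suminf_le [OF _ summableI summableI])
    fix k
    have "(\<integral>\<^sup>+ x. ennreal (2 ^ k) * ennreal ((norm (d k x))\<^sup>2) \<partial>M) \<le> ennreal (2 ^ k) * ennreal ((1/8) ^ k)"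
      by (subst nn_integral_cmult) (auto intro: mult_left_mono dI)
    also have "\<dots> = ennreal ((1/4) ^ k)"
      by (simp add: ennreal_mult' [symmetric] power_mult_distrib [symmetric])
    finally show "(\<integral>\<^sup>+ x. ennreal (2 ^ k) * ennreal ((norm (d k x))\<^sup>2) \<partial>M) \<le> ennreal ((1/4) ^ k)" .
  qed
  also have "\<dots> = ennreal (1 / (1 - 1/4))"
    by (rule suminf_ennreal_eq) (use geometric_sums [of "1/4 :: real"] in auto)
  finally have "(\<integral>\<^sup>+ x. (\<Sum>k. ennreal (2 ^ k) * ennreal ((norm (d k x))\<^sup>2)) \<partial>M) \<noteq> \<infinity>"
    by (auto simp: top_unique)
  then have "AE x in M. (\<Sum>k. ennreal (2 ^ k) * ennreal ((norm (d k x))\<^sup>2)) \<noteq> \<infinity>"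
    by (intro nn_integral_noteq_infinite) measurable
  then have conv: "AE x in M. convergent (\<lambda>k. f (r k) x)"
  proof eventually_elim
    case (elim x)
    then obtain c where c: "c \<ge> 0" "(\<Sum>k. ennreal (2 ^ k) * ennreal ((norm (d k x))\<^sup>2)) = ennreal c"
      by (cases "\<Sum>k. ennreal (2 ^ k) * ennreal ((norm (d k x))\<^sup>2)") auto
    \<comment> \<open>A single term of the series is at most its sum \<open>c\<close>; taking square
      roots gives a geometric majorant for the steps.\<close>
    have le: "norm (d k x) \<le> sqrt c * sqrt (1/2) ^ k" for k
    proof -
      have "(\<Sum>k\<in>{k}. ennreal (2 ^ k) * ennreal ((norm (d k x))\<^sup>2)) \<le> ennreal c"
        unfolding c(2) [symmetric] by (rule sum_le_suminf) auto
      then have "2 ^ k * (norm (d k x))\<^sup>2 \<le> c"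
        using c(1) by (simp add: ennreal_mult' [symmetric])
      then have "(norm (d k x))\<^sup>2 \<le> c * (1/2) ^ k" by (simp add: field_simps power_one_over)
      then have "norm (d k x) \<le> sqrt (c * (1/2) ^ k)" by (rule real_le_rsqrt)
      then show ?thesis by (simp add: real_sqrt_mult real_sqrt_power)
    qed
    have "summable (\<lambda>k. d k x)"
    proof (rule summable_comparison_test' [OF _ le])
      show "summable (\<lambda>k. sqrt c * sqrt (1/2) ^ k)"
        by (intro summable_mult summable_geometric) (simp add: real_sqrt_divide)
    qed
    then have "convergent (\<lambda>n. \<Sum>k<n. d k x)"
      by (simp add: summable_iff_convergent)
    then have "convergent (\<lambda>n. f (r n) x - f (r 0) x)"
      unfolding d_def by (simp add: sum_lessThan_telescope [where f = "\<lambda>k. f (r k) x"])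
    then obtain l where "(\<lambda>n. f (r n) x - f (r 0) x) \<longlonglongrightarrow> l" by (auto simp: convergent_def)
    from tendsto_add [OF this tendsto_const [of "f (r 0) x"]] show ?case
      by (auto simp: convergent_def)
  qed
  define g where "g x = lim (\<lambda>k. f (r k) x)" for x
  have g [measurable]: "g \<in> borel_measurable M"
    unfolding g_def by (rule borel_measurable_lim_metric) measurable
  have lim: "AE x in M. (\<lambda>k. f (r k) x) \<longlonglongrightarrow> g x"
    using conv by eventually_elim (simp add: g_def convergent_LIMSEQ_iff)
  have "(\<lambda>n. \<integral>\<^sup>+ x. ennreal ((norm (f n x - g x))\<^sup>2) \<partial>M) \<longlonglongrightarrow> 0"
  proof (rule tendsto_ennreal_0I)
    fix \<epsilon> :: real assume "\<epsilon> > 0"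
    from cau [OF this] obtain K where K: "\<And>m n. m \<ge> K \<Longrightarrow> n \<ge> K \<Longrightarrow> ?I m n \<le> ennreal \<epsilon>" by blast
    have "(\<integral>\<^sup>+ x. ennreal ((norm (f n x - g x))\<^sup>2) \<partial>M) \<le> ennreal \<epsilon>" if n: "n \<ge> K" for n
    proof -
      have "(\<integral>\<^sup>+ x. ennreal ((norm (f n x - g x))\<^sup>2) \<partial>M)
          = (\<integral>\<^sup>+ x. liminf (\<lambda>k. ennreal ((norm (f n x - f (r k) x))\<^sup>2)) \<partial>M)"
      proof (rule nn_integral_cong_AE, use lim in eventually_elim)
        case (elim x)
        then have "(\<lambda>k. ennreal ((norm (f n x - f (r k) x))\<^sup>2)) \<longlonglongrightarrow> ennreal ((norm (f n x - g x))\<^sup>2)"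
          by (intro tendsto_intros tendsto_ennrealI)
        then show ?case by (rule lim_imp_Liminf [OF trivial_limit_sequentially, symmetric])
      qed
      \<comment> \<open>Fatou's lemma along the subsequence passes the Cauchy estimate on to the
        limit function, and thereby to the full sequence.\<close>
      also have "\<dots> \<le> liminf (\<lambda>k. ?I n (r k))" by (rule nn_integral_liminf) measurable
      also have "\<dots> \<le> ennreal \<epsilon>"
      proof (rule Liminf_le)
        have "r k \<ge> K" if "k \<ge> K" for k using that seq_suble [OF rm, of k] by linarith
        then show "\<forall>\<^sub>F k in sequentially. ?I n (r k) \<le> ennreal \<epsilon>"
          unfolding eventually_sequentially using K [OF n] by blast
      qed simp
      finally show ?thesis .
    qed
    then show "\<forall>\<^sub>F n in sequentially. (\<integral>\<^sup>+ x. ennreal ((norm (f n x - g x))\<^sup>2) \<partial>M) \<le> ennreal \<epsilon>"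
      unfolding eventually_sequentially by blast
  qed
  with g rm lim show ?thesis by (rule that)
qed

lemma norm_add_sq_le: "(norm (a + b))\<^sup>2 \<le> 2 * (norm a)\<^sup>2 + 2 * (norm b)\<^sup>2"
  for a b :: "'a::real_normed_vector"
proof -
  have "(norm (a + b))\<^sup>2 \<le> (norm a + norm b)\<^sup>2" by (intro power_mono norm_triangle_ineq) simp
  also have "\<dots> \<le> 2 * (norm a)\<^sup>2 + 2 * (norm b)\<^sup>2"
    using sum_squares_bound [of "norm a" "norm b"] by (simp add: power2_sum)
  finally show ?thesis .
qed

lemma integrable_norm_sq_add:
  fixes f g :: "'a \<Rightarrow> 'b::{banach, second_countable_topology}"
  assumes [measurable]: "f \<in> borel_measurable M" "g \<in> borel_measurable M"
    and "integrable M (\<lambda>x. (norm (f x))\<^sup>2)" "integrable M (\<lambda>x. (norm (g x))\<^sup>2)"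
  shows "integrable M (\<lambda>x. (norm (f x + g x))\<^sup>2)"
proof (rule Bochner_Integration.integrable_bound)
  show "integrable M (\<lambda>x. 2 * (norm (f x))\<^sup>2 + 2 * (norm (g x))\<^sup>2)" using assms by auto
  show "AE x in M. norm ((norm (f x + g x))\<^sup>2) \<le> norm (2 * (norm (f x))\<^sup>2 + 2 * (norm (g x))\<^sup>2)"
    using norm_add_sq_le by (intro AE_I2) simp
qed measurable

lemma integrable_norm_sq_iff:
  fixes f :: "'a \<Rightarrow> 'b::{banach, second_countable_topology}"
  assumes [measurable]: "f \<in> borel_measurable M"
  shows "integrable M (\<lambda>x. (norm (f x))\<^sup>2) \<longleftrightarrow> (\<integral>\<^sup>+ x. ennreal ((norm (f x))\<^sup>2) \<partial>M) < \<infinity>"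
  by (subst integrable_iff_bounded) auto

lemma integrable_L2_limit:
  fixes f :: "nat \<Rightarrow> 'a \<Rightarrow> 'b::{banach, second_countable_topology}"
  assumes [measurable]: "\<And>n. f n \<in> borel_measurable M" "g \<in> borel_measurable M"
    and "\<And>n. integrable M (\<lambda>x. (norm (f n x))\<^sup>2)"
    and "(\<lambda>n. \<integral>\<^sup>+ x. ennreal ((norm (f n x - g x))\<^sup>2) \<partial>M) \<longlonglongrightarrow> 0"
  shows "integrable M (\<lambda>x. (norm (g x))\<^sup>2)"
proof -
  have "\<forall>\<^sub>F n in sequentially. (\<integral>\<^sup>+ x. ennreal ((norm (f n x - g x))\<^sup>2) \<partial>M) < 1"
    by (rule order_tendstoD [OF assms(4)]) simp
  then obtain n where "(\<integral>\<^sup>+ x. ennreal ((norm (f n x - g x))\<^sup>2) \<partial>M) < 1"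
    unfolding eventually_sequentially by blast
  then have "integrable M (\<lambda>x. (norm (f n x - g x))\<^sup>2)"
    by (subst integrable_norm_sq_iff) (auto intro: less_le_trans)
  then have "integrable M (\<lambda>x. (norm (g x - f n x))\<^sup>2)" by (simp add: norm_minus_commute)
  from integrable_norm_sq_add [OF _ _ this assms(3) [of n]] show ?thesis by simp
qed

text \<open>The Cauchy-Schwarz inequality in weighted form: |h| |\<phi>| is at most \<delta>
  \<phi>^2 + h^2 / \<delta>, where \<delta> is fixed first to make the \<phi> term small and then n
  is taken large for the other term.\<close>

lemma L2_imp_L1_mult:
  fixes h :: "nat \<Rightarrow> 'a \<Rightarrow> real"
  assumes [measurable]: "\<And>n. h n \<in> borel_measurable M" "\<phi> \<in> borel_measurable M"
    and \<phi>: "integrable M (\<lambda>x. (\<phi> x)\<^sup>2)"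
    and 0: "(\<lambda>n. \<integral>\<^sup>+ x. ennreal ((h n x)\<^sup>2) \<partial>M) \<longlonglongrightarrow> 0"
  shows "(\<lambda>n. \<integral>\<^sup>+ x. ennreal (\<bar>h n x\<bar> * \<bar>\<phi> x\<bar>) \<partial>M) \<longlonglongrightarrow> 0"
proof (rule tendsto_ennreal_0I)
  fix \<epsilon> :: real assume e: "\<epsilon> > 0"
  define C where "C = (\<integral>x. (\<phi> x)\<^sup>2 \<partial>M)"
  have C: "C \<ge> 0" "(\<integral>\<^sup>+ x. ennreal ((\<phi> x)\<^sup>2) \<partial>M) = ennreal C"
    unfolding C_def by (auto simp: nn_integral_eq_integral [OF \<phi>])
  \<comment> \<open>Chosen so that \<delta> C is at most half of \<epsilon>; the added 1 covers C =
    0. The second half is reached once the integral of h^2 is below \<delta> \<epsilon> / 2.\<close>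
  define \<delta> where "\<delta> = \<epsilon> / (2 * (C + 1))"
  have d: "\<delta> > 0" using e C by (simp add: \<delta>_def)
  have dC: "\<delta> * C \<le> \<epsilon> / 2" using e C by (simp add: \<delta>_def field_simps)
  have "\<forall>\<^sub>F n in sequentially. (\<integral>\<^sup>+ x. ennreal ((h n x)\<^sup>2) \<partial>M) < ennreal (\<delta> * \<epsilon> / 2)"
    by (rule order_tendstoD [OF 0]) (use d e in simp)
  then show "\<forall>\<^sub>F n in sequentially. (\<integral>\<^sup>+ x. ennreal (\<bar>h n x\<bar> * \<bar>\<phi> x\<bar>) \<partial>M) \<le> ennreal \<epsilon>"
  proof eventually_elim
    case (elim n)
    have "\<bar>h n x\<bar> * \<bar>\<phi> x\<bar> \<le> \<delta> * (\<phi> x)\<^sup>2 + (1 / \<delta>) * (h n x)\<^sup>2" for x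
    proof -
      have "0 \<le> (\<delta> * \<bar>\<phi> x\<bar> - \<bar>h n x\<bar>)\<^sup>2 + \<delta> * (\<bar>h n x\<bar> * \<bar>\<phi> x\<bar>)" using d by simp
      then have "\<delta> * (\<bar>h n x\<bar> * \<bar>\<phi> x\<bar>) \<le> \<delta>\<^sup>2 * (\<phi> x)\<^sup>2 + (h n x)\<^sup>2"
        by (simp add: power2_diff power_mult_distrib algebra_simps)
      then show ?thesis using d by (simp add: field_simps power2_eq_square)
    qed
    then have "(\<integral>\<^sup>+ x. ennreal (\<bar>h n x\<bar> * \<bar>\<phi> x\<bar>) \<partial>M)
        \<le> (\<integral>\<^sup>+ x. ennreal \<delta> * ennreal ((\<phi> x)\<^sup>2) + ennreal (1 / \<delta>) * ennreal ((h n x)\<^sup>2) \<partial>M)"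
      using d by (intro nn_integral_mono) (simp flip: ennreal_mult ennreal_plus add: ennreal_leI)
    also have "\<dots> = ennreal \<delta> * ennreal C + ennreal (1 / \<delta>) * (\<integral>\<^sup>+ x. ennreal ((h n x)\<^sup>2) \<partial>M)"
      by (simp add: nn_integral_add nn_integral_cmult C)
    also have "\<dots> \<le> ennreal (\<epsilon> / 2) + ennreal (1 / \<delta>) * ennreal (\<delta> * \<epsilon> / 2)"
      using elim dC d C(1) by (intro add_mono mult_left_mono) (auto simp flip: ennreal_mult intro: ennreal_leI)
    also have "\<dots> = ennreal \<epsilon>"
      using d e by (simp flip: ennreal_mult ennreal_plus)
    finally show ?case .
  qed
qed

lemma integrable_inner_L2:
  fixes f g :: "'a \<Rightarrow> 'b::euclidean_space"
  assumes [measurable]: "f \<in> borel_measurable M" "g \<in> borel_measurable M"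
    and "integrable M (\<lambda>x. (norm (f x))\<^sup>2)" "integrable M (\<lambda>x. (norm (g x))\<^sup>2)"
  shows "integrable M (\<lambda>x. f x \<bullet> g x)"
proof (rule Bochner_Integration.integrable_bound)
  show "integrable M (\<lambda>x. (norm (f x))\<^sup>2 + (norm (g x))\<^sup>2)" using assms by auto
  have "\<bar>a \<bullet> b\<bar> \<le> (norm a)\<^sup>2 + (norm b)\<^sup>2" for a b :: 'b
    using Cauchy_Schwarz_ineq2 [of a b] sum_squares_bound [of "norm a" "norm b"]
      mult_nonneg_nonneg [OF norm_ge_zero [of a] norm_ge_zero [of b]] by linarith
  then show "AE x in M. norm (f x \<bullet> g x) \<le> norm ((norm (f x))\<^sup>2 + (norm (g x))\<^sup>2)"
    by (intro AE_I2) (simp add: order_trans [OF _ abs_ge_self])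
qed measurable

section \<open>Functions of finite energy\<close>

lemma conf_pos: "conf x > 0"
  using one_plus_norm_sq_pos [of x] by (simp add: conf_def)

lemma continuous_conf: "continuous_on S conf"
  unfolding conf_def by (intro continuous_intros) (simp add: one_plus_norm_sq_ne)

lemma conf_measurable [measurable]: "conf \<in> borel_measurable borel"
  by (rule borel_measurable_continuous_onI) (rule continuous_conf)

lemma conf_inversion: "x \<noteq> 0 \<Longrightarrow> conf (inversion x) = conf x * norm x ^ 4"
  by (simp add: conf_def norm_inversion field_simps power2_eq_square power4_eq_xxxx)

text \<open>The squared norm of \<open>fvec \<omega> U V\<close> is the density of the form plus that of the \<open>L\<^sup>2\<close>-norm,
  for the function \<open>U\<close> with gradient \<open>V\<close> in the first chart.\<close>

definition fvec :: "real \<Rightarrow> (real^2 \<Rightarrow> real) \<Rightarrow> (real^2 \<Rightarrow> real^2) \<Rightarrow> real^2 \<Rightarrow> real \<times> (real^2) \<times> real" where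
  "fvec \<omega> U V x = (sqrt (conf x) * U x, V x, \<omega> * norm x * (sqrt (conf x) * U x))"

lemma fvec_measurable [measurable (raw)]:
  assumes [measurable]: "U \<in> borel_measurable borel" "V \<in> borel_measurable borel"
  shows "fvec \<omega> U V \<in> borel_measurable borel"
  unfolding fvec_def [abs_def] by (intro borel_measurable_Pair) measurable

text \<open>No conformal factor stands at the gradients: the factor 1 / \<open>conf\<close> of the
  covector metric cancels against the area density. Through \<open>fvec\<close> the form plus the
  scalar product becomes a plain scalar product of vector-valued square-integrable functions, so
  that closedness reduces to completeness.\<close>

lemma inner_fvec: "fvec \<omega> U V x \<bullet> fvec \<omega> U' V' x =
    conf x * (U x * U' x) + (V x \<bullet> V' x + \<omega>\<^sup>2 * (norm x)\<^sup>2 * conf x * (U x * U' x))"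
  using conf_pos [of x] by (simp add: fvec_def algebra_simps power2_eq_square flip: real_sqrt_mult)

lemma norm_fvec: "(norm (fvec \<omega> U V x))\<^sup>2 =
    conf x * (U x)\<^sup>2 + ((norm (V x))\<^sup>2 + \<omega>\<^sup>2 * (norm x)\<^sup>2 * conf x * (U x)\<^sup>2)"
  unfolding power2_norm_eq_inner inner_fvec by (simp add: power2_eq_square)

lemma fvec_lincomb: "fvec \<omega> (\<lambda>x. a * U x + b * U' x) (\<lambda>x. a *\<^sub>R V x + b *\<^sub>R V' x) x
    = a *\<^sub>R fvec \<omega> U V x + b *\<^sub>R fvec \<omega> U' V' x"
  by (simp add: fvec_def algebra_simps)

lemma norm_fvec_ge:
  "sqrt (conf x) * \<bar>U x\<bar> \<le> norm (fvec \<omega> U V x)" "norm (V x) \<le> norm (fvec \<omega> U V x)"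
proof -
  show "sqrt (conf x) * \<bar>U x\<bar> \<le> norm (fvec \<omega> U V x)"
    using norm_fst_le [of "sqrt (conf x) * U x"] conf_pos [of x] by (simp add: fvec_def abs_mult)
  have "norm (V x) \<le> norm (snd (fvec \<omega> U V x))"
    using norm_fst_le [of "V x"] by (simp add: fvec_def)
  also have "\<dots> \<le> norm (fvec \<omega> U V x)"
    using norm_snd_le [of "snd (fvec \<omega> U V x)" "fst (fvec \<omega> U V x)"] by simp
  finally show "norm (V x) \<le> norm (fvec \<omega> U V x)" .
qed

text \<open>The gradient of \<open>U \<circ> inversion\<close> when \<open>V\<close> is that of
  \<open>U\<close>. The chain rule asks for the transpose of the derivative, which equals the
  derivative itself by symmetry.\<close>

definition pull :: "(real^2 \<Rightarrow> real^2) \<Rightarrow> real^2 \<Rightarrow> real^2" where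
  "pull V x = inversion' x (V (inversion x))"

lemma norm_inversion': "norm (inversion' x h) = norm h / (norm x)\<^sup>2"
proof (cases "x = 0")
  case False
  have "(norm (inversion' x h))\<^sup>2 = (norm h / (norm x)\<^sup>2)\<^sup>2"
    using False unfolding inversion'_def power2_norm_eq_inner power_divide
    by (simp add: algebra_simps inner_commute power4_eq_xxxx)
      (simp add: field_simps power2_eq_square flip: power2_norm_eq_inner)
  then show ?thesis by (simp add: power2_eq_iff_nonneg)
qed (simp add: inversion'_def)

lemma norm_pull: "norm (pull V x) = norm (V (inversion x)) / (norm x)\<^sup>2"
  by (simp add: pull_def norm_inversion')

lemma pull_lincomb: "pull (\<lambda>x. a *\<^sub>R V x + b *\<^sub>R V' x) x = a *\<^sub>R pull V x + b *\<^sub>R pull V' x"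
  by (simp add: pull_def inversion'_def algebra_simps add_divide_distrib)

lemma pull_measurable [measurable (raw)]:
  assumes [measurable]: "V \<in> borel_measurable borel"
  shows "pull V \<in> borel_measurable borel"
  unfolding pull_def [abs_def] inversion'_def [abs_def] by measurable

text \<open>Stronger on its face than membership in the form domain, because the weak gradient in
  the second chart is required to be the pullback of the one in the first. With the second gradient
  tied to the first, convergence in the first chart controls both.\<close>

definition nice :: "real \<Rightarrow> (real^2 \<Rightarrow> real) \<Rightarrow> (real^2 \<Rightarrow> real^2) \<Rightarrow> bool" where
  "nice \<omega> U V \<longleftrightarrow> weak_gradient U V \<and> weak_gradient (U \<circ> inversion) (pull V) \<and>
     integrable lborel (\<lambda>x. (norm (fvec \<omega> U V x))\<^sup>2)"

lemma weak_gradient_measurable: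
  assumes "weak_gradient U V"
  shows "U \<in> borel_measurable borel" "V \<in> borel_measurable borel"
  using assms by (auto simp: weak_gradient_def intro: locally_integrable_measurable)

lemma nice_lincomb:
  assumes "nice \<omega> U V" "nice \<omega> U' V'"
  shows "nice \<omega> (\<lambda>x. a * U x + b * U' x) (\<lambda>x. a *\<^sub>R V x + b *\<^sub>R V' x)"
proof -
  have [measurable]: "U \<in> borel_measurable borel" "V \<in> borel_measurable borel"
    "U' \<in> borel_measurable borel" "V' \<in> borel_measurable borel"
    using assms weak_gradient_measurable by (auto simp: nice_def)
  have "weak_gradient ((\<lambda>x. a * U x + b * U' x) \<circ> inversion) (pull (\<lambda>x. a *\<^sub>R V x + b *\<^sub>R V' x))"
    using assms weak_gradient_lincomb [of "U \<circ> inversion" "pull V" "U' \<circ> inversion" "pull V'" a b]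
    by (simp add: nice_def o_def pull_lincomb [abs_def])
  moreover have "integrable lborel (\<lambda>x. (norm (a *\<^sub>R fvec \<omega> U V x + b *\<^sub>R fvec \<omega> U' V' x))\<^sup>2)"
    using assms by (intro integrable_norm_sq_add) (auto simp: nice_def power_mult_distrib)
  ultimately show ?thesis
    using assms by (simp add: nice_def weak_gradient_lincomb fvec_lincomb)
qed

text \<open>On a compact set \<open>c\<close> is bounded, and |h| is at most h^2 + 1, which is
  integrable there.\<close>

lemma locally_integrable_bound:
  fixes f :: "real^2 \<Rightarrow> 'b::{banach, second_countable_topology}"
  assumes [measurable]: "f \<in> borel_measurable borel" "h \<in> borel_measurable borel"
    and h: "integrable lborel (\<lambda>x. (h x :: real)\<^sup>2)" and c: "continuous_on UNIV c"
    and le: "AE x in lborel. norm (f x) \<le> h x * c x"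
  shows "locally_integrable f"
  unfolding locally_integrable_def
proof (intro allI impI)
  fix K :: "(real^2) set" assume K: "compact K"
  then have [measurable]: "K \<in> sets borel" by (simp add: borel_compact)
  have "bounded (c ` K)"
    using c K by (meson compact_continuous_image compact_imp_bounded continuous_on_subset subset_UNIV)
  then obtain C where C: "\<And>x. x \<in> K \<Longrightarrow> \<bar>c x\<bar> \<le> C" unfolding bounded_iff by (metis imageI real_norm_def)
  show "set_integrable lborel K f"
    unfolding set_integrable_def
  proof (rule Bochner_Integration.integrable_bound)
    have "integrable lborel (indicator K :: real^2 \<Rightarrow> real)"
      using emeasure_compact_finite [OF K] by (intro integrable_real_indicator) auto
    then show "integrable lborel (\<lambda>x. \<bar>C\<bar> * ((h x)\<^sup>2 + indicator K x))" using h by auto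
    show "AE x in lborel. norm (indicator K x *\<^sub>R f x) \<le> norm (\<bar>C\<bar> * ((h x)\<^sup>2 + indicator K x))"
      using le
    proof eventually_elim
      case (elim x)
      show ?case
      proof (cases "x \<in> K")
        case True
        have "norm (f x) \<le> \<bar>h x\<bar> * \<bar>c x\<bar>" using elim by (metis abs_ge_self abs_mult order_trans)
        also have "\<dots> \<le> \<bar>h x\<bar> * \<bar>C\<bar>" using C [OF True] by (intro mult_left_mono) auto
        also have "\<bar>h x\<bar> \<le> (h x)\<^sup>2 + 1"
          using sum_power2_ge_zero [of "\<bar>h x\<bar> - 1" 0] by (simp add: power2_eq_square algebra_simps)
        finally show ?thesis using True by (simp add: mult.commute mult_right_mono)
      qed simp
    qed
  qed measurable
qed

lemma weak_gradient_limit: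
  assumes w: "\<And>n. weak_gradient (U n) (V n)" and l: "locally_integrable u" "locally_integrable v"
    and U: "\<And>\<phi>. continuous_on UNIV \<phi> \<Longrightarrow> bsupp \<phi> \<Longrightarrow>
        (\<lambda>n. \<integral>\<^sup>+ x. ennreal (\<bar>U n x - u x\<bar> * \<bar>\<phi> x\<bar>) \<partial>lborel) \<longlonglongrightarrow> 0"
    and V: "\<And>\<phi>. continuous_on UNIV \<phi> \<Longrightarrow> bsupp \<phi> \<Longrightarrow>
        (\<lambda>n. \<integral>\<^sup>+ x. ennreal (norm (V n x - v x) * \<bar>\<phi> x\<bar>) \<partial>lborel) \<longlonglongrightarrow> 0"
  shows "weak_gradient u v"
proof (rule weak_gradientI [OF l])
  fix \<phi> i assume t: "test_function \<phi>"
  note t' = t [unfolded test_function_iff]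
  have c: "continuous_on UNIV \<phi>" "bsupp \<phi>" "continuous_on UNIV (pd i \<phi>)" "bsupp (pd i \<phi>)"
    using t' by (auto intro: smooth_imp_continuous bsupp_pd)
  have lU: "locally_integrable (U n)" "locally_integrable (\<lambda>x. V n x $ i)" for n
    using w [of n] by (auto simp: weak_gradient_def intro: locally_integrable_nth)
  have "(\<lambda>n. \<integral>x. U n x * pd i \<phi> x \<partial>lborel) \<longlonglongrightarrow> (\<integral>x. u x * pd i \<phi> x \<partial>lborel)"
  proof (rule tendsto_L1_int)
    show "(\<lambda>n. \<integral>\<^sup>+ x. ennreal (norm (U n x * pd i \<phi> x - u x * pd i \<phi> x)) \<partial>lborel) \<longlonglongrightarrow> 0"
      using U [OF c(3,4)] by (simp add: abs_mult flip: left_diff_distrib)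
  qed (use lU l c in \<open>auto intro: locally_integrable_mult_bsupp\<close>)
  moreover have "(\<lambda>n. \<integral>x. V n x $ i * \<phi> x \<partial>lborel) \<longlonglongrightarrow> (\<integral>x. v x $ i * \<phi> x \<partial>lborel)"
  proof (rule tendsto_L1_int)
    show "(\<lambda>n. \<integral>\<^sup>+ x. ennreal (norm (V n x $ i * \<phi> x - v x $ i * \<phi> x)) \<partial>lborel) \<longlonglongrightarrow> 0"
    proof (rule tendsto_sandwich [OF _ _ tendsto_const V [OF c(1,2)]])
      have "norm (V n x $ i * \<phi> x - v x $ i * \<phi> x) \<le> norm (V n x - v x) * \<bar>\<phi> x\<bar>" for n x
        using component_le_norm_cart [of "V n x - v x" i]
        by (simp add: abs_mult mult_right_mono flip: left_diff_distrib)
      then show "\<forall>\<^sub>F n in sequentially. (\<integral>\<^sup>+ x. ennreal (norm (V n x $ i * \<phi> x - v x $ i * \<phi> x)) \<partial>lborel)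
          \<le> (\<integral>\<^sup>+ x. ennreal (norm (V n x - v x) * \<bar>\<phi> x\<bar>) \<partial>lborel)"
        by (intro always_eventually allI nn_integral_mono ennreal_leI)
    qed simp
  qed (use lU locally_integrable_nth [OF l(2)] c in \<open>auto intro: locally_integrable_mult_bsupp\<close>)
  ultimately show "(\<integral>x. u x * pd i \<phi> x \<partial>lborel) = - (\<integral>x. v x $ i * \<phi> x \<partial>lborel)"
    unfolding weak_gradientD [OF w t] by (intro LIMSEQ_unique [OF _ tendsto_minus])
qed

text \<open>The norm on the sphere controls a function only after multiplication by
  \<open>sqrt (conf x)\<close>. The missing factor is continuous, hence harmless against functions
  of bounded support. The majorants \<open>G\<close> and \<open>H\<close> are left free so that the
  same statement serves both charts.\<close>

lemma weak_gradient_L2_limit: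
  assumes w: "\<And>n. weak_gradient (U n) (V n)"
    and [measurable]: "u \<in> borel_measurable borel" "v \<in> borel_measurable borel"
      "H \<in> borel_measurable borel" "\<And>n. G n \<in> borel_measurable borel"
    and H: "integrable lborel (\<lambda>x. (H x)\<^sup>2)"
      "AE x in lborel. \<bar>u x\<bar> \<le> H x / sqrt (conf x)" "AE x in lborel. norm (v x) \<le> H x"
    and G: "(\<lambda>n. \<integral>\<^sup>+ x. ennreal ((G n x)\<^sup>2) \<partial>lborel) \<longlonglongrightarrow> 0"
      "\<And>n. AE x in lborel. \<bar>U n x - u x\<bar> \<le> G n x / sqrt (conf x)"
      "\<And>n. AE x in lborel. norm (V n x - v x) \<le> G n x"
  shows "weak_gradient u v"
proof -
  have cc: "continuous_on UNIV (\<lambda>x. 1 / sqrt (conf x))"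
    by (intro continuous_intros continuous_conf) (use conf_pos in \<open>auto simp: less_imp_neq [symmetric]\<close>)
  have lim: "(\<lambda>n. \<integral>\<^sup>+ x. ennreal (A n x * \<bar>\<phi> x\<bar>) \<partial>lborel) \<longlonglongrightarrow> 0"
    if c: "continuous_on UNIV c" "continuous_on UNIV \<phi>" "bsupp \<phi>" and c0: "\<And>x. c x > 0"
      and A: "\<And>n. AE x in lborel. A n x \<le> G n x * c x" for A and c \<phi> :: "real^2 \<Rightarrow> real"
  proof (rule tendsto_sandwich [OF _ _ tendsto_const])
    have [measurable]: "c \<in> borel_measurable borel" "\<phi> \<in> borel_measurable borel"
      using c by (auto intro: borel_measurable_continuous_onI)
    have "integrable lborel (\<lambda>x. (c x * \<phi> x)\<^sup>2)"
      using c by (intro integrable_bsupp) (auto simp: power2_eq_square intro!: continuous_intros bsupp_mult_left)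
    then show "(\<lambda>n. \<integral>\<^sup>+ x. ennreal (\<bar>G n x\<bar> * \<bar>c x * \<phi> x\<bar>) \<partial>lborel) \<longlonglongrightarrow> 0"
      by (intro L2_imp_L1_mult G(1)) auto
    have "(\<integral>\<^sup>+ x. ennreal (A n x * \<bar>\<phi> x\<bar>) \<partial>lborel) \<le> (\<integral>\<^sup>+ x. ennreal (\<bar>G n x\<bar> * \<bar>c x * \<phi> x\<bar>) \<partial>lborel)" for n
    proof (rule nn_integral_mono_AE, use A [of n] in eventually_elim)
      case (elim x)
      also have "G n x * c x \<le> \<bar>G n x\<bar> * c x" using c0 [of x] by (intro mult_right_mono) auto
      finally have "A n x * \<bar>\<phi> x\<bar> \<le> \<bar>G n x\<bar> * c x * \<bar>\<phi> x\<bar>" by (rule mult_right_mono) simp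
      then show ?case using c0 [of x] by (intro ennreal_leI) (simp add: abs_mult mult.assoc)
    qed
    then show "\<forall>\<^sub>F n in sequentially. (\<integral>\<^sup>+ x. ennreal (A n x * \<bar>\<phi> x\<bar>) \<partial>lborel)
        \<le> (\<integral>\<^sup>+ x. ennreal (\<bar>G n x\<bar> * \<bar>c x * \<phi> x\<bar>) \<partial>lborel)" by simp
  qed simp
  show ?thesis
  proof (rule weak_gradient_limit [OF w])
    show "locally_integrable u"
      by (rule locally_integrable_bound [OF _ _ H(1) cc]) (use H(2) in simp_all)
    show "locally_integrable v"
      by (rule locally_integrable_bound [OF _ _ H(1) continuous_on_const [of _ 1]]) (use H(3) in simp_all)
  next
    fix \<phi> :: "real^2 \<Rightarrow> real" assume \<phi>: "continuous_on UNIV \<phi>" "bsupp \<phi>"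
    show "(\<lambda>n. \<integral>\<^sup>+ x. ennreal (\<bar>U n x - u x\<bar> * \<bar>\<phi> x\<bar>) \<partial>lborel) \<longlonglongrightarrow> 0"
      by (rule lim [OF cc \<phi>]) (use G(2) conf_pos in simp_all)
    show "(\<lambda>n. \<integral>\<^sup>+ x. ennreal (norm (V n x - v x) * \<bar>\<phi> x\<bar>) \<partial>lborel) \<longlonglongrightarrow> 0"
      by (rule lim [OF continuous_on_const [of _ 1] \<phi>]) (use G(3) in simp_all)
  qed
qed

lemma le_divide_sqrt_conf_iff: "\<bar>a\<bar> \<le> h / sqrt (conf x) \<longleftrightarrow> sqrt (conf x) * \<bar>a\<bar> \<le> h"
  using conf_pos [of x] by (simp add: field_simps)

text \<open>Convergence in the second chart is deduced from that in the first. The majorants there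
  are composed with the inversion and divided by \<open>(norm x)\<^sup>2\<close>; the Jacobian
  \<open>1 / norm x ^ 4\<close> preserves their square integrals, and \<open>conf_inversion\<close>
  makes the weights match.\<close>

lemma nice_limit:
  assumes n: "\<And>n. nice \<omega> (U n) (V n)"
    and [measurable]: "u \<in> borel_measurable borel" "v \<in> borel_measurable borel"
    and lim: "(\<lambda>n. \<integral>\<^sup>+ x. ennreal ((norm (fvec \<omega> (U n) (V n) x - fvec \<omega> u v x))\<^sup>2) \<partial>lborel) \<longlonglongrightarrow> 0"
  shows "nice \<omega> u v"
proof -
  have [measurable]: "U n \<in> borel_measurable borel" "V n \<in> borel_measurable borel" for n
    using n [of n] weak_gradient_measurable by (auto simp: nice_def)
  have int: "integrable lborel (\<lambda>x. (norm (fvec \<omega> u v x))\<^sup>2)"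
    by (rule integrable_L2_limit [OF _ _ _ lim]) (use n in \<open>auto simp: nice_def\<close>)
  define G where "G n x = norm (fvec \<omega> (U n) (V n) x - fvec \<omega> u v x)" for n x
  define H where "H x = norm (fvec \<omega> u v x)" for x
  have [measurable]: "G n \<in> borel_measurable borel" "H \<in> borel_measurable borel" for n
    unfolding G_def H_def by measurable
  have G_eq: "G n x = norm (fvec \<omega> (\<lambda>x. U n x - u x) (\<lambda>x. V n x - v x) x)" for n x
    using fvec_lincomb [of \<omega> 1 "U n" "-1" u "V n" v x] by (simp add: G_def)
  have Gint: "integrable lborel (\<lambda>x. (G n x)\<^sup>2)" for n
    using integrable_norm_sq_add [of "fvec \<omega> (U n) (V n)" lborel "\<lambda>x. - fvec \<omega> u v x"] n int
    by (simp add: G_def nice_def)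
  have Gb: "sqrt (conf x) * \<bar>U n x - u x\<bar> \<le> G n x" "norm (V n x - v x) \<le> G n x" for n x
    unfolding G_eq using norm_fvec_ge [where x = x and U = "\<lambda>x. U n x - u x" and V = "\<lambda>x. V n x - v x"] by auto
  have Hb: "sqrt (conf x) * \<bar>u x\<bar> \<le> H x" "norm (v x) \<le> H x" for x
    unfolding H_def by (rule norm_fvec_ge)+
  have 1: "weak_gradient u v"
  proof (rule weak_gradient_L2_limit [where H = H and G = G])
    show "weak_gradient (U n) (V n)" for n using n [of n] by (simp add: nice_def)
  qed (use int lim Gb Hb in \<open>auto simp: le_divide_sqrt_conf_iff G_def H_def\<close>)
  define G' where "G' n x = G n (inversion x) / (norm x)\<^sup>2" for n x
  define H' where "H' x = H (inversion x) / (norm x)\<^sup>2" for x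
  have sc: "sqrt (conf x) * a \<le> h / (norm x)\<^sup>2" if "sqrt (conf (inversion x)) * a \<le> h" "x \<noteq> 0"
    for a h and x :: "real^2"
  proof -
    have "sqrt (norm x ^ 4) = (norm x)\<^sup>2"
      by (rule real_sqrt_unique) (simp_all flip: power_mult)
    then have "sqrt (conf (inversion x)) = sqrt (conf x) * (norm x)\<^sup>2"
      using that(2) by (simp add: conf_inversion real_sqrt_mult)
    then show ?thesis using that by (simp add: field_simps)
  qed
  have nz: "AE x::real^2 in lborel. x \<noteq> 0" by (rule AE_lborel_singleton)
  have pow: "(h / (norm x)\<^sup>2)\<^sup>2 = h\<^sup>2 / norm x ^ 4" for h and x :: "real^2"
    by (simp add: power_divide flip: power_mult)
  have 2: "weak_gradient (u \<circ> inversion) (pull v)"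
  proof (rule weak_gradient_L2_limit [where H = H' and G = G'])
    show "weak_gradient (U n \<circ> inversion) (pull (V n))" for n using n [of n] by (simp add: nice_def)
    show "integrable lborel (\<lambda>x. (H' x)\<^sup>2)"
      unfolding H'_def pow using int by (intro integrable_inversion) (simp_all add: H_def)
    have "(\<integral>\<^sup>+ x. ennreal ((G' n x)\<^sup>2) \<partial>lborel) = (\<integral>\<^sup>+ x. ennreal ((G n x)\<^sup>2) \<partial>lborel)" for n
    proof -
      have "(\<integral>\<^sup>+ x. ennreal ((G' n x)\<^sup>2) \<partial>lborel) = ennreal (\<integral>x. (G' n x)\<^sup>2 \<partial>lborel)"
        unfolding G'_def pow by (intro nn_integral_eq_integral integrable_inversion Gint) auto
      also have "\<dots> = ennreal (\<integral>x. (G n x)\<^sup>2 \<partial>lborel)"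
        unfolding G'_def pow by (subst integral_inversion [where f = "\<lambda>x. (G n x)\<^sup>2"]) (use Gint in auto)
      also have "\<dots> = (\<integral>\<^sup>+ x. ennreal ((G n x)\<^sup>2) \<partial>lborel)"
        by (intro nn_integral_eq_integral [symmetric] Gint) auto
      finally show ?thesis .
    qed
    then show "(\<lambda>n. \<integral>\<^sup>+ x. ennreal ((G' n x)\<^sup>2) \<partial>lborel) \<longlonglongrightarrow> 0"
      using lim by (simp add: G_def)
    show "AE x in lborel. \<bar>(u \<circ> inversion) x\<bar> \<le> H' x / sqrt (conf x)"
      using nz by eventually_elim (unfold le_divide_sqrt_conf_iff H'_def o_def, rule sc [OF Hb(1)])
    show "AE x in lborel. \<bar>(U n \<circ> inversion) x - (u \<circ> inversion) x\<bar> \<le> G' n x / sqrt (conf x)" for n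
      using nz by eventually_elim (unfold le_divide_sqrt_conf_iff G'_def o_def, rule sc [OF Gb(1)])
    show "AE x in lborel. norm (pull v x) \<le> H' x"
      using Hb by (intro AE_I2) (auto simp: norm_pull H'_def intro!: divide_right_mono)
    show "AE x in lborel. norm (pull (V n) x - pull v x) \<le> G' n x" for n
    proof (rule AE_I2)
      fix x
      have "pull (V n) x - pull v x = pull (\<lambda>x. V n x - v x) x"
        using pull_lincomb [of 1 "V n" "-1" v x] by simp
      then show "norm (pull (V n) x - pull v x) \<le> G' n x"
        using Gb(2) [of n "inversion x"] by (simp add: norm_pull G'_def divide_right_mono)
    qed
  qed (unfold G'_def H'_def o_def, measurable)
  show ?thesis using 1 2 int by (simp add: nice_def)
qed

lemma inner_inversion': "h \<bullet> inversion' x k = inversion' x h \<bullet> k"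
  by (simp add: inversion'_def inner_diff_left inner_diff_right inner_commute)

lemma nice_test_function:
  assumes t: "test_function T"
  shows "nice \<omega> T (grad T)"
proof -
  have sm: "smooth T" and bs: "bsupp T" using t by (auto simp: test_function_iff)
  obtain R0 where "\<And>x. norm x > R0 \<Longrightarrow> T x = 0" using bs unfolding bsupp_def by blast
  then obtain R where R: "R > 0" "\<And>x. norm x > R \<Longrightarrow> T x = 0"
    by (metis max.strict_boundedE zero_less_one max.cobounded1 less_max_iff_disj max_less_iff_conj
        linorder_not_less less_le_trans)
  \<comment> \<open>Composing with the inversion would give the value \<open>T 0\<close> at the
    origin. The correct value at the pole is 0, and with it the function vanishes near the origin
    because \<open>T\<close> has bounded support.\<close>
  define T2 where "T2 x = (if x = 0 then 0 else T (inversion x))" for x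
  have near0: "T2 x = 0" if "x \<in> ball 0 (1 / R)" for x
  proof (cases "x = 0")
    case False
    then have "norm (inversion x) > R" using that R(1) by (simp add: norm_inversion field_simps)
    then show ?thesis using R(2) by (simp add: T2_def)
  qed (simp add: T2_def)
  have d0: "(T2 has_derivative (\<lambda>h. 0)) (at x)" if "x \<in> ball 0 (1 / R)" for x
    by (rule has_derivative_transform_within_open [of "\<lambda>x. 0" _ _ _ "ball 0 (1 / R)"])
      (use that near0 in auto)
  have d1: "(T2 has_derivative (\<lambda>h. grad T (inversion x) \<bullet> inversion' x h)) (at x)" if "x \<noteq> 0" for x
  proof (rule has_derivative_transform_within_open [of "\<lambda>x. T (inversion x)" _ _ _ "- {0}"])
    show "((\<lambda>x. T (inversion x)) has_derivative (\<lambda>h. grad T (inversion x) \<bullet> inversion' x h)) (at x)"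
      by (rule has_derivative_compose [OF inversion_has_derivative [OF that]
            has_derivative_grad [OF smooth_imp_differentiable [OF sm]]])
  qed (use that in \<open>auto simp: T2_def\<close>)
  have g0: "pd i T2 x = 0" if "x \<in> ball 0 (1 / R)" for x i
    using pd_eqI [OF d0 [OF that]] .
  have g1: "pd i T2 x = pull (grad T) x $ i" if "x \<noteq> 0" for x i
    using pd_eqI [OF d1 [OF that], of i] by (simp add: inner_inversion' pull_def inner_axis)
  have C1: "C_diff (Suc 0) T2"
    unfolding C_diff_Suc_pd
  proof (intro conjI allI)
    fix x
    show "T2 differentiable (at x)"
      using d0 [of 0] d1 [of x] R(1) unfolding differentiable_def by (cases "x = 0") auto
  next
    fix i
    have "continuous_on (ball 0 (1 / R)) (pd i T2)"
      using continuous_on_cong [of "ball 0 (1 / R)" "ball 0 (1 / R)" "pd i T2" "\<lambda>_. 0"] g0 by simp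
    moreover have "continuous_on (- {0}) (pd i T2)"
    proof -
      have ci: "continuous_on (- {0}) inversion"
        unfolding inversion_def by (intro continuous_intros) auto
      have "continuous_on UNIV (grad T)"
        unfolding grad_def using sm by (intro continuous_on_vec_lambda smooth_imp_continuous smooth_pd)
      then have "continuous_on (- {0}) (\<lambda>x. grad T (inversion x))"
        using ci by (rule continuous_on_compose2) auto
      then have "continuous_on (- {0}) (\<lambda>x. pull (grad T) x $ i)"
        unfolding pull_def inversion'_def by (intro continuous_intros) auto
      then show ?thesis
        using g1 by (subst continuous_on_cong [OF refl, where g = "\<lambda>x. pull (grad T) x $ i"]) simp_all
    qed
    ultimately have "continuous_on (ball 0 (1 / R) \<union> - {0}) (pd i T2)"
      by (intro continuous_on_open_Un) auto
    moreover have "ball 0 (1 / R) \<union> - {0} = (UNIV :: (real^2) set)" using R(1) by auto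
    ultimately show "C_diff 0 (pd i T2)" by simp
  qed
  have "grad T2 = pull (grad T)"
  proof
    fix x
    show "grad T2 x = pull (grad T) x"
    proof (cases "x = 0")
      case True
      show ?thesis
        unfolding True vec_eq_iff using g0 [of 0] R(1) by (simp add: grad_def pull_def inversion'_def)
    next
      case False
      then show ?thesis using g1 unfolding vec_eq_iff by (simp add: grad_def)
    qed
  qed
  moreover have "T \<in> borel_measurable borel"
    using sm by (intro borel_measurable_continuous_onI smooth_imp_continuous)
  then have "T \<circ> inversion \<in> borel_measurable borel" by (simp add: o_def)
  moreover have "AE x in lborel. T2 x = (T \<circ> inversion) x"
    using AE_lborel_singleton [of "0 :: real^2"] by eventually_elim (simp add: T2_def)
  ultimately have "weak_gradient (T \<circ> inversion) (pull (grad T))"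
    using weak_gradient_cong_AE [OF weak_gradient_C1 [OF C1]] by metis
  moreover have "weak_gradient T (grad T)"
    using sm by (intro weak_gradient_C1) (simp add: smooth_def)
  moreover have "integrable lborel (\<lambda>x. (norm (fvec \<omega> T (grad T) x))\<^sup>2)"
  proof (rule integrable_bsupp)
    have c: "continuous_on UNIV (grad T)" "continuous_on UNIV T"
      unfolding grad_def using sm by (auto intro!: continuous_on_vec_lambda smooth_imp_continuous smooth_pd)
    then show "continuous_on UNIV (\<lambda>x. (norm (fvec \<omega> T (grad T) x))\<^sup>2)"
      unfolding norm_fvec by (intro continuous_intros continuous_conf)
    have "bsupp (pd i T)" for i by (rule bsupp_pd [OF bs])
    then obtain S where S: "\<And>i x. norm x > S i \<Longrightarrow> pd i T x = 0" unfolding bsupp_def by metis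
    have "(norm (fvec \<omega> T (grad T) x))\<^sup>2 = 0" if "norm x > max R (max (S 1) (S 2))" for x
      using that R(2) [of x] S [of 1 x] S [of 2 x]
      unfolding norm_fvec by (simp add: grad_def vec_eq_iff forall_2)
    then show "bsupp (\<lambda>x. (norm (fvec \<omega> T (grad T) x))\<^sup>2)"
      unfolding bsupp_def by blast
  qed
  ultimately show ?thesis by (simp add: nice_def)
qed

section \<open>The eigenfunctions\<close>

subsection \<open>Harmonic polynomials\<close>

text \<open>The flag \<open>\<sigma>\<close> selects the imaginary part, which is identically zero
  for \<open>n = 0\<close>; this is the source of multiplicity one in that case and two
  otherwise.\<close>

definition harmp :: "nat \<Rightarrow> bool \<Rightarrow> real^2 \<Rightarrow> real" where
  "harmp n \<sigma> x = (if \<sigma> then Im else Re) (Complex (x $ 1) (x $ 2) ^ n)"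

lemma harm_0: "harmp 0 False = (\<lambda>x. 1)" "harmp 0 True = (\<lambda>x. 0)"
  by (simp_all add: harmp_def fun_eq_iff)

lemma harm_Suc:
  "harmp (Suc n) False = (\<lambda>x. x $ 1 * harmp n False x - x $ 2 * harmp n True x)"
  "harmp (Suc n) True = (\<lambda>x. x $ 1 * harmp n True x + x $ 2 * harmp n False x)"
  by (simp_all add: harmp_def fun_eq_iff)

lemma smooth_harm [intro]: "smooth (harmp n \<sigma>)"
proof (induction n arbitrary: \<sigma>)
  case 0
  then show ?case by (cases \<sigma>) (simp_all add: harm_0)
next
  case (Suc n)
  then show ?case
    by (cases \<sigma>) (simp_all only: harm_Suc smooth_diff smooth_add smooth_mult smooth_coord)
qed

lemma pd_diff: "smooth f \<Longrightarrow> smooth g \<Longrightarrow> pd i (\<lambda>x. f x - g x) x = pd i f x - pd i g x"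
  using pd_add [of f "\<lambda>x. - 1 * g x" i x] pd_cmult [of g i "-1" x] smooth_mult [OF smooth_const, of g "-1"]
  by simp

lemma pd_coord_mult: "smooth f \<Longrightarrow> pd i (\<lambda>x. x $ j * f x) x = x $ j * pd i f x + (if i = j then f x else 0)"
  by (simp add: pd_mult pd_coord)

lemma pd_harm_0: "pd i (harmp 0 \<sigma>) x = 0"
  by (cases \<sigma>) (simp_all add: harm_0)

text \<open>In real terms: the derivative of z^(n+1) is (n+1) z^n in the first direction and i times
  that in the second.\<close>

lemma pd_harm_Suc:
  "pd 1 (harmp (Suc n) \<sigma>) x = real (Suc n) * harmp n \<sigma> x"
  "pd 2 (harmp (Suc n) False) x = - real (Suc n) * harmp n True x"
  "pd 2 (harmp (Suc n) True) x = real (Suc n) * harmp n False x"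
proof (induction n arbitrary: \<sigma>)
  case 0
  { case 1 show ?case
      by (cases \<sigma>) (simp_all add: harm_Suc pd_diff pd_add pd_coord_mult smooth_mult smooth_harm pd_harm_0) }
  { case 2 show ?case
      by (simp add: harm_Suc pd_diff pd_coord_mult smooth_mult smooth_harm pd_harm_0) }
  { case 3 show ?case
      by (simp add: harm_Suc pd_add pd_coord_mult smooth_mult smooth_harm pd_harm_0) }
next
  case (Suc n)
  { case 1 show ?case
      unfolding harm_Suc [of "Suc n"]
      by (cases \<sigma>) (simp_all add: harm_Suc(1,2) [of "Suc n"] pd_diff pd_add pd_coord_mult smooth_mult
          smooth_harm Suc.IH, simp_all add: harm_Suc algebra_simps) }
  { case 2 show ?case
      by (simp add: harm_Suc(1) [of "Suc n"] pd_diff pd_coord_mult smooth_mult smooth_harm Suc.IH)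
        (simp add: harm_Suc algebra_simps) }
  { case 3 show ?case
      by (simp add: harm_Suc(2) [of "Suc n"] pd_add pd_coord_mult smooth_mult smooth_harm Suc.IH)
        (simp add: harm_Suc algebra_simps) }
qed

lemma euler_harm: "x $ 1 * pd 1 (harmp n \<sigma>) x + x $ 2 * pd 2 (harmp n \<sigma>) x = real n * harmp n \<sigma> x"
proof (cases n)
  case 0
  then show ?thesis by (simp add: pd_harm_0)
next
  case (Suc k)
  then show ?thesis
    by (cases \<sigma>) (simp_all add: pd_harm_Suc, simp_all add: harm_Suc algebra_simps)
qed

lemma laplace_harm: "pd 1 (pd 1 (harmp n \<sigma>)) x + pd 2 (pd 2 (harmp n \<sigma>)) x = 0"
proof -
  have e: "pd 1 (harmp (Suc k) \<tau>) = (\<lambda>x. real (Suc k) * harmp k \<tau> x)"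
    "pd 2 (harmp (Suc k) False) = (\<lambda>x. - real (Suc k) * harmp k True x)"
    "pd 2 (harmp (Suc k) True) = (\<lambda>x. real (Suc k) * harmp k False x)" for k \<tau>
    by (simp_all only: fun_eq_iff pd_harm_Suc simp_thms)
  have z: "pd i (harmp 0 \<sigma>) = (\<lambda>x. 0)" for i by (simp add: fun_eq_iff pd_harm_0)
  consider "n = 0" | "n = 1" | k where "n = Suc (Suc k)" by (metis One_nat_def not0_implies_Suc)
  then show ?thesis
  proof cases
    case 1
    then show ?thesis by (simp add: z)
  next
    case 2
    then show ?thesis
      by (cases \<sigma>) (simp_all only: e One_nat_def pd_cmult [OF smooth_harm] pd_harm_0 mult_zero_right add_0)
  next
    case 3
    show ?thesis
      unfolding 3 by (cases \<sigma>) (simp_all add: e pd_cmult [OF smooth_harm] pd_harm_Suc, simp_all add: algebra_simps)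
  qed
qed

lemma cmod_coords: "cmod (Complex (x $ 1) (x $ 2)) = norm (x :: real^2)"
  by (simp add: cmod_def norm_vec_def L2_set_def sum_2)

lemma abs_harm_le: "\<bar>harmp n \<sigma> x\<bar> \<le> norm x ^ n"
  unfolding harmp_def cmod_coords [symmetric] norm_power [symmetric]
  by (simp add: abs_Re_le_cmod abs_Im_le_cmod)

lemma abs_pd_harm_le: "\<bar>pd i (harmp n \<sigma>) x\<bar> \<le> real n * norm x ^ (n - 1)"
proof (cases n)
  case (Suc k)
  have "i = 1 \<or> i = 2" using exhaust_2 by blast
  moreover have "real (Suc k) * \<bar>harmp k \<tau> x\<bar> \<le> real (Suc k) * norm x ^ k" for \<tau>
    by (intro mult_left_mono abs_harm_le) simp
  ultimately show ?thesis
    using Suc by (cases \<sigma>) (auto simp: pd_harm_Suc abs_mult simp del: of_nat_Suc)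
qed (simp add: pd_harm_0)

subsection \<open>Powers of the conformal factor\<close>

text \<open>\<open>spow 1\<close> is (1 - y) / 2 in terms of the height y on the sphere, and
  \<open>conf\<close> is four times \<open>spow 2\<close>; products of powers stay in the
  family.\<close>

definition spow :: "real \<Rightarrow> real^2 \<Rightarrow> real" where
  "spow b x = (1 + (norm x)\<^sup>2) powr - b"

lemma norm_sq_coords: "(norm (x::real^2))\<^sup>2 = (x $ 1)\<^sup>2 + (x $ 2)\<^sup>2"
  unfolding power2_norm_eq_inner inner_vec_def sum_2 by (simp add: power2_eq_square)

lemma smooth_one_plus_norm_sq [intro]: "smooth (\<lambda>x. 1 + (norm x)\<^sup>2)"
  unfolding norm_sq_coords by (intro smooth_add smooth_power smooth_coord smooth_const)

lemma smooth_spow [intro]: "smooth (spow b)"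
  unfolding spow_def by (intro smooth_powr smooth_one_plus_norm_sq one_plus_norm_sq_pos)

lemma pd_one_plus_norm_sq: "pd i (\<lambda>x. 1 + (norm x)\<^sup>2) x = 2 * x $ i"
proof -
  have "((\<lambda>x::real^2. 1 + (norm x)\<^sup>2) has_derivative (\<lambda>h. 2 * (x \<bullet> h))) (at x)"
    unfolding power2_norm_eq_inner by (auto intro!: derivative_eq_intros simp: inner_commute)
  from pd_eqI [OF this] show ?thesis by (simp add: inner_axis)
qed

lemma pd_spow: "pd i (spow b) x = - 2 * b * x $ i * spow (b + 1) x"
proof -
  have "((\<lambda>t. t powr - b) has_real_derivative - b * (1 + (norm x)\<^sup>2) powr (- b - 1)) (at (1 + (norm x)\<^sup>2))"
    using has_real_derivative_powr [OF one_plus_norm_sq_pos] .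
  from pd_compose_at [OF smooth_imp_differentiable [OF smooth_one_plus_norm_sq] this, of i]
  show ?thesis by (simp add: spow_def [abs_def] pd_one_plus_norm_sq)
qed

lemma spow_pos: "spow b x > 0"
  using one_plus_norm_sq_pos [of x] by (simp add: spow_def)

lemma spow_add: "spow b x * spow c x = spow (b + c) x"
  using one_plus_norm_sq_pos [of x] by (simp add: spow_def flip: powr_add)

lemma spow_0 [simp]: "spow 0 x = 1"
  using one_plus_norm_sq_ne [of x] by (simp add: spow_def)

lemma spow_uminus_1: "spow (- 1) x = 1 + (norm x)\<^sup>2"
  using one_plus_norm_sq_pos [of x] by (simp add: spow_def)

lemma spow_antimono: "b \<le> c \<Longrightarrow> spow c x \<le> spow b x"
  unfolding spow_def by (intro powr_mono) auto

lemma norm_sq_spow: "(norm x)\<^sup>2 * spow (b + 1) x = spow b x - spow (b + 1) x"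
proof -
  have "spow b x = (1 + (norm x)\<^sup>2) * spow (b + 1) x"
    unfolding spow_uminus_1 [symmetric] spow_add by simp
  then show ?thesis by (simp add: algebra_simps)
qed

lemma norm_power_le_spow: "norm x ^ n \<le> spow (- (real n / 2)) x"
proof -
  have "norm x \<le> (1 + (norm x)\<^sup>2) powr (1 / 2)"
    unfolding powr_half_sqrt [OF less_imp_le [OF one_plus_norm_sq_pos]] by (rule real_le_rsqrt) simp
  then have "norm x ^ n \<le> ((1 + (norm x)\<^sup>2) powr (1 / 2)) ^ n" by (intro power_mono) auto
  also have "\<dots> = spow (- (real n / 2)) x"
    using one_plus_norm_sq_pos [of x] by (simp add: spow_def powr_power)
  finally show ?thesis .
qed

lemma conf_spow: "conf x = 4 * spow 2 x"
proof -
  have "spow 2 x = 1 / (1 + (norm x)\<^sup>2)\<^sup>2"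
    using one_plus_norm_sq_pos [of x] by (simp add: spow_def powr_minus_divide powr_numeral)
  then show ?thesis by (simp add: conf_def)
qed

lemma integrable_spow: "q > 1 \<Longrightarrow> integrable lborel (spow q)"
  unfolding spow_def [abs_def] by (rule integrable_radial_powr)

subsection \<open>Radial factors\<close>

text \<open>The larger root of the indicial equation a^2 - n a = \<omega>^2. With it,
  \<open>harmp n \<sigma>\<close> times \<open>spow a\<close> has size at most of order |x|^(-\<nu>)
  at infinity, where \<nu> is the square root of n^2 + 4 \<omega>^2.\<close>

definition aexp :: "real \<Rightarrow> nat \<Rightarrow> real" where
  "aexp \<omega> n = (real n + sqrt ((real n)\<^sup>2 + 4 * \<omega>\<^sup>2)) / 2"

lemma aexp_quadratic: "(aexp \<omega> n)\<^sup>2 - real n * aexp \<omega> n = \<omega>\<^sup>2"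
proof -
  have "(sqrt ((real n)\<^sup>2 + 4 * \<omega>\<^sup>2))\<^sup>2 = (real n)\<^sup>2 + 4 * \<omega>\<^sup>2" by simp
  then show ?thesis unfolding aexp_def by (simp add: power2_eq_square field_simps)
qed

lemma aexp_ge: "real n \<le> aexp \<omega> n"
  using real_le_rsqrt [of "real n" "(real n)\<^sup>2 + 4 * \<omega>\<^sup>2"] by (simp add: aexp_def)

lemma aexp_gt: "\<omega> \<noteq> 0 \<or> n > 0 \<Longrightarrow> real n / 2 < aexp \<omega> n"
proof -
  assume "\<omega> \<noteq> 0 \<or> n > 0"
  then have "(real n)\<^sup>2 + 4 * \<omega>\<^sup>2 > 0" by (auto simp: add_pos_nonneg add_nonneg_pos)
  then show ?thesis by (simp add: aexp_def)
qed

lemma eigval_aexp: "eigval \<omega> m n = (aexp \<omega> n + real m) * (aexp \<omega> n + real m + 1) - \<omega>\<^sup>2"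
  unfolding eigval_def aexp_def by (simp add: power2_eq_square field_simps)

text \<open>A term with exponent a + k, where a is \<open>aexp \<omega> n\<close>, contributes to
  the equation k (k + 2 a - n) times the power a + k + 1 and minus
  \<open>eigval \<omega> k n\<close> times the power a + k + 2. Matching the terms k and k + 1 gives
  the recursion. Its denominators are positive by \<open>aexp_ge\<close>, and the numerator vanishes
  at k = m.\<close>

primrec ecoeff :: "real \<Rightarrow> nat \<Rightarrow> nat \<Rightarrow> nat \<Rightarrow> real" where
  "ecoeff \<omega> n m 0 = 1"
| "ecoeff \<omega> n m (Suc k) = (eigval \<omega> k n - eigval \<omega> m n) * ecoeff \<omega> n m k
     / (real (Suc k) * (real (Suc k) + 2 * aexp \<omega> n - real n))"

lemma ecoeff_Suc: "ecoeff \<omega> n m (Suc k) * (real (Suc k) * (real (Suc k) + 2 * aexp \<omega> n - real n))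
    = (eigval \<omega> k n - eigval \<omega> m n) * ecoeff \<omega> n m k"
  using aexp_ge [of n \<omega>] by simp

lemma eigval_strict_mono: "k < m \<Longrightarrow> eigval \<omega> k n < eigval \<omega> m n"
proof -
  assume "k < m"
  have "aexp \<omega> n \<ge> 0" using aexp_ge [of n \<omega>] by (rule order_trans [rotated]) simp
  with \<open>k < m\<close> show ?thesis
    unfolding eigval_aexp by (intro diff_strict_right_mono mult_strict_mono') auto
qed

lemma ecoeff_nonzero: "k \<le> m \<Longrightarrow> ecoeff \<omega> n m k \<noteq> 0"
proof (induction k)
  case (Suc k)
  then have "(eigval \<omega> k n - eigval \<omega> m n) * ecoeff \<omega> n m k \<noteq> 0"
    using eigval_strict_mono [of k m \<omega> n] by simp
  then have "ecoeff \<omega> n m (Suc k) * (real (Suc k) * (real (Suc k) + 2 * aexp \<omega> n - real n)) \<noteq> 0"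
    by (simp only: ecoeff_Suc not_False_eq_True)
  then show ?case by (metis mult_zero_left)
qed simp

definition ef :: "real \<Rightarrow> nat \<Rightarrow> bool \<Rightarrow> nat \<Rightarrow> real^2 \<Rightarrow> real" where
  "ef \<omega> n \<sigma> m x = (\<Sum>k\<le>m. ecoeff \<omega> n m k * (harmp n \<sigma> x * spow (aexp \<omega> n + real k) x))"

lemma smooth_ef: "smooth (ef \<omega> n \<sigma> m)"
  unfolding ef_def by (intro smooth_sum smooth_mult smooth_const smooth_harm smooth_spow)

lemma pd_sum:
  "finite J \<Longrightarrow> (\<And>j. j \<in> J \<Longrightarrow> smooth (f j)) \<Longrightarrow> pd i (\<lambda>x. \<Sum>j\<in>J. f j x) x = (\<Sum>j\<in>J. pd i (f j) x)"
  by (induction J rule: finite_induct) (simp_all add: pd_add smooth_sum)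

lemma pd_harm_spow: "pd i (\<lambda>x. harmp n \<sigma> x * spow b x) x =
    pd i (harmp n \<sigma>) x * spow b x - 2 * b * (x $ i * harmp n \<sigma> x) * spow (b + 1) x"
  by (subst pd_mult) (auto simp: pd_spow)

text \<open>Harmonicity removes one term of the product rule, Euler's identity for homogeneous
  functions turns the mixed term into a multiple of n, and \<open>norm_sq_spow\<close> trades the
  squared norm for a lower power, so only two powers remain.\<close>

lemma laplace_harm_spow:
  fixes n \<sigma> b
  defines "f \<equiv> \<lambda>x. harmp n \<sigma> x * spow b x"
  shows "pd 1 (pd 1 f) x + pd 2 (pd 2 f) x =
    4 * b * harmp n \<sigma> x * ((b - real n) * spow (b + 1) x - (b + 1) * spow (b + 2) x)"
proof -
  have "pd i f = (\<lambda>x. pd i (harmp n \<sigma>) x * spow b x - 2 * b * (x $ i * (harmp n \<sigma> x * spow (b + 1) x)))" for i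
    unfolding f_def by (simp add: fun_eq_iff pd_harm_spow mult.assoc)
  then have 2: "pd i (pd i f) x = (pd i (harmp n \<sigma>) x * (- 2 * b * x $ i * spow (b + 1) x)
      + pd i (pd i (harmp n \<sigma>)) x * spow b x)
      - 2 * b * (x $ i * (harmp n \<sigma> x * (- 2 * (b + 1) * x $ i * spow (b + 2) x)
      + pd i (harmp n \<sigma>) x * spow (b + 1) x) + harmp n \<sigma> x * spow (b + 1) x)" for i
    by (simp add: pd_diff pd_mult pd_cmult pd_coord pd_spow smooth_mult smooth_harm smooth_spow smooth_pd
        add_ac)
  have "pd 1 (pd 1 f) x + pd 2 (pd 2 f) x =
     (pd 1 (pd 1 (harmp n \<sigma>)) x + pd 2 (pd 2 (harmp n \<sigma>)) x) * spow b x
     - 4 * b * (x $ 1 * pd 1 (harmp n \<sigma>) x + x $ 2 * pd 2 (harmp n \<sigma>) x) * spow (b + 1) x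
     - 4 * b * harmp n \<sigma> x * spow (b + 1) x
     + 4 * b * (b + 1) * harmp n \<sigma> x * (((x $ 1)\<^sup>2 + (x $ 2)\<^sup>2) * spow (b + 2) x)"
    unfolding 2 by (simp add: algebra_simps power2_eq_square)
  also have "((x $ 1)\<^sup>2 + (x $ 2)\<^sup>2) * spow (b + 2) x = spow (b + 1) x - spow (b + 2) x"
    using norm_sq_spow [of x "b + 1"] by (simp add: norm_sq_coords add.assoc)
  finally show ?thesis
    unfolding euler_harm laplace_harm by (simp add: algebra_simps)
qed

lemma laplace_ef:
  "pd 1 (pd 1 (ef \<omega> n \<sigma> m)) x + pd 2 (pd 2 (ef \<omega> n \<sigma> m)) x =
    (\<omega>\<^sup>2 * (norm x)\<^sup>2 - eigval \<omega> m n) * conf x * ef \<omega> n \<sigma> m x"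
proof -
  let ?a = "aexp \<omega> n" and ?c = "ecoeff \<omega> n m" and ?h = "harmp n \<sigma> x"
  define g where "g k = (\<lambda>x. harmp n \<sigma> x * spow (?a + real k) x)" for k
  have sg: "smooth (g k)" for k unfolding g_def by (intro smooth_mult smooth_harm smooth_spow)
  have ef_g: "ef \<omega> n \<sigma> m = (\<lambda>x. \<Sum>k\<le>m. ?c k * g k x)"
    by (simp add: fun_eq_iff ef_def g_def)
  have "pd i (ef \<omega> n \<sigma> m) = (\<lambda>x. \<Sum>k\<le>m. ?c k * pd i (g k) x)" for i
    unfolding ef_g by (simp add: fun_eq_iff pd_sum pd_cmult sg smooth_mult)
  then have "pd i (pd i (ef \<omega> n \<sigma> m)) x = (\<Sum>k\<le>m. ?c k * pd i (pd i (g k)) x)" for i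
    by (simp add: pd_sum pd_cmult sg smooth_mult smooth_pd)
  then have L: "pd 1 (pd 1 (ef \<omega> n \<sigma> m)) x + pd 2 (pd 2 (ef \<omega> n \<sigma> m)) x
      = (\<Sum>k\<le>m. ?c k * (pd 1 (pd 1 (g k)) x + pd 2 (pd 2 (g k)) x))"
    by (simp add: sum.distrib algebra_simps)
  define s where "s k = spow (?a + real k + 2) x" for k
  have t: "?c k * (pd 1 (pd 1 (g k)) x + pd 2 (pd 2 (g k)) x) - ?c k * (\<omega>\<^sup>2 * (norm x)\<^sup>2 * conf x * g k x)
      = 4 * ?h * (?c k * (real k * (real k + 2 * ?a - real n)) * spow (?a + real k + 1) x
          - eigval \<omega> k n * ?c k * s k)" for k
  proof -
    let ?b = "?a + real k"
    have "(norm x)\<^sup>2 * conf x * g k x = 4 * ?h * ((norm x)\<^sup>2 * (spow 2 x * spow ?b x))"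
      by (simp add: conf_spow g_def)
    also have "spow 2 x * spow ?b x = spow ((?b + 1) + 1) x" by (simp add: spow_add add_ac)
    also have "(norm x)\<^sup>2 * \<dots> = spow (?b + 1) x - s k"
      unfolding norm_sq_spow by (simp add: s_def add_ac)
    finally have 1: "(norm x)\<^sup>2 * conf x * g k x = 4 * ?h * (spow (?b + 1) x - s k)" .
    have 2: "pd 1 (pd 1 (g k)) x + pd 2 (pd 2 (g k)) x
        = 4 * ?b * ?h * ((?b - real n) * spow (?b + 1) x - (?b + 1) * s k)"
      unfolding g_def s_def by (rule laplace_harm_spow)
    \<comment> \<open>The quadratic equation for \<open>aexp\<close> absorbs the potential,
      completely at \<open>k = 0\<close>; what is left is the denominator of the recursion.\<close>
    have 3: "?b * (?b - real n) - \<omega>\<^sup>2 = real k * (real k + 2 * ?a - real n)"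
      using aexp_quadratic [of \<omega> n] by (simp add: power2_eq_square algebra_simps)
    have 4: "?b * (?b + 1) - \<omega>\<^sup>2 = eigval \<omega> k n" by (simp add: eigval_aexp add_ac)
    have "?c k * (pd 1 (pd 1 (g k)) x + pd 2 (pd 2 (g k)) x) - ?c k * (\<omega>\<^sup>2 * ((norm x)\<^sup>2 * conf x * g k x))
      = 4 * ?h * (?c k * (?b * (?b - real n) - \<omega>\<^sup>2) * spow (?b + 1) x
          - (?b * (?b + 1) - \<omega>\<^sup>2) * ?c k * s k)"
      unfolding 1 2 by (simp add: algebra_simps)
    then show ?thesis unfolding 3 4 by (simp add: mult.assoc)
  qed
  \<comment> \<open>The term \<open>k = 0\<close> vanishes through its factor k, and the shift of
    the index turns the exponent a + k + 1 into the exponent a + k + 2 of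
    \<open>s k\<close>.\<close>
  have "(\<Sum>k\<le>m. ?c k * (real k * (real k + 2 * ?a - real n)) * spow (?a + real k + 1) x)
      = (\<Sum>k<m. ?c (Suc k) * (real (Suc k) * (real (Suc k) + 2 * ?a - real n)) * s k)"
    by (subst sum.atMost_shift) (simp add: s_def add_ac)
  also have "\<dots> = (\<Sum>k<m. (eigval \<omega> k n - eigval \<omega> m n) * ?c k * s k)"
    by (simp only: ecoeff_Suc)
  \<comment> \<open>The term added at \<open>k = m\<close> is zero: here the eigenvalue terminates
    the recursion.\<close>
  also have "\<dots> = (\<Sum>k\<le>m. (eigval \<omega> k n - eigval \<omega> m n) * ?c k * s k)"
    by (simp add: lessThan_Suc_atMost [symmetric])
  finally have "(\<Sum>k\<le>m. ?c k * (pd 1 (pd 1 (g k)) x + pd 2 (pd 2 (g k)) x)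
      - ?c k * (\<omega>\<^sup>2 * (norm x)\<^sup>2 * conf x * g k x))
      = 4 * ?h * (\<Sum>k\<le>m. (eigval \<omega> k n - eigval \<omega> m n) * ?c k * s k - eigval \<omega> k n * ?c k * s k)"
    unfolding t sum_distrib_left [symmetric] sum_subtractf by simp
  also have "\<dots> = - eigval \<omega> m n * (\<Sum>k\<le>m. ?c k * (4 * ?h * s k))"
    by (simp add: sum_distrib_left algebra_simps)
  also have "(\<Sum>k\<le>m. ?c k * (4 * ?h * s k)) = conf x * ef \<omega> n \<sigma> m x"
    unfolding ef_def s_def conf_spow sum_distrib_left
    by (intro sum.cong refl) (simp add: spow_add [symmetric])
  finally have "pd 1 (pd 1 (ef \<omega> n \<sigma> m)) x + pd 2 (pd 2 (ef \<omega> n \<sigma> m)) x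
      - \<omega>\<^sup>2 * (norm x)\<^sup>2 * conf x * ef \<omega> n \<sigma> m x = - eigval \<omega> m n * (conf x * ef \<omega> n \<sigma> m x)"
    unfolding L sum_subtractf by (simp add: ef_def g_def sum_distrib_left algebra_simps)
  then show ?thesis by (simp add: algebra_simps)
qed

subsection \<open>Decay of the eigenfunctions\<close>

lemma harm_spow_le:
  assumes "aexp \<omega> n \<le> b"
  shows "\<bar>harmp n \<sigma> x * spow b x\<bar> \<le> spow (aexp \<omega> n - real n / 2) x"
proof -
  have "\<bar>harmp n \<sigma> x * spow b x\<bar> = \<bar>harmp n \<sigma> x\<bar> * spow b x"
    using spow_pos [of b x] by (simp add: abs_mult)
  also have "\<dots> \<le> spow (- (real n / 2)) x * spow (aexp \<omega> n) x"
    using abs_harm_le [of n \<sigma> x] norm_power_le_spow [of x n] spow_pos less_imp_le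
    by (intro mult_mono spow_antimono assms) (auto intro: order_trans less_imp_le)
  finally show ?thesis by (simp add: spow_add)
qed

lemma abs_sum_le: "(\<And>k. k \<in> J \<Longrightarrow> \<bar>f k\<bar> \<le> g k * (c::real)) \<Longrightarrow> \<bar>\<Sum>k\<in>J. f k\<bar> \<le> (\<Sum>k\<in>J. g k) * c"
  unfolding sum_distrib_right by (rule order_trans [OF sum_abs sum_mono])

lemma ef_le:
  obtains C where "C \<ge> 0" "\<And>x. \<bar>ef \<omega> n \<sigma> m x\<bar> \<le> C * spow (aexp \<omega> n - real n / 2) x"
proof
  show "(\<Sum>k\<le>m. \<bar>ecoeff \<omega> n m k\<bar>) \<ge> 0" by (rule sum_nonneg) simp
  fix x
  have "\<bar>ecoeff \<omega> n m k * (harmp n \<sigma> x * spow (aexp \<omega> n + real k) x)\<bar>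
      \<le> \<bar>ecoeff \<omega> n m k\<bar> * spow (aexp \<omega> n - real n / 2) x" for k
    unfolding abs_mult [of "ecoeff \<omega> n m k"] by (intro mult_left_mono harm_spow_le) auto
  then show "\<bar>ef \<omega> n \<sigma> m x\<bar> \<le> (\<Sum>k\<le>m. \<bar>ecoeff \<omega> n m k\<bar>) * spow (aexp \<omega> n - real n / 2) x"
    unfolding ef_def by (intro abs_sum_le)
qed

lemma abs_coord_harm_spow_le:
  "\<bar>x $ i * harmp n \<sigma> x * spow (b + 1) x\<bar> \<le> spow (b + 1 / 2 - real n / 2) x"
proof -
  have "\<bar>x $ i\<bar> * \<bar>harmp n \<sigma> x\<bar> \<le> norm x * norm x ^ n"
    by (intro mult_mono component_le_norm_cart abs_harm_le) auto
  also have "\<dots> \<le> spow (- (real (Suc n) / 2)) x"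
    using norm_power_le_spow [of x "Suc n"] by simp
  finally have "\<bar>x $ i * harmp n \<sigma> x * spow (b + 1) x\<bar> \<le> spow (- (real (Suc n) / 2)) x * spow (b + 1) x"
    using spow_pos [of "b + 1" x] by (simp add: abs_mult mult_right_mono)
  moreover have "- (real (Suc n) / 2) + (b + 1) = b + 1 / 2 - real n / 2"
    by (simp add: field_simps)
  ultimately show ?thesis by (simp only: spow_add)
qed

text \<open>The exponent \<open>p\<close> is \<open>(\<nu> + 1)/2\<close> with \<open>\<nu> = sqrt (n\<^sup>2 + 4 \<omega>\<^sup>2)\<close>, except that \<open>p = 1\<close> in the
  case \<open>\<nu> = 0\<close>, where the eigenfunction is a polynomial in \<open>1 / (1 + \<bar>x\<bar>\<^sup>2)\<close>.\<close>

lemma pd_ef_le: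
  obtains C p where "C \<ge> 0" "p > 1 / 2" "\<omega> = 0 \<Longrightarrow> p \<ge> 1"
    "\<And>i x. \<bar>pd i (ef \<omega> n \<sigma> m) x\<bar> \<le> C * spow p x"
proof -
  let ?a = "aexp \<omega> n"
  define p where "p = (if \<omega> = 0 \<and> n = 0 then 1 else ?a + 1 / 2 - real n / 2)"
  have a0: "?a = 0" if "\<omega> = 0" "n = 0" using that by (simp add: aexp_def)
  have an: "?a = real n" if "\<omega> = 0" using that by (simp add: aexp_def)
  have ag: "?a \<ge> 0" using aexp_ge [of n \<omega>] by (rule order_trans [rotated]) simp
  have p1: "p > 1 / 2" using aexp_gt [of \<omega> n] by (auto simp: p_def)
  have p2: "p \<ge> 1" if "\<omega> = 0" using an [OF that] that by (cases n) (auto simp: p_def field_simps)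
  have b: "\<bar>pd i (\<lambda>x. harmp n \<sigma> x * spow (?a + real k) x) x\<bar> \<le> (real n + 2 * (?a + real k)) * spow p x" for i k x
  proof -
    have 1: "\<bar>pd i (harmp n \<sigma>) x * spow (?a + real k) x\<bar> \<le> real n * spow p x"
    proof (cases n)
      case 0
      then show ?thesis by (simp add: pd_harm_0)
    next
      case (Suc j)
      have "\<bar>pd i (harmp n \<sigma>) x\<bar> * spow (?a + real k) x \<le> (real n * spow (- (real j / 2)) x) * spow ?a x"
        using abs_pd_harm_le [of i n \<sigma> x] norm_power_le_spow [of x j] Suc spow_pos
        by (intro mult_mono spow_antimono) (auto intro: order_trans mult_left_mono less_imp_le)
      also have "\<dots> = real n * spow p x"
      proof -
        have "- (real j / 2) + ?a = p" using Suc by (simp add: p_def field_simps)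
        then show ?thesis by (simp only: mult.assoc spow_add)
      qed
      finally show ?thesis using spow_pos [of "?a + real k" x] by (simp add: abs_mult)
    qed
    have 2: "\<bar>2 * (?a + real k) * (x $ i * harmp n \<sigma> x) * spow (?a + real k + 1) x\<bar> \<le> 2 * (?a + real k) * spow p x"
    proof (cases "?a + real k = 0")
      case False
      have "p \<le> ?a + real k + 1 / 2 - real n / 2"
      proof (cases "\<omega> = 0 \<and> n = 0")
        case True
        then have "k \<noteq> 0" using False a0 by auto
        then have "real k \<ge> 1" by simp
        then show ?thesis using True a0 by (simp add: p_def)
      qed (auto simp: p_def)
      then have "\<bar>x $ i * harmp n \<sigma> x * spow (?a + real k + 1) x\<bar> \<le> spow p x"
        using abs_coord_harm_spow_le [of x i n \<sigma> "?a + real k"] spow_antimono order_trans by blast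
      then have "2 * (?a + real k) * \<bar>x $ i * harmp n \<sigma> x * spow (?a + real k + 1) x\<bar> \<le> 2 * (?a + real k) * spow p x"
        using ag by (intro mult_left_mono) auto
      then show ?thesis using ag by (simp add: abs_mult mult.assoc)
    qed simp
    show ?thesis
      unfolding pd_harm_spow distrib_right using 1 2 by linarith
  qed
  define C where "C = (\<Sum>k\<le>m. \<bar>ecoeff \<omega> n m k\<bar> * (real n + 2 * (?a + real k)))"
  have "C \<ge> 0" unfolding C_def using ag by (intro sum_nonneg mult_nonneg_nonneg) auto
  moreover have "\<bar>pd i (ef \<omega> n \<sigma> m) x\<bar> \<le> C * spow p x" for i x
  proof -
    have "pd i (ef \<omega> n \<sigma> m) x = (\<Sum>k\<le>m. ecoeff \<omega> n m k * pd i (\<lambda>x. harmp n \<sigma> x * spow (?a + real k) x) x)"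
      unfolding ef_def [abs_def]
      by (simp add: pd_sum pd_cmult smooth_mult smooth_harm smooth_spow)
    also have "\<bar>\<dots>\<bar> \<le> C * spow p x"
      unfolding C_def
      by (rule abs_sum_le) (use b in \<open>simp add: abs_mult mult.assoc mult_left_mono\<close>)
    finally show ?thesis .
  qed
  ultimately show ?thesis using that p1 p2 by blast
qed

subsection \<open>A logarithmic cutoff\<close>

text \<open>In dimension two a point has capacity zero: a cutoff in \<open>ln (1 + \<bar>x\<bar>\<^sup>2)\<close> has arbitrarily
  small energy. The factor \<open>exp 1\<close> normalizes \<open>bump 1\<close>.\<close>

definition cutoff :: "nat \<Rightarrow> real^2 \<Rightarrow> real" where
  "cutoff N x = exp 1 * bump (1 - ln (1 + (norm x)\<^sup>2) / real (Suc N))"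

lemma smooth_cutoff: "smooth (cutoff N)"
proof -
  have "smooth (\<lambda>x. 1 - (1 / real (Suc N)) * ln (1 + (norm x)\<^sup>2))"
    by (intro smooth_diff smooth_mult smooth_const smooth_ln smooth_one_plus_norm_sq one_plus_norm_sq_pos)
  from smooth_mult [OF smooth_const smooth_bump [OF this], of "exp 1"]
  show ?thesis by (simp add: cutoff_def [abs_def])
qed

lemma cutoff_range: "0 \<le> cutoff N x" "cutoff N x \<le> 1"
proof -
  have "ln (1 + (norm x)\<^sup>2) \<ge> 0" by simp
  then have "bump (1 - ln (1 + (norm x)\<^sup>2) / real (Suc N)) \<le> bump 1"
    by (intro bump_mono) (simp add: divide_nonneg_pos)
  then have "cutoff N x \<le> exp 1 * exp (- 1)"
    unfolding cutoff_def bump_1 by (intro mult_left_mono) auto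
  then show "cutoff N x \<le> 1" by (simp flip: exp_add)
qed (simp add: cutoff_def bump_nonneg)

lemma bsupp_cutoff: "bsupp (cutoff N)"
  unfolding bsupp_def
proof (intro exI allI impI)
  fix x :: "real^2"
  assume x: "norm x > sqrt (exp (real (Suc N)))"
  then have "(norm x)\<^sup>2 > exp (real (Suc N))"
    by (metis abs_norm_cancel real_sqrt_abs real_sqrt_less_iff)
  then have "1 + (norm x)\<^sup>2 \<ge> exp (real (Suc N))" by linarith
  then have "ln (1 + (norm x)\<^sup>2) \<ge> real (Suc N)"
    by (metis exp_gt_zero ln_exp ln_mono)
  then show "cutoff N x = 0"
    unfolding cutoff_def by (subst bump_eq_0) auto
qed

lemma test_function_cutoff: "smooth f \<Longrightarrow> test_function (\<lambda>x. f x * cutoff N x)"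
  by (intro test_function_mult) (simp_all add: test_function_iff smooth_cutoff bsupp_cutoff)

lemma cutoff_tendsto: "(\<lambda>N. cutoff N x) \<longlonglongrightarrow> 1"
proof -
  have "(\<lambda>N. 1 - ln (1 + (norm x)\<^sup>2) * inverse (real (Suc N))) \<longlonglongrightarrow> 1 - ln (1 + (norm x)\<^sup>2) * 0"
    by (intro tendsto_intros LIMSEQ_inverse_real_of_nat)
  moreover have "isCont bump 1" using bump_has_derivative DERIV_isCont by blast
  ultimately have "(\<lambda>N. bump (1 - ln (1 + (norm x)\<^sup>2) * inverse (real (Suc N)))) \<longlonglongrightarrow> bump 1"
    using isCont_tendsto_compose by fastforce
  from tendsto_mult_left [OF this, of "exp 1"]
  show ?thesis unfolding cutoff_def bump_1 by (simp add: divide_inverse flip: exp_add)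
qed

lemma pd_cutoff: "pd i (cutoff N) x =
  - exp 1 * bump' (1 - ln (1 + (norm x)\<^sup>2) / real (Suc N)) / real (Suc N) * (2 * x $ i / (1 + (norm x)\<^sup>2))"
proof -
  have "((\<lambda>t. exp 1 * bump (1 - ln t / real (Suc N))) has_real_derivative
      exp 1 * (bump' (1 - ln (1 + (norm x)\<^sup>2) / real (Suc N)) * - (inverse (1 + (norm x)\<^sup>2) / real (Suc N))))
      (at (1 + (norm x)\<^sup>2))"
    by (intro DERIV_cmult DERIV_chain2 [OF bump_has_derivative])
      (use one_plus_norm_sq_pos [of x] in \<open>auto intro!: derivative_eq_intros simp: divide_inverse\<close>)
  from pd_compose_at [OF smooth_imp_differentiable [OF smooth_one_plus_norm_sq] this, of i]
  show ?thesis by (simp add: cutoff_def [abs_def] pd_one_plus_norm_sq divide_inverse mult_ac)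
qed

text \<open>The gradient has size of order 1 / (N + 1) times |x| / (1 + |x|^2) and lives where the
  logarithm is at most N + 1. The integral over that region is pi (N + 1), so the energy is of order
  1 / (N + 1).\<close>

lemma grad_cutoff_tendsto_0:
  "(\<lambda>N. \<integral>\<^sup>+ x. ennreal ((norm (grad (cutoff N) x))\<^sup>2) \<partial>lborel) \<longlonglongrightarrow> 0"
proof -
  obtain B where B: "B \<ge> 0" "\<And>s. s \<le> 1 \<Longrightarrow> \<bar>bump' s\<bar> \<le> B" using bump'_bounded by blast
  \<comment> \<open>The factor \<open>exp 1\<close> normalizes the cutoff, \<open>B\<close> bounds
    \<open>bump'\<close>, and 2 comes from differentiating the squared norm.\<close>
  define D where "D = (exp 1 * B * 2)\<^sup>2"
  have le: "(norm (grad (cutoff N) x))\<^sup>2 \<le> (D / (real (Suc N))\<^sup>2) *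
      (indicator {x. ln (1 + (norm x)\<^sup>2) \<le> real (Suc N)} x / (1 + (norm x)\<^sup>2))" for N x
  proof -
    let ?t = "1 - ln (1 + (norm x)\<^sup>2) / real (Suc N)" and ?i = "indicator {x. ln (1 + (norm x)\<^sup>2) \<le> real (Suc N)} x :: real"
    have "(norm (grad (cutoff N) x))\<^sup>2 = (exp 1 * bump' ?t / real (Suc N) * 2)\<^sup>2 * ((norm x)\<^sup>2 / (1 + (norm x)\<^sup>2)\<^sup>2)"
    proof -
      define k where "k = exp 1 * bump' ?t / real (Suc N) * 2"
      have "pd i (cutoff N) x = - k * (x $ i / (1 + (norm x)\<^sup>2))" for i
        unfolding pd_cutoff k_def by (simp del: of_nat_Suc)
      then have "(norm (grad (cutoff N) x))\<^sup>2
          = (k * (x $ 1 / (1 + (norm x)\<^sup>2)))\<^sup>2 + (k * (x $ 2 / (1 + (norm x)\<^sup>2)))\<^sup>2"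
        unfolding norm_sq_coords [of "grad (cutoff N) x"] by (simp add: grad_def)
      also have "\<dots> = k\<^sup>2 * (((x $ 1)\<^sup>2 + (x $ 2)\<^sup>2) / (1 + (norm x)\<^sup>2)\<^sup>2)"
        by (simp add: power_mult_distrib power_divide add_divide_distrib distrib_left)
      finally show ?thesis unfolding k_def norm_sq_coords [of x, symmetric] .
    qed
    also have "\<dots> \<le> (exp 1 * B / real (Suc N) * 2)\<^sup>2 * ?i * (1 / (1 + (norm x)\<^sup>2))"
    proof (rule mult_mono)
      have b: "\<bar>bump' ?t\<bar> \<le> B * ?i"
      proof (cases "ln (1 + (norm x)\<^sup>2) \<le> real (Suc N)")
        case True
        then show ?thesis using B(2) [of ?t] by (simp add: divide_nonneg_pos)
      next
        case False
        then have "?t \<le> 0" by simp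
        then show ?thesis using False by (simp add: bump'_eq_0 del: of_nat_Suc)
      qed
      have "\<bar>exp 1 * bump' ?t / real (Suc N) * 2\<bar> \<le> \<bar>exp 1 * (B * ?i) / real (Suc N) * 2\<bar>"
        using b B(1) by (simp add: abs_mult divide_right_mono del: of_nat_Suc)
      then have "(exp 1 * bump' ?t / real (Suc N) * 2)\<^sup>2 \<le> (exp 1 * (B * ?i) / real (Suc N) * 2)\<^sup>2"
        by (simp only: abs_le_square_iff)
      also have "\<dots> = (exp 1 * B / real (Suc N) * 2)\<^sup>2 * ?i"
        by (simp add: indicator_def del: of_nat_Suc)
      finally show "(exp 1 * bump' ?t / real (Suc N) * 2)\<^sup>2 \<le> (exp 1 * B / real (Suc N) * 2)\<^sup>2 * ?i" .
      show "(norm x)\<^sup>2 / (1 + (norm x)\<^sup>2)\<^sup>2 \<le> 1 / (1 + (norm x)\<^sup>2)"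
        using divide_right_mono [of "(norm x)\<^sup>2" "1 + (norm x)\<^sup>2" "(1 + (norm x)\<^sup>2)\<^sup>2"]
          one_plus_norm_sq_ne [of x] by (simp add: power2_eq_square [of "1 + (norm x)\<^sup>2"])
    qed auto
    also have "\<dots> = (D / (real (Suc N))\<^sup>2) * (?i / (1 + (norm x)\<^sup>2))"
      by (simp add: D_def power_mult_distrib power_divide)
    finally show ?thesis .
  qed
  have bound: "(\<integral>\<^sup>+ x. ennreal ((norm (grad (cutoff N) x))\<^sup>2) \<partial>lborel) \<le> ennreal (D * pi * inverse (real (Suc N)))" for N
  proof -
    have "(\<integral>\<^sup>+ x. ennreal ((norm (grad (cutoff N) x))\<^sup>2) \<partial>lborel)
        \<le> (\<integral>\<^sup>+ x. ennreal (D / (real (Suc N))\<^sup>2) *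
          ennreal (indicator {x::real^2. ln (1 + (norm x)\<^sup>2) \<le> real (Suc N)} x / (1 + (norm x)\<^sup>2)) \<partial>lborel)"
      by (intro nn_integral_mono) (use le in \<open>simp add: ennreal_leI D_def flip: ennreal_mult\<close>)
    also have "\<dots> = ennreal (D / (real (Suc N))\<^sup>2) * ennreal (pi * real (Suc N))"
      by (subst nn_integral_cmult) (simp_all add: nn_integral_log_annulus del: of_nat_Suc)
    also have "\<dots> = ennreal (D * pi * inverse (real (Suc N)))"
    proof -
      have "D / (real (Suc N))\<^sup>2 * (pi * real (Suc N)) = D * pi * inverse (real (Suc N))"
        by (simp add: power2_eq_square field_simps del: of_nat_Suc)
      moreover have "0 \<le> D / (real (Suc N))\<^sup>2" "0 \<le> pi * real (Suc N)" by (simp_all add: D_def)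
      ultimately show ?thesis by (metis ennreal_mult)
    qed
    finally show ?thesis .
  qed
  have "(\<lambda>N. ennreal (D * pi * inverse (real (Suc N)))) \<longlonglongrightarrow> ennreal (D * pi * 0)"
    by (intro tendsto_ennrealI tendsto_intros LIMSEQ_inverse_real_of_nat)
  then have lim: "(\<lambda>N. ennreal (D * pi * inverse (real (Suc N)))) \<longlonglongrightarrow> 0"
    by (simp only: mult_zero_right ennreal_0)
  show ?thesis
    by (rule tendsto_sandwich [OF always_eventually always_eventually tendsto_const lim])
      (simp_all only: bound zero_le simp_thms)
qed

lemma grad_measurable [measurable]: "smooth f \<Longrightarrow> grad f \<in> borel_measurable borel"
  unfolding grad_def
  by (intro borel_measurable_continuous_onI continuous_on_vec_lambda smooth_imp_continuous smooth_pd)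

lemma norm_grad_sq_le: "(norm (grad f x))\<^sup>2 \<le> 2 * c\<^sup>2" if "\<And>i. \<bar>pd i f x\<bar> \<le> c"
proof -
  have "(pd i f x)\<^sup>2 \<le> c\<^sup>2" for i
    using that [of i] by (metis abs_ge_zero power2_abs power_mono)
  then show ?thesis
    unfolding norm_sq_coords grad_def using add_mono [of "(pd 1 f x)\<^sup>2" "c\<^sup>2" "(pd 2 f x)\<^sup>2" "c\<^sup>2"] by simp
qed

lemma integrable_fvec_ef:
  "integrable lborel (\<lambda>x. (norm (fvec \<omega> (ef \<omega> n \<sigma> m) (grad (ef \<omega> n \<sigma> m)) x))\<^sup>2)"
proof -
  obtain C where C: "C \<ge> 0" "\<And>x. \<bar>ef \<omega> n \<sigma> m x\<bar> \<le> C * spow (aexp \<omega> n - real n / 2) x"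
    using ef_le [where \<omega> = \<omega> and n = n and \<sigma> = \<sigma> and m = m] by blast
  obtain D p where D: "D \<ge> 0" "p > 1 / 2" "\<And>i x. \<bar>pd i (ef \<omega> n \<sigma> m) x\<bar> \<le> D * spow p x"
    using pd_ef_le [where \<omega> = \<omega> and n = n and \<sigma> = \<sigma> and m = m] by metis
  let ?q = "aexp \<omega> n - real n / 2"
  have q: "?q \<ge> 0" using aexp_ge [of n \<omega>] by simp
  have [measurable]: "ef \<omega> n \<sigma> m \<in> borel_measurable borel" "grad (ef \<omega> n \<sigma> m) \<in> borel_measurable borel"
    by (auto intro: borel_measurable_continuous_onI smooth_imp_continuous smooth_ef grad_measurable)
  show ?thesis
  proof (rule Bochner_Integration.integrable_bound)
    have "integrable lborel (\<lambda>x. 4 * C\<^sup>2 * (\<omega>\<^sup>2 * spow (1 + 2 * ?q) x))"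
    \<comment> \<open>For \<omega> = 0 the whole term is zero, whereas for n = 0 its power alone
      would have the nonintegrable exponent 1.\<close>
    proof (cases "\<omega> = 0")
      case False
      then have "1 + 2 * ?q > 1" using aexp_gt [of \<omega> n] by simp
      from integrable_spow [OF this] show ?thesis by simp
    qed simp
    then show "integrable lborel (\<lambda>x. 4 * C\<^sup>2 * spow 2 x + (2 * D\<^sup>2 * spow (2 * p) x + 4 * C\<^sup>2 * (\<omega>\<^sup>2 * spow (1 + 2 * ?q) x)))"
      using integrable_spow [of 2] integrable_spow [of "2 * p"] D(2) by auto
    have "(norm (fvec \<omega> (ef \<omega> n \<sigma> m) (grad (ef \<omega> n \<sigma> m)) x))\<^sup>2
        \<le> 4 * C\<^sup>2 * spow 2 x + (2 * D\<^sup>2 * spow (2 * p) x + 4 * C\<^sup>2 * (\<omega>\<^sup>2 * spow (1 + 2 * ?q) x))" for x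
    proof -
      have sq: "(spow c x)\<^sup>2 = spow (2 * c) x" for c
        by (simp add: power2_eq_square spow_add)
      have e2: "(ef \<omega> n \<sigma> m x)\<^sup>2 \<le> C\<^sup>2 * spow (2 * ?q) x"
        using power_mono [OF C(2) abs_ge_zero, of x 2] by (simp add: power_mult_distrib sq)
      also have "\<dots> \<le> C\<^sup>2 * spow 0 x" using q by (intro mult_left_mono spow_antimono) auto
      finally have e1: "(ef \<omega> n \<sigma> m x)\<^sup>2 \<le> C\<^sup>2" by simp
      have 1: "conf x * (ef \<omega> n \<sigma> m x)\<^sup>2 \<le> 4 * C\<^sup>2 * spow 2 x"
        unfolding conf_spow using e1 spow_pos [of 2 x] by (simp add: mult_left_mono mult.commute)
      have 2: "(norm (grad (ef \<omega> n \<sigma> m) x))\<^sup>2 \<le> 2 * D\<^sup>2 * spow (2 * p) x"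
        using norm_grad_sq_le [of "ef \<omega> n \<sigma> m" x, OF D(3)] by (simp add: power_mult_distrib sq)
      have c1: "(norm x)\<^sup>2 * conf x \<le> 4 * spow 1 x"
        using norm_sq_spow [of x 1] spow_pos [of 2 x] by (simp add: conf_spow)
      then have "((norm x)\<^sup>2 * conf x) * (ef \<omega> n \<sigma> m x)\<^sup>2 \<le> 4 * spow 1 x * (C\<^sup>2 * spow (2 * ?q) x)"
        using mult_mono [OF c1 e2] spow_pos [of 1 x] by simp
      also have "\<dots> = 4 * C\<^sup>2 * spow (1 + 2 * ?q) x" by (simp add: spow_add [symmetric])
      finally have "\<omega>\<^sup>2 * (((norm x)\<^sup>2 * conf x) * (ef \<omega> n \<sigma> m x)\<^sup>2) \<le> \<omega>\<^sup>2 * (4 * C\<^sup>2 * spow (1 + 2 * ?q) x)"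
        by (intro mult_left_mono) auto
      then show ?thesis using 1 2 unfolding norm_fvec by (simp add: algebra_simps)
    qed
    then show "AE x in lborel. norm ((norm (fvec \<omega> (ef \<omega> n \<sigma> m) (grad (ef \<omega> n \<sigma> m)) x))\<^sup>2)
        \<le> norm (4 * C\<^sup>2 * spow 2 x + (2 * D\<^sup>2 * spow (2 * p) x + 4 * C\<^sup>2 * (\<omega>\<^sup>2 * spow (1 + 2 * ?q) x)))"
      by (intro AE_I2) (simp add: order_trans [OF _ abs_ge_self])
  qed measurable
qed

subsection \<open>The eigenfunctions belong to the form domain\<close>

lemma ef_measurable [measurable]: "ef \<omega> n \<sigma> m \<in> borel_measurable borel"
  and grad_ef_measurable [measurable]: "grad (ef \<omega> n \<sigma> m) \<in> borel_measurable borel"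
  and cutoff_measurable [measurable]: "cutoff N \<in> borel_measurable borel"
  and grad_cutoff_measurable [measurable]: "grad (cutoff N) \<in> borel_measurable borel"
  by (auto intro: borel_measurable_continuous_onI smooth_imp_continuous smooth_ef smooth_cutoff
      grad_measurable)

text \<open>The error of the cut-off function splits into \<open>cutoff N x - 1\<close> times the
  energy vector of the eigenfunction, which tends to zero by dominated convergence, and the
  eigenfunction times the gradient of the cutoff, which does so because the eigenfunction is
  bounded.\<close>

lemma nice_ef: "nice \<omega> (ef \<omega> n \<sigma> m) (grad (ef \<omega> n \<sigma> m))"
proof -
  let ?e = "ef \<omega> n \<sigma> m"
  define U where "U N = (\<lambda>x. ?e x * cutoff N x)" for N
  obtain C where C: "C \<ge> 0" "\<And>x. \<bar>?e x\<bar> \<le> C * spow (aexp \<omega> n - real n / 2) x"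
    using ef_le [where \<omega> = \<omega> and n = n and \<sigma> = \<sigma> and m = m] by blast
  have eC: "\<bar>?e x\<bar> \<le> C" for x
  proof -
    have "C * spow (aexp \<omega> n - real n / 2) x \<le> C * spow 0 x"
      using C(1) aexp_ge [of n \<omega>] by (intro mult_left_mono spow_antimono) auto
    then show ?thesis using C(2) [of x] by simp
  qed
  show ?thesis
  proof (rule nice_limit)
    show "nice \<omega> (U N) (grad (U N))" for N
      unfolding U_def by (intro nice_test_function test_function_cutoff smooth_ef)
    let ?F = "\<lambda>x. (norm (fvec \<omega> ?e (grad ?e) x))\<^sup>2"
    have gU: "grad (U N) x = cutoff N x *\<^sub>R grad ?e x + ?e x *\<^sub>R grad (cutoff N) x" for N x
      unfolding U_def by (simp add: vec_eq_iff grad_def pd_mult smooth_ef smooth_cutoff algebra_simps)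
    have le: "(norm (fvec \<omega> (U N) (grad (U N)) x - fvec \<omega> ?e (grad ?e) x))\<^sup>2
        \<le> 2 * ((1 - cutoff N x)\<^sup>2 * ?F x) + 2 * C\<^sup>2 * (norm (grad (cutoff N) x))\<^sup>2" for N x
    proof -
      have "fvec \<omega> (U N) (grad (U N)) x - fvec \<omega> ?e (grad ?e) x
          = (cutoff N x - 1) *\<^sub>R fvec \<omega> ?e (grad ?e) x + (0, ?e x *\<^sub>R grad (cutoff N) x, 0)"
        unfolding fvec_def gU by (simp add: U_def algebra_simps)
      then have "(norm (fvec \<omega> (U N) (grad (U N)) x - fvec \<omega> ?e (grad ?e) x))\<^sup>2
          \<le> 2 * ((cutoff N x - 1)\<^sup>2 * ?F x) + 2 * ((?e x)\<^sup>2 * (norm (grad (cutoff N) x))\<^sup>2)"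
        using norm_add_sq_le [of "(cutoff N x - 1) *\<^sub>R fvec \<omega> ?e (grad ?e) x" "(0, ?e x *\<^sub>R grad (cutoff N) x, 0)"]
        by (simp add: norm_Pair power_mult_distrib)
      also have "(?e x)\<^sup>2 * (norm (grad (cutoff N) x))\<^sup>2 \<le> C\<^sup>2 * (norm (grad (cutoff N) x))\<^sup>2"
        using eC [of x] C(1) by (intro mult_right_mono) (simp_all add: abs_le_square_iff [symmetric])
      finally show ?thesis by (simp add: power2_commute [of 1])
    qed
    have "(\<lambda>N. \<integral>\<^sup>+ x. ennreal ((1 - cutoff N x)\<^sup>2 * ?F x) \<partial>lborel) \<longlonglongrightarrow> (\<integral>\<^sup>+ x. 0 \<partial>(lborel :: (real^2) measure))"
    proof (rule nn_integral_dominated_convergence [where w = "\<lambda>x. ennreal (?F x)"])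
      show "(\<integral>\<^sup>+ x. ennreal (?F x) \<partial>lborel) < \<infinity>"
        using integrable_fvec_ef [of \<omega> n \<sigma> m] by (simp add: integrable_norm_sq_iff)
      have "(1 - cutoff N x)\<^sup>2 * ?F x \<le> ?F x" for N x
        using cutoff_range [of N x] by (intro mult_left_le_one_le) (auto simp: power_le_one)
      then show "AE x in lborel. ennreal ((1 - cutoff N x)\<^sup>2 * ?F x) \<le> ennreal (?F x)" for N
        by (intro AE_I2 ennreal_leI)
      have "(\<lambda>N. ennreal ((1 - cutoff N x)\<^sup>2 * ?F x)) \<longlonglongrightarrow> ennreal ((1 - 1)\<^sup>2 * ?F x)" for x
        by (intro tendsto_ennrealI tendsto_intros cutoff_tendsto)
      then show "AE x in lborel. (\<lambda>N. ennreal ((1 - cutoff N x)\<^sup>2 * ?F x)) \<longlonglongrightarrow> 0" by simp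
    qed measurable
    then have "(\<lambda>N. 2 * (\<integral>\<^sup>+ x. ennreal ((1 - cutoff N x)\<^sup>2 * ?F x) \<partial>lborel)
        + ennreal (2 * C\<^sup>2) * (\<integral>\<^sup>+ x. ennreal ((norm (grad (cutoff N) x))\<^sup>2) \<partial>lborel)) \<longlonglongrightarrow> 2 * 0 + ennreal (2 * C\<^sup>2) * 0"
      by (intro tendsto_add ennreal_tendsto_cmult grad_cutoff_tendsto_0) auto
    then have lim: "(\<lambda>N. 2 * (\<integral>\<^sup>+ x. ennreal ((1 - cutoff N x)\<^sup>2 * ?F x) \<partial>lborel)
        + ennreal (2 * C\<^sup>2) * (\<integral>\<^sup>+ x. ennreal ((norm (grad (cutoff N) x))\<^sup>2) \<partial>lborel)) \<longlonglongrightarrow> 0"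
      by (simp only: mult_zero_right add_0)
    have bound: "(\<integral>\<^sup>+ x. ennreal ((norm (fvec \<omega> (U N) (grad (U N)) x - fvec \<omega> ?e (grad ?e) x))\<^sup>2) \<partial>lborel)
      \<le> 2 * (\<integral>\<^sup>+ x. ennreal ((1 - cutoff N x)\<^sup>2 * ?F x) \<partial>lborel)
        + ennreal (2 * C\<^sup>2) * (\<integral>\<^sup>+ x. ennreal ((norm (grad (cutoff N) x))\<^sup>2) \<partial>lborel)" for N
    proof -
      have "(\<integral>\<^sup>+ x. ennreal ((norm (fvec \<omega> (U N) (grad (U N)) x - fvec \<omega> ?e (grad ?e) x))\<^sup>2) \<partial>lborel)
        \<le> (\<integral>\<^sup>+ x. ennreal 2 * ennreal ((1 - cutoff N x)\<^sup>2 * ?F x)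
            + ennreal (2 * C\<^sup>2) * ennreal ((norm (grad (cutoff N) x))\<^sup>2) \<partial>lborel)"
        by (intro nn_integral_mono) (use le in \<open>simp add: ennreal_leI flip: ennreal_mult ennreal_plus ennreal_numeral\<close>)
      then show ?thesis by (simp add: nn_integral_add nn_integral_cmult)
    qed
    show "(\<lambda>N. \<integral>\<^sup>+ x. ennreal ((norm (fvec \<omega> (U N) (grad (U N)) x - fvec \<omega> ?e (grad ?e) x))\<^sup>2) \<partial>lborel)
        \<longlonglongrightarrow> 0"
      by (rule tendsto_sandwich [OF always_eventually always_eventually tendsto_const lim])
        (simp_all only: bound zero_le simp_thms)
  qed measurable
qed

subsection \<open>The weak eigenvalue equation\<close>

lemma inner_grad: "v \<bullet> grad f x = v $ 1 * pd 1 f x + v $ 2 * pd 2 f x"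
  by (simp add: inner_vec_def sum_2 grad_def)

text \<open>As \<open>U\<close> may be unbounded, the cutoff is attached to the partial derivatives
  of the eigenfunction, which then serve as test functions in the weak gradient of \<open>U\<close>.
  What remains is the integral of \<open>U\<close> times the product of the gradients of cutoff and
  eigenfunction; it tends to zero once \<open>U\<close> times the bound on the gradient of the
  eigenfunction is square integrable, which is what the exponents of \<open>pd_ef_le\<close>
  ensure.\<close>

lemma weak_eigen_equation:
  assumes w: "weak_gradient U V" and i: "integrable lborel (\<lambda>x. (norm (fvec \<omega> U V x))\<^sup>2)"
  shows "(\<integral>x. V x \<bullet> grad (ef \<omega> n \<sigma> m) x + \<omega>\<^sup>2 * (norm x)\<^sup>2 * conf x * (U x * ef \<omega> n \<sigma> m x) \<partial>lborel)
    = eigval \<omega> m n * (\<integral>x. conf x * (U x * ef \<omega> n \<sigma> m x) \<partial>lborel)" (is ?eq)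
    and "integrable lborel (\<lambda>x. V x \<bullet> grad (ef \<omega> n \<sigma> m) x + \<omega>\<^sup>2 * (norm x)\<^sup>2 * conf x * (U x * ef \<omega> n \<sigma> m x))"
    and "integrable lborel (\<lambda>x. conf x * (U x * ef \<omega> n \<sigma> m x))"
proof -
  let ?e = "ef \<omega> n \<sigma> m" and ?l = "eigval \<omega> m n"
  note [measurable] = weak_gradient_measurable [OF w]
  have ie: "integrable lborel (\<lambda>x. (norm (fvec \<omega> ?e (grad ?e) x))\<^sup>2)" by (rule integrable_fvec_ef)
  have i0: "integrable lborel (\<lambda>x. fvec \<omega> U V x \<bullet> fvec \<omega> ?e (grad ?e) x)"
    by (intro integrable_inner_L2 i ie) auto
  have cint: "integrable lborel (\<lambda>x. (sqrt (conf x) * u x)\<^sup>2)"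
    if "integrable lborel (\<lambda>x. (norm (fvec \<omega> u v x))\<^sup>2)" "u \<in> borel_measurable borel" for u v
  proof (rule Bochner_Integration.integrable_bound [OF that(1)])
    show "AE x in lborel. norm ((sqrt (conf x) * u x)\<^sup>2) \<le> norm ((norm (fvec \<omega> u v x))\<^sup>2)"
    proof (rule AE_I2)
      fix x
      have "(sqrt (conf x) * \<bar>u x\<bar>)\<^sup>2 \<le> (norm (fvec \<omega> u v x))\<^sup>2"
        using norm_fvec_ge(1) [of x u \<omega> v] conf_pos [of x] by (intro power_mono) auto
      then show "norm ((sqrt (conf x) * u x)\<^sup>2) \<le> norm ((norm (fvec \<omega> u v x))\<^sup>2)"
        by (simp add: power_mult_distrib)
    qed
  qed (use that(2) in measurable)
  have "integrable lborel (\<lambda>x. (sqrt (conf x) * U x) \<bullet> (sqrt (conf x) * ?e x))"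
    by (intro integrable_inner_L2) (use cint [OF i] cint [OF ie] in \<open>auto simp: power_mult_distrib\<close>)
  moreover have "(sqrt (conf x) * U x) \<bullet> (sqrt (conf x) * ?e x) = conf x * (U x * ?e x)" for x
    using real_sqrt_mult_self [of "conf x"] conf_pos [of x]
    by (metis abs_of_pos inner_real_def mult.assoc mult.left_commute)
  then have "(\<lambda>x. (sqrt (conf x) * U x) \<bullet> (sqrt (conf x) * ?e x)) = (\<lambda>x. conf x * (U x * ?e x))"
    by (rule ext)
  ultimately show i1: "integrable lborel (\<lambda>x. conf x * (U x * ?e x))" by (simp only:)
  from Bochner_Integration.integrable_diff [OF i0 i1]
  show i2: "integrable lborel (\<lambda>x. V x \<bullet> grad ?e x + \<omega>\<^sup>2 * (norm x)\<^sup>2 * conf x * (U x * ?e x))"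
    unfolding inner_fvec by simp
  define f where "f x = V x \<bullet> grad ?e x + \<omega>\<^sup>2 * (norm x)\<^sup>2 * conf x * (U x * ?e x) - ?l * (conf x * (U x * ?e x))" for x
  have fi: "integrable lborel f" unfolding f_def using i1 i2 by auto
  have lU: "locally_integrable U" "locally_integrable V" using w by (auto simp: weak_gradient_def)
  have eq: "(\<integral>x. cutoff N x * f x \<partial>lborel) = - (\<integral>x. U x * (grad (cutoff N) x \<bullet> grad ?e x) \<partial>lborel)" for N
  proof -
    have t: "test_function (\<lambda>x. pd j ?e x * cutoff N x)" for j
      by (intro test_function_cutoff smooth_pd smooth_ef)
    have ip: "integrable lborel (\<lambda>x. U x * \<phi> x)" "integrable lborel (\<lambda>x. V x $ j * \<phi> x)"
      if "smooth \<phi>" "bsupp \<phi>" for \<phi> j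
      using that lU by (auto intro!: locally_integrable_mult_bsupp smooth_imp_continuous locally_integrable_nth)
    note sm = smooth_pd smooth_ef smooth_cutoff smooth_mult bsupp_pd bsupp_cutoff bsupp_mult_left bsupp_mult_right
    have i3: "integrable lborel (\<lambda>x. U x * pd j (\<lambda>x. pd j ?e x * cutoff N x) x)"
      "integrable lborel (\<lambda>x. V x $ j * (pd j ?e x * cutoff N x))" for j
      by (intro ip sm)+
    have "(\<integral>x. U x * pd 1 (\<lambda>x. pd 1 ?e x * cutoff N x) x + U x * pd 2 (\<lambda>x. pd 2 ?e x * cutoff N x) x \<partial>lborel)
        = - (\<integral>x. V x $ 1 * (pd 1 ?e x * cutoff N x) + V x $ 2 * (pd 2 ?e x * cutoff N x) \<partial>lborel)"
      using weak_gradientD [OF w t, of 1 1] weak_gradientD [OF w t, of 2 2] i3 by simp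
    moreover have "U x * pd 1 (\<lambda>x. pd 1 ?e x * cutoff N x) x + U x * pd 2 (\<lambda>x. pd 2 ?e x * cutoff N x) x
        = U x * (grad (cutoff N) x \<bullet> grad ?e x)
          + cutoff N x * (\<omega>\<^sup>2 * (norm x)\<^sup>2 * conf x * (U x * ?e x) - ?l * (conf x * (U x * ?e x)))" for x
    proof -
      have "U x * pd 1 (\<lambda>x. pd 1 ?e x * cutoff N x) x + U x * pd 2 (\<lambda>x. pd 2 ?e x * cutoff N x) x
        = U x * (grad (cutoff N) x \<bullet> grad ?e x)
          + U x * cutoff N x * (pd 1 (pd 1 ?e) x + pd 2 (pd 2 ?e) x)"
        by (simp add: pd_mult sm inner_grad) (simp add: grad_def algebra_simps)
      then show ?thesis unfolding laplace_ef by (simp add: algebra_simps)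
    qed
    moreover have "integrable lborel (\<lambda>x. U x * (pd j (cutoff N) x * pd j ?e x))" for j
      by (intro ip sm)
    from Bochner_Integration.integrable_add [OF this [of 1] this [of 2]]
    have i4: "integrable lborel (\<lambda>x. U x * (grad (cutoff N) x \<bullet> grad ?e x))"
      unfolding inner_grad by (simp add: grad_def distrib_left)
    moreover have i5: "integrable lborel (\<lambda>x. cutoff N x * f x)"
    proof (rule Bochner_Integration.integrable_bound [OF fi])
      show "AE x in lborel. norm (cutoff N x * f x) \<le> norm (f x)"
        using cutoff_range [of N] by (intro AE_I2) (simp add: abs_mult mult_left_le_one_le)
      show "(\<lambda>x. cutoff N x * f x) \<in> borel_measurable lborel"
        using fi by (intro borel_measurable_times) auto
    qed
    have i6: "integrable lborel (\<lambda>x. V x $ 1 * (pd 1 ?e x * cutoff N x) + V x $ 2 * (pd 2 ?e x * cutoff N x))"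
      using i3 by auto
    have "cutoff N x * (\<omega>\<^sup>2 * (norm x)\<^sup>2 * conf x * (U x * ?e x) - ?l * (conf x * (U x * ?e x)))
        = cutoff N x * f x - (V x $ 1 * (pd 1 ?e x * cutoff N x) + V x $ 2 * (pd 2 ?e x * cutoff N x))" for x
      by (simp add: f_def inner_grad algebra_simps)
    ultimately show ?thesis using i4 i5 i6 by simp
  qed
  have "(\<lambda>N. \<integral>x. cutoff N x * f x \<partial>lborel) \<longlonglongrightarrow> integral\<^sup>L lborel f"
  proof (rule integral_dominated_convergence [where w = "\<lambda>x. norm (f x)"])
    show "AE x in lborel. (\<lambda>N. cutoff N x * f x) \<longlonglongrightarrow> f x"
      using tendsto_mult_right [OF cutoff_tendsto] by (intro AE_I2) fastforce
    show "AE x in lborel. norm (cutoff N x * f x) \<le> norm (f x)" for N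
      using cutoff_range [of N] by (intro AE_I2) (simp add: abs_mult mult_left_le_one_le)
    have [measurable]: "f \<in> borel_measurable lborel" using fi by auto
    show "(\<lambda>x. cutoff N x * f x) \<in> borel_measurable lborel" for N by measurable
  qed (use fi in auto)
  moreover have "(\<lambda>N. \<integral>x. U x * (grad (cutoff N) x \<bullet> grad ?e x) \<partial>lborel) \<longlonglongrightarrow> 0"
  proof -
    obtain D p where D: "D \<ge> 0" "p > 1 / 2" "\<omega> = 0 \<Longrightarrow> p \<ge> 1" "\<And>i x. \<bar>pd i ?e x\<bar> \<le> D * spow p x"
      using pd_ef_le [where \<omega> = \<omega> and n = n and \<sigma> = \<sigma> and m = m] by metis
    have Ui: "integrable lborel (\<lambda>x. (U x * (2 * D * spow p x))\<^sup>2)"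
    proof (rule Bochner_Integration.integrable_bound)
      \<comment> \<open>For \<omega> nonzero, 4 \<open>spow 1\<close> equals \<open>conf x\<close>
        plus the squared norm times \<open>conf x\<close>; the energy controls the second summand
        only after multiplication by \<omega>^2, hence the term 1 / \<omega>^2. For \<omega> = 0 the
        exponent p is at least 1 and \<open>conf x\<close> alone suffices.\<close>
      define K where "K = (if \<omega> = 0 then 1 else 1 + 1 / \<omega>\<^sup>2)"
      show "integrable lborel (\<lambda>x. D\<^sup>2 * K * (norm (fvec \<omega> U V x))\<^sup>2)" using i by simp
      have "(spow p x)\<^sup>2 * (U x)\<^sup>2 * 4 \<le> K * (norm (fvec \<omega> U V x))\<^sup>2" for x
      proof -
        have sq: "(spow p x)\<^sup>2 = spow (2 * p) x" by (simp add: power2_eq_square spow_add)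
        have nf: "(norm (fvec \<omega> U V x))\<^sup>2 \<ge> conf x * (U x)\<^sup>2 + \<omega>\<^sup>2 * ((norm x)\<^sup>2 * conf x * (U x)\<^sup>2)"
          unfolding norm_fvec by (simp add: mult.assoc)
        show ?thesis
        proof (cases "\<omega> = 0")
          case True
          have "(spow p x)\<^sup>2 * 4 \<le> conf x"
            unfolding sq conf_spow using D(3) [OF True] by (simp add: spow_antimono)
          then have "(spow p x)\<^sup>2 * 4 * (U x)\<^sup>2 \<le> conf x * (U x)\<^sup>2" by (rule mult_right_mono) simp
          then show ?thesis using nf True by (simp add: K_def algebra_simps)
        next
          case False
          have "spow (2 * p) x \<le> spow 1 x" using D(2) by (intro spow_antimono) simp
          also have "\<dots> = spow 2 x + (norm x)\<^sup>2 * spow 2 x"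
            using norm_sq_spow [of x 1] by simp
          finally have "(spow p x)\<^sup>2 * 4 \<le> conf x + (norm x)\<^sup>2 * conf x"
            unfolding sq conf_spow by simp
          then have "(spow p x)\<^sup>2 * 4 * (U x)\<^sup>2 \<le> (conf x + (norm x)\<^sup>2 * conf x) * (U x)\<^sup>2" by (rule mult_right_mono) simp
          also have "\<dots> \<le> K * (conf x * (U x)\<^sup>2 + \<omega>\<^sup>2 * ((norm x)\<^sup>2 * conf x * (U x)\<^sup>2))"
          proof -
            have "0 \<le> conf x * (U x)\<^sup>2 / \<omega>\<^sup>2" "0 \<le> \<omega>\<^sup>2 * ((norm x)\<^sup>2 * conf x * (U x)\<^sup>2)"
              using conf_pos [of x] by auto
            then show ?thesis using False by (simp add: K_def algebra_simps)
          qed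
          also have "\<dots> \<le> K * (norm (fvec \<omega> U V x))\<^sup>2"
            using nf by (intro mult_left_mono) (auto simp: K_def)
          finally show ?thesis by (simp add: algebra_simps)
        qed
      qed
      then have "D\<^sup>2 * ((spow p x)\<^sup>2 * (U x)\<^sup>2 * 4) \<le> D\<^sup>2 * (K * (norm (fvec \<omega> U V x))\<^sup>2)" for x
        by (intro mult_left_mono) auto
      then show "AE x in lborel. norm ((U x * (2 * D * spow p x))\<^sup>2) \<le> norm (D\<^sup>2 * K * (norm (fvec \<omega> U V x))\<^sup>2)"
        by (intro AE_I2) (simp add: power_mult_distrib mult_ac order_trans [OF _ abs_ge_self])
      have [measurable]: "spow p \<in> borel_measurable borel"
        by (intro borel_measurable_continuous_onI smooth_imp_continuous smooth_spow)
      show "(\<lambda>x. (U x * (2 * D * spow p x))\<^sup>2) \<in> borel_measurable lborel" by measurable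
    qed
    have [measurable]: "spow p \<in> borel_measurable borel"
      by (intro borel_measurable_continuous_onI smooth_imp_continuous smooth_spow)
    have z: "(\<lambda>N. \<integral>\<^sup>+ x. ennreal (\<bar>norm (grad (cutoff N) x)\<bar> * \<bar>U x * (2 * D * spow p x)\<bar>) \<partial>lborel) \<longlonglongrightarrow> 0"
      by (rule L2_imp_L1_mult [OF _ _ Ui]) (use grad_cutoff_tendsto_0 in auto)
    have "\<bar>U x * (grad (cutoff N) x \<bullet> grad ?e x)\<bar> \<le> \<bar>norm (grad (cutoff N) x)\<bar> * \<bar>U x * (2 * D * spow p x)\<bar>" for N x
    proof -
      have "norm (grad ?e x) \<le> \<bar>grad ?e x $ 1\<bar> + \<bar>grad ?e x $ 2\<bar>"
        using norm_le_l1_cart [of "grad ?e x"] by (simp add: sum_2)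
      also have "\<dots> \<le> 2 * D * spow p x" using D(4) [of 1 x] D(4) [of 2 x] by (simp add: grad_def)
      finally have "norm (grad ?e x) \<le> 2 * D * spow p x" .
      then have "\<bar>grad (cutoff N) x \<bullet> grad ?e x\<bar> \<le> norm (grad (cutoff N) x) * (2 * D * spow p x)"
        by (rule order_trans [OF Cauchy_Schwarz_ineq2 mult_left_mono [OF _ norm_ge_zero]])
      then have "\<bar>U x\<bar> * \<bar>grad (cutoff N) x \<bullet> grad ?e x\<bar> \<le> \<bar>U x\<bar> * (norm (grad (cutoff N) x) * (2 * D * spow p x))"
        by (intro mult_left_mono) auto
      then show ?thesis using D(1) spow_pos [of p x] by (simp add: abs_mult mult_ac)
    qed
    then have bound: "(\<integral>\<^sup>+ x. ennreal (norm (U x * (grad (cutoff N) x \<bullet> grad ?e x))) \<partial>lborel)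
        \<le> (\<integral>\<^sup>+ x. ennreal (\<bar>norm (grad (cutoff N) x)\<bar> * \<bar>U x * (2 * D * spow p x)\<bar>) \<partial>lborel)" for N
      by (intro nn_integral_mono ennreal_leI) (simp only: real_norm_def)
    have "ennreal (norm (\<integral>x. U x * (grad (cutoff N) x \<bullet> grad ?e x) \<partial>lborel))
        \<le> (\<integral>\<^sup>+ x. ennreal (norm (U x * (grad (cutoff N) x \<bullet> grad ?e x))) \<partial>lborel)" for N
    proof (cases "integrable lborel (\<lambda>x. U x * (grad (cutoff N) x \<bullet> grad ?e x))")
      case True
      then show ?thesis by (rule integral_norm_bound_ennreal)
    next
      case False
      from not_integrable_integral_eq [OF this] show ?thesis by simp
    qed
    from order_trans [OF this bound]
    have le: "ennreal (norm (\<integral>x. U x * (grad (cutoff N) x \<bullet> grad ?e x) \<partial>lborel))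
        \<le> (\<integral>\<^sup>+ x. ennreal (\<bar>norm (grad (cutoff N) x)\<bar> * \<bar>U x * (2 * D * spow p x)\<bar>) \<partial>lborel)" for N .
    have "(\<lambda>N. ennreal (norm (\<integral>x. U x * (grad (cutoff N) x \<bullet> grad ?e x) \<partial>lborel))) \<longlonglongrightarrow> 0"
      by (rule tendsto_sandwich [OF always_eventually always_eventually tendsto_const z])
        (simp_all only: le zero_le simp_thms)
    then have "(\<lambda>N. ennreal (norm (\<integral>x. U x * (grad (cutoff N) x \<bullet> grad ?e x) \<partial>lborel))) \<longlonglongrightarrow> ennreal 0"
      by (simp only: ennreal_0)
    then have "(\<lambda>N. norm (\<integral>x. U x * (grad (cutoff N) x \<bullet> grad ?e x) \<partial>lborel)) \<longlonglongrightarrow> 0"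
      by (subst (asm) tendsto_ennreal_iff) auto
    then show ?thesis by (rule tendsto_norm_zero_cancel)
  qed
  ultimately have "integral\<^sup>L lborel f = - 0"
    unfolding eq by (intro LIMSEQ_unique [OF _ tendsto_minus]) auto
  then show ?eq unfolding f_def using i1 i2 by simp
qed

section \<open>The form on the sphere in the first chart\<close>

lemma space_dV [simp]: "space dV = S2" and sets_dV: "sets dV = sets (restrict_space borel S2)"
  by (simp_all add: dV_def space_restrict_space)

lemma unstereo_measurable_borel [measurable]: "unstereo \<in> borel \<rightarrow>\<^sub>M dV"
proof -
  have "unstereo \<in> borel \<rightarrow>\<^sub>M restrict_space borel S2"
    using unstereo_measurable by (simp add: measurable_def)
  then show ?thesis by (simp add: measurable_def sets_dV space_restrict_space)
qed

lemma stereo_measurable [measurable]: "stereo \<in> dV \<rightarrow>\<^sub>M borel"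
proof -
  have "fst \<in> borel_measurable (borel :: point3 measure)" "snd \<in> borel_measurable (borel :: point3 measure)"
    by (intro borel_measurable_continuous_onI continuous_on_fst continuous_on_snd continuous_on_id)+
  then have "stereo \<in> borel_measurable borel"
    unfolding stereo_def [abs_def] by measurable
  then have "stereo \<in> restrict_space borel S2 \<rightarrow>\<^sub>M borel" by (rule measurable_restrict_space1)
  then show ?thesis by (simp add: measurable_def sets_dV space_restrict_space)
qed

text \<open>A distribution depends on its target only through space and measurable sets, so the
  target may be called \<open>dV\<close>; functions known to be measurable for \<open>dV\<close> can
  then be substituted directly.\<close>

lemma dV_distr: "dV = distr (density lborel (\<lambda>x. ennreal (conf x))) dV unstereo"
  unfolding dV_def by (rule distr_cong) simp_all

lemma integrable_dV_iff:
  fixes g :: "point3 \<Rightarrow> real"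
  assumes [measurable]: "g \<in> borel_measurable dV"
  shows "integrable dV g \<longleftrightarrow> integrable lborel (\<lambda>x. conf x * g (unstereo x))"
proof -
  have "integrable dV g \<longleftrightarrow> integrable (density lborel (\<lambda>x. ennreal (conf x))) (\<lambda>x. g (unstereo x))"
    by (subst dV_distr, subst integrable_distr_eq) auto
  also have "\<dots> \<longleftrightarrow> integrable lborel (\<lambda>x. conf x *\<^sub>R g (unstereo x))"
    by (subst integrable_density) (auto simp: conf_pos less_imp_le)
  finally show ?thesis by simp
qed

lemma integral_dV:
  fixes g :: "point3 \<Rightarrow> real"
  assumes [measurable]: "g \<in> borel_measurable dV"
  shows "integral\<^sup>L dV g = (\<integral>x. conf x * g (unstereo x) \<partial>lborel)"
proof -
  have "integral\<^sup>L dV g = (\<integral>x. g (unstereo x) \<partial>density lborel (\<lambda>x. ennreal (conf x)))"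
    by (subst dV_distr, subst integral_distr) auto
  also have "\<dots> = (\<integral>x. conf x *\<^sub>R g (unstereo x) \<partial>lborel)"
    by (subst integral_density) (auto simp: conf_pos less_imp_le)
  finally show ?thesis by simp
qed

lemma AE_dV_iff:
  fixes u v :: "point3 \<Rightarrow> real"
  assumes [measurable]: "u \<in> borel_measurable dV" "v \<in> borel_measurable dV"
  shows "(AE p in dV. u p = v p) \<longleftrightarrow> (AE x in lborel. u (unstereo x) = v (unstereo x))"
proof -
  have "{p \<in> space dV. u p = v p} \<in> sets dV" by measurable
  then have "(AE p in dV. u p = v p) \<longleftrightarrow>
      (AE x in density lborel (\<lambda>x. ennreal (conf x)). u (unstereo x) = v (unstereo x))"
    by (subst dV_distr, subst AE_distr_iff) auto
  then show ?thesis by (simp add: AE_density conf_pos)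
qed

subsection \<open>Representatives\<close>

lemma l2_eq_rep: "l2_eq (rep_L2_S2 f) (rep_L2_S2 f)"
  using Quotient_rep_reflp [OF Quotient_L2_S2] .

lemma abs_rep_L2_S2: "abs_L2_S2 (rep_L2_S2 f) = f"
  using Quotient_abs_rep [OF Quotient_L2_S2] .

lemma rep_abs_L2_S2: "l2_eq u u \<Longrightarrow> l2_eq (rep_L2_S2 (abs_L2_S2 u)) u"
  using Quotient_rep_abs [OF Quotient_L2_S2] .

text \<open>Representatives are chosen arbitrarily, so this map is linear only almost everywhere.
  This is why identities between charts of classes carry an AE quantifier.\<close>

definition chart :: "L2_S2 \<Rightarrow> real^2 \<Rightarrow> real" where
  "chart f = rep_L2_S2 f \<circ> unstereo"

lemma rep_measurable [measurable]: "rep_L2_S2 f \<in> borel_measurable dV"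
  using l2_eq_rep [of f] by (simp add: l2_eq_def sq_integrable_def)

lemma chart_measurable [measurable]: "chart f \<in> borel_measurable borel"
  unfolding chart_def o_def by measurable

lemma integrable_chart_sq: "integrable lborel (\<lambda>x. conf x * (chart f x)\<^sup>2)"
proof -
  have "integrable dV (\<lambda>p. (rep_L2_S2 f p)\<^sup>2)"
    using l2_eq_rep [of f] by (simp add: l2_eq_def sq_integrable_def)
  then show ?thesis by (subst (asm) integrable_dV_iff) (auto simp: chart_def)
qed

lemma inner_chart: "f \<bullet> g = (\<integral>x. conf x * (chart f x * chart g x) \<partial>lborel)"
proof -
  have "f \<bullet> g = (\<integral>p. rep_L2_S2 f p * rep_L2_S2 g p \<partial>dV)"
    by (simp add: inner_L2_S2.rep_eq)
  then show ?thesis by (subst (asm) integral_dV) (auto simp: chart_def)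
qed

lemma norm_chart: "(norm f)\<^sup>2 = (\<integral>x. conf x * (chart f x)\<^sup>2 \<partial>lborel)"
  unfolding power2_norm_eq_inner inner_chart by (simp add: power2_eq_square)

lemma chart_lincomb: "AE x in lborel. chart (a *\<^sub>R f + b *\<^sub>R g) x = a * chart f x + b * chart g x"
proof -
  have sc: "a *\<^sub>R f = abs_L2_S2 (\<lambda>p. a * rep_L2_S2 f p)"
      "l2_eq (\<lambda>p. a * rep_L2_S2 f p) (\<lambda>p. a * rep_L2_S2 f p)" for a f
    using scaleR_L2_S2.abs_eq [OF l2_eq_rep, of a f] l2_eq_rep [of f]
    by (simp_all add: abs_rep_L2_S2 l2_eq_refl_iff sq_integrable_scale)
  have "a *\<^sub>R f + b *\<^sub>R g = abs_L2_S2 (\<lambda>p. a * rep_L2_S2 f p + b * rep_L2_S2 g p)"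
    unfolding sc(1) by (rule plus_L2_S2.abs_eq [OF sc(2) sc(2)])
  moreover have "l2_eq (\<lambda>p. a * rep_L2_S2 f p + b * rep_L2_S2 g p) (\<lambda>p. a * rep_L2_S2 f p + b * rep_L2_S2 g p)"
    using l2_eq_rep by (simp add: l2_eq_refl_iff sq_integrable_add sq_integrable_scale)
  ultimately have "AE p in dV. rep_L2_S2 (a *\<^sub>R f + b *\<^sub>R g) p = a * rep_L2_S2 f p + b * rep_L2_S2 g p"
    using rep_abs_L2_S2 by (simp add: l2_eq_def)
  then show ?thesis by (subst (asm) AE_dV_iff) (auto simp: chart_def)
qed

text \<open>The inverse of \<open>chart\<close> up to null sets; at the pole, where
  \<open>stereo\<close> divides by zero, the value is arbitrary.\<close>

definition cls :: "(real^2 \<Rightarrow> real) \<Rightarrow> L2_S2" where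
  "cls U = abs_L2_S2 (U \<circ> stereo)"

lemma chart_cls:
  assumes [measurable]: "U \<in> borel_measurable borel" and "integrable lborel (\<lambda>x. conf x * (U x)\<^sup>2)"
  shows "AE x in lborel. chart (cls U) x = U x"
proof -
  have m [measurable]: "U \<circ> stereo \<in> borel_measurable dV" unfolding o_def by measurable
  have "integrable dV (\<lambda>p. ((U \<circ> stereo) p)\<^sup>2)"
    by (subst integrable_dV_iff) (use assms in \<open>auto simp: stereo_unstereo\<close>)
  then have "l2_eq (U \<circ> stereo) (U \<circ> stereo)" using m by (simp add: l2_eq_refl_iff sq_integrable_def)
  from rep_abs_L2_S2 [OF this] have "AE p in dV. rep_L2_S2 (cls U) p = (U \<circ> stereo) p"
    by (simp add: l2_eq_def cls_def)
  then show ?thesis by (subst (asm) AE_dV_iff) (auto simp: chart_def stereo_unstereo)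
qed

lemma L2_S2_eqI: "AE x in lborel. chart f x = chart g x \<Longrightarrow> f = g"
proof -
  assume ae: "AE x in lborel. chart f x = chart g x"
  have "AE x in lborel. conf x * (chart (f - g) x)\<^sup>2 = 0"
    using ae chart_lincomb [of 1 f "-1" g] by eventually_elim simp
  then have "(norm (f - g))\<^sup>2 = 0"
    unfolding norm_chart by (subst integral_cong_AE [where g = "\<lambda>_. 0"]) auto
  then show "f = g" by simp
qed

text \<open>Multiplication by \<open>sqrt (conf x)\<close> identifies the space with the
  square-integrable functions on the plane, for which \<open>riesz_fischer_L2\<close> gives
  limits.\<close>

instance L2_S2 :: complete_space
proof
  fix X :: "nat \<Rightarrow> L2_S2" assume X: "Cauchy X"
  define f where "f n x = sqrt (conf x) * chart (X n) x" for n x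
  have [measurable]: "f n \<in> borel_measurable lborel" for n unfolding f_def by measurable
  have nf: "(\<integral>\<^sup>+ x. ennreal ((sqrt (conf x) * u x)\<^sup>2) \<partial>lborel) = ennreal ((norm h)\<^sup>2)"
    if "AE x in lborel. chart h x = u x" "u \<in> borel_measurable borel" for h u
  proof -
    have "(\<integral>\<^sup>+ x. ennreal ((sqrt (conf x) * u x)\<^sup>2) \<partial>lborel) = (\<integral>\<^sup>+ x. ennreal (conf x * (chart h x)\<^sup>2) \<partial>lborel)"
      by (rule nn_integral_cong_AE, use that(1) in eventually_elim)
        (simp add: power_mult_distrib less_imp_le conf_pos)
    then show ?thesis
      by (simp add: norm_chart nn_integral_eq_integral [OF integrable_chart_sq] less_imp_le conf_pos)
  qed
  have ae: "AE x in lborel. chart (X m - X n) x = chart (X m) x - chart (X n) x" for m n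
    using chart_lincomb [of 1 "X m" "-1" "X n"] by simp
  obtain g r where g: "g \<in> borel_measurable lborel"
    "(\<lambda>n. \<integral>\<^sup>+ x. ennreal ((norm (f n x - g x))\<^sup>2) \<partial>lborel) \<longlonglongrightarrow> 0"
  proof (rule riesz_fischer_L2 [of f lborel])
    fix \<epsilon> :: real assume "\<epsilon> > 0"
    then obtain N where N: "\<And>m n. m \<ge> N \<Longrightarrow> n \<ge> N \<Longrightarrow> dist (X m) (X n) < sqrt \<epsilon>"
      using X unfolding Cauchy_def by (metis real_sqrt_gt_zero)
    have "(\<integral>\<^sup>+ x. ennreal ((norm (f m x - f n x))\<^sup>2) \<partial>lborel) \<le> ennreal \<epsilon>" if "m \<ge> N" "n \<ge> N" for m n
    proof -
      have "(\<integral>\<^sup>+ x. ennreal ((norm (f m x - f n x))\<^sup>2) \<partial>lborel) = ennreal ((norm (X m - X n))\<^sup>2)"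
        using nf [OF ae [of m n]] by (simp add: f_def right_diff_distrib)
      moreover have "norm (X m - X n) < sqrt \<epsilon>" using N [OF that] by (simp add: dist_norm)
      then have "(norm (X m - X n))\<^sup>2 \<le> (sqrt \<epsilon>)\<^sup>2" by (intro power_mono) auto
      ultimately show ?thesis using \<open>\<epsilon> > 0\<close> by (simp add: ennreal_leI)
    qed
    then show "\<exists>N. \<forall>m\<ge>N. \<forall>n\<ge>N. (\<integral>\<^sup>+ x. ennreal ((norm (f m x - f n x))\<^sup>2) \<partial>lborel) \<le> ennreal \<epsilon>"
      by blast
  qed auto
  have gm [measurable]: "g \<in> borel_measurable borel" using g(1) by simp
  define u where "u x = g x / sqrt (conf x)" for x
  have um [measurable]: "u \<in> borel_measurable borel" unfolding u_def by measurable
  have gu: "g x = sqrt (conf x) * u x" for x using conf_pos [of x] by (simp add: u_def)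
  have "integrable lborel (\<lambda>x. (norm (f n x))\<^sup>2)" for n
    using integrable_chart_sq [of "X n"] conf_pos
    by (simp add: f_def power_mult_distrib less_imp_le)
  then have "integrable lborel (\<lambda>x. (norm (g x))\<^sup>2)"
    by (intro integrable_L2_limit [OF _ _ _ g(2)]) auto
  then have "integrable lborel (\<lambda>x. conf x * (u x)\<^sup>2)"
    unfolding gu using conf_pos by (simp add: power_mult_distrib less_imp_le)
  then have cu: "AE x in lborel. chart (cls u) x = u x" by (rule chart_cls [OF um])
  have "ennreal ((norm (X n - cls u))\<^sup>2) = (\<integral>\<^sup>+ x. ennreal ((norm (f n x - g x))\<^sup>2) \<partial>lborel)" for n
  proof -
    have "AE x in lborel. chart (X n - cls u) x = chart (X n) x - u x"
      using chart_lincomb [of 1 "X n" "-1" "cls u"] cu by eventually_elim simp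
    from nf [OF this] show ?thesis by (simp add: f_def gu right_diff_distrib)
  qed
  then have "(\<lambda>n. ennreal ((norm (X n - cls u))\<^sup>2)) \<longlonglongrightarrow> ennreal 0"
    using g(2) by (simp only: ennreal_0)
  then have "(\<lambda>n. (norm (X n - cls u))\<^sup>2) \<longlonglongrightarrow> 0"
    by (rule tendsto_ennreal_iff [THEN iffD1, rotated -1]) simp_all
  then have "(\<lambda>n. norm (X n - cls u)) \<longlonglongrightarrow> 0"
    using tendsto_real_sqrt [of "\<lambda>n. (norm (X n - cls u))\<^sup>2" 0] by simp
  then have "(\<lambda>n. X n - cls u) \<longlonglongrightarrow> 0" by (rule tendsto_norm_zero_cancel)
  then show "convergent X" by (rule convergentI [OF LIM_zero_cancel])
qed

subsection \<open>The form domain\<close>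

lemma unstereo'_inversion: "x \<noteq> 0 \<Longrightarrow> unstereo' x = unstereo (inversion x)"
proof -
  assume "x \<noteq> 0"
  then have p: "(norm x)\<^sup>2 > 0" by simp
  have n: "(norm (inversion x))\<^sup>2 = 1 / (norm x)\<^sup>2" by (simp add: norm_inversion power_divide)
  have "2 / (1 + 1 / r) * (1 / r) = 2 / (1 + r)" "(1 / r - 1) / (1 + 1 / r) = (1 - r) / (1 + r)" if "r > 0" for r :: real
  proof -
    have "1 / r - 1 = (1 - r) / r" "1 + 1 / r = (1 + r) / r" using that by (simp_all add: field_simps)
    then show "2 / (1 + 1 / r) * (1 / r) = 2 / (1 + r)" "(1 / r - 1) / (1 + 1 / r) = (1 - r) / (1 + r)"
      using that by simp_all
  qed
  from this [OF p] show ?thesis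
    unfolding unstereo_def unstereo'_def n by (simp add: inversion_def)
qed

lemma unstereo'_measurable [measurable]: "unstereo' \<in> borel \<rightarrow>\<^sub>M dV"
proof -
  have "(\<lambda>x. if x = 0 then unstereo' 0 else unstereo (inversion x)) \<in> borel \<rightarrow>\<^sub>M dV"
  proof (rule measurable_If)
    have "unstereo' 0 \<in> space dV" by (simp add: S2_def unstereo'_def)
    then show "(\<lambda>x. unstereo' 0) \<in> borel \<rightarrow>\<^sub>M dV" by simp
    show "(\<lambda>x. unstereo (inversion x)) \<in> borel \<rightarrow>\<^sub>M dV" by measurable
  qed simp
  moreover have "(\<lambda>x. if x = 0 then unstereo' 0 else unstereo (inversion x)) = unstereo'"
    by (auto simp: fun_eq_iff unstereo'_inversion)
  ultimately show ?thesis by simp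
qed

text \<open>At the origin the two functions are evaluated at opposite poles; elsewhere they
  coincide.\<close>

lemma weak_gradient_unstereo':
  "weak_gradient (rep_L2_S2 f \<circ> unstereo') v \<longleftrightarrow> weak_gradient (chart f \<circ> inversion) v"
proof -
  have "AE x in lborel. (rep_L2_S2 f \<circ> unstereo') x = (chart f \<circ> inversion) x"
    using AE_lborel_singleton [of "0 :: real^2"]
    by eventually_elim (simp add: chart_def unstereo'_inversion)
  moreover from this have "AE x in lborel. (chart f \<circ> inversion) x = (rep_L2_S2 f \<circ> unstereo') x"
    by eventually_elim simp
  moreover have "rep_L2_S2 f \<circ> unstereo' \<in> borel_measurable borel" "chart f \<circ> inversion \<in> borel_measurable borel"
    unfolding o_def by measurable
  ultimately show ?thesis using weak_gradient_cong_AE by blast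
qed

definition wgrad :: "L2_S2 \<Rightarrow> real^2 \<Rightarrow> real^2" where
  "wgrad f = (SOME v. weak_gradient (chart f) v)"

lemma energy_density_unstereo:
  "conf x * energy_density \<omega> (rep_L2_S2 f) (rep_L2_S2 g) (unstereo x) =
    wgrad f x \<bullet> wgrad g x + \<omega>\<^sup>2 * (norm x)\<^sup>2 * conf x * (chart f x * chart g x)"
  using conf_pos [of x]
  by (simp add: energy_density_def differential_def wgrad_def stereo_unstereo chart_def
      distrib_left less_imp_neq [symmetric])

lemma energy_density_measurable:
  assumes "weak_gradient (chart f) (wgrad f)" "weak_gradient (chart g) (wgrad g)"
  shows "energy_density \<omega> (rep_L2_S2 f) (rep_L2_S2 g) \<in> borel_measurable dV"
proof -
  note [measurable] = weak_gradient_measurable(2) [OF assms(1)] weak_gradient_measurable(2) [OF assms(2)]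
  show ?thesis
    unfolding energy_density_def [abs_def] differential_def wgrad_def [unfolded chart_def, symmetric]
    by measurable
qed

lemma wgrad_weak_gradient: "weak_gradient (chart f) V \<Longrightarrow> weak_gradient (chart f) (wgrad f)"
  unfolding wgrad_def by (rule someI [of "weak_gradient (chart f)"])

text \<open>The energy density is built on some chosen weak gradient. By uniqueness almost
  everywhere any weak gradient may be used in its place, and square integrability of
  \<open>f\<close> allows its density to be added to that of the form.\<close>

lemma form_domain_iff: "f \<in> form_domain \<omega> \<longleftrightarrow>
    (\<exists>V. weak_gradient (chart f) V \<and> integrable lborel (\<lambda>x. (norm (fvec \<omega> (chart f) V x))\<^sup>2)) \<and>
    (\<exists>V. weak_gradient (chart f \<circ> inversion) V)"
proof -
  have *: "integrable dV (energy_density \<omega> (rep_L2_S2 f) (rep_L2_S2 f)) \<longleftrightarrow>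
      integrable lborel (\<lambda>x. (norm (fvec \<omega> (chart f) V x))\<^sup>2)" if V: "weak_gradient (chart f) V" for V
  proof -
    note w = wgrad_weak_gradient [OF V]
    note [measurable] = weak_gradient_measurable(2) [OF V] weak_gradient_measurable(2) [OF w]
    have "integrable dV (energy_density \<omega> (rep_L2_S2 f) (rep_L2_S2 f)) \<longleftrightarrow>
        integrable lborel (\<lambda>x. wgrad f x \<bullet> wgrad f x + \<omega>\<^sup>2 * (norm x)\<^sup>2 * conf x * (chart f x * chart f x))"
      by (subst integrable_dV_iff [OF energy_density_measurable [OF w w]]) (simp only: energy_density_unstereo)
    also have "\<dots> \<longleftrightarrow> integrable lborel (\<lambda>x. (norm (V x))\<^sup>2 + \<omega>\<^sup>2 * (norm x)\<^sup>2 * conf x * (chart f x)\<^sup>2)"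
    proof (rule integrable_cong_AE)
      show "AE x in lborel. wgrad f x \<bullet> wgrad f x + \<omega>\<^sup>2 * (norm x)\<^sup>2 * conf x * (chart f x * chart f x)
          = (norm (V x))\<^sup>2 + \<omega>\<^sup>2 * (norm x)\<^sup>2 * conf x * (chart f x)\<^sup>2"
        using weak_gradient_unique [OF w V]
        by eventually_elim (simp add: power2_norm_eq_inner, simp add: power2_eq_square)
    qed measurable
    also have "\<dots> \<longleftrightarrow> integrable lborel (\<lambda>x. (norm (fvec \<omega> (chart f) V x))\<^sup>2)"
      unfolding norm_fvec
    proof
      assume "integrable lborel (\<lambda>x. (norm (V x))\<^sup>2 + \<omega>\<^sup>2 * (norm x)\<^sup>2 * conf x * (chart f x)\<^sup>2)"
      from Bochner_Integration.integrable_add [OF integrable_chart_sq [of f] this]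
      show "integrable lborel (\<lambda>x. conf x * (chart f x)\<^sup>2
          + ((norm (V x))\<^sup>2 + \<omega>\<^sup>2 * (norm x)\<^sup>2 * conf x * (chart f x)\<^sup>2))" .
    next
      assume "integrable lborel (\<lambda>x. conf x * (chart f x)\<^sup>2
          + ((norm (V x))\<^sup>2 + \<omega>\<^sup>2 * (norm x)\<^sup>2 * conf x * (chart f x)\<^sup>2))"
      from Bochner_Integration.integrable_diff [OF this integrable_chart_sq [of f]]
      show "integrable lborel (\<lambda>x. (norm (V x))\<^sup>2 + \<omega>\<^sup>2 * (norm x)\<^sup>2 * conf x * (chart f x)\<^sup>2)"
        by (simp only: add_diff_cancel_left')
    qed
    finally show ?thesis .
  qed
  show ?thesis
    unfolding form_domain_def weakly_differentiable_def mem_Collect_eq weak_gradient_unstereo'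
      chart_def [symmetric]
    using * by blast
qed

lemma form_Q_eq:
  assumes f: "weak_gradient (chart f) V" and g: "weak_gradient (chart g) W"
  shows "form_Q \<omega> f g = (\<integral>x. V x \<bullet> W x + \<omega>\<^sup>2 * (norm x)\<^sup>2 * conf x * (chart f x * chart g x) \<partial>lborel)"
proof -
  note wf = wgrad_weak_gradient [OF f] and wg = wgrad_weak_gradient [OF g]
  note [measurable] = weak_gradient_measurable(2) [OF f] weak_gradient_measurable(2) [OF wf]
    weak_gradient_measurable(2) [OF g] weak_gradient_measurable(2) [OF wg]
  have "form_Q \<omega> f g = (\<integral>x. wgrad f x \<bullet> wgrad g x + \<omega>\<^sup>2 * (norm x)\<^sup>2 * conf x * (chart f x * chart g x) \<partial>lborel)"
    unfolding form_Q_def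
    by (subst integral_dV [OF energy_density_measurable [OF wf wg]]) (simp only: energy_density_unstereo)
  also have "\<dots> = (\<integral>x. V x \<bullet> W x + \<omega>\<^sup>2 * (norm x)\<^sup>2 * conf x * (chart f x * chart g x) \<partial>lborel)"
  proof (rule integral_cong_AE)
    show "AE x in lborel. wgrad f x \<bullet> wgrad g x + \<omega>\<^sup>2 * (norm x)\<^sup>2 * conf x * (chart f x * chart g x)
        = V x \<bullet> W x + \<omega>\<^sup>2 * (norm x)\<^sup>2 * conf x * (chart f x * chart g x)"
      using weak_gradient_unique [OF wf f] weak_gradient_unique [OF wg g] by eventually_elim simp
  qed measurable
  finally show ?thesis .
qed

section \<open>Orthogonality of the eigenfunctions\<close>

definition rot :: "real \<Rightarrow> real^2 \<Rightarrow> real^2" where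
  "rot \<alpha> x = vector [cos \<alpha> * x $ 1 - sin \<alpha> * x $ 2, sin \<alpha> * x $ 1 + cos \<alpha> * x $ 2]"

lemma rot_nth: "rot \<alpha> x $ 1 = cos \<alpha> * x $ 1 - sin \<alpha> * x $ 2"
  "rot \<alpha> x $ 2 = sin \<alpha> * x $ 1 + cos \<alpha> * x $ 2"
  by (simp_all add: rot_def vector_2)

lemma Complex_rot: "Complex (rot \<alpha> x $ 1) (rot \<alpha> x $ 2) = cis \<alpha> * Complex (x $ 1) (x $ 2)"
  by (simp add: rot_nth complex_eq_iff)

lemma norm_rot: "norm (rot \<alpha> x) = norm x"
  unfolding cmod_coords [symmetric] Complex_rot by (simp add: norm_mult)

lemma linear_rot: "linear (rot \<alpha>)"
  by (rule linearI) (simp_all add: vec_eq_iff forall_2 rot_nth algebra_simps)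

lemma det_rot: "\<bar>det (matrix (rot \<alpha>))\<bar> = 1"
proof -
  have "det (matrix (rot \<alpha>)) = (cos \<alpha>)\<^sup>2 + (sin \<alpha>)\<^sup>2"
    by (simp add: det_2 matrix_def rot_nth axis_def power2_eq_square)
  then show ?thesis by simp
qed

lemma inj_rot: "inj (rot \<alpha>)"
  using norm_rot [of \<alpha>] by (simp add: linear_injective_0 [OF linear_rot]) (metis norm_eq_zero)

text \<open>The rotation by \<open>pi / k\<close> changes the sign of \<open>z ^ k\<close>.\<close>

lemma integral_harm_radial_eq_0:
  assumes k: "k > 0" and [measurable]: "K \<in> borel_measurable borel"
    and i: "integrable lborel (\<lambda>x. harmp k \<sigma> x * K ((norm x)\<^sup>2))"
  shows "(\<integral>x. harmp k \<sigma> x * K ((norm x)\<^sup>2) \<partial>lborel) = 0"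
proof -
  let ?T = "rot (pi / real k)"
  have "cis (pi / real k) ^ k = cis (real k * (pi / real k))" by (rule Complex.DeMoivre)
  then have "cis (pi / real k) ^ k = - 1" using k by simp
  then have "harmp k \<sigma> (?T x) = - harmp k \<sigma> x" for x
    by (simp add: harmp_def Complex_rot power_mult_distrib)
  then have "(\<integral>x. harmp k \<sigma> (?T x) * K ((norm (?T x))\<^sup>2) \<partial>lborel) = - (\<integral>x. harmp k \<sigma> x * K ((norm x)\<^sup>2) \<partial>lborel)"
    by (simp add: norm_rot)
  moreover have "(\<integral>x. harmp k \<sigma> (?T x) * K ((norm (?T x))\<^sup>2) \<partial>lborel) = (\<integral>x. harmp k \<sigma> x * K ((norm x)\<^sup>2) \<partial>lborel)"
    by (rule integral_linear_isometry [OF linear_rot inj_rot det_rot, where f = "\<lambda>x. harmp k \<sigma> x * K ((norm x)\<^sup>2)"])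
      (use i in auto)
  ultimately show ?thesis by simp
qed

text \<open>The product-to-sum formulas: products of real and imaginary parts of a and b are
  combinations of the parts of a b and of a times the conjugate of b, and z^n times the conjugate of
  z^n' is |z|^(2 n') z^(n - n').\<close>

lemma harm_mult_harm:
  assumes "n' \<le> n"
  obtains s t where "\<And>x. harmp n \<sigma> x * harmp n' \<sigma>' x =
    s * harmp (n + n') (\<sigma> \<noteq> \<sigma>') x + t * (((norm x)\<^sup>2) ^ n' * harmp (n - n') (\<sigma> \<noteq> \<sigma>') x)"
proof -
  have c: "z ^ n * cnj z ^ n' = of_real ((cmod z)\<^sup>2 ^ n') * z ^ (n - n')" for z :: complex
  proof -
    have "z ^ n = z ^ (n - n') * z ^ n'" using assms by (simp flip: power_add)
    moreover have "z ^ n' * cnj z ^ n' = of_real ((cmod z)\<^sup>2 ^ n')"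
      unfolding power_mult_distrib [symmetric] complex_norm_square [symmetric] by simp
    ultimately show ?thesis by (metis mult.assoc mult.commute)
  qed
  have id: "Re a * Re b = 1/2 * Re (a * b) + 1/2 * Re (a * cnj b)"
    "Im a * Im b = - 1/2 * Re (a * b) + 1/2 * Re (a * cnj b)"
    "Re a * Im b = 1/2 * Im (a * b) + - 1/2 * Im (a * cnj b)"
    "Im a * Re b = 1/2 * Im (a * b) + 1/2 * Im (a * cnj b)" for a b
    by (simp_all add: field_simps)
  define s :: real where "s = (if \<sigma> \<and> \<sigma>' then - 1/2 else 1/2)"
  define t :: real where "t = (if \<not> \<sigma> \<and> \<sigma>' then - 1/2 else 1/2)"
  have "harmp n \<sigma> x * harmp n' \<sigma>' x =
    s * harmp (n + n') (\<sigma> \<noteq> \<sigma>') x + t * (((norm x)\<^sup>2) ^ n' * harmp (n - n') (\<sigma> \<noteq> \<sigma>') x)" for x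
  proof -
    let ?z = "Complex (x $ 1) (x $ 2)"
    have 1: "Re (?z ^ n * cnj (?z ^ n')) = ((norm x)\<^sup>2) ^ n' * Re (?z ^ (n - n'))"
      "Im (?z ^ n * cnj (?z ^ n')) = ((norm x)\<^sup>2) ^ n' * Im (?z ^ (n - n'))"
      unfolding complex_cnj_power c cmod_coords by simp_all
    show ?thesis
      by (cases \<sigma>; cases \<sigma>')
        (simp_all only: harmp_def s_def t_def if_True if_False simp_thms id 1 power_add [symmetric] not_True_eq_False)
  qed
  then show ?thesis by (rule that)
qed

definition rad :: "real \<Rightarrow> nat \<Rightarrow> nat \<Rightarrow> real \<Rightarrow> real" where
  "rad \<omega> n m t = (\<Sum>k\<le>m. ecoeff \<omega> n m k * (1 + t) powr - (aexp \<omega> n + real k))"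

lemma ef_rad: "ef \<omega> n \<sigma> m x = harmp n \<sigma> x * rad \<omega> n m ((norm x)\<^sup>2)"
  by (simp add: ef_def rad_def spow_def sum_distrib_left mult_ac)

lemma rad_measurable [measurable]: "rad \<omega> n m \<in> borel_measurable borel"
  unfolding rad_def [abs_def] by measurable

lemma rad_le:
  obtains C where "\<And>x::real^2. norm x ^ n * \<bar>rad \<omega> n m ((norm x)\<^sup>2)\<bar> \<le> C"
proof
  fix x :: "real^2"
  have "norm x ^ n * \<bar>rad \<omega> n m ((norm x)\<^sup>2)\<bar>
      \<le> spow (- (real n / 2)) x * (\<Sum>k\<le>m. \<bar>ecoeff \<omega> n m k\<bar> * spow (aexp \<omega> n) x)"
  proof (intro mult_mono norm_power_le_spow)
    have "\<bar>rad \<omega> n m ((norm x)\<^sup>2)\<bar> \<le> (\<Sum>k\<le>m. \<bar>ecoeff \<omega> n m k * spow (aexp \<omega> n + real k) x\<bar>)"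
      unfolding rad_def spow_def by (rule sum_abs)
    also have "\<dots> \<le> (\<Sum>k\<le>m. \<bar>ecoeff \<omega> n m k\<bar> * spow (aexp \<omega> n) x)"
      using spow_pos by (intro sum_mono) (auto simp: abs_mult less_imp_le intro!: mult_left_mono spow_antimono)
    finally show "\<bar>rad \<omega> n m ((norm x)\<^sup>2)\<bar> \<le> (\<Sum>k\<le>m. \<bar>ecoeff \<omega> n m k\<bar> * spow (aexp \<omega> n) x)" .
  qed (auto simp: spow_pos less_imp_le)
  also have "\<dots> = (\<Sum>k\<le>m. \<bar>ecoeff \<omega> n m k\<bar>) * spow (aexp \<omega> n - real n / 2) x"
    by (simp add: sum_distrib_right [symmetric] mult.left_commute [of _ "sum _ _"] spow_add)
  also have "\<dots> \<le> (\<Sum>k\<le>m. \<bar>ecoeff \<omega> n m k\<bar>) * spow 0 x"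
    using aexp_ge [of n \<omega>] by (intro mult_left_mono spow_antimono) (auto intro: sum_nonneg)
  finally show "norm x ^ n * \<bar>rad \<omega> n m ((norm x)\<^sup>2)\<bar> \<le> (\<Sum>k\<le>m. \<bar>ecoeff \<omega> n m k\<bar>)" by simp
qed

lemma integrable_conf: "integrable lborel conf"
  using integrable_spow [of 2] by (simp add: conf_spow [abs_def])

lemma harmp_measurable [measurable]: "harmp n \<sigma> \<in> borel_measurable borel"
  by (intro borel_measurable_continuous_onI smooth_imp_continuous smooth_harm)

text \<open>Together the assumptions force n > 0. The product formula leaves harmonic factors of
  degrees n + n' > 0 and n - n', each times a radial function. The second factor either has positive
  degree or is \<open>harmp 0 True\<close>, which is zero, because equal degrees mean different
  flags.\<close>

lemma orthogonal_angular_le: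
  assumes n: "n' \<le> n" and ne: "(n, \<sigma>) \<noteq> (n', \<sigma>')" and \<sigma>: "n = 0 \<Longrightarrow> \<sigma> = \<sigma>'"
  shows "(\<integral>x. conf x * (ef \<omega> n \<sigma> m x * ef \<omega> n' \<sigma>' m' x) \<partial>lborel) = 0"
proof -
  define K where "K t = 4 * (1 + t) powr - 2 * (rad \<omega> n m t * rad \<omega> n' m' t)" for t
  have [measurable]: "K \<in> borel_measurable borel" unfolding K_def by measurable
  have Kx: "K ((norm x)\<^sup>2) = conf x * (rad \<omega> n m ((norm x)\<^sup>2) * rad \<omega> n' m' ((norm x)\<^sup>2))" for x :: "real^2"
    by (simp add: K_def conf_spow spow_def)
  obtain C where C: "\<And>x::real^2. norm x ^ n * \<bar>rad \<omega> n m ((norm x)\<^sup>2)\<bar> \<le> C"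
    using rad_le [where \<omega> = \<omega> and n = n and m = m] by blast
  obtain C' where C': "\<And>x::real^2. norm x ^ n' * \<bar>rad \<omega> n' m' ((norm x)\<^sup>2)\<bar> \<le> C'"
    using rad_le [where \<omega> = \<omega> and n = n' and m = m'] by blast
  have bound: "\<bar>h * K ((norm x)\<^sup>2)\<bar> \<le> C * C' * conf x" if "\<bar>h\<bar> \<le> norm x ^ (n + n')" for h and x :: "real^2"
  proof -
    have "\<bar>h * K ((norm x)\<^sup>2)\<bar> \<le> norm x ^ (n + n') * \<bar>K ((norm x)\<^sup>2)\<bar>"
      unfolding abs_mult by (intro mult_right_mono that) simp
    also have "\<dots> = conf x * ((norm x ^ n * \<bar>rad \<omega> n m ((norm x)\<^sup>2)\<bar>) * (norm x ^ n' * \<bar>rad \<omega> n' m' ((norm x)\<^sup>2)\<bar>))"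
      using conf_pos [of x] by (simp add: Kx abs_mult power_add)
    also have "\<dots> \<le> conf x * (C * C')"
      using conf_pos [of x] by (intro mult_left_mono mult_mono C C' order_trans [OF _ C]) auto
    finally show ?thesis by (simp add: mult.commute)
  qed
  have int: "integrable lborel (\<lambda>x. g x * K ((norm x)\<^sup>2))"
    if [measurable]: "g \<in> borel_measurable borel" and "\<And>x. \<bar>g x\<bar> \<le> norm x ^ (n + n')" for g :: "real^2 \<Rightarrow> real"
  proof (rule Bochner_Integration.integrable_bound)
    show "integrable lborel (\<lambda>x. C * C' * conf x)" using integrable_conf by simp
    show "AE x in lborel. norm (g x * K ((norm x)\<^sup>2)) \<le> norm (C * C' * conf x)"
      using bound [OF that(2)] by (intro AE_I2) (simp add: order_trans [OF _ abs_ge_self])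
  qed measurable
  let ?b = "\<sigma> \<noteq> \<sigma>'"
  obtain s t where st: "\<And>x. harmp n \<sigma> x * harmp n' \<sigma>' x =
    s * harmp (n + n') ?b x + t * (((norm x)\<^sup>2) ^ n' * harmp (n - n') ?b x)"
    using harm_mult_harm [OF n] by blast
  have i1: "integrable lborel (\<lambda>x. harmp (n + n') ?b x * K ((norm x)\<^sup>2))"
    by (rule int) (auto intro: abs_harm_le)
  have i2: "integrable lborel (\<lambda>x. (((norm x)\<^sup>2) ^ n' * harmp (n - n') ?b x) * K ((norm x)\<^sup>2))"
  proof (rule int)
    fix x :: "real^2"
    have "((norm x)\<^sup>2) ^ n' * \<bar>harmp (n - n') ?b x\<bar> \<le> ((norm x)\<^sup>2) ^ n' * norm x ^ (n - n')"
      by (intro mult_left_mono abs_harm_le) simp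
    also have "\<dots> = norm x ^ (n + n')" using n by (simp add: add.commute flip: power_mult power_add)
    finally show "\<bar>((norm x)\<^sup>2) ^ n' * harmp (n - n') ?b x\<bar> \<le> norm x ^ (n + n')" by (simp add: abs_mult)
  qed measurable
  have z1: "(\<integral>x. harmp (n + n') ?b x * K ((norm x)\<^sup>2) \<partial>lborel) = 0"
  proof (rule integral_harm_radial_eq_0 [OF _ _ i1])
    show "n + n' > 0" using n ne \<sigma> by auto
  qed measurable
  have z2: "(\<integral>x. (((norm x)\<^sup>2) ^ n' * harmp (n - n') ?b x) * K ((norm x)\<^sup>2) \<partial>lborel) = 0"
  proof (cases "n = n'")
    case True
    then have "harmp (n - n') ?b = (\<lambda>x. 0)" using ne by (simp add: harm_0)
    then show ?thesis by simp
  next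
    case False
    have "(\<integral>x. harmp (n - n') ?b x * (((norm x)\<^sup>2) ^ n' * K ((norm x)\<^sup>2)) \<partial>lborel) = 0"
      by (rule integral_harm_radial_eq_0 [where K = "\<lambda>t. t ^ n' * K t"])
        (use False n i2 in \<open>auto simp: mult_ac\<close>)
    then show ?thesis by (simp add: mult_ac)
  qed
  have "conf x * (ef \<omega> n \<sigma> m x * ef \<omega> n' \<sigma>' m' x) = (harmp n \<sigma> x * harmp n' \<sigma>' x) * K ((norm x)\<^sup>2)" for x
    by (simp add: ef_rad Kx)
  then have "(\<integral>x. conf x * (ef \<omega> n \<sigma> m x * ef \<omega> n' \<sigma>' m' x) \<partial>lborel)
    = (\<integral>x. s * (harmp (n + n') ?b x * K ((norm x)\<^sup>2))
        + t * ((((norm x)\<^sup>2) ^ n' * harmp (n - n') ?b x) * K ((norm x)\<^sup>2)) \<partial>lborel)"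
    by (simp add: st algebra_simps)
  also have "\<dots> = 0"
    using i1 i2 z1 z2 by (subst Bochner_Integration.integral_add) (auto simp del: integral_mult_right_zero)
  finally show ?thesis .
qed

lemma weak_gradient_ef: "weak_gradient (ef \<omega> n \<sigma> m) (grad (ef \<omega> n \<sigma> m))"
  using nice_ef by (simp add: nice_def)

lemma ef_orthogonal:
  assumes "(m, n, \<sigma>) \<noteq> (m', n', \<sigma>')" "n = 0 \<Longrightarrow> \<not> \<sigma>" "n' = 0 \<Longrightarrow> \<not> \<sigma>'"
  shows "(\<integral>x. conf x * (ef \<omega> n \<sigma> m x * ef \<omega> n' \<sigma>' m' x) \<partial>lborel) = 0"
proof (cases "(n, \<sigma>) = (n', \<sigma>')")
  case False
  show ?thesis
  proof (cases "n' \<le> n")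
    case True
    then show ?thesis using False assms by (intro orthogonal_angular_le) auto
  next
    case *: False
    have "(\<integral>x. conf x * (ef \<omega> n' \<sigma>' m' x * ef \<omega> n \<sigma> m x) \<partial>lborel) = 0"
      using * False assms by (intro orthogonal_angular_le) auto
    then show ?thesis by (simp add: mult.commute)
  qed
next
  case True
  then have m: "m \<noteq> m'" using assms by auto
  let ?I = "\<integral>x. conf x * (ef \<omega> n \<sigma> m x * ef \<omega> n \<sigma> m' x) \<partial>lborel"
  have "eigval \<omega> m' n * ?I = eigval \<omega> m n * ?I"
    using weak_eigen_equation(1) [OF weak_gradient_ef integrable_fvec_ef, of \<omega> n \<sigma> m n \<sigma> m']
      weak_eigen_equation(1) [OF weak_gradient_ef integrable_fvec_ef, of \<omega> n \<sigma> m' n \<sigma> m]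
    by (simp add: inner_commute mult.commute [of "ef \<omega> n \<sigma> m _"])
  moreover have "eigval \<omega> m' n \<noteq> eigval \<omega> m n"
    using m eigval_strict_mono [of m m' \<omega> n] eigval_strict_mono [of m' m \<omega> n] by (cases "m < m'") auto
  ultimately show ?thesis using True by simp
qed

lemma integrable_conf_ef_sq: "integrable lborel (\<lambda>x. conf x * (ef \<omega> n \<sigma> m x)\<^sup>2)"
  using weak_eigen_equation(3) [OF weak_gradient_ef integrable_fvec_ef, of \<omega> n \<sigma> m n \<sigma> m]
  by (simp add: power2_eq_square)

text \<open>In the variable s = 1 / (1 + |x|^2) the radial factor is a power of s times a polynomial
  with constant term 1, hence positive for small s, that is, far out in the plane. Where the angular
  factor is nonzero as well the function does not vanish, and by continuity this happens on a
  nonnegligible open set.\<close>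

lemma ef_norm_pos:
  assumes "n = 0 \<Longrightarrow> \<not> \<sigma>"
  shows "(\<integral>x. conf x * (ef \<omega> n \<sigma> m x)\<^sup>2 \<partial>lborel) > 0"
proof -
  have "\<exists>x. ef \<omega> n \<sigma> m x \<noteq> 0"
  proof -
    have "isCont (\<lambda>s. \<Sum>k\<le>m. ecoeff \<omega> n m k * s ^ k) 0" by (intro continuous_intros)
    then have "((\<lambda>s. \<Sum>k\<le>m. ecoeff \<omega> n m k * s ^ k) \<longlongrightarrow> (\<Sum>k\<le>m. ecoeff \<omega> n m k * 0 ^ k)) (at_right 0)"
      by (rule tendsto_mono [OF at_le [OF subset_UNIV] isContD])
    moreover have "(\<Sum>k\<le>m. ecoeff \<omega> n m k * 0 ^ k) = 1"
      by (simp add: power_0_left if_distrib cong: if_cong)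
    ultimately have "\<forall>\<^sub>F s in at_right 0. (\<Sum>k\<le>m. ecoeff \<omega> n m k * s ^ k) > 0"
      by (intro order_tendstoD(1) [where a = 0]) auto
    moreover have "\<forall>\<^sub>F s in at_right 0. (s::real) \<in> {0<..<1}"
      by (rule eventually_at_right_real) simp
    ultimately have "\<forall>\<^sub>F s in at_right 0. (\<Sum>k\<le>m. ecoeff \<omega> n m k * s ^ k) > 0 \<and> s \<in> {0<..<1}"
      by eventually_elim simp
    then obtain s where s: "(\<Sum>k\<le>m. ecoeff \<omega> n m k * s ^ k) > 0" "0 < s" "s < 1"
      using eventually_happens trivial_limit_at_right_real by (metis (mono_tags, lifting) greaterThanLessThan_iff)
    define R where "R = sqrt (1 / s - 1)"
    have R: "R > 0" "1 + R\<^sup>2 = 1 / s" using s by (simp_all add: R_def field_simps)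
    \<comment> \<open>This argument makes z^n equal to i R^n for the imaginary part and to R^n for
      the real part.\<close>
    define \<theta> where "\<theta> = (if \<sigma> then pi / (2 * real n) else 0)"
    define x :: "real^2" where "x = vector [R * cos \<theta>, R * sin \<theta>]"
    have z: "Complex (x $ 1) (x $ 2) = of_real R * cis \<theta>"
      by (simp add: x_def vector_2 complex_eq_iff)
    have nx: "norm x = R" unfolding cmod_coords [symmetric] z using R by (simp add: norm_mult)
    have "harmp n \<sigma> x = R ^ n"
    proof (cases \<sigma>)
      case True
      then have "n > 0" using assms by auto
      then have "real n * \<theta> = pi / 2" using True by (simp add: \<theta>_def)
      then have "cis \<theta> ^ n = \<i>" by (metis Complex.DeMoivre cis_pi_half)
      then show ?thesis using True
        by (simp add: harmp_def z power_mult_distrib flip: of_real_power)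
    next
      case False
      then show ?thesis by (simp add: harmp_def z \<theta>_def flip: of_real_power)
    qed
    moreover have "rad \<omega> n m ((norm x)\<^sup>2) = s powr aexp \<omega> n * (\<Sum>k\<le>m. ecoeff \<omega> n m k * s ^ k)"
    proof -
      have "(1 + (norm x)\<^sup>2) powr - (aexp \<omega> n + real k) = s powr aexp \<omega> n * s ^ k" for k
      proof -
        have "1 / s = s powr - 1" using s(2) by (simp add: powr_minus_divide)
        then have "(1 / s) powr - (aexp \<omega> n + real k) = s powr (- 1 * - (aexp \<omega> n + real k))"
          by (simp only: powr_powr)
        also have "\<dots> = s powr (aexp \<omega> n + real k)" by (simp add: add.commute)
        finally show ?thesis
          using s(2) unfolding nx R(2) by (simp add: powr_add powr_realpow)
      qed
      then show ?thesis unfolding rad_def by (simp add: sum_distrib_left mult_ac)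
    qed
    ultimately have "ef \<omega> n \<sigma> m x \<noteq> 0" using s R(1) by (simp add: ef_rad)
    then show ?thesis by blast
  qed
  moreover have "open {x. ef \<omega> n \<sigma> m x \<noteq> 0}"
    by (intro open_Collect_neq smooth_imp_continuous smooth_ef continuous_on_const)
  ultimately have neg: "\<not> negligible {x. ef \<omega> n \<sigma> m x \<noteq> 0}"
    by (intro open_not_negligible) auto
  have "(\<integral>x. conf x * (ef \<omega> n \<sigma> m x)\<^sup>2 \<partial>lborel) \<noteq> 0"
  proof
    assume "(\<integral>x. conf x * (ef \<omega> n \<sigma> m x)\<^sup>2 \<partial>lborel) = 0"
    then have "AE x in lborel. conf x * (ef \<omega> n \<sigma> m x)\<^sup>2 = 0"
      using integrable_conf_ef_sq conf_pos by (subst (asm) integral_nonneg_eq_0_iff_AE) (auto simp: less_imp_le)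
    then have "AE x in lborel. ef \<omega> n \<sigma> m x = 0"
      by eventually_elim (use conf_pos in \<open>simp add: less_imp_neq [symmetric]\<close>)
    then have "AE x in lborel. x \<notin> {x. ef \<omega> n \<sigma> m x \<noteq> 0}" by simp
    then have "{x. ef \<omega> n \<sigma> m x \<noteq> 0} \<in> null_sets lborel"
      by (subst AE_iff_null_sets) auto
    then show False using neg by (simp add: negligible_iff_null_sets null_sets_completionI)
  qed
  moreover have "(\<integral>x. conf x * (ef \<omega> n \<sigma> m x)\<^sup>2 \<partial>lborel) \<ge> 0"
    using conf_pos by (intro integral_nonneg_AE) (auto simp: less_imp_le)
  ultimately show ?thesis by simp
qed

section \<open>Completeness of the eigenfunctions\<close>

lemma sets_borel_eq_compact:
  "sets (borel :: 'a::euclidean_space measure) = sigma_sets UNIV (Collect compact)"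
proof
  have "Collect compact \<subseteq> sets (borel :: 'a measure)" by (auto intro: borel_compact)
  from sets.sigma_sets_subset [OF this]
  show "sigma_sets UNIV (Collect compact) \<subseteq> sets (borel :: 'a measure)" by simp
  have "S \<in> sigma_sets UNIV (Collect compact)" if S: "closed S" for S :: "'a set"
  proof -
    have "S = (\<Union>n. S \<inter> cball 0 (real n))" using real_arch_simple by auto
    moreover have "(\<Union>n. S \<inter> cball 0 (real n)) \<in> sigma_sets UNIV (Collect compact)"
      using S by (intro sigma_sets.Union sigma_sets.Basic) (simp add: closed_Int_compact)
    ultimately show ?thesis by simp
  qed
  then have "sigma_sets UNIV (Collect closed) \<subseteq> sigma_sets UNIV (Collect (compact :: 'a set \<Rightarrow> bool))"
    by (intro sigma_sets_mono) auto
  then show "sets (borel :: 'a measure) \<subseteq> sigma_sets UNIV (Collect compact)"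
    by (simp add: borel_eq_closed)
qed

locale orthogonal_to_ef =
  fixes \<omega> :: real and F :: "real^2 \<Rightarrow> real"
  assumes F [measurable]: "F \<in> borel_measurable borel"
    and F_sq: "integrable lborel (\<lambda>x. conf x * (F x)\<^sup>2)"
    and orth: "\<And>n \<sigma> m. (\<integral>x. conf x * (F x * ef \<omega> n \<sigma> m x) \<partial>lborel) = 0"
begin

lemma spow_measurable [measurable]: "spow b \<in> borel_measurable borel"
  by (intro borel_measurable_continuous_onI smooth_imp_continuous smooth_spow)

lemma F_int: "integrable lborel (\<lambda>x. conf x * \<bar>F x\<bar>)"
proof (rule Bochner_Integration.integrable_bound)
  show "integrable lborel (\<lambda>x. conf x + conf x * (F x)\<^sup>2)" using F_sq integrable_conf by auto
  have "conf x * \<bar>F x\<bar> \<le> conf x + conf x * (F x)\<^sup>2" for x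
  proof -
    have "\<bar>F x\<bar> \<le> 1 + (F x)\<^sup>2"
      using sum_power2_ge_zero [of "\<bar>F x\<bar> - 1" 0] by (simp add: power2_eq_square algebra_simps)
    then have "conf x * \<bar>F x\<bar> \<le> conf x * (1 + (F x)\<^sup>2)" using conf_pos [of x] by (intro mult_left_mono) auto
    then show ?thesis by (simp add: distrib_left)
  qed
  then show "AE x in lborel. norm (conf x * \<bar>F x\<bar>) \<le> norm (conf x + conf x * (F x)\<^sup>2)"
    by (intro AE_I2) (simp add: abs_mult abs_of_pos [OF conf_pos] order_trans [OF _ abs_ge_self])
qed measurable

lemma F_mult_int:
  assumes [measurable]: "g \<in> borel_measurable borel" and g: "\<And>x. \<bar>g x\<bar> \<le> C"
  shows "integrable lborel (\<lambda>x. conf x * F x * g x)"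
proof (rule Bochner_Integration.integrable_bound)
  show "integrable lborel (\<lambda>x. C * (conf x * \<bar>F x\<bar>))" using F_int by simp
  have "\<bar>conf x * F x * g x\<bar> \<le> C * (conf x * \<bar>F x\<bar>)" for x
    using mult_left_mono [OF g [of x], of "conf x * \<bar>F x\<bar>"] conf_pos [of x] by (simp add: abs_mult mult_ac)
  then show "AE x in lborel. norm (conf x * F x * g x) \<le> norm (C * (conf x * \<bar>F x\<bar>))"
    by (intro AE_I2) (simp add: order_trans [OF _ abs_ge_self])
qed measurable

lemma harm_spow_bounded: "real n / 2 \<le> b \<Longrightarrow> \<bar>harmp n \<sigma> x * spow b x\<bar> \<le> 1"
proof -
  assume b: "real n / 2 \<le> b"
  have "\<bar>harmp n \<sigma> x * spow b x\<bar> \<le> spow (- (real n / 2)) x * spow b x"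
    using order_trans [OF abs_harm_le norm_power_le_spow] spow_pos [of b x]
    by (auto simp: abs_mult intro!: mult_right_mono)
  also have "\<dots> \<le> spow 0 x" unfolding spow_add using b by (intro spow_antimono) simp
  finally show ?thesis by simp
qed

lemma aexp_ge_half: "real n / 2 \<le> aexp \<omega> n + real k"
proof -
  have "real n / 2 \<le> real n" by simp
  then show ?thesis using aexp_ge [of n \<omega>] by linarith
qed

text \<open>The coefficient matrix expressing eigenfunctions through powers is triangular.\<close>

lemma orth_power: "(\<integral>x. conf x * F x * (harmp n \<sigma> x * spow (aexp \<omega> n + real k) x) \<partial>lborel) = 0"
proof (induction k rule: less_induct)
  case (less k)
  let ?g = "\<lambda>j x. conf x * F x * (harmp n \<sigma> x * spow (aexp \<omega> n + real j) x)"
  have i: "integrable lborel (?g j)" for j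
    by (rule F_mult_int) (auto intro: harm_spow_bounded aexp_ge_half)
  have "0 = (\<integral>x. (\<Sum>j\<le>k. ecoeff \<omega> n k j * ?g j x) \<partial>lborel)"
    using orth [of n \<sigma> k] by (simp add: ef_def sum_distrib_left mult_ac)
  also have "\<dots> = (\<Sum>j\<le>k. ecoeff \<omega> n k j * integral\<^sup>L lborel (?g j))"
    by (subst Bochner_Integration.integral_sum) (use i in auto)
  also have "\<dots> = ecoeff \<omega> n k k * integral\<^sup>L lborel (?g k)"
    by (subst sum.remove [of _ k]) (use less in \<open>auto intro!: sum.neutral\<close>)
  finally show ?case using ecoeff_nonzero [of k k \<omega> n] by simp
qed

lemma spow_1_power: "spow 1 x ^ k = spow (real k) x"
  by (induction k) (simp_all add: spow_add add.commute)

lemma spow_1_range: "0 < spow 1 x" "spow 1 x \<le> 1"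
  using spow_pos [of 1 x] spow_antimono [of 0 1 x] by auto

lemma orth_continuous:
  assumes c: "continuous_on {0..1} c"
  shows "(\<integral>x. conf x * F x * (harmp n \<sigma> x * spow (aexp \<omega> n) x) * c (spow 1 x) \<partial>lborel) = 0"
proof -
  let ?W = "\<lambda>x. conf x * F x * (harmp n \<sigma> x * spow (aexp \<omega> n) x)"
  have iW: "integrable lborel ?W"
    by (rule F_mult_int) (use aexp_ge_half [of n 0] in \<open>auto intro: harm_spow_bounded\<close>)
  \<comment> \<open>A continuous extension to the whole line by constants, needed for measurability;
    \<open>spow 1\<close> takes its values in {0..1} only.\<close>
  define c' where "c' t = c (max 0 (min 1 t))" for t
  have cc: "continuous_on UNIV c'"
    unfolding c'_def by (rule continuous_on_compose2 [OF c]) (auto intro!: continuous_intros)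
  have [measurable]: "c' \<in> borel_measurable borel" using cc by (rule borel_measurable_continuous_onI)
  have c'_eq: "c' (spow 1 x) = c (spow 1 x)" for x
    using spow_1_range [of x] by (simp add: c'_def max_def min_def)
  have "\<bar>\<integral>x. ?W x * c' (spow 1 x) \<partial>lborel\<bar> \<le> \<epsilon> * (\<integral>x. \<bar>?W x\<bar> \<partial>lborel)" if "\<epsilon> > 0" for \<epsilon>
  proof -
    obtain g where g: "real_polynomial_function g" "\<And>t. t \<in> {0..1} \<Longrightarrow> \<bar>c t - g t\<bar> < \<epsilon>"
      using Stone_Weierstrass_real_polynomial_function [OF compact_Icc c \<open>\<epsilon> > 0\<close>] by blast
    obtain a N where gp: "g = (\<lambda>t. \<Sum>i\<le>N. a i * t ^ i)"
      using g(1) unfolding real_polynomial_function_iff_sum by blast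
    have [measurable]: "g \<in> borel_measurable borel" unfolding gp by measurable
    have i: "integrable lborel (\<lambda>x. conf x * F x * (harmp n \<sigma> x * spow (aexp \<omega> n + real j) x))" for j
      by (rule F_mult_int) (auto intro: harm_spow_bounded aexp_ge_half)
    \<comment> \<open>Multiplying the weight by powers of \<open>spow 1\<close> yields exactly the
      exponents \<open>aexp \<omega> n + j\<close> treated in \<open>orth_power\<close>.\<close>
    have e: "?W x * g (spow 1 x) = (\<Sum>j\<le>N. a j * (conf x * F x * (harmp n \<sigma> x * spow (aexp \<omega> n + real j) x)))" for x
      by (simp add: gp spow_1_power sum_distrib_left spow_add [symmetric] mult_ac)
    have ig: "integrable lborel (\<lambda>x. ?W x * g (spow 1 x))" unfolding e using i by auto
    have g0: "(\<integral>x. ?W x * g (spow 1 x) \<partial>lborel) = 0"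
      unfolding e using i by (subst Bochner_Integration.integral_sum) (auto simp: orth_power)
    have d: "\<bar>c' (spow 1 x) - g (spow 1 x)\<bar> \<le> \<epsilon>" for x
      unfolding c'_eq using g(2) [of "spow 1 x"] spow_1_range [of x] by simp
    have ib: "\<bar>?W x * (c' (spow 1 x) - g (spow 1 x))\<bar> \<le> \<epsilon> * \<bar>?W x\<bar>" for x
      unfolding abs_mult [of "?W x"] using mult_left_mono [OF d, of "\<bar>?W x\<bar>"] by (simp add: mult.commute)
    have id: "integrable lborel (\<lambda>x. ?W x * (c' (spow 1 x) - g (spow 1 x)))"
    proof (rule Bochner_Integration.integrable_bound)
      show "integrable lborel (\<lambda>x. \<epsilon> * \<bar>?W x\<bar>)" using iW by auto
      show "AE x in lborel. norm (?W x * (c' (spow 1 x) - g (spow 1 x))) \<le> norm (\<epsilon> * \<bar>?W x\<bar>)"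
        using ib by (intro AE_I2) (simp only: real_norm_def order_trans [OF _ abs_ge_self])
    qed measurable
    have "?W x * c' (spow 1 x) = ?W x * (c' (spow 1 x) - g (spow 1 x)) + ?W x * g (spow 1 x)" for x
      by (simp add: algebra_simps)
    then have "(\<integral>x. ?W x * c' (spow 1 x) \<partial>lborel) = (\<integral>x. ?W x * (c' (spow 1 x) - g (spow 1 x)) \<partial>lborel)"
      using id ig g0 by (simp only: Bochner_Integration.integral_add add_0_right)
    also have "\<bar>\<dots>\<bar> \<le> (\<integral>x. \<bar>?W x * (c' (spow 1 x) - g (spow 1 x))\<bar> \<partial>lborel)"
      using integral_norm_bound [of lborel "\<lambda>x. ?W x * (c' (spow 1 x) - g (spow 1 x))"] by simp
    also have "\<dots> \<le> (\<integral>x. \<epsilon> * \<bar>?W x\<bar> \<partial>lborel)"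
      by (rule integral_mono) (use id iW ib in auto)
    finally show ?thesis by simp
  qed
  note b = this
  let ?J = "\<integral>x. \<bar>?W x\<bar> \<partial>lborel"
  have J: "?J \<ge> 0" by simp
  have "\<bar>\<integral>x. ?W x * c' (spow 1 x) \<partial>lborel\<bar> \<le> 0"
  proof (rule field_le_epsilon)
    fix e :: real assume "e > 0"
    \<comment> \<open>The added 1 keeps the denominator positive when the integral \<open>?J\<close>
      is zero.\<close>
    then have "e / (?J + 1) > 0" by (intro divide_pos_pos add_nonneg_pos J) simp_all
    from b [OF this] have "\<bar>\<integral>x. ?W x * c' (spow 1 x) \<partial>lborel\<bar> \<le> e / (?J + 1) * ?J" .
    also have "e / (a + 1) * a \<le> e" if "a \<ge> 0" for a :: real using that \<open>e > 0\<close> by (simp add: field_simps)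
    note this [OF J]
    finally show "\<bar>\<integral>x. ?W x * c' (spow 1 x) \<partial>lborel\<bar> \<le> 0 + e" by simp
  qed
  then show ?thesis by (simp add: c'_eq)
qed

text \<open>The function t^(n + k - a) would turn the exponent a into n + k, but it may be singular
  at t = 0, the pole, since a is at least n. Replacing t^(-a) by (t + d)^(-a) makes it continuous.
  As d tends to 0 the products converge, and they stay below
  \<open>harmp n \<sigma> x * spow (real (n + k)) x\<close> in absolute value, which is
  bounded.\<close>

lemma orth_integer_power: "(\<integral>x. conf x * F x * (harmp n \<sigma> x * spow (real (n + k)) x) \<partial>lborel) = 0"
proof -
  let ?a = "aexp \<omega> n"
  have a0: "?a \<ge> 0" using aexp_ge [of n \<omega>] by (rule order_trans [rotated]) simp
  define d :: "nat \<Rightarrow> real" where "d j = inverse (real (Suc j))" for j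
  have d: "d j > 0" for j by (simp add: d_def)
  define c where "c j t = t ^ (n + k) * (t + d j) powr - ?a" for j t
  let ?g = "\<lambda>j x. conf x * F x * (harmp n \<sigma> x * spow ?a x) * c j (spow 1 x)"
  have [measurable]: "c j \<in> borel_measurable borel" for j unfolding c_def by measurable
  have "integral\<^sup>L lborel (?g j) = 0" for j
  proof (rule orth_continuous)
    show "continuous_on {0..1} (c j)"
      unfolding c_def using d [of j] by (intro continuous_intros) (auto simp: add_nonneg_pos less_imp_neq [symmetric])
  qed
  moreover have "(\<lambda>j. integral\<^sup>L lborel (?g j)) \<longlonglongrightarrow>
      (\<integral>x. conf x * F x * (harmp n \<sigma> x * spow (real (n + k)) x) \<partial>lborel)"
  proof (rule integral_dominated_convergence [where w = "\<lambda>x. conf x * \<bar>F x\<bar>"])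
    have pw: "spow ?a x = spow 1 x powr ?a" for x
      by (simp only: spow_def powr_powr mult_minus_left mult_1)
    have lim: "(\<lambda>j. spow ?a x * c j (spow 1 x)) \<longlonglongrightarrow> spow (real (n + k)) x" for x
    proof -
      let ?s = "spow 1 x"
      have "(\<lambda>j. ?s powr ?a * (?s ^ (n + k) * (?s + d j) powr - ?a)) \<longlonglongrightarrow>
          ?s powr ?a * (?s ^ (n + k) * (?s + 0) powr - ?a)"
        unfolding d_def using spow_1_range [of x]
        by (intro tendsto_intros LIMSEQ_inverse_real_of_nat) auto
      moreover have "?s powr ?a * (?s ^ (n + k) * (?s + 0) powr - ?a) = spow (real (n + k)) x"
        using spow_1_range [of x] unfolding spow_1_power [symmetric] by (simp add: powr_minus)
      ultimately show ?thesis unfolding pw c_def by simp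
    qed
    then show "AE x in lborel. (\<lambda>j. ?g j x) \<longlonglongrightarrow> conf x * F x * (harmp n \<sigma> x * spow (real (n + k)) x)"
      by (intro AE_I2) (simp only: mult.assoc, intro tendsto_intros)
    have "\<bar>?g j x\<bar> \<le> conf x * \<bar>F x\<bar>" for j x
    proof -
      let ?s = "spow 1 x"
      have "?s powr ?a * (?s + d j) powr - ?a = (?s / (?s + d j)) powr ?a"
        using spow_1_range [of x] d [of j] by (simp add: powr_minus_divide powr_divide)
      also have "\<dots> \<le> 1" using spow_1_range [of x] d [of j] a0 by (intro powr_le1) auto
      finally have "?s ^ (n + k) * (?s powr ?a * (?s + d j) powr - ?a) \<le> ?s ^ (n + k) * 1"
        using spow_1_range [of x] by (intro mult_left_mono) auto
      then have "spow ?a x * c j ?s \<le> spow (real (n + k)) x"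
        unfolding pw c_def spow_1_power [symmetric] by (simp add: mult_ac)
      moreover have "0 \<le> spow ?a x * c j ?s"
        using spow_1_range [of x] by (simp add: pw c_def)
      ultimately have "\<bar>harmp n \<sigma> x\<bar> * \<bar>spow ?a x * c j ?s\<bar> \<le> \<bar>harmp n \<sigma> x\<bar> * spow (real (n + k)) x"
        by (intro mult_left_mono) auto
      also have "\<dots> = \<bar>harmp n \<sigma> x * spow (real (n + k)) x\<bar>"
        using spow_pos [of "real (n + k)" x] by (simp add: abs_mult)
      also have "\<dots> \<le> 1" by (rule harm_spow_bounded) simp
      finally have "(conf x * \<bar>F x\<bar>) * (\<bar>harmp n \<sigma> x\<bar> * \<bar>spow ?a x * c j ?s\<bar>) \<le> (conf x * \<bar>F x\<bar>) * 1"
        using conf_pos [of x] by (intro mult_left_mono) auto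
      then show ?thesis using conf_pos [of x] by (simp add: abs_mult mult_ac)
    qed
    then show "AE x in lborel. norm (?g j x) \<le> conf x * \<bar>F x\<bar>" for j by simp
  qed (use F_int in measurable)
  ultimately show ?thesis by (simp add: LIMSEQ_const_iff)
qed

end

subsection \<open>Polynomials on the sphere\<close>

text \<open>Functions that agree on the sphere with a linear combination of harmonic polynomials in
  the plane coordinates times powers of the height. The rule \<open>cong\<close> lets |x|^2 = 1 -
  y^2 be used; the class turns out to be an algebra containing the coordinates, hence all
  polynomials.\<close>

inductive sphpoly :: "(point3 \<Rightarrow> real) \<Rightarrow> bool" where
  base: "sphpoly (\<lambda>p. harmp n \<sigma> (fst p) * snd p ^ j)"
| add: "sphpoly f \<Longrightarrow> sphpoly g \<Longrightarrow> sphpoly (\<lambda>p. f p + g p)"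
| scale: "sphpoly f \<Longrightarrow> sphpoly (\<lambda>p. c * f p)"
| cong: "sphpoly f \<Longrightarrow> (\<And>p. p \<in> S2 \<Longrightarrow> f p = g p) \<Longrightarrow> sphpoly g"

lemma S2_norm_fst: "p \<in> S2 \<Longrightarrow> (norm (fst p))\<^sup>2 = 1 - (snd p)\<^sup>2"
proof -
  assume "p \<in> S2"
  then have "(norm p)\<^sup>2 = 1" by (simp add: S2_def)
  then show ?thesis by (cases p) (simp add: norm_Pair)
qed

text \<open>The coordinates are (z + w) / 2 and (z - w) / (2 i) with w the conjugate of z, so
  multiplication raises the degree by one and, through z w = |z|^2, lowers it by one; the second
  coordinate also exchanges real and imaginary part.\<close>

lemma coord_mult_harm:
  "x $ 1 * harmp (Suc n) \<sigma> x = 1/2 * harmp (Suc (Suc n)) \<sigma> x + 1/2 * ((norm x)\<^sup>2 * harmp n \<sigma> x)"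
  "x $ 2 * harmp (Suc n) \<sigma> x =
    (if \<sigma> then - 1/2 else 1/2) * harmp (Suc (Suc n)) (\<not> \<sigma>) x
    + (if \<sigma> then 1/2 else - 1/2) * ((norm x)\<^sup>2 * harmp n (\<not> \<sigma>) x)"
proof -
  have "2 * (x $ 1 * harmp (Suc n) \<sigma> x) = harmp (Suc (Suc n)) \<sigma> x + (norm x)\<^sup>2 * harmp n \<sigma> x"
    by (cases \<sigma>) (simp_all add: harm_Suc norm_sq_coords, simp_all add: power2_eq_square algebra_simps)
  then show "x $ 1 * harmp (Suc n) \<sigma> x = 1/2 * harmp (Suc (Suc n)) \<sigma> x + 1/2 * ((norm x)\<^sup>2 * harmp n \<sigma> x)"
    by linarith
  have "2 * (x $ 2 * harmp (Suc n) \<sigma> x) = (if \<sigma> then - 1 else 1) * harmp (Suc (Suc n)) (\<not> \<sigma>) x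
      + (if \<sigma> then 1 else - 1) * ((norm x)\<^sup>2 * harmp n (\<not> \<sigma>) x)"
    by (cases \<sigma>) (simp_all add: harm_Suc norm_sq_coords, simp_all add: power2_eq_square algebra_simps)
  then show "x $ 2 * harmp (Suc n) \<sigma> x = (if \<sigma> then - 1/2 else 1/2) * harmp (Suc (Suc n)) (\<not> \<sigma>) x
      + (if \<sigma> then 1/2 else - 1/2) * ((norm x)\<^sup>2 * harmp n (\<not> \<sigma>) x)"
    by (cases \<sigma>) simp_all
qed

lemma coord_mult_harm_0:
  "x $ 1 * harmp 0 \<sigma> x = (if \<sigma> then 0 else 1) * harmp 1 False x"
  "x $ 2 * harmp 0 \<sigma> x = (if \<sigma> then 0 else 1) * harmp 1 True x"
  by (cases \<sigma>; simp add: harm_Suc harm_0)+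

lemma sphpoly_mult_snd: "sphpoly f \<Longrightarrow> sphpoly (\<lambda>p. snd p * f p)"
proof (induction rule: sphpoly.induct)
  case (base n \<sigma> j)
  then show ?case using sphpoly.base [of n \<sigma> "Suc j"] by (simp add: mult_ac)
next
  case (add f g)
  then show ?case using sphpoly.add by (simp add: distrib_left)
next
  case (scale f c)
  then show ?case using sphpoly.scale [of "\<lambda>p. snd p * f p" c] by (simp add: mult_ac)
next
  case (cong f g)
  show ?case by (rule sphpoly.cong [OF cong.IH]) (simp add: cong.hyps)
qed

lemma sphpoly_norm_fst: "sphpoly f \<Longrightarrow> sphpoly (\<lambda>p. (norm (fst p))\<^sup>2 * f p)"
proof -
  assume f: "sphpoly f"
  have "sphpoly (\<lambda>p. f p + - 1 * (snd p * (snd p * f p)))"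
    by (intro sphpoly.add sphpoly.scale sphpoly_mult_snd f)
  then show ?thesis
  proof (rule sphpoly.cong)
    fix p :: point3 assume "p \<in> S2"
    then show "f p + - 1 * (snd p * (snd p * f p)) = (norm (fst p))\<^sup>2 * f p"
      unfolding S2_norm_fst [OF \<open>p \<in> S2\<close>] by (simp add: power2_eq_square algebra_simps)
  qed
qed

lemma sphpoly_mult_fst: "sphpoly f \<Longrightarrow> sphpoly (\<lambda>p. fst p $ i * f p)"
proof (induction rule: sphpoly.induct)
  case (base n \<sigma> j)
  obtain s t \<tau> n' n'' where *: "\<And>x. x $ i * harmp n \<sigma> x = s * harmp n' \<tau> x + t * ((norm x)\<^sup>2 * harmp n'' \<tau> x)"
  proof (cases n)
    case 0
    have "i = 1 \<or> i = 2" using exhaust_2 by blast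
    then show ?thesis
      using coord_mult_harm_0 [of _ \<sigma>] 0
        that [of "if \<sigma> then 0 else 1" 1 "i = 2" 0 0] by auto
  next
    case (Suc k)
    have "i = 1 \<or> i = 2" using exhaust_2 by blast
    then show ?thesis
    proof
      assume "i = 1"
      then show ?thesis using coord_mult_harm(1) [of _ k \<sigma>] Suc by (intro that [of "1/2" "Suc (Suc k)" \<sigma> "1/2" k]) simp
    next
      assume "i = 2"
      then show ?thesis using coord_mult_harm(2) [of _ k \<sigma>] Suc
        by (intro that [of "if \<sigma> then - 1/2 else 1/2" "Suc (Suc k)" "\<not> \<sigma>" "if \<sigma> then 1/2 else - 1/2" k]) simp
    qed
  qed
  have "sphpoly (\<lambda>p. s * (harmp n' \<tau> (fst p) * snd p ^ j) + t * ((norm (fst p))\<^sup>2 * (harmp n'' \<tau> (fst p) * snd p ^ j)))"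
    by (intro sphpoly.add sphpoly.scale sphpoly_norm_fst sphpoly.base)
  moreover have "(\<lambda>p::point3. s * (harmp n' \<tau> (fst p) * snd p ^ j) + t * ((norm (fst p))\<^sup>2 * (harmp n'' \<tau> (fst p) * snd p ^ j)))
      = (\<lambda>p. fst p $ i * (harmp n \<sigma> (fst p) * snd p ^ j))"
    using * by (simp add: fun_eq_iff mult.assoc [symmetric] distrib_right [symmetric])
  ultimately show ?case by simp
next
  case (add f g)
  then show ?case using sphpoly.add by (simp add: distrib_left)
next
  case (scale f c)
  then show ?case using sphpoly.scale [of "\<lambda>p. fst p $ i * f p" c] by (simp add: mult_ac)
next
  case (cong f g)
  show ?case by (rule sphpoly.cong [OF cong.IH]) (simp add: cong.hyps)
qed

lemma sphpoly_mult_harm: "sphpoly f \<Longrightarrow> sphpoly (\<lambda>p. harmp n \<sigma> (fst p) * f p)"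
proof (induction n arbitrary: \<sigma>)
  case 0
  then show ?case using sphpoly.scale [of f 0] by (cases \<sigma>) (simp_all add: harm_0)
next
  case (Suc n)
  define g where "g \<sigma> i = (\<lambda>p. fst p $ i * (harmp n \<sigma> (fst p) * f p))" for \<sigma> i
  have g: "sphpoly (g \<sigma> i)" for \<sigma> i unfolding g_def by (rule sphpoly_mult_fst [OF Suc.IH [OF Suc.prems]])
  have "(\<lambda>p. harmp (Suc n) \<sigma> (fst p) * f p) = (\<lambda>p. g \<sigma> 1 p + (if \<sigma> then 1 else - 1) * g (\<not> \<sigma>) 2 p)"
    by (cases \<sigma>) (simp_all add: fun_eq_iff harm_Suc g_def algebra_simps)
  then show ?case using sphpoly.add [OF g sphpoly.scale [OF g]] by simp
qed

lemma sphpoly_mult: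
  assumes f: "sphpoly f" and g: "sphpoly g"
  shows "sphpoly (\<lambda>p. g p * f p)"
  using g
proof (induction rule: sphpoly.induct)
  case (base n \<sigma> j)
  have "sphpoly (\<lambda>p. snd p ^ j * f p)"
  proof (induction j)
    case 0
    then show ?case using f by simp
  next
    case (Suc j)
    then show ?case using sphpoly_mult_snd [OF Suc] by (simp add: mult.assoc)
  qed
  from sphpoly_mult_harm [OF this] show ?case by (simp add: mult.assoc)
next
  case (add f' g')
  then show ?case using sphpoly.add by (simp add: distrib_right)
next
  case (scale h c)
  then show ?case using sphpoly.scale [of "\<lambda>p. h p * f p" c] by (simp add: mult_ac)
next
  case (cong h g')
  show ?case by (rule sphpoly.cong [OF cong.IH]) (simp add: cong.hyps)
qed

lemma sphpoly_const: "sphpoly (\<lambda>p. c)"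
  using sphpoly.scale [OF sphpoly.base [of 0 False 0], of c] by (simp add: harm_0)

lemma sphpoly_polynomial_function: "real_polynomial_function g \<Longrightarrow> sphpoly g"
proof (induction rule: real_polynomial_function.induct)
  case (linear f)
  then interpret bounded_linear f .
  have "f p = f (axis 1 1, 0) * (fst p $ 1) + f (axis 2 1, 0) * (fst p $ 2) + f (0, 1) * snd p" for p
  proof -
    have "p = (fst p $ 1) *\<^sub>R (axis 1 1, 0) + (fst p $ 2) *\<^sub>R (axis 2 1, 0) + snd p *\<^sub>R (0, 1)"
      by (cases p) (simp add: vec_eq_iff forall_2 axis_def)
    then have "f p = f ((fst p $ 1) *\<^sub>R (axis 1 1, 0) + (fst p $ 2) *\<^sub>R (axis 2 1, 0) + snd p *\<^sub>R (0, 1))"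
      by (rule arg_cong)
    then show ?thesis by (simp only: add scaleR real_scaleR_def mult.commute)
  qed
  moreover have "sphpoly (\<lambda>p. f (axis 1 1, 0) * (fst p $ 1) + f (axis 2 1, 0) * (fst p $ 2) + f (0, 1) * snd p)"
    using sphpoly_mult_fst [OF sphpoly_const [of 1]] sphpoly_mult_snd [OF sphpoly_const [of 1]]
    by (intro sphpoly.add sphpoly.scale) simp_all
  ultimately show ?case by (metis (no_types, lifting) ext)
next
  case (const c)
  show ?case by (rule sphpoly_const)
next
  case (add f g)
  then show ?case by (intro sphpoly.add)
next
  case (mult f g)
  then show ?case using sphpoly_mult by blast
qed

context orthogonal_to_ef
begin

lemma harm_scale: "harmp n \<sigma> (c *\<^sub>R x) = c ^ n * harmp n \<sigma> x"
proof -
  have "Complex ((c *\<^sub>R x) $ 1) ((c *\<^sub>R x) $ 2) = of_real c * Complex (x $ 1) (x $ 2)"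
    by (simp add: complex_eq_iff)
  then show ?thesis by (simp add: harmp_def power_mult_distrib flip: of_real_power)
qed

lemma unstereo_spow: "fst (unstereo x) = (2 * spow 1 x) *\<^sub>R x" "snd (unstereo x) = 1 - 2 * spow 1 x"
proof -
  have s: "spow 1 x = 1 / (1 + (norm x)\<^sup>2)"
    using one_plus_norm_sq_pos [of x] by (simp add: spow_def powr_minus_divide)
  show "fst (unstereo x) = (2 * spow 1 x) *\<^sub>R x" by (simp add: unstereo_def s)
  show "snd (unstereo x) = 1 - 2 * spow 1 x"
    using one_plus_norm_sq_pos [of x] by (simp add: unstereo_def s field_simps)
qed

text \<open>These are the restrictions to the sphere of the generators of \<open>sphpoly\<close>: by
  homogeneity \<open>harmp n \<sigma>\<close> of the plane coordinates brings in the integer power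
  \<open>spow n\<close>. Multiplying by the height \<open>1 - 2 * spow 1 x\<close> raises
  \<open>k\<close> by one in one of two terms, so the induction on \<open>j\<close> keeps
  \<open>k\<close> arbitrary.\<close>

lemma orth_sphere_base:
  "(\<integral>x. conf x * F x * (harmp n \<sigma> x * spow (real (n + k)) x * (1 - 2 * spow 1 x) ^ j) \<partial>lborel) = 0"
    (is "integral\<^sup>L lborel (?g k j) = 0")
  and orth_sphere_base_int:
  "integrable lborel (\<lambda>x. conf x * F x * (harmp n \<sigma> x * spow (real (n + k)) x * (1 - 2 * spow 1 x) ^ j))"
proof -
  have i: "integrable lborel (?g k j)" for k j
  proof (rule F_mult_int)
    fix x
    have "\<bar>harmp n \<sigma> x * spow (real (n + k)) x\<bar> * \<bar>(1 - 2 * spow 1 x) ^ j\<bar> \<le> 1 * 1"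
      using spow_1_range [of x]
      by (intro mult_mono harm_spow_bounded) (auto simp: power_abs intro!: power_le_one)
    then show "\<bar>harmp n \<sigma> x * spow (real (n + k)) x * (1 - 2 * spow 1 x) ^ j\<bar> \<le> 1" by (simp add: abs_mult)
  qed measurable
  show "integrable lborel (?g k j)" by (rule i)
  show "integral\<^sup>L lborel (?g k j) = 0"
  proof (induction j arbitrary: k)
    case 0
    then show ?case using orth_integer_power [of n \<sigma> k] by simp
  next
    case (Suc j)
    have "?g k (Suc j) x = ?g k j x - 2 * ?g (Suc k) j x" for x
    proof -
      have "spow (real (n + Suc k)) x = spow (real (n + k)) x * spow 1 x" by (simp add: spow_add add_ac)
      then show ?thesis by (simp only: power_Suc) (simp add: algebra_simps)
    qed
    then have eq: "?g k (Suc j) = (\<lambda>x. ?g k j x - 2 * ?g (Suc k) j x)" by (rule ext)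
    have "integral\<^sup>L lborel (?g k (Suc j)) = integral\<^sup>L lborel (?g k j) - 2 * integral\<^sup>L lborel (?g (Suc k) j)"
      unfolding eq by (subst Bochner_Integration.integral_diff [OF i integrable_mult_right [OF i]]) simp
    then show ?case by (simp only: Suc.IH mult_zero_right diff_zero)
  qed
qed

lemma orth_sphpoly:
  assumes "sphpoly g"
  shows "(\<integral>x. conf x * F x * g (unstereo x) \<partial>lborel) = 0 \<and> integrable lborel (\<lambda>x. conf x * F x * g (unstereo x))"
  using assms
proof (induction rule: sphpoly.induct)
  case (base n \<sigma> j)
  have "harmp n \<sigma> (fst (unstereo x)) * snd (unstereo x) ^ j
      = 2 ^ n * (harmp n \<sigma> x * spow (real (n + 0)) x * (1 - 2 * spow 1 x) ^ j)" for x
    unfolding unstereo_spow harm_scale power_mult_distrib spow_1_power by (simp add: mult_ac)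
  then have eq: "(\<lambda>x. conf x * F x * (harmp n \<sigma> (fst (unstereo x)) * snd (unstereo x) ^ j))
      = (\<lambda>x. 2 ^ n * (conf x * F x * (harmp n \<sigma> x * spow (real (n + 0)) x * (1 - 2 * spow 1 x) ^ j)))"
    by (simp only: mult_ac)
  show ?case
    unfolding eq using orth_sphere_base [of n \<sigma> 0 j] orth_sphere_base_int [of n \<sigma> 0 j] by simp
next
  case (add f g)
  then show ?case by (simp add: distrib_left)
next
  case (scale f c)
  then show ?case by (simp add: mult.left_commute [of _ c])
next
  case (cong f g)
  then show ?case by (simp add: unstereo_in_S2)
qed

lemma orth_continuous_sphere:
  assumes g: "continuous_on S2 g"
  shows "(\<integral>x. conf x * F x * g (unstereo x) \<partial>lborel) = 0"
proof -
  have cS: "compact S2" by (simp add: S2_def)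
  have "g \<in> restrict_space borel S2 \<rightarrow>\<^sub>M borel"
    using g by (intro borel_measurable_continuous_on_restrict)
  then have "g \<in> dV \<rightarrow>\<^sub>M borel" by (simp add: measurable_def sets_dV space_restrict_space)
  then have gm [measurable]: "(\<lambda>x. g (unstereo x)) \<in> borel_measurable borel"
    by (rule measurable_compose [OF unstereo_measurable_borel])
  let ?J = "\<integral>x. conf x * \<bar>F x\<bar> \<partial>lborel"
  have J: "?J \<ge> 0" using conf_pos by (intro integral_nonneg_AE) (auto simp: less_imp_le)
  have b: "\<bar>\<integral>x. conf x * F x * g (unstereo x) \<partial>lborel\<bar> \<le> \<epsilon> * ?J" if "\<epsilon> > 0" for \<epsilon>
  proof -
    obtain q where q: "real_polynomial_function q" "\<And>p. p \<in> S2 \<Longrightarrow> \<bar>g p - q p\<bar> < \<epsilon>"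
      using Stone_Weierstrass_real_polynomial_function [OF cS g \<open>\<epsilon> > 0\<close>] by blast
    note oq = orth_sphpoly [OF sphpoly_polynomial_function [OF q(1)]]
    have "continuous_on UNIV q"
      using continuous_real_polymonial_function [OF q(1)] by (intro continuous_at_imp_continuous_on) blast
    then have [measurable]: "q \<in> borel_measurable borel" by (rule borel_measurable_continuous_onI)
    have "q \<in> restrict_space borel S2 \<rightarrow>\<^sub>M borel" by (rule measurable_restrict_space1) measurable
    then have "q \<in> dV \<rightarrow>\<^sub>M borel" by (simp add: measurable_def sets_dV space_restrict_space)
    then have [measurable]: "(\<lambda>x. q (unstereo x)) \<in> borel_measurable borel"
      by (rule measurable_compose [OF unstereo_measurable_borel])
    have d: "\<bar>g (unstereo x) - q (unstereo x)\<bar> \<le> \<epsilon>" for x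
      using q(2) [OF unstereo_in_S2, of x] by simp
    have id: "integrable lborel (\<lambda>x. conf x * F x * (g (unstereo x) - q (unstereo x)))"
      by (rule F_mult_int [OF _ d]) measurable
    have "conf x * F x * g (unstereo x) = conf x * F x * (g (unstereo x) - q (unstereo x)) + conf x * F x * q (unstereo x)" for x
      by (simp add: algebra_simps)
    then have "(\<integral>x. conf x * F x * g (unstereo x) \<partial>lborel) = (\<integral>x. conf x * F x * (g (unstereo x) - q (unstereo x)) \<partial>lborel)"
      using id oq by (simp only: Bochner_Integration.integral_add add_0_right)
    also have "\<bar>\<dots>\<bar> \<le> (\<integral>x. \<bar>conf x * F x * (g (unstereo x) - q (unstereo x))\<bar> \<partial>lborel)"
      using integral_norm_bound [of lborel "\<lambda>x. conf x * F x * (g (unstereo x) - q (unstereo x))"] by simp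
    also have "\<dots> \<le> (\<integral>x. \<epsilon> * (conf x * \<bar>F x\<bar>) \<partial>lborel)"
    proof (rule integral_mono)
      show "\<bar>conf x * F x * (g (unstereo x) - q (unstereo x))\<bar> \<le> \<epsilon> * (conf x * \<bar>F x\<bar>)" for x
        using mult_left_mono [OF d [of x], of "conf x * \<bar>F x\<bar>"] conf_pos [of x] by (simp add: abs_mult mult_ac)
    qed (use id F_int in auto)
    finally show ?thesis by simp
  qed
  have "\<bar>\<integral>x. conf x * F x * g (unstereo x) \<partial>lborel\<bar> \<le> 0"
  proof (rule field_le_epsilon)
    fix e :: real assume "e > 0"
    then have "e / (?J + 1) > 0" by (intro divide_pos_pos add_nonneg_pos J) simp_all
    from b [OF this] have "\<bar>\<integral>x. conf x * F x * g (unstereo x) \<partial>lborel\<bar> \<le> e / (?J + 1) * ?J" .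
    also have "e / (a + 1) * a \<le> e" if "a \<ge> 0" for a :: real using that \<open>e > 0\<close> by (simp add: field_simps)
    note this [OF J]
    finally show "\<bar>\<integral>x. conf x * F x * g (unstereo x) \<partial>lborel\<bar> \<le> 0 + e" by simp
  qed
  then show ?thesis by simp
qed

lemma AE_F_eq_0: "AE x in lborel. F x = 0"
proof -
  have i: "integrable lborel (\<lambda>x. conf x * F x)"
    using F_mult_int [of "\<lambda>x. 1" 1] by simp
  have "AE x in lborel. conf x * F x = 0"
  proof (rule AE_zero_if_integrals_zero [OF i])
    show "sets lborel = sigma_sets (space lborel) (Collect (compact :: (real^2) set \<Rightarrow> bool))"
      by (simp add: sets_borel_eq_compact)
    show "Int_stable (Collect (compact :: (real^2) set \<Rightarrow> bool))"
      unfolding Int_stable_def by (auto intro: compact_Int)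
    show "Collect compact \<subseteq> Pow (space lborel)" by simp
    show "(\<integral>x. conf x * F x \<partial>lborel) = 0"
      using orth_continuous_sphere [of "\<lambda>p. 1"] by (simp add: continuous_on_const)
    fix A :: "(real^2) set" assume "A \<in> Collect compact"
    then have A: "compact A" by simp
    show "(\<integral>x. indicator A x * (conf x * F x) \<partial>lborel) = 0"
    proof (cases "A = {}")
      case False
      have cu: "continuous_on UNIV unstereo"
        unfolding unstereo_def by (intro continuous_intros) (auto simp: one_plus_norm_sq_ne)
      define K where "K = unstereo ` A"
      have K: "compact K" "K \<noteq> {}"
        using A False cu by (auto simp: K_def intro!: compact_continuous_image intro: continuous_on_subset)
      have memK: "unstereo x \<in> K \<longleftrightarrow> x \<in> A" for x
        unfolding K_def by (metis image_iff stereo_unstereo)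
      \<comment> \<open>The distance is taken in the ambient space, so these functions are
        continuous on the whole sphere, pole included, and they decrease to the indicator of
        \<open>K\<close>. Distance to the empty set is 0 by convention, hence the separate case for
        \<open>A\<close>.\<close>
      define g where "g j p = max 0 (1 - real j * infdist p K)" for j and p :: point3
      have z: "(\<integral>x. conf x * F x * g j (unstereo x) \<partial>lborel) = 0" for j
        unfolding g_def by (rule orth_continuous_sphere) (intro continuous_intros)
      have [measurable]: "(\<lambda>x. g j (unstereo x)) \<in> borel_measurable borel" for j
        unfolding g_def by (intro borel_measurable_continuous_onI continuous_intros cu)
      have "(\<lambda>j. \<integral>x. conf x * F x * g j (unstereo x) \<partial>lborel) \<longlonglongrightarrow> (\<integral>x. conf x * F x * indicator A x \<partial>lborel)"
      proof (rule integral_dominated_convergence [where w = "\<lambda>x. conf x * \<bar>F x\<bar>"])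
        have [measurable]: "A \<in> sets borel" using A by (simp add: borel_compact)
        show "(\<lambda>x. conf x * F x * indicator A x) \<in> borel_measurable lborel" by measurable
        have "(\<lambda>j. g j (unstereo x)) \<longlonglongrightarrow> indicator A x" for x
        proof (cases "x \<in> A")
          case True
          then show ?thesis using memK by (simp add: g_def)
        next
          case False
          then have "infdist (unstereo x) K > 0"
            using memK infdist_pos_not_in_closed [OF compact_imp_closed [OF K(1)] K(2)] by simp
          from reals_Archimedean3 [OF this]
          obtain N where N: "real N * infdist (unstereo x) K > 1" by blast
          have "\<forall>\<^sub>F j in sequentially. g j (unstereo x) = 0"
            using eventually_ge_at_top [of N]
          proof eventually_elim
            case (elim j)
            have "real N * infdist (unstereo x) K \<le> real j * infdist (unstereo x) K"
              using elim by (intro mult_right_mono infdist_nonneg) simp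
            then show ?case using N by (simp add: g_def)
          qed
          then show ?thesis using False by (simp add: tendsto_eventually)
        qed
        then show "AE x in lborel. (\<lambda>j. conf x * F x * g j (unstereo x)) \<longlonglongrightarrow> conf x * F x * indicator A x"
          by (intro AE_I2 tendsto_intros)
        have g1: "\<bar>g j p\<bar> \<le> 1" for j p
          using mult_nonneg_nonneg [OF of_nat_0_le_iff [of j] infdist_nonneg [of p K]] by (simp add: g_def max_def)
        have "\<bar>conf x * F x * g j (unstereo x)\<bar> \<le> conf x * \<bar>F x\<bar>" for j x
          using mult_left_mono [OF g1, of "conf x * \<bar>F x\<bar>" j "unstereo x"] conf_pos [of x] by (simp add: abs_mult)
        then show "AE x in lborel. norm (conf x * F x * g j (unstereo x)) \<le> conf x * \<bar>F x\<bar>" for j by simp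
      qed (use F_int in measurable)
      with z show ?thesis by (simp add: LIMSEQ_const_iff mult.commute)
    qed simp
  qed
  then show ?thesis by eventually_elim (use conf_pos in \<open>simp add: less_imp_neq [symmetric]\<close>)
qed

end

section \<open>Orthonormal bases and diagonal operators\<close>

text \<open>Totality is stated as triviality of the orthogonal complement, the form in which the
  eigenfunctions provide it; completeness of the space turns it into density of the span.\<close>

locale hilbert_basis =
  fixes e :: "'i \<Rightarrow> 'h::{real_inner, complete_space}" and K :: "'i set"
  assumes orthonormal: "\<And>i j. i \<in> K \<Longrightarrow> j \<in> K \<Longrightarrow> e i \<bullet> e j = (if i = j then 1 else 0)"
    and total: "\<And>f. (\<And>i. i \<in> K \<Longrightarrow> f \<bullet> e i = 0) \<Longrightarrow> f = 0"
begin

lemma eqI: "(\<And>i. i \<in> K \<Longrightarrow> f \<bullet> e i = g \<bullet> e i) \<Longrightarrow> f = g"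
  using total [of "f - g"] by (simp add: inner_diff_left)

lemma inner_sum_e:
  assumes "finite F" "F \<subseteq> K" "j \<in> K"
  shows "(\<Sum>i\<in>F. c i *\<^sub>R e i) \<bullet> e j = (if j \<in> F then c j else 0)"
proof -
  have "(\<Sum>i\<in>F. c i *\<^sub>R e i) \<bullet> e j = (\<Sum>i\<in>F. c i * (e i \<bullet> e j))"
    by (simp add: inner_sum_left)
  also have "\<dots> = (\<Sum>i\<in>F. if i = j then c i else 0)"
    using assms by (intro sum.cong) (auto simp: orthonormal subset_iff)
  finally have "(\<Sum>i\<in>F. c i *\<^sub>R e i) \<bullet> e j = (\<Sum>i\<in>F. if i = j then c i else 0)" .
  then show ?thesis using assms by simp
qed

lemma norm_sum_e:
  assumes "finite F" "F \<subseteq> K"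
  shows "(norm (\<Sum>i\<in>F. c i *\<^sub>R e i))\<^sup>2 = (\<Sum>i\<in>F. (c i)\<^sup>2)"
proof -
  have "(norm (\<Sum>i\<in>F. c i *\<^sub>R e i))\<^sup>2 = (\<Sum>j\<in>F. c j * ((\<Sum>i\<in>F. c i *\<^sub>R e i) \<bullet> e j))"
    by (simp add: power2_norm_eq_inner inner_sum_right)
  also have "\<dots> = (\<Sum>j\<in>F. (c j)\<^sup>2)"
    using assms(2) by (intro sum.cong) (auto simp: inner_sum_e [OF assms subsetD] power2_eq_square)
  finally show ?thesis .
qed

lemma bessel:
  assumes "finite F" "F \<subseteq> K"
  shows "(\<Sum>i\<in>F. (f \<bullet> e i)\<^sup>2) \<le> (norm f)\<^sup>2"
proof -
  define s where "s = (\<Sum>i\<in>F. (f \<bullet> e i) *\<^sub>R e i)"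
  have 1: "s \<bullet> s = (\<Sum>i\<in>F. (f \<bullet> e i)\<^sup>2)"
    using norm_sum_e [OF assms] by (simp add: s_def power2_norm_eq_inner)
  have 2: "f \<bullet> s = (\<Sum>i\<in>F. (f \<bullet> e i)\<^sup>2)"
    by (simp add: s_def inner_sum_right power2_eq_square)
  have "0 \<le> (f - s) \<bullet> (f - s)" by simp
  also have "\<dots> = f \<bullet> f - 2 * (f \<bullet> s) + s \<bullet> s"
    by (simp add: algebra_simps inner_commute)
  finally show ?thesis using 1 2 by (simp add: power2_norm_eq_inner)
qed

lemma summable_coeffs: "(\<lambda>i. (f \<bullet> e i)\<^sup>2) summable_on K"
  by (rule nonneg_bdd_above_summable_on) (auto intro!: bdd_aboveI2 bessel)

lemma riesz_fischer:
  assumes "(\<lambda>i. (c i)\<^sup>2) summable_on K"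
  shows "(\<lambda>i. c i *\<^sub>R e i) summable_on K"
proof -
  let ?s = "\<lambda>F. \<Sum>i\<in>F. c i *\<^sub>R e i"
  have "cauchy_filter (filtermap ?s (finite_subsets_at_top K))"
    unfolding cauchy_filter_metric_filtermap
  proof (intro allI impI)
    fix r :: real assume "r > 0"
    \<comment> \<open>Two errors below (r/3)^2 add up to less than (r/2)^2, so any two late partial
      sums are within r of each other.\<close>
    then have "(r / 3)\<^sup>2 > 0" by simp
    obtain S where S: "((\<lambda>i. (c i)\<^sup>2) has_sum S) K" using assms summable_on_def by blast
    then have "(sum (\<lambda>i. (c i)\<^sup>2) \<longlongrightarrow> S) (finite_subsets_at_top K)"
      unfolding has_sum_def .
    from tendstoD [OF this \<open>(r / 3)\<^sup>2 > 0\<close>]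
    have "\<forall>\<^sub>F F in finite_subsets_at_top K. dist (\<Sum>i\<in>F. (c i)\<^sup>2) S < (r / 3)\<^sup>2" .
    then have "\<exists>X. finite X \<and> X \<subseteq> K \<and> (\<forall>Y. finite Y \<and> X \<subseteq> Y \<and> Y \<subseteq> K \<longrightarrow>
        dist (\<Sum>i\<in>Y. (c i)\<^sup>2) S < (r / 3)\<^sup>2)"
      by (simp only: eventually_finite_subsets_at_top)
    then obtain F0 where F0: "finite F0" "F0 \<subseteq> K"
      "\<And>F. finite F \<Longrightarrow> F0 \<subseteq> F \<Longrightarrow> F \<subseteq> K \<Longrightarrow> dist (\<Sum>i\<in>F. (c i)\<^sup>2) S < (r / 3)\<^sup>2"
      by (elim exE conjE) simp
    have close: "dist (?s F) (?s F0) < r / 2" if F: "finite F" "F0 \<subseteq> F" "F \<subseteq> K" for F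
    proof -
      have "?s F - ?s F0 = ?s (F - F0)"
        using F by (simp add: sum_diff)
      then have "(dist (?s F) (?s F0))\<^sup>2 = (\<Sum>i\<in>F - F0. (c i)\<^sup>2)"
        using norm_sum_e [of "F - F0" c] F by (auto simp: dist_norm)
      also have "\<dots> = (\<Sum>i\<in>F. (c i)\<^sup>2) - (\<Sum>i\<in>F0. (c i)\<^sup>2)"
        using F F0 by (simp add: sum_diff)
      also have "\<dots> < 2 * (r / 3)\<^sup>2"
        using F0(3) [OF F] F0(3) [OF F0(1) _ F0(2)] by (simp add: dist_real_def)
      also have "\<dots> \<le> (r / 2)\<^sup>2" by (simp add: power2_eq_square)
      finally show ?thesis
        using power2_less_imp_less [of "dist (?s F) (?s F0)" "r / 2"] \<open>r > 0\<close> by simp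
    qed
    show "\<exists>P. eventually P (finite_subsets_at_top K) \<and> (\<forall>x y. P x \<and> P y \<longrightarrow> dist (?s x) (?s y) < r)"
    proof (intro exI conjI allI impI)
      show "\<forall>\<^sub>F F in finite_subsets_at_top K. finite F \<and> F0 \<subseteq> F \<and> F \<subseteq> K"
        unfolding eventually_finite_subsets_at_top using F0 by blast
      fix F G assume "(finite F \<and> F0 \<subseteq> F \<and> F \<subseteq> K) \<and> finite G \<and> F0 \<subseteq> G \<and> G \<subseteq> K"
      then show "dist (?s F) (?s G) < r"
        using close [of F] close [of G] dist_triangle_half_r [of "?s F0" "?s F" r "?s G"]
        by (simp add: dist_commute)
    qed
  qed
  moreover have "complete (UNIV :: 'h set)"
    by (meson Cauchy_convergent UNIV_I complete_def convergent_def)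
  ultimately obtain x where "filtermap ?s (finite_subsets_at_top K) \<le> nhds x"
    using cauchy_filter_complete_converges [of "filtermap ?s (finite_subsets_at_top K)" UNIV]
    by (auto simp: filtermap_bot_iff)
  then show ?thesis
    by (auto simp: summable_on_def has_sum_def filterlim_def)
qed

lemma inner_has_sum:
  assumes "((\<lambda>i. c i *\<^sub>R e i) has_sum g) K" "j \<in> K"
  shows "g \<bullet> e j = c j"
proof -
  have "((\<lambda>i. (c i *\<^sub>R e i) \<bullet> e j) has_sum (g \<bullet> e j)) K"
    by (rule has_sum_bounded_linear [OF bounded_linear_inner_left assms(1)])
  then have "((\<lambda>i. (c i *\<^sub>R e i) \<bullet> e j) has_sum (g \<bullet> e j)) {j}"
    by (subst (asm) has_sum_cong_neutral [where T = "{j}" and g = "\<lambda>i. (c i *\<^sub>R e i) \<bullet> e j"])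
      (use assms(2) in \<open>auto simp: orthonormal\<close>)
  then show ?thesis
    using assms(2) by (simp add: has_sum_finite_iff orthonormal)
qed

lemma expansion: "((\<lambda>i. (f \<bullet> e i) *\<^sub>R e i) has_sum f) K"
proof -
  obtain g where g: "((\<lambda>i. (f \<bullet> e i) *\<^sub>R e i) has_sum g) K"
    using riesz_fischer [OF summable_coeffs, of f] summable_on_def by blast
  moreover have "g = f" by (rule eqI) (rule inner_has_sum [OF g])
  ultimately show ?thesis by simp
qed

lemma parseval: "((\<lambda>i. (f \<bullet> e i) * (g \<bullet> e i)) has_sum (f \<bullet> g)) K"
  using has_sum_bounded_linear [OF bounded_linear_inner_left expansion, of g f]
  by (simp add: inner_commute mult.commute)

lemma parseval_norm: "((\<lambda>i. (f \<bullet> e i)\<^sup>2) has_sum (norm f)\<^sup>2) K"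
  using parseval [of f f] by (simp add: power2_eq_square power2_norm_eq_inner [symmetric])

lemma orthonormal_basis_image: "orthonormal_basis (e ` K)"
  unfolding orthonormal_basis_def
proof (intro conjI ballI)
  show "pairwise orthogonal (e ` K)"
    by (auto simp: pairwise_def orthogonal_def orthonormal split: if_splits)
  show "norm x = 1" if "x \<in> e ` K" for x
    using that by (auto simp: norm_eq_sqrt_inner orthonormal)
  have "f \<in> closure (span (e ` K))" for f
  proof (rule Lim_in_closed_set [OF closed_closure])
    show "((\<lambda>F. \<Sum>i\<in>F. (f \<bullet> e i) *\<^sub>R e i) \<longlongrightarrow> f) (finite_subsets_at_top K)"
      using expansion [of f] by (simp add: has_sum_def)
    have "(\<Sum>i\<in>F. (f \<bullet> e i) *\<^sub>R e i) \<in> span (e ` K)" if "F \<subseteq> K" for F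
      using that by (intro span_sum span_scale span_base) auto
    then show "\<forall>\<^sub>F F in finite_subsets_at_top K.
        (\<Sum>i\<in>F. (f \<bullet> e i) *\<^sub>R e i) \<in> closure (span (e ` K))"
      unfolding eventually_finite_subsets_at_top using closure_subset by (intro exI [of _ "{}"]) blast
  qed simp
  then show "closure (span (e ` K)) = UNIV" by blast
qed

text \<open>The sum is meaningful for bounded \<open>c\<close>, which the facts below assume;
  otherwise it may take the default value 0.\<close>

definition diag :: "('i \<Rightarrow> real) \<Rightarrow> 'h \<Rightarrow> 'h" where
  "diag c f = infsum (\<lambda>i. (c i * (f \<bullet> e i)) *\<^sub>R e i) K"

lemma diag_has_sum:
  assumes "\<And>i. i \<in> K \<Longrightarrow> \<bar>c i\<bar> \<le> C"
  shows "((\<lambda>i. (c i * (f \<bullet> e i)) *\<^sub>R e i) has_sum diag c f) K"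
proof -
  have "(\<lambda>i. (c i * (f \<bullet> e i))\<^sup>2) summable_on K"
  proof (rule summable_on_comparison_test)
    show "(\<lambda>i. C\<^sup>2 * (f \<bullet> e i)\<^sup>2) summable_on K"
      by (intro summable_on_cmult_right summable_coeffs)
    show "(c i * (f \<bullet> e i))\<^sup>2 \<le> C\<^sup>2 * (f \<bullet> e i)\<^sup>2" if "i \<in> K" for i
    proof -
      have "\<bar>c i\<bar> \<le> \<bar>C\<bar>" using assms [OF that] by linarith
      then show ?thesis
        unfolding power_mult_distrib abs_le_square_iff by (intro mult_right_mono) auto
    qed
  qed auto
  from riesz_fischer [OF this] show ?thesis
    unfolding diag_def by (rule has_sum_infsum)
qed

lemma inner_diag:
  assumes "\<And>i. i \<in> K \<Longrightarrow> \<bar>c i\<bar> \<le> C" "j \<in> K"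
  shows "diag c f \<bullet> e j = c j * (f \<bullet> e j)"
  using inner_has_sum [OF diag_has_sum [of c C f, OF assms(1)] assms(2)] .

lemma bounded_linear_diag:
  assumes "\<And>i. i \<in> K \<Longrightarrow> \<bar>c i\<bar> \<le> C"
  shows "bounded_linear (diag c)"
proof (rule bounded_linear_intro)
  note i = inner_diag [of c C, OF assms]
  show "diag c (f + g) = diag c f + diag c g" for f g
    by (rule eqI) (simp add: i inner_left_distrib algebra_simps)
  show "diag c (r *\<^sub>R f) = r *\<^sub>R diag c f" for f r
    by (rule eqI) (simp add: i)
  show "norm (diag c f) \<le> norm f * \<bar>C\<bar>" for f
  proof -
    have "(norm (diag c f))\<^sup>2 \<le> C\<^sup>2 * (norm f)\<^sup>2"
    proof (rule has_sum_mono)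
      show "((\<lambda>i. (diag c f \<bullet> e i)\<^sup>2) has_sum (norm (diag c f))\<^sup>2) K" by (rule parseval_norm)
      show "((\<lambda>i. C\<^sup>2 * (f \<bullet> e i)\<^sup>2) has_sum C\<^sup>2 * (norm f)\<^sup>2) K"
        by (intro has_sum_cmult_right parseval_norm)
      show "(diag c f \<bullet> e j)\<^sup>2 \<le> C\<^sup>2 * (f \<bullet> e j)\<^sup>2" if "j \<in> K" for j
      proof -
        have "\<bar>c j\<bar> \<le> \<bar>C\<bar>" using assms [OF that] by linarith
        then show ?thesis
          unfolding i [OF _ that, simplified] power_mult_distrib abs_le_square_iff
          by (intro mult_right_mono) auto
      qed
    qed
    then have "(norm (diag c f))\<^sup>2 \<le> (norm f * \<bar>C\<bar>)\<^sup>2" by (simp add: power_mult_distrib mult.commute)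
    then show ?thesis by (rule power2_le_imp_le) simp
  qed
qed

lemma diag_eqI:
  assumes "bounded_linear T" "\<And>i. i \<in> K \<Longrightarrow> T (e i) = c i *\<^sub>R e i"
    and j: "j \<in> K"
  shows "T f \<bullet> e j = c j * (f \<bullet> e j)"
proof -
  interpret T: bounded_linear T by fact
  have "((\<lambda>i. T ((f \<bullet> e i) *\<^sub>R e i)) has_sum T f) K"
    by (rule has_sum_bounded_linear [OF assms(1) expansion])
  then have "((\<lambda>i. (c i * (f \<bullet> e i)) *\<^sub>R e i) has_sum T f) K"
    by (subst (asm) has_sum_cong [where g = "\<lambda>i. (c i * (f \<bullet> e i)) *\<^sub>R e i"])
      (simp_all add: T.scaleR assms(2) mult.commute)
  from inner_has_sum [OF this j] show ?thesis .
qed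

end

lemma hilbert_basis_orthonormal_basis:
  fixes B :: "'h::{real_inner, complete_space} set"
  assumes B: "orthonormal_basis B"
  shows "hilbert_basis (\<lambda>b. b) B"
proof
  show "i \<bullet> j = (if i = j then 1 else 0)" if "i \<in> B" "j \<in> B" for i j
    using B that unfolding orthonormal_basis_def pairwise_def orthogonal_def
    by (auto simp: norm_eq_sqrt_inner)
  fix f :: 'h assume 0: "\<And>b. b \<in> B \<Longrightarrow> f \<bullet> b = 0"
  have "span B \<subseteq> {x. f \<bullet> x = 0}"
  proof (rule span_minimal)
    show "subspace {x. f \<bullet> x = 0}" by (auto simp: subspace_def inner_right_distrib)
  qed (use 0 in auto)
  moreover have "closed {x. f \<bullet> x = 0}"
    by (intro closed_Collect_eq continuous_intros)
  ultimately have "closure (span B) \<subseteq> {x. f \<bullet> x = 0}" by (rule closure_minimal)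
  with B have "f \<bullet> f = 0" unfolding orthonormal_basis_def by blast
  then show "f = 0" by simp
qed

text \<open>Parseval in both bases turns the sum over an arbitrary basis into a double series of
  nonnegative terms.\<close>

lemma (in hilbert_basis) has_trace_diag:
  assumes T: "\<And>i. i \<in> K \<Longrightarrow> blinfun_apply T (e i) = c i *\<^sub>R e i"
    and c: "\<And>i. i \<in> K \<Longrightarrow> c i \<ge> 0" "(c has_sum \<tau>) K"
  shows "has_trace T \<tau>"
  unfolding has_trace_def
proof (intro conjI allI impI)
  note coeff = diag_eqI [OF blinfun.bounded_linear_right [of T], of c, OF T]
  have p: "((\<lambda>i. c i * (f \<bullet> e i) * (g \<bullet> e i)) has_sum (T f \<bullet> g)) K" for f g
    using parseval [of "T f" g]
    by (subst (asm) has_sum_cong [where g = "\<lambda>i. c i * (f \<bullet> e i) * (g \<bullet> e i)"]) (simp_all add: coeff)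
  show "T f \<bullet> g = f \<bullet> T g" for f g
    using has_sum_unique [OF p [of f g]] p [of g f] by (simp add: inner_commute mult.commute mult.left_commute)
  show "0 \<le> f \<bullet> T f" for f
    using has_sum_nonneg [OF p [of f f]] c(1) by (simp add: inner_commute mult.assoc)
  show "\<exists>B::'h set. orthonormal_basis B" using orthonormal_basis_image by blast
  fix B :: "'h set" assume "orthonormal_basis B"
  then interpret B: hilbert_basis "\<lambda>b. b" B by (rule hilbert_basis_orthonormal_basis)
  define F where "F = (\<lambda>(i, b). c i * (b \<bullet> e i)\<^sup>2)"
  have 1: "((\<lambda>b. F (i, b)) has_sum c i) B" if "i \<in> K" for i
    using has_sum_cmult_right [OF B.parseval_norm [of "e i"], of "c i"] orthonormal [OF that that]
    by (simp add: F_def inner_commute power2_norm_eq_inner)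
  have "F summable_on K \<times> B"
    by (rule summable_on_SigmaI [OF 1]) (use c in \<open>auto simp: F_def has_sum_imp_summable\<close>)
  with 1 c(2) have "(F has_sum \<tau>) (K \<times> B)" by (rule has_sum_SigmaI)
  then have "((\<lambda>(b, i). F (i, b)) has_sum \<tau>) (B \<times> K)" by (subst (asm) has_sum_swap)
  then show "((\<lambda>b. b \<bullet> T b) has_sum \<tau>) B"
  proof (rule has_sum_SigmaD)
    show "((\<lambda>i. case (b, i) of (b, i) \<Rightarrow> F (i, b)) has_sum b \<bullet> T b) K" for b
      using p [of b b] by (simp add: F_def inner_commute power2_eq_square mult.assoc)
  qed
qed

section \<open>Projection-valued measures\<close>

lemma
  assumes P: "projection_valued_measure P"
  shows pvm_inner_commute: "B \<in> sets borel \<Longrightarrow> P B f \<bullet> g = f \<bullet> P B g"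
    and pvm_Int: "B \<in> sets borel \<Longrightarrow> C \<in> sets borel \<Longrightarrow> P B (P C f) = P (B \<inter> C) f"
    and pvm_UNIV: "P UNIV f = f"
    and pvm_sums: "range A \<subseteq> sets borel \<Longrightarrow> disjoint_family A \<Longrightarrow>
        (\<lambda>n::nat. P (A n) f) sums P (\<Union>n. A n) f"
  using P unfolding projection_valued_measure_def by auto

text \<open>A series with constant terms converges only if the terms are zero.\<close>

lemma pvm_empty:
  assumes P: "projection_valued_measure P"
  shows "P {} f = 0"
proof -
  have "(\<lambda>n::nat. P {} f) sums P {} f"
    using pvm_sums [OF P, of "\<lambda>_. {}" f] by (simp add: disjoint_family_on_def)
  then have "(\<lambda>n::nat. P {} f) \<longlonglongrightarrow> 0"
    using sums_summable summable_LIMSEQ_zero by blast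
  then show ?thesis by (simp add: LIMSEQ_const_iff)
qed

lemma pvm_Un:
  assumes P: "projection_valued_measure P" and "B \<in> sets borel" "C \<in> sets borel" "B \<inter> C = {}"
  shows "P (B \<union> C) f = P B f + P C f"
proof -
  have "(\<lambda>n. P (binaryset B C n) f) sums P (\<Union>n. binaryset B C n) f"
    using assms by (intro pvm_sums) (auto simp: range_binaryset_eq disjoint_family_on_def binaryset_def)
  moreover have "(\<lambda>n. P (binaryset B C n) f) sums (P B f + P C f)"
    by (rule binaryset_sums) (rule pvm_empty [OF P])
  ultimately show ?thesis by (metis UN_binaryset_eq sums_unique2)
qed

lemma pvm_inner_eq_norm:
  assumes "projection_valued_measure P" "B \<in> sets borel"
  shows "f \<bullet> P B f = (norm (P B f))\<^sup>2"
  using pvm_inner_commute [OF assms, of f "P B f"] pvm_Int [OF assms assms(2), of f]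
  by (simp add: power2_norm_eq_inner)

lemma
  assumes P: "projection_valued_measure P"
  shows sets_scalar_measure [simp]: "sets (scalar_measure P f) = sets borel"
    and space_scalar_measure [simp]: "space (scalar_measure P f) = UNIV"
    and emeasure_scalar_measure:
      "B \<in> sets borel \<Longrightarrow> emeasure (scalar_measure P f) B = ennreal (f \<bullet> P B f)"
proof -
  show 1: "sets (scalar_measure P f) = sets borel" "space (scalar_measure P f) = UNIV"
    unfolding scalar_measure_def by (simp_all add: sets.sigma_sets_eq [of borel, simplified])
  assume B: "B \<in> sets borel"
  have "countably_additive (sets (scalar_measure P f)) (\<lambda>B. ennreal (f \<bullet> P B f))"
  proof (rule countably_additiveI)
    fix A :: "nat \<Rightarrow> real set"
    assume A: "range A \<subseteq> sets (scalar_measure P f)" "disjoint_family A"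
    then have "(\<lambda>n. f \<bullet> P (A n) f) sums (f \<bullet> P (\<Union>n. A n) f)"
      using bounded_linear.sums [OF bounded_linear_inner_right pvm_sums [OF P, of A f]] 1 by simp
    moreover have "0 \<le> f \<bullet> P (A n) f" for n
      using A 1 by (subst pvm_inner_eq_norm [OF P]) auto
    ultimately show "(\<Sum>n. ennreal (f \<bullet> P (A n) f)) = ennreal (f \<bullet> P (\<Union>n. A n) f)"
      by (intro suminf_ennreal_eq) auto
  qed
  then show "emeasure (scalar_measure P f) B = ennreal (f \<bullet> P B f)"
    using B 1 unfolding scalar_measure_def
    by (intro emeasure_measure_of) (auto simp: positive_def pvm_empty [OF P] scalar_measure_def)
qed

lemma finite_measure_scalar_measure:
  "projection_valued_measure P \<Longrightarrow> finite_measure (scalar_measure P f)"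
  by (rule finite_measureI) (simp add: emeasure_scalar_measure)

lemma scalar_measure_eqI:
  assumes P: "projection_valued_measure P" and "sets M = sets borel"
    "\<And>B. B \<in> sets borel \<Longrightarrow> emeasure M B = ennreal (f \<bullet> P B f)"
  shows "scalar_measure P f = M"
  using assms by (intro measure_eqI) (auto simp: emeasure_scalar_measure)

text \<open>An eigenvector \<open>e\<close> of the spectral integral of the identity has its scalar measure
  concentrated at the eigenvalue: testing against \<open>P B e\<close> shows that the integral of \<open>s - l\<close>
  over every Borel set \<open>B\<close> vanishes.\<close>

lemma pvm_eigenvector:
  assumes P: "projection_valued_measure P" and A: "is_spectral_integral P (\<lambda>s. s) D A"
    and e: "e \<in> D" "A e = l *\<^sub>R e"
  shows "P {l} e = e"
proof -
  let ?\<mu> = "scalar_measure P e"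
  interpret \<mu>: finite_measure ?\<mu> by (rule finite_measure_scalar_measure [OF P])
  note [measurable_cong] = sets_scalar_measure [OF P]
  have sq: "integrable ?\<mu> (\<lambda>s. s\<^sup>2)"
    using A e(1) unfolding is_spectral_integral_def by auto
  have id: "integrable ?\<mu> (\<lambda>s. s)"
  proof (rule Bochner_Integration.integrable_bound)
    show "integrable ?\<mu> (\<lambda>s. 1 + s\<^sup>2)" using sq by simp
    have "\<bar>s\<bar> \<le> 1 + s\<^sup>2" for s :: real
      using sum_power2_ge_zero [of "\<bar>s\<bar> - 1" 0] by (simp add: power2_eq_square algebra_simps)
    then show "AE s in ?\<mu>. norm s \<le> norm (1 + s\<^sup>2)" by simp
  qed simp
  have mult: "(\<integral>s. indicator B s * (s - l) \<partial>?\<mu>) = 0" if B: "B \<in> sets borel" for B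
  proof -
    define h where "h = P B e"
    have PC: "P C h = P (C \<inter> B) e" if "C \<in> sets borel" for C
      unfolding h_def using pvm_Int [OF P that B] .
    have eB: "e \<bullet> P (C \<inter> B) e = measure ?\<mu> (C \<inter> B)" "e \<bullet> P C e = measure ?\<mu> C"
      if "C \<in> sets borel" for C
      using that B emeasure_scalar_measure [OF P, of _ e] pvm_inner_eq_norm [OF P, of _ e]
      by (simp_all add: measure_def)
    have hC: "h \<bullet> P C h = measure ?\<mu> (C \<inter> B)" "h \<bullet> P C e = measure ?\<mu> (C \<inter> B)"
        "e \<bullet> P C h = measure ?\<mu> (C \<inter> B)" if C: "C \<in> sets borel" for C
    proof -
      have CB: "C \<inter> B \<in> sets borel" using B C by auto
      have "h \<bullet> P C h = e \<bullet> P (C \<inter> B) e"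
        using pvm_inner_commute [OF P B, of e "P (C \<inter> B) e"] pvm_Int [OF P B CB, of e]
        by (simp add: PC [OF C] h_def [symmetric] Int_ac)
      moreover have "h \<bullet> P C e = e \<bullet> P (C \<inter> B) e"
        using pvm_inner_commute [OF P B, of e "P C e"] pvm_Int [OF P B C, of e]
        by (simp add: h_def [symmetric] Int_ac)
      ultimately show "h \<bullet> P C h = measure ?\<mu> (C \<inter> B)" "h \<bullet> P C e = measure ?\<mu> (C \<inter> B)"
        "e \<bullet> P C h = measure ?\<mu> (C \<inter> B)"
        using eB(1) [OF C] by (simp_all add: PC [OF C])
    qed
    have emB: "(\<integral>\<^sup>+ s. ennreal (a + b * indicator B s) * indicator C s \<partial>?\<mu>)
        = ennreal (a * measure ?\<mu> C + b * measure ?\<mu> (C \<inter> B))"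
      if C: "C \<in> sets borel" and ab: "\<And>s. 0 \<le> a + b * indicator B (s::real)" for a b :: real and C
    proof -
      have "(\<integral>\<^sup>+ s. ennreal (a + b * indicator B s) * indicator C s \<partial>?\<mu>)
          = (\<integral>\<^sup>+ s. ennreal (a * indicator C s + b * indicator (C \<inter> B) s) \<partial>?\<mu>)"
        by (intro nn_integral_cong) (auto simp: indicator_def)
      also have "\<dots> = ennreal (\<integral>s. a * indicator C s + b * indicator (C \<inter> B) s \<partial>?\<mu>)"
      proof (rule nn_integral_eq_integral)
        show "integrable ?\<mu> (\<lambda>s. a * indicator C s + b * indicator (C \<inter> B) s)"
          using B C by (auto simp: less_top [symmetric] intro!: Bochner_Integration.integrable_add
              integrable_mult_right integrable_real_indicator)
        show "AE s in ?\<mu>. 0 \<le> a * indicator C s + b * indicator (C \<inter> B) s"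
        proof (rule AE_I2)
          fix s
          show "0 \<le> a * indicator C s + b * indicator (C \<inter> B) s"
            using ab [of s] by (cases "s \<in> C"; cases "s \<in> B") auto
        qed
      qed
      also have "(\<integral>s. a * indicator C s + b * indicator (C \<inter> B) s \<partial>?\<mu>)
          = a * measure ?\<mu> C + b * measure ?\<mu> (C \<inter> B)"
        using B C by (subst Bochner_Integration.integral_add)
          (auto simp: less_top [symmetric] intro!: integrable_mult_right integrable_real_indicator)
      finally show ?thesis .
    qed
    have dens: "scalar_measure P f = density ?\<mu> (\<lambda>s. ennreal (a + b * indicator B s))"
      if "\<And>C. C \<in> sets borel \<Longrightarrow> f \<bullet> P C f = a * measure ?\<mu> C + b * measure ?\<mu> (C \<inter> B)"
        "\<And>s. 0 \<le> a + b * indicator B (s::real)" for f a b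
    proof (rule scalar_measure_eqI [OF P])
      fix C :: "real set" assume C: "C \<in> sets borel"
      then show "emeasure (density ?\<mu> (\<lambda>s. ennreal (a + b * indicator B s))) C = ennreal (f \<bullet> P C f)"
        using emB [OF C that(2)] that(1) [OF C] B by (subst emeasure_density) auto
    qed (simp add: P)
    \<comment> \<open>In spectral terms \<open>h\<close> is \<open>e\<close> multiplied by the
      indicator of \<open>B\<close>. Squaring 1 plus and 1 minus that indicator gives the densities
      1 + 3 on \<open>B\<close> for \<open>h + e\<close> and 1 - 1 on \<open>B\<close> for
      \<open>h - e\<close>.\<close>
    have d0: "scalar_measure P h = density ?\<mu> (\<lambda>s. ennreal (0 + 1 * indicator B s))"
      by (rule dens) (auto simp: hC)
    have d1: "scalar_measure P (h + e) = density ?\<mu> (\<lambda>s. ennreal (1 + 3 * indicator B s))"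
      by (rule dens) (auto simp: hC eB blinfun.add_right algebra_simps)
    have d2: "scalar_measure P (h - e) = density ?\<mu> (\<lambda>s. ennreal (1 + (-1) * indicator B s))"
      by (rule dens) (auto simp: hC eB blinfun.diff_right algebra_simps indicator_def)
    have B' [measurable]: "B \<in> sets borel" by (rule B)
    \<comment> \<open>The polarized formula is available only for vectors of the domain, so
      \<open>h\<close> has to be shown to lie in it.\<close>
    have "integrable (scalar_measure P h) (\<lambda>s. s\<^sup>2)"
      unfolding d0 using integrable_mult_indicator [of B ?\<mu> "\<lambda>s. s\<^sup>2"] sq B
      by (subst integrable_density) auto
    then have "h \<in> D" using A unfolding is_spectral_integral_def by auto
    then have "h \<bullet> A e = ((\<integral>s. s \<partial>scalar_measure P (h + e)) - (\<integral>s. s \<partial>scalar_measure P (h - e))) / 4"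
      using A e(1) unfolding is_spectral_integral_def by blast
    also have "(\<integral>s. s \<partial>scalar_measure P (h + e)) = (\<integral>s. (1 + 3 * indicator B s) *\<^sub>R s \<partial>?\<mu>)"
      unfolding d1 by (rule integral_density) auto
    also have "(\<integral>s. s \<partial>scalar_measure P (h - e)) = (\<integral>s. (1 + (-1) * indicator B s) *\<^sub>R s \<partial>?\<mu>)"
      unfolding d2 by (rule integral_density) (auto simp: indicator_def)
    finally have "l * (h \<bullet> e) = ((\<integral>s. (1 + 3 * indicator B s) *\<^sub>R s \<partial>?\<mu>)
        - (\<integral>s. (1 + (-1) * indicator B s) *\<^sub>R s \<partial>?\<mu>)) / 4"
      using e(2) by simp
    moreover have iB: "integrable ?\<mu> (\<lambda>s. indicator B s * s)"
      using integrable_mult_indicator [of B ?\<mu> "\<lambda>s. s"] id B by simp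
    ultimately have "l * (h \<bullet> e) = (\<integral>s. indicator B s * s \<partial>?\<mu>)"
      using id by (simp add: distrib_right left_diff_distrib mult.assoc)
    moreover have "h \<bullet> e = measure ?\<mu> B"
      using eB(2) [OF B] by (simp add: h_def inner_commute)
    moreover have "(\<integral>s. indicator B s * (s - l) \<partial>?\<mu>) = (\<integral>s. indicator B s * s - indicator B s * l \<partial>?\<mu>)"
      by (simp add: right_diff_distrib)
    moreover have "integrable ?\<mu> (indicator B :: real \<Rightarrow> real)"
      using B by (intro integrable_real_indicator) (auto simp: less_top [symmetric])
    ultimately show ?thesis using iB B by (simp add: mult.commute)
  qed
  have "AE s in ?\<mu>. s - l = 0"
    by (rule density_unique_real)
      (use id mult in \<open>auto simp: set_lebesgue_integral_def sets_scalar_measure [OF P]\<close>)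
  then have "AE s in ?\<mu>. s \<notin> - {l}" by eventually_elim simp
  then have "emeasure ?\<mu> (- {l}) = 0"
    by (subst (asm) AE_iff_measurable [of "- {l}"]) (auto simp: P)
  then have "norm (P (- {l}) e) = 0"
    by (simp add: emeasure_scalar_measure [OF P] pvm_inner_eq_norm [OF P])
  moreover have "P ({l} \<union> - {l}) e = P {l} e + P (- {l}) e"
    by (rule pvm_Un [OF P]) auto
  ultimately show ?thesis
    using pvm_UNIV [OF P, of e] by (simp add: Un_commute)
qed

text \<open>Split \<open>g\<close> into its component in the range of \<open>P {l}\<close> and the
  rest. For the first, \<open>g + e\<close> and \<open>g - e\<close> have scalar measures
  concentrated at \<open>l\<close>, and polarization gives \<phi>(l) times the scalar product. For
  the rest the mixed terms vanish, so both scalar measures coincide and the difference of the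
  integrals is zero.\<close>

lemma pvm_function_eigenvector:
  assumes P: "projection_valued_measure P" and T: "is_spectral_integral P \<phi> UNIV T"
    and e: "P {l} e = e" and \<phi>: "\<phi> \<in> borel_measurable borel"
  shows "T e = \<phi> l *\<^sub>R e"
proof -
  have pol: "g \<bullet> T e = ((\<integral>s. \<phi> s \<partial>scalar_measure P (g + e)) - (\<integral>s. \<phi> s \<partial>scalar_measure P (g - e))) / 4" for g
    using T unfolding is_spectral_integral_def by blast
  have Pe: "P C e = indicator C l *\<^sub>R e" if C: "C \<in> sets borel" for C
  proof -
    have "P C e = P (C \<inter> {l}) e"
      using pvm_Int [OF P C, of "{l}" e] e by simp
    then show ?thesis using e pvm_empty [OF P] by (cases "l \<in> C") auto
  qed
  have conc: "(\<integral>s. \<phi> s \<partial>scalar_measure P f) = \<phi> l * (norm f)\<^sup>2" if f: "P {l} f = f" for f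
  proof -
    have "f = P {l} f + P (- {l}) f"
      using pvm_Un [OF P, of "{l}" "- {l}" f] pvm_UNIV [OF P, of f] by simp
    then have "P (- {l}) f = 0" using f by simp
    then have "emeasure (scalar_measure P f) (- {l}) = 0"
      by (simp add: emeasure_scalar_measure [OF P])
    then have ae: "AE s in scalar_measure P f. \<phi> s = \<phi> l"
      by (intro AE_I [where N = "- {l}"]) (auto simp: P)
    have "(\<integral>s. \<phi> s \<partial>scalar_measure P f) = (\<integral>s. \<phi> l \<partial>scalar_measure P f)"
      using \<phi> measurable_cong_sets [OF sets_scalar_measure [OF P] refl]
      by (intro integral_cong_AE ae) auto
    also have "\<dots> = \<phi> l * measure (scalar_measure P f) UNIV"
      by (simp add: P)
    also have "measure (scalar_measure P f) UNIV = (norm f)\<^sup>2"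
      by (simp add: measure_def emeasure_scalar_measure [OF P] pvm_UNIV [OF P] power2_norm_eq_inner)
    finally show ?thesis .
  qed
  have "g \<bullet> T e = g \<bullet> (\<phi> l *\<^sub>R e)" for g
  proof -
    define g1 where "g1 = P {l} g"
    define g0 where "g0 = g - g1"
    have l: "{l} \<in> sets borel" by simp
    have g1: "P {l} g1 = g1" unfolding g1_def using pvm_Int [OF P l l] by simp
    have g0: "P {l} g0 = 0" unfolding g0_def by (simp add: blinfun.diff_right g1) (simp add: g1_def)
    have "g0 \<bullet> e = 0" using pvm_inner_commute [OF P l, of g0 e] g0 e by simp
    have "g1 \<bullet> T e = (\<phi> l * (norm (g1 + e))\<^sup>2 - \<phi> l * (norm (g1 - e))\<^sup>2) / 4"
      unfolding pol by (subst (1 2) conc) (simp_all add: blinfun.add_right blinfun.diff_right g1 e)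
    also have "\<dots> = \<phi> l * (g1 \<bullet> e)"
      by (simp add: power2_norm_eq_inner algebra_simps inner_commute)
    finally have 1: "g1 \<bullet> T e = \<phi> l * (g1 \<bullet> e)" .
    have "scalar_measure P (g0 + e) = scalar_measure P (g0 - e)"
    proof (rule scalar_measure_eqI [OF P])
      fix C :: "real set" assume C: "C \<in> sets borel"
      have "e \<bullet> P C g0 = 0" "g0 \<bullet> P C e = 0"
        using pvm_inner_commute [OF P C, of e g0] Pe [OF C] \<open>g0 \<bullet> e = 0\<close> by (auto simp: inner_commute)
      then have "(g0 + e) \<bullet> P C (g0 + e) = (g0 - e) \<bullet> P C (g0 - e)"
        by (simp add: blinfun.add_right blinfun.diff_right algebra_simps)
      then show "emeasure (scalar_measure P (g0 - e)) C = ennreal ((g0 + e) \<bullet> P C (g0 + e))"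
        using C by (simp add: emeasure_scalar_measure [OF P])
    qed (simp add: P)
    then have 0: "g0 \<bullet> T e = 0" unfolding pol by simp
    have "g = g0 + g1" by (simp add: g0_def)
    with 0 1 \<open>g0 \<bullet> e = 0\<close> show ?thesis by (simp add: inner_left_distrib)
  qed
  then show ?thesis by (metis inner_eq_zero_iff inner_diff_right right_minus_eq)
qed

section \<open>Spectral measures of diagonal operators\<close>

lemma integrable_count_space_iff:
  "integrable (count_space K) f \<longleftrightarrow> f summable_on K" for f :: "'i \<Rightarrow> real"
  by (metis Infinite_Set_Sum.abs_summable_on_def abs_summable_equivalent summable_on_iff_abs_summable_on_real)

lemma integral_count_space_has_sum:
  "(f has_sum s) K \<Longrightarrow> integral\<^sup>L (count_space K) f = s" for f :: "'i \<Rightarrow> real"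
  by (metis Infinite_Set_Sum.abs_summable_on_def has_sum_imp_summable infsetsum_def infsetsum_infsum
      infsumI integrable_count_space_iff)

lemma nn_integral_count_space_has_sum:
  fixes f :: "'i \<Rightarrow> real"
  assumes "(f has_sum s) K" "\<And>i. i \<in> K \<Longrightarrow> 0 \<le> f i"
  shows "(\<integral>\<^sup>+ i. ennreal (f i) \<partial>count_space K) = ennreal s"
proof -
  have "integrable (count_space K) f"
    using assms(1) integrable_count_space_iff has_sum_imp_summable by blast
  then show ?thesis
    using integral_count_space_has_sum [OF assms(1)] assms(2)
    by (subst nn_integral_eq_integral) (auto simp: AE_count_space)
qed

locale spectral_basis = hilbert_basis +
  fixes \<mu> :: "'a \<Rightarrow> real"
begin

definition proj :: "real set \<Rightarrow> 'b \<Rightarrow>\<^sub>L 'b" where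
  "proj B = Blinfun (diag (\<lambda>i. indicator B (\<mu> i)))"

lemma proj_apply: "proj B f = diag (\<lambda>i. indicator B (\<mu> i)) f"
  unfolding proj_def
  by (subst bounded_linear_Blinfun_apply [OF bounded_linear_diag [where C = 1]]) auto

lemma inner_proj: "i \<in> K \<Longrightarrow> proj B f \<bullet> e i = indicator B (\<mu> i) * (f \<bullet> e i)"
  unfolding proj_apply by (rule inner_diag [where C = 1]) auto

lemma proj_has_sum: "((\<lambda>i. (f \<bullet> e i) *\<^sub>R e i) has_sum proj B f) {i \<in> K. \<mu> i \<in> B}"
proof -
  have "((\<lambda>i. (indicator B (\<mu> i) * (f \<bullet> e i)) *\<^sub>R e i) has_sum proj B f) K"
    unfolding proj_apply by (rule diag_has_sum [where C = 1]) auto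
  then show ?thesis
    by (subst (asm) has_sum_cong_neutral [where T = "{i \<in> K. \<mu> i \<in> B}" and g = "\<lambda>i. (f \<bullet> e i) *\<^sub>R e i"])
      auto
qed

lemma inner_proj_has_sum:
  "((\<lambda>i. indicator B (\<mu> i) * (f \<bullet> e i) * (g \<bullet> e i)) has_sum (proj B f \<bullet> g)) K"
  using parseval [of "proj B f" g]
  by (subst (asm) has_sum_cong [where g = "\<lambda>i. indicator B (\<mu> i) * (f \<bullet> e i) * (g \<bullet> e i)"])
    (simp_all add: inner_proj)

lemma pvm_proj: "projection_valued_measure proj"
  unfolding projection_valued_measure_def
proof (intro conjI ballI allI impI)
  show "proj B f \<bullet> g = f \<bullet> proj B g" for B f g
    using has_sum_unique [OF inner_proj_has_sum [of B f g]] inner_proj_has_sum [of B g f]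
    by (simp add: inner_commute mult.commute mult.left_commute)
  show "proj (B \<inter> C) f = proj B (proj C f)" for B C f
    by (rule eqI) (simp add: inner_proj indicator_inter_arith)
  show "proj UNIV f = f" for f
    by (rule eqI) (simp add: inner_proj)
  fix B :: "nat \<Rightarrow> real set" and f assume "disjoint_family B"
  let ?S = "\<lambda>n. {i \<in> K. \<mu> i \<in> B n}"
  \<comment> \<open>Countable additivity is the regrouping of one unordered sum along the disjoint
    sets of indices whose eigenvalue lies in \<open>B n\<close>.\<close>
  have b: "bij_betw snd (Sigma UNIV ?S) {i \<in> K. \<mu> i \<in> (\<Union>n. B n)}"
    using \<open>disjoint_family B\<close>
    by (fastforce simp: bij_betw_def inj_on_def disjoint_family_on_def image_iff)
  have "((\<lambda>p. (f \<bullet> e (snd p)) *\<^sub>R e (snd p)) has_sum proj (\<Union>n. B n) f) (Sigma UNIV ?S)"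
    using proj_has_sum [of f "\<Union>n. B n"] by (subst has_sum_reindex_bij_betw [OF b])
  then have "((\<lambda>n. proj (B n) f) has_sum proj (\<Union>n. B n) f) UNIV"
    by (rule has_sum_SigmaD) (simp add: proj_has_sum)
  then show "(\<lambda>n. proj (B n) f) sums proj (\<Union>n. B n) f" by (rule has_sum_imp_sums)
qed

text \<open>Written as an image of a weighted counting measure, so that the weights of equal
  eigenvalues are added without further argument and integrals become sums over
  \<open>K\<close>.\<close>

lemma scalar_measure_proj:
  "scalar_measure proj f = distr (density (count_space K) (\<lambda>i. ennreal ((f \<bullet> e i)\<^sup>2))) borel \<mu>"
proof (rule scalar_measure_eqI [OF pvm_proj])
  fix B :: "real set" assume B: "B \<in> sets borel"
  have s: "((\<lambda>i. indicator B (\<mu> i) * (f \<bullet> e i) * (f \<bullet> e i)) has_sum (f \<bullet> proj B f)) K"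
    using inner_proj_has_sum [of B f f] by (simp add: inner_commute)
  have "emeasure (distr (density (count_space K) (\<lambda>i. ennreal ((f \<bullet> e i)\<^sup>2))) borel \<mu>) B
      = (\<integral>\<^sup>+ i. ennreal ((f \<bullet> e i)\<^sup>2) * indicator (\<mu> -` B \<inter> K) i \<partial>count_space K)"
    using B by (subst emeasure_distr) (auto simp: emeasure_density)
  also have "\<dots> = (\<integral>\<^sup>+ i. ennreal (indicator B (\<mu> i) * (f \<bullet> e i) * (f \<bullet> e i)) \<partial>count_space K)"
    by (rule nn_integral_cong) (auto simp: indicator_def power2_eq_square)
  also have "\<dots> = ennreal (f \<bullet> proj B f)"
    using s by (intro nn_integral_count_space_has_sum) (auto simp: indicator_def)
  finally show "emeasure (distr (density (count_space K) (\<lambda>i. ennreal ((f \<bullet> e i)\<^sup>2))) borel \<mu>) B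
      = ennreal (f \<bullet> proj B f)" .
qed simp

lemma integrable_scalar_measure_proj:
  assumes "\<phi> \<in> borel_measurable borel"
  shows "integrable (scalar_measure proj f) \<phi> \<longleftrightarrow> (\<lambda>i. \<phi> (\<mu> i) * (f \<bullet> e i)\<^sup>2) summable_on K"
proof -
  have "integrable (scalar_measure proj f) \<phi> \<longleftrightarrow>
      integrable (density (count_space K) (\<lambda>i. ennreal ((f \<bullet> e i)\<^sup>2))) (\<lambda>i. \<phi> (\<mu> i))"
    unfolding scalar_measure_proj using assms by (intro integrable_distr_eq) auto
  also have "\<dots> \<longleftrightarrow> integrable (count_space K) (\<lambda>i. (f \<bullet> e i)\<^sup>2 *\<^sub>R \<phi> (\<mu> i))"
    by (intro integrable_density) auto
  finally show ?thesis by (simp add: integrable_count_space_iff mult.commute)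
qed

lemma integral_scalar_measure_proj:
  assumes "\<phi> \<in> borel_measurable borel" "((\<lambda>i. \<phi> (\<mu> i) * (f \<bullet> e i)\<^sup>2) has_sum s) K"
  shows "(\<integral>x. \<phi> x \<partial>scalar_measure proj f) = s"
proof -
  have "(\<integral>x. \<phi> x \<partial>scalar_measure proj f) =
      (\<integral>i. \<phi> (\<mu> i) \<partial>density (count_space K) (\<lambda>i. ennreal ((f \<bullet> e i)\<^sup>2)))"
    unfolding scalar_measure_proj using assms by (intro integral_distr) auto
  also have "\<dots> = (\<integral>i. (f \<bullet> e i)\<^sup>2 *\<^sub>R \<phi> (\<mu> i) \<partial>count_space K)"
    by (intro integral_density) auto
  also have "\<dots> = s" using assms(2) by (intro integral_count_space_has_sum) (simp add: mult.commute)
  finally show ?thesis .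
qed

text \<open>The polarization identity is applied to each coefficient. Summability of the two series
  uses |p| <= 1 + p^2 and the bound 2 (x^2 + y^2) for the squares of y + x and y - x.\<close>

lemma is_spectral_integral_proj:
  assumes \<phi>: "\<phi> \<in> borel_measurable borel"
    and D: "D = {f. (\<lambda>i. (\<phi> (\<mu> i))\<^sup>2 * (f \<bullet> e i)\<^sup>2) summable_on K}"
    and A: "\<And>f i. f \<in> D \<Longrightarrow> i \<in> K \<Longrightarrow> A f \<bullet> e i = \<phi> (\<mu> i) * (f \<bullet> e i)"
  shows "is_spectral_integral proj \<phi> D A"
  unfolding is_spectral_integral_def
proof (intro conjI ballI)
  have "(\<lambda>s. (\<phi> s)\<^sup>2) \<in> borel_measurable borel" using \<phi> by measurable
  from integrable_scalar_measure_proj [OF this]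
  show "D = {f. integrable (scalar_measure proj f) (\<lambda>s. (\<phi> s)\<^sup>2)}"
    unfolding D by simp
  fix f g assume f: "f \<in> D" and g: "g \<in> D"
  have sm: "(\<lambda>i. 2 * ((f \<bullet> e i)\<^sup>2 + (g \<bullet> e i)\<^sup>2 + ((\<phi> (\<mu> i))\<^sup>2 * (f \<bullet> e i)\<^sup>2 + (\<phi> (\<mu> i))\<^sup>2 * (g \<bullet> e i)\<^sup>2)))
      summable_on K"
    using f g unfolding D by (intro summable_on_cmult_right summable_on_add summable_coeffs) auto
  have s: "(\<lambda>i. \<phi> (\<mu> i) * ((g + c *\<^sub>R f) \<bullet> e i)\<^sup>2) summable_on K" if c: "c = 1 \<or> c = -1" for c
  proof (rule summable_on_iff_abs_summable_on_real [THEN iffD2], rule Infinite_Sum.abs_summable_on_comparison_test' [OF sm])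
    fix i
    let ?p = "\<phi> (\<mu> i)" and ?x = "f \<bullet> e i" and ?y = "g \<bullet> e i"
    have "\<bar>?p\<bar> \<le> 1 + ?p\<^sup>2"
      using sum_power2_ge_zero [of "\<bar>?p\<bar> - 1" 0] by (simp add: power2_eq_square algebra_simps)
    moreover have "((g + c *\<^sub>R f) \<bullet> e i)\<^sup>2 \<le> 2 * (?x\<^sup>2 + ?y\<^sup>2)"
      using c sum_squares_ge_zero [of "?y - ?x" 0] sum_squares_ge_zero [of "?y + ?x" 0]
      by (auto simp: inner_left_distrib inner_diff_left power2_eq_square algebra_simps)
    ultimately have "\<bar>?p\<bar> * ((g + c *\<^sub>R f) \<bullet> e i)\<^sup>2 \<le> (1 + ?p\<^sup>2) * (2 * (?x\<^sup>2 + ?y\<^sup>2))"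
      by (intro mult_mono) auto
    then show "norm (?p * ((g + c *\<^sub>R f) \<bullet> e i)\<^sup>2) \<le>
        2 * (?x\<^sup>2 + ?y\<^sup>2 + (?p\<^sup>2 * ?x\<^sup>2 + ?p\<^sup>2 * ?y\<^sup>2))"
      by (simp add: abs_mult algebra_simps)
  qed
  define S where "S c = infsum (\<lambda>i. \<phi> (\<mu> i) * ((g + c *\<^sub>R f) \<bullet> e i)\<^sup>2) K" for c
  have hs: "((\<lambda>i. \<phi> (\<mu> i) * ((g + c *\<^sub>R f) \<bullet> e i)\<^sup>2) has_sum S c) K" if "c = 1 \<or> c = -1" for c
    unfolding S_def by (rule has_sum_infsum [OF s [OF that]])
  have i1: "(\<integral>s. \<phi> s \<partial>scalar_measure proj (g + f)) = S 1"
    using integral_scalar_measure_proj [OF \<phi> hs [of 1]] by simp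
  have i2: "(\<integral>s. \<phi> s \<partial>scalar_measure proj (g - f)) = S (-1)"
    using integral_scalar_measure_proj [OF \<phi> hs [of "-1"]] by simp
  have "((\<lambda>i. \<phi> (\<mu> i) * ((g + 1 *\<^sub>R f) \<bullet> e i)\<^sup>2 + -1 * (\<phi> (\<mu> i) * ((g + (-1) *\<^sub>R f) \<bullet> e i)\<^sup>2))
      has_sum (S 1 + -1 * S (-1))) K"
    by (intro has_sum_add has_sum_cmult_right hs) auto
  moreover have "((\<lambda>i. 4 * ((g \<bullet> e i) * (A f \<bullet> e i))) has_sum 4 * (g \<bullet> A f)) K"
    by (intro has_sum_cmult_right parseval)
  then have "((\<lambda>i. \<phi> (\<mu> i) * ((g + 1 *\<^sub>R f) \<bullet> e i)\<^sup>2 + -1 * (\<phi> (\<mu> i) * ((g + (-1) *\<^sub>R f) \<bullet> e i)\<^sup>2))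
      has_sum 4 * (g \<bullet> A f)) K"
    by (rule has_sum_cong [THEN iffD1, rotated])
      (simp add: A [OF f] inner_left_distrib inner_diff_left power2_eq_square algebra_simps)
  ultimately have "S 1 + -1 * S (-1) = 4 * (g \<bullet> A f)" by (rule has_sum_unique)
  then show "g \<bullet> A f = ((\<integral>s. \<phi> s \<partial>scalar_measure proj (g + f)) - (\<integral>s. \<phi> s \<partial>scalar_measure proj (g - f))) / 4"
    unfolding i1 i2 by simp
qed

context
  fixes D :: "'b set" and A :: "'b \<Rightarrow> 'b" and \<phi> :: "real \<Rightarrow> real" and C :: real
  assumes D: "D = {f. (\<lambda>i. (\<mu> i)\<^sup>2 * (f \<bullet> e i)\<^sup>2) summable_on K}"
    and A: "\<And>f i. f \<in> D \<Longrightarrow> i \<in> K \<Longrightarrow> A f \<bullet> e i = \<mu> i * (f \<bullet> e i)"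
    and \<phi>: "\<phi> \<in> borel_measurable borel" "\<And>i. i \<in> K \<Longrightarrow> \<bar>\<phi> (\<mu> i)\<bar> \<le> C"
begin

lemma basis_in_domain: assumes "i \<in> K" shows "e i \<in> D"
proof -
  have "(\<lambda>j. (\<mu> j)\<^sup>2 * (e i \<bullet> e j)\<^sup>2) summable_on {i}" by simp
  then have "(\<lambda>j. (\<mu> j)\<^sup>2 * (e i \<bullet> e j)\<^sup>2) summable_on K"
    by (rule summable_on_cong_neutral [THEN iffD1, rotated -1]) (use assms in \<open>auto simp: orthonormal\<close>)
  then show ?thesis by (simp add: D)
qed

lemma function_of_operator_basis:
  assumes "is_function_of_operator D A \<phi> T" "i \<in> K"
  shows "T (e i) = \<phi> (\<mu> i) *\<^sub>R e i"
proof -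
  obtain P where P: "projection_valued_measure P" "is_spectral_integral P (\<lambda>s. s) D A"
      "is_spectral_integral P \<phi> UNIV (blinfun_apply T)"
    using assms(1) unfolding is_function_of_operator_def by blast
  have "A (e i) = \<mu> i *\<^sub>R e i"
    using assms(2) by (intro eqI) (simp add: A basis_in_domain orthonormal)
  then have "P {\<mu> i} (e i) = e i"
    using pvm_eigenvector [OF P(1,2) basis_in_domain] assms(2) by blast
  then show ?thesis using pvm_function_eigenvector [OF P(1,3) _ \<phi>(1)] by blast
qed

lemma ex1_function_of_operator: "\<exists>!T. is_function_of_operator D A \<phi> T"
proof (rule ex_ex1I)
  have "is_spectral_integral proj (\<lambda>s. s) D A"
    by (rule is_spectral_integral_proj) (use D A in auto)
  moreover have "is_spectral_integral proj \<phi> UNIV (Blinfun (diag (\<lambda>i. \<phi> (\<mu> i))))"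
  proof (rule is_spectral_integral_proj [OF \<phi>(1)])
    show "Blinfun (diag (\<lambda>i. \<phi> (\<mu> i))) f \<bullet> e i = \<phi> (\<mu> i) * (f \<bullet> e i)" if "i \<in> K" for f i
      using that by (subst bounded_linear_Blinfun_apply [OF bounded_linear_diag [where C = C]])
        (auto intro!: inner_diag [where C = C] \<phi>(2))
    have "(\<lambda>i. (\<phi> (\<mu> i))\<^sup>2 * (f \<bullet> e i)\<^sup>2) summable_on K" for f
    proof (rule summable_on_comparison_test)
      show "(\<lambda>i. C\<^sup>2 * (f \<bullet> e i)\<^sup>2) summable_on K"
        by (intro summable_on_cmult_right summable_coeffs)
      show "(\<phi> (\<mu> i))\<^sup>2 * (f \<bullet> e i)\<^sup>2 \<le> C\<^sup>2 * (f \<bullet> e i)\<^sup>2" if "i \<in> K" for i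
      proof -
        have "\<bar>\<phi> (\<mu> i)\<bar> \<le> \<bar>C\<bar>" using \<phi>(2) [OF that] by linarith
        then show ?thesis
          unfolding abs_le_square_iff by (intro mult_right_mono) auto
      qed
    qed auto
    then show "UNIV = {f. (\<lambda>i. (\<phi> (\<mu> i))\<^sup>2 * (f \<bullet> e i)\<^sup>2) summable_on K}" by auto
  qed
  ultimately show "\<exists>T. is_function_of_operator D A \<phi> T"
    using pvm_proj unfolding is_function_of_operator_def by blast
  fix T T' assume T: "is_function_of_operator D A \<phi> T" "is_function_of_operator D A \<phi> T'"
  show "T = T'"
  proof (rule blinfun_eqI)
    fix f
    show "T f = T' f"
      by (rule eqI) (simp add: diag_eqI [OF blinfun.bounded_linear_right function_of_operator_basis] T)
  qed
qed

end

end

section \<open>The operator of a closed form with an eigenbasis\<close>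

text \<open>The form need only be known to be closed along sequences in the span of the eigenbasis.\<close>

locale form_basis = hilbert_basis e "UNIV :: nat set" for e :: "nat \<Rightarrow> 'h::{real_inner, complete_space}" +
  fixes l :: "nat \<Rightarrow> real" and E :: "'h set" and Q :: "'h \<Rightarrow> 'h \<Rightarrow> real"
  assumes sub: "subspace E" and basis_E: "\<And>i. e i \<in> E"
    and Q_add: "\<And>f g h. f \<in> E \<Longrightarrow> g \<in> E \<Longrightarrow> h \<in> E \<Longrightarrow> Q f (g + h) = Q f g + Q f h"
    and Q_scale: "\<And>f g r. f \<in> E \<Longrightarrow> g \<in> E \<Longrightarrow> Q f (r *\<^sub>R g) = r * Q f g"
    and Q_sym: "\<And>f g. f \<in> E \<Longrightarrow> g \<in> E \<Longrightarrow> Q f g = Q g f"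
    and Q_nonneg: "\<And>f. f \<in> E \<Longrightarrow> 0 \<le> Q f f"
    and Q_basis: "\<And>f i. f \<in> E \<Longrightarrow> Q f (e i) = l i * (f \<bullet> e i)"
    and closed: "\<And>X f. (\<And>n. X n \<in> span (range e)) \<Longrightarrow> X \<longlonglongrightarrow> f \<Longrightarrow>
        (\<And>\<epsilon>. \<epsilon> > 0 \<Longrightarrow> \<exists>N::nat. \<forall>m\<ge>N. \<forall>n\<ge>N. Q (X m - X n) (X m - X n) < \<epsilon>) \<Longrightarrow>
        f \<in> E \<and> (\<lambda>n. Q (X n - f) (X n - f)) \<longlonglongrightarrow> 0"
begin

lemma Q_diff: "f \<in> E \<Longrightarrow> g \<in> E \<Longrightarrow> h \<in> E \<Longrightarrow> Q f (g - h) = Q f g - Q f h"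
  using Q_add [of f g "-1 *\<^sub>R h"] Q_scale [of f h "-1"] sub by (simp add: subspace_neg)

lemma Q_sum:
  assumes "f \<in> E" "finite F" "\<And>i. i \<in> F \<Longrightarrow> g i \<in> E"
  shows "Q f (\<Sum>i\<in>F. g i) = (\<Sum>i\<in>F. Q f (g i))"
  using assms(2,1,3)
proof (induction F rule: finite_induct)
  case empty
  then show ?case using Q_scale [of f 0 0] sub by (simp add: subspace_0)
next
  case (insert i F)
  then show ?case using sub by (simp add: Q_add subspace_sum)
qed

lemma lincomb_E: "(\<Sum>i\<in>F. c i *\<^sub>R e i) \<in> E"
  by (intro subspace_sum [OF sub] subspace_scale [OF sub] basis_E)

lemma Q_lincomb: "f \<in> E \<Longrightarrow> finite F \<Longrightarrow> Q f (\<Sum>i\<in>F. c i *\<^sub>R e i) = (\<Sum>i\<in>F. c i * (l i * (f \<bullet> e i)))"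
  using sub basis_E by (subst Q_sum) (auto simp: Q_scale Q_basis subspace_scale)

text \<open>The form is only assumed nonnegative, and for \<omega> = 0 it does vanish on constants,
  so the degenerate case is treated on its own.\<close>

lemma Q_Cauchy_Schwarz:
  assumes "f \<in> E" "g \<in> E"
  shows "(Q f g)\<^sup>2 \<le> Q f f * Q g g"
proof -
  have exp: "0 \<le> Q f f + 2 * r * Q f g + r\<^sup>2 * Q g g" for r
  proof -
    have rg: "r *\<^sub>R g \<in> E" and s: "f + r *\<^sub>R g \<in> E"
      using assms sub by (auto simp: subspace_add subspace_scale)
    have "Q (f + r *\<^sub>R g) (f + r *\<^sub>R g) = Q f f + 2 * r * Q f g + r\<^sup>2 * Q g g"
      using assms rg s Q_sym [OF s assms(1)] Q_sym [OF s assms(2)] Q_sym [OF assms]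
      by (simp add: Q_add Q_scale algebra_simps power2_eq_square)
    then show ?thesis using Q_nonneg [OF s] by simp
  qed
  show ?thesis
  proof (cases "Q g g = 0")
    case True
    have "Q f g = 0"
    proof (rule ccontr)
      assume "Q f g \<noteq> 0"
      \<comment> \<open>With this value of \<open>r\<close> the expansion equals -1, against its
        nonnegativity.\<close>
      then have "2 * (- (Q f f + 1) / (2 * Q f g)) * Q f g = - (Q f f + 1)" by simp
      then show False using exp [of "- (Q f f + 1) / (2 * Q f g)"] True by simp
    qed
    then show ?thesis using True by simp
  next
    case False
    then have pos: "Q g g > 0" using Q_nonneg [OF assms(2)] by simp
    have "0 \<le> Q g g * (Q f f + 2 * (- Q f g / Q g g) * Q f g + (- Q f g / Q g g)\<^sup>2 * Q g g)"
      using mult_nonneg_nonneg [OF less_imp_le [OF pos] exp [of "- Q f g / Q g g"]] .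
    also have "\<dots> = Q f f * Q g g - (Q f g)\<^sup>2"
      using pos by (simp add: field_simps power2_eq_square)
    finally show ?thesis by simp
  qed
qed

definition D where "D = {g \<in> E. continuous_on E (\<lambda>f. Q f g)}"

definition L where "L g = (THE h. \<forall>f\<in>E. Q f g = f \<bullet> h)"

text \<open>The energies of differences of partial sums are blocks of the series of l (g \<bullet>
  e)^2, which converges because |l| <= 1 + l^2. Closedness then puts \<open>g\<close> into
  \<open>E\<close>, and the Cauchy-Schwarz inequality for \<open>Q\<close> lets \<open>Q f\<close>
  pass to the limit along the partial sums.\<close>

lemma Q_partial_sums:
  assumes "(\<lambda>i. (l i)\<^sup>2 * (g \<bullet> e i)\<^sup>2) summable_on UNIV"
  shows "g \<in> D" "L g \<bullet> e i = l i * (g \<bullet> e i)"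
proof -
  define X where "X n = (\<Sum>i<n. (g \<bullet> e i) *\<^sub>R e i)" for n
  have X: "X \<longlonglongrightarrow> g"
    using has_sum_imp_sums [OF expansion [of g]] unfolding X_def sums_def .
  have XE: "X n \<in> E" for n unfolding X_def by (rule lincomb_E)
  have sm: "summable (\<lambda>i. l i * (g \<bullet> e i)\<^sup>2)"
  proof (rule summable_comparison_test')
    show "summable (\<lambda>i. (g \<bullet> e i)\<^sup>2 + (l i)\<^sup>2 * (g \<bullet> e i)\<^sup>2)"
      using assms summable_coeffs by (intro summable_add summable_on_imp_summable) auto
    fix i
    have "\<bar>l i\<bar> \<le> 1 + (l i)\<^sup>2"
      using sum_power2_ge_zero [of "\<bar>l i\<bar> - 1" 0] by (simp add: power2_eq_square algebra_simps)
    then show "norm (l i * (g \<bullet> e i)\<^sup>2) \<le> (g \<bullet> e i)\<^sup>2 + (l i)\<^sup>2 * (g \<bullet> e i)\<^sup>2"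
      using mult_right_mono [of "\<bar>l i\<bar>" "1 + (l i)\<^sup>2" "(g \<bullet> e i)\<^sup>2"] by (simp add: abs_mult algebra_simps)
  qed
  have Qd: "Q (X m - X n) (X m - X n) = (\<Sum>i=n..<m. l i * (g \<bullet> e i)\<^sup>2)" if "n \<le> m" for m n
  proof -
    have "X m - X n = (\<Sum>i=n..<m. (g \<bullet> e i) *\<^sub>R e i)"
      unfolding X_def using sum_diff_nat_ivl [of 0 n m "\<lambda>i. (g \<bullet> e i) *\<^sub>R e i"] that
      by (simp add: atLeast0LessThan)
    then show ?thesis
      using lincomb_E inner_sum_e [of "{n..<m}"]
      by (auto simp: Q_lincomb power2_eq_square intro!: sum.cong)
  qed
  have cau: "\<exists>N. \<forall>m\<ge>N. \<forall>n\<ge>N. Q (X m - X n) (X m - X n) < \<epsilon>" if e: "\<epsilon> > 0" for \<epsilon>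
  proof -
    obtain N where N: "\<And>m n. m \<ge> N \<Longrightarrow> norm (\<Sum>i=m..<n. l i * (g \<bullet> e i)\<^sup>2) < \<epsilon>"
      using sm e unfolding summable_Cauchy by meson
    have "Q (X m - X n) (X m - X n) < \<epsilon>" if mn: "m \<ge> N" "n \<ge> N" for m n
    proof (cases "n \<le> m")
      case True
      then show ?thesis using Qd [OF True] N [OF mn(2), of m] by simp
    next
      case False
      have "Q (X n - X m) (X n - X m) = Q (X m - X n) (X m - X n)"
      proof -
        have "X m - X n \<in> E" using XE sub by (simp add: subspace_diff)
        moreover have "X n - X m = (-1) *\<^sub>R (X m - X n)" by simp
        ultimately show ?thesis using sub
          by (metis Q_scale Q_sym mult_minus1 minus_minus subspace_scale)
      qed
      then show ?thesis using Qd [of m n] N [OF mn(1), of n] False by simp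
    qed
    then show ?thesis by blast
  qed
  have "X n \<in> span (range e)" for n
    unfolding X_def by (intro span_sum span_scale span_base) auto
  from closed [OF this X cau] have gE: "g \<in> E" and Q0: "(\<lambda>n. Q (X n - g) (X n - g)) \<longlonglongrightarrow> 0"
    by auto
  have "(\<lambda>i. (l i * (g \<bullet> e i))\<^sup>2) summable_on UNIV"
    using assms by (simp add: power_mult_distrib)
  from riesz_fischer [OF this]
  obtain h where h: "((\<lambda>i. (l i * (g \<bullet> e i)) *\<^sub>R e i) has_sum h) UNIV"
    unfolding summable_on_def by (elim exE)
  have Qh: "Q f g = f \<bullet> h" if f: "f \<in> E" for f
  proof (rule LIMSEQ_unique)
    have "Q f (X n) = f \<bullet> (\<Sum>i<n. (l i * (g \<bullet> e i)) *\<^sub>R e i)" for n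
      unfolding X_def Q_lincomb [OF f finite_lessThan] by (simp add: inner_sum_right algebra_simps)
    then show "(\<lambda>n. Q f (X n)) \<longlonglongrightarrow> f \<bullet> h"
      using tendsto_inner [OF tendsto_const has_sum_imp_sums [OF h, unfolded sums_def], of f] by simp
    have lim0: "(\<lambda>n. Q f f * Q (X n - g) (X n - g)) \<longlonglongrightarrow> 0"
      using tendsto_mult_left [OF Q0, of "Q f f"] by simp
    have "norm ((Q f (X n) - Q f g)\<^sup>2) \<le> Q f f * Q (X n - g) (X n - g)" for n
      using Q_Cauchy_Schwarz [OF f subspace_diff [OF sub XE gE], of n]
      by (simp add: Q_diff [OF f XE gE])
    then have "(\<lambda>n. (Q f (X n) - Q f g)\<^sup>2) \<longlonglongrightarrow> 0"
      by (rule Lim_null_comparison [OF always_eventually [OF allI] lim0])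
    then have "(\<lambda>n. sqrt ((Q f (X n) - Q f g)\<^sup>2)) \<longlonglongrightarrow> sqrt 0" by (rule tendsto_real_sqrt)
    then have "(\<lambda>n. Q f (X n) - Q f g) \<longlonglongrightarrow> 0" by (simp add: tendsto_rabs_zero_iff)
    then show "(\<lambda>n. Q f (X n)) \<longlonglongrightarrow> Q f g" by (simp add: LIM_zero_iff)
  qed
  have "continuous_on E (\<lambda>f. f \<bullet> h)" by (intro continuous_intros)
  then show "g \<in> D"
    using gE unfolding D_def by (auto simp: Qh cong: continuous_on_cong)
  have "L g = h"
    unfolding L_def
  proof (rule the_equality)
    show "\<forall>f\<in>E. Q f g = f \<bullet> h" using Qh by blast
    fix h' assume "\<forall>f\<in>E. Q f g = f \<bullet> h'"
    then have "e i \<bullet> h' = e i \<bullet> h" for i using Qh basis_E by metis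
    then show "h' = h" by (intro eqI) (simp add: inner_commute)
  qed
  then show "L g \<bullet> e i = l i * (g \<bullet> e i)"
    using inner_has_sum [OF h] by simp
qed

text \<open>Continuity at 0 and homogeneity make \<open>f \<mapsto> Q f g\<close> bounded by a
  multiple of the norm, with one constant for all \<open>f\<close>. Testing with suitable finite
  combinations of basis vectors bounds the partial sums of the series.\<close>

lemma D_imp_summable:
  assumes "g \<in> D"
  shows "(\<lambda>i. (l i)\<^sup>2 * (g \<bullet> e i)\<^sup>2) summable_on UNIV"
proof -
  have gE: "g \<in> E" and c: "continuous_on E (\<lambda>f. Q f g)" using assms by (auto simp: D_def)
  have zE: "0 \<in> E" using sub by (rule subspace_0)
  have Q0: "Q 0 g = 0" using Q_sym [OF zE gE] Q_scale [OF gE gE, of 0] by simp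
  obtain d where d: "d > 0" "\<And>f. f \<in> E \<Longrightarrow> dist f 0 < d \<Longrightarrow> \<bar>Q f g\<bar> < 1"
    using c zE Q0 unfolding continuous_on_iff by (metis dist_real_def diff_zero zero_less_one)
  have bound: "\<bar>Q f g\<bar> \<le> (2 / d) * norm f" if f: "f \<in> E" for f
  proof (cases "f = 0")
    case False
    define r where "r = d / (2 * norm f)"
    have r: "r > 0" using d(1) False by (simp add: r_def)
    have rf: "r *\<^sub>R f \<in> E" using f sub by (simp add: subspace_scale)
    have "dist (r *\<^sub>R f) 0 < d" using d(1) False r by (simp add: r_def)
    then have "\<bar>Q (r *\<^sub>R f) g\<bar> < 1" by (rule d(2) [OF rf])
    then have "r * \<bar>Q f g\<bar> < 1"
      using Q_sym [OF rf gE] Q_sym [OF f gE] Q_scale [OF gE f] r by (simp add: abs_mult)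
    then show ?thesis using d(1) False by (simp add: r_def field_simps)
  qed (simp add: Q0)
  show ?thesis
  proof (rule nonneg_bdd_above_summable_on)
    show "bdd_above (sum (\<lambda>i. (l i)\<^sup>2 * (g \<bullet> e i)\<^sup>2) ` {F. F \<subseteq> UNIV \<and> finite F})"
    proof (rule bdd_aboveI2)
      fix F :: "nat set" assume "F \<in> {F. F \<subseteq> UNIV \<and> finite F}"
      then have F: "finite F" by simp
      \<comment> \<open>For this choice \<open>Q f g\<close> and the squared norm of
        \<open>f\<close> are both equal to the partial sum, so the bound on \<open>Q f g\<close>
        becomes a bound on the norm of \<open>f\<close> itself.\<close>
      define f where "f = (\<Sum>i\<in>F. (l i * (g \<bullet> e i)) *\<^sub>R e i)"
      define S where "S = (\<Sum>i\<in>F. (l i)\<^sup>2 * (g \<bullet> e i)\<^sup>2)"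
      have fE: "f \<in> E" unfolding f_def by (rule lincomb_E)
      have "Q f g = S"
        by (subst Q_sym [OF fE gE])
          (simp add: f_def Q_lincomb [OF gE F] S_def power2_eq_square algebra_simps)
      moreover have "(norm f)\<^sup>2 = S"
        unfolding f_def S_def using norm_sum_e [OF F] by (simp add: power_mult_distrib)
      ultimately have "(norm f)\<^sup>2 \<le> (2 / d) * norm f" using bound [OF fE] by simp
      then have "norm f \<le> 2 / d"
        using d(1) by (cases "f = 0") (auto simp: power2_eq_square intro: mult_right_le_imp_le [of _ "norm f"])
      then have "(norm f)\<^sup>2 \<le> (2 / d)\<^sup>2" by (intro power_mono) auto
      then show "(\<Sum>i\<in>F. (l i)\<^sup>2 * (g \<bullet> e i)\<^sup>2) \<le> (2 / d)\<^sup>2"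
        using \<open>(norm f)\<^sup>2 = S\<close> by (simp add: S_def)
    qed
  qed simp
qed

lemma D_eq: "D = {g. (\<lambda>i. (l i)\<^sup>2 * (g \<bullet> e i)\<^sup>2) summable_on UNIV}"
  using Q_partial_sums(1) D_imp_summable by blast

lemma inner_L: "g \<in> D \<Longrightarrow> L g \<bullet> e i = l i * (g \<bullet> e i)"
  using Q_partial_sums(2) D_imp_summable by blast

end

section \<open>The spectral decomposition\<close>

lemma nice_cong_AE:
  assumes n: "nice \<omega> U V" and ae: "AE x in lborel. U x = U' x" and [measurable]: "U' \<in> borel_measurable borel"
  shows "nice \<omega> U' V"
proof -
  note w = n [unfolded nice_def]
  note [measurable] = weak_gradient_measurable [OF conjunct1 [OF w]]
  have "AE x in lborel. U (inversion x) = U' (inversion x)"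
    by (rule AE_inversion [OF ae]) measurable
  then have "AE x in lborel. (U \<circ> inversion) x = (U' \<circ> inversion) x" by simp
  moreover have "U' \<circ> inversion \<in> borel_measurable borel" unfolding o_def by measurable
  ultimately have "weak_gradient (U' \<circ> inversion) (pull V)"
    by (rule weak_gradient_cong_AE [OF conjunct1 [OF conjunct2 [OF w]]])
  moreover have "integrable lborel (\<lambda>x. (norm (fvec \<omega> U' V x))\<^sup>2)"
  proof (subst integrable_cong_AE)
    show "AE x in lborel. (norm (fvec \<omega> U' V x))\<^sup>2 = (norm (fvec \<omega> U V x))\<^sup>2"
      using ae by eventually_elim (simp add: fvec_def)
  qed (use w in auto)
  ultimately show ?thesis
    using w weak_gradient_cong_AE [OF _ ae] by (simp add: nice_def)
qed

lemma nice_imp_form_domain: "nice \<omega> (chart f) V \<Longrightarrow> f \<in> form_domain \<omega>"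
  unfolding form_domain_iff nice_def by blast

lemma nice_chart_lincomb:
  assumes "nice \<omega> (chart f) V" "nice \<omega> (chart g) W"
  shows "nice \<omega> (chart (a *\<^sub>R f + b *\<^sub>R g)) (\<lambda>x. a *\<^sub>R V x + b *\<^sub>R W x)"
proof (rule nice_cong_AE [OF nice_lincomb [OF assms, of a b]])
  show "AE x in lborel. a * chart f x + b * chart g x = chart (a *\<^sub>R f + b *\<^sub>R g) x"
    using chart_lincomb [of a f b g] by eventually_elim simp
qed simp

subsection \<open>The form as an inner product\<close>

definition ivec :: "real \<Rightarrow> L2_S2 \<Rightarrow> real^2 \<Rightarrow> real \<times> (real^2) \<times> real" where
  "ivec \<omega> f = fvec \<omega> (chart f) (wgrad f)"

lemma form_domain_wgrad:
  assumes "f \<in> form_domain \<omega>"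
  shows "weak_gradient (chart f) (wgrad f)" "ivec \<omega> f \<in> borel_measurable borel"
    "integrable lborel (\<lambda>x. (norm (ivec \<omega> f x))\<^sup>2)"
proof -
  obtain V where V: "weak_gradient (chart f) V" "integrable lborel (\<lambda>x. (norm (fvec \<omega> (chart f) V x))\<^sup>2)"
    using assms unfolding form_domain_iff by blast
  show w: "weak_gradient (chart f) (wgrad f)" by (rule wgrad_weak_gradient [OF V(1)])
  note [measurable] = weak_gradient_measurable(2) [OF w] weak_gradient_measurable(2) [OF V(1)]
  show m: "ivec \<omega> f \<in> borel_measurable borel" unfolding ivec_def by measurable
  show "integrable lborel (\<lambda>x. (norm (ivec \<omega> f x))\<^sup>2)"
  proof (subst integrable_cong_AE)
    show "AE x in lborel. (norm (ivec \<omega> f x))\<^sup>2 = (norm (fvec \<omega> (chart f) V x))\<^sup>2"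
      using weak_gradient_unique [OF w V(1)] by eventually_elim (simp add: ivec_def fvec_def)
  qed (use m V(2) in auto)
qed

lemma subspace_form_domain: "subspace (form_domain \<omega>)"
proof -
  have lc: "a *\<^sub>R f + b *\<^sub>R g \<in> form_domain \<omega>" if f: "f \<in> form_domain \<omega>" and g: "g \<in> form_domain \<omega>" for a b f g
  proof -
    obtain V V' where V: "weak_gradient (chart f) V" "integrable lborel (\<lambda>x. (norm (fvec \<omega> (chart f) V x))\<^sup>2)"
      "weak_gradient (chart f \<circ> inversion) V'" using f unfolding form_domain_iff by blast
    obtain W W' where W: "weak_gradient (chart g) W" "integrable lborel (\<lambda>x. (norm (fvec \<omega> (chart g) W x))\<^sup>2)"
      "weak_gradient (chart g \<circ> inversion) W'" using g unfolding form_domain_iff by blast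
    note [measurable] = weak_gradient_measurable(2) [OF V(1)] weak_gradient_measurable(2) [OF W(1)]
    have ae: "AE x in lborel. a * chart f x + b * chart g x = chart (a *\<^sub>R f + b *\<^sub>R g) x"
      using chart_lincomb [of a f b g] by eventually_elim simp
    then have ae': "AE x in lborel. a * chart f (inversion x) + b * chart g (inversion x)
        = chart (a *\<^sub>R f + b *\<^sub>R g) (inversion x)"
      by (rule AE_inversion) measurable
    have "weak_gradient (chart (a *\<^sub>R f + b *\<^sub>R g)) (\<lambda>x. a *\<^sub>R V x + b *\<^sub>R W x)"
      by (rule weak_gradient_cong_AE [OF weak_gradient_lincomb [OF V(1) W(1)] ae]) simp
    moreover have "weak_gradient (chart (a *\<^sub>R f + b *\<^sub>R g) \<circ> inversion) (\<lambda>x. a *\<^sub>R V' x + b *\<^sub>R W' x)"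
      using weak_gradient_cong_AE [OF weak_gradient_lincomb [OF V(3) W(3)], of a b] ae' by (simp add: o_def)
    moreover have "integrable lborel (\<lambda>x. (norm (fvec \<omega> (chart (a *\<^sub>R f + b *\<^sub>R g)) (\<lambda>x. a *\<^sub>R V x + b *\<^sub>R W x) x))\<^sup>2)"
    proof (subst integrable_cong_AE)
      show "AE x in lborel. (norm (fvec \<omega> (chart (a *\<^sub>R f + b *\<^sub>R g)) (\<lambda>x. a *\<^sub>R V x + b *\<^sub>R W x) x))\<^sup>2
          = (norm (a *\<^sub>R fvec \<omega> (chart f) V x + b *\<^sub>R fvec \<omega> (chart g) W x))\<^sup>2"
        unfolding fvec_lincomb [symmetric] using ae by eventually_elim (simp add: fvec_def)
      show "integrable lborel (\<lambda>x. (norm (a *\<^sub>R fvec \<omega> (chart f) V x + b *\<^sub>R fvec \<omega> (chart g) W x))\<^sup>2)"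
        using V(2) W(2) by (intro integrable_norm_sq_add) (auto simp: power_mult_distrib)
    qed measurable
    ultimately show ?thesis unfolding form_domain_iff by blast
  qed
  have "0 \<in> form_domain \<omega>"
  proof -
    have "test_function (\<lambda>x. 0)" by (simp add: test_function_iff bsupp_def)
    then have "nice \<omega> (\<lambda>x. 0) (grad (\<lambda>x. 0))" by (rule nice_test_function)
    moreover have "AE x in lborel. 0 = chart 0 x"
      using chart_lincomb [of 0 0 0 0] by eventually_elim simp
    ultimately show ?thesis using nice_cong_AE nice_imp_form_domain chart_measurable by blast
  qed
  then show ?thesis
    unfolding subspace_def using lc [of _ _ 1 1] lc [of _ _ _ 0] by fastforce
qed

lemma ivec_lincomb:
  assumes "f \<in> form_domain \<omega>" "g \<in> form_domain \<omega>"
  shows "AE x in lborel. ivec \<omega> (a *\<^sub>R f + b *\<^sub>R g) x = a *\<^sub>R ivec \<omega> f x + b *\<^sub>R ivec \<omega> g x"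
proof -
  note f = form_domain_wgrad [OF assms(1)] and g = form_domain_wgrad [OF assms(2)]
  have ae: "AE x in lborel. a * chart f x + b * chart g x = chart (a *\<^sub>R f + b *\<^sub>R g) x"
    using chart_lincomb [of a f b g] by eventually_elim simp
  have "weak_gradient (chart (a *\<^sub>R f + b *\<^sub>R g)) (\<lambda>x. a *\<^sub>R wgrad f x + b *\<^sub>R wgrad g x)"
    by (rule weak_gradient_cong_AE [OF weak_gradient_lincomb [OF f(1) g(1)] ae]) simp
  from weak_gradient_unique [OF this wgrad_weak_gradient [OF this]] ae
  show ?thesis
  proof eventually_elim
    case (elim x)
    show ?case unfolding ivec_def fvec_def elim [symmetric] by (simp add: algebra_simps)
  qed
qed

lemma integrable_ivec_inner:
  "f \<in> form_domain \<omega> \<Longrightarrow> g \<in> form_domain \<omega> \<Longrightarrow> integrable lborel (\<lambda>x. ivec \<omega> f x \<bullet> ivec \<omega> g x)"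
  using form_domain_wgrad by (intro integrable_inner_L2) auto

lemma integrable_chart_inner: "integrable lborel (\<lambda>x. conf x * (chart f x * chart g x))"
proof -
  have "integrable lborel (\<lambda>x. (sqrt (conf x) * chart f x) \<bullet> (sqrt (conf x) * chart g x))"
    using integrable_chart_sq conf_pos
    by (intro integrable_inner_L2) (auto simp: power_mult_distrib less_imp_le)
  moreover have "(sqrt (conf x) * chart f x) \<bullet> (sqrt (conf x) * chart g x) = conf x * (chart f x * chart g x)" for x
    using real_sqrt_mult_self [of "conf x"] conf_pos [of x]
    by (metis abs_of_pos inner_real_def mult.assoc mult.left_commute)
  then have "(\<lambda>x. (sqrt (conf x) * chart f x) \<bullet> (sqrt (conf x) * chart g x)) = (\<lambda>x. conf x * (chart f x * chart g x))"
    by (rule ext)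
  ultimately show ?thesis by (simp only:)
qed

lemma form_Q_ivec:
  assumes f: "f \<in> form_domain \<omega>" and g: "g \<in> form_domain \<omega>"
  shows "form_Q \<omega> f g = (\<integral>x. ivec \<omega> f x \<bullet> ivec \<omega> g x \<partial>lborel) - f \<bullet> g"
proof -
  have "form_Q \<omega> f g = (\<integral>x. ivec \<omega> f x \<bullet> ivec \<omega> g x - conf x * (chart f x * chart g x) \<partial>lborel)"
    unfolding form_Q_eq [OF form_domain_wgrad(1) [OF f] form_domain_wgrad(1) [OF g]] ivec_def inner_fvec
    by simp
  also have "\<dots> = (\<integral>x. ivec \<omega> f x \<bullet> ivec \<omega> g x \<partial>lborel) - (\<integral>x. conf x * (chart f x * chart g x) \<partial>lborel)"
    by (rule Bochner_Integration.integral_diff [OF integrable_ivec_inner [OF f g] integrable_chart_inner])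
  finally show ?thesis by (simp add: inner_chart)
qed

lemma form_Q_lincomb:
  assumes f: "f \<in> form_domain \<omega>" and g: "g \<in> form_domain \<omega>" and h: "h \<in> form_domain \<omega>"
  shows "form_Q \<omega> f (a *\<^sub>R g + b *\<^sub>R h) = a * form_Q \<omega> f g + b * form_Q \<omega> f h"
proof -
  note [measurable] = form_domain_wgrad(2) [OF f] form_domain_wgrad(2) [OF g] form_domain_wgrad(2) [OF h]
  have gh: "a *\<^sub>R g + b *\<^sub>R h \<in> form_domain \<omega>"
    using g h subspace_form_domain by (simp add: subspace_add subspace_scale)
  note [measurable] = form_domain_wgrad(2) [OF gh]
  have "(\<integral>x. ivec \<omega> f x \<bullet> ivec \<omega> (a *\<^sub>R g + b *\<^sub>R h) x \<partial>lborel)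
      = (\<integral>x. a * (ivec \<omega> f x \<bullet> ivec \<omega> g x) + b * (ivec \<omega> f x \<bullet> ivec \<omega> h x) \<partial>lborel)"
  proof (rule integral_cong_AE)
    show "AE x in lborel. ivec \<omega> f x \<bullet> ivec \<omega> (a *\<^sub>R g + b *\<^sub>R h) x
        = a * (ivec \<omega> f x \<bullet> ivec \<omega> g x) + b * (ivec \<omega> f x \<bullet> ivec \<omega> h x)"
      using ivec_lincomb [OF g h, of a b] by eventually_elim (simp add: inner_add_right)
  qed measurable
  also have "\<dots> = a * (\<integral>x. ivec \<omega> f x \<bullet> ivec \<omega> g x \<partial>lborel) + b * (\<integral>x. ivec \<omega> f x \<bullet> ivec \<omega> h x \<partial>lborel)"
    using integrable_ivec_inner [OF f g] integrable_ivec_inner [OF f h] by simp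
  finally show ?thesis
    unfolding form_Q_ivec [OF f gh] form_Q_ivec [OF f g] form_Q_ivec [OF f h]
    by (simp add: inner_add_right algebra_simps)
qed

lemma form_Q_nonneg: "f \<in> form_domain \<omega> \<Longrightarrow> 0 \<le> form_Q \<omega> f f"
  unfolding form_Q_eq [OF form_domain_wgrad(1) form_domain_wgrad(1)]
  using conf_pos by (intro integral_nonneg_AE AE_I2) (simp add: less_imp_le)

lemma form_Q_plus_norm:
  assumes "f \<in> form_domain \<omega>" "g \<in> form_domain \<omega>"
  shows "(\<integral>\<^sup>+ x. ennreal ((norm (ivec \<omega> f x - ivec \<omega> g x))\<^sup>2) \<partial>lborel)
    = ennreal (form_Q \<omega> (f - g) (f - g) + (norm (f - g))\<^sup>2)"
proof -
  have fg: "f - g \<in> form_domain \<omega>" using assms subspace_form_domain by (simp add: subspace_diff)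
  have "(\<integral>\<^sup>+ x. ennreal ((norm (ivec \<omega> f x - ivec \<omega> g x))\<^sup>2) \<partial>lborel)
      = (\<integral>\<^sup>+ x. ennreal ((norm (ivec \<omega> (f - g) x))\<^sup>2) \<partial>lborel)"
    by (rule nn_integral_cong_AE, use ivec_lincomb [OF assms, of 1 "-1"] in eventually_elim) simp
  also have "\<dots> = ennreal (\<integral>x. (norm (ivec \<omega> (f - g) x))\<^sup>2 \<partial>lborel)"
    by (rule nn_integral_eq_integral [OF form_domain_wgrad(3) [OF fg]]) simp
  also have "(\<integral>x. (norm (ivec \<omega> (f - g) x))\<^sup>2 \<partial>lborel) = form_Q \<omega> (f - g) (f - g) + (norm (f - g))\<^sup>2"
    unfolding form_Q_ivec [OF fg fg] power2_norm_eq_inner by simp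
  finally show ?thesis .
qed

subsection \<open>Closedness\<close>

text \<open>The energy vectors of \<open>X n\<close> form a Cauchy sequence of square-integrable
  functions. Their limit has to be recognized as the energy vector of \<open>f\<close> with some
  gradient \<open>V\<close>, after which \<open>nice_limit\<close> shows that \<open>V\<close> is
  the weak gradient.\<close>

lemma form_closed:
  assumes nice: "\<And>n. \<exists>V. nice \<omega> (chart (X n)) V" and X: "X \<longlonglongrightarrow> f"
    and cau: "\<And>\<epsilon>. \<epsilon> > 0 \<Longrightarrow> \<exists>N::nat. \<forall>m\<ge>N. \<forall>n\<ge>N. form_Q \<omega> (X m - X n) (X m - X n) < \<epsilon>"
  shows "f \<in> form_domain \<omega> \<and> (\<lambda>n. form_Q \<omega> (X n - f) (X n - f)) \<longlonglongrightarrow> 0"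
proof -
  have XE: "X n \<in> form_domain \<omega>" for n using nice nice_imp_form_domain by blast
  note [measurable] = form_domain_wgrad(2) [OF XE]
  have cau': "\<exists>N. \<forall>m\<ge>N. \<forall>n\<ge>N.
      (\<integral>\<^sup>+ x. ennreal ((norm (ivec \<omega> (X m) x - ivec \<omega> (X n) x))\<^sup>2) \<partial>lborel) \<le> ennreal \<epsilon>" if e: "\<epsilon> > 0" for \<epsilon>
  proof -
    obtain N1 where N1: "\<And>m n. m \<ge> N1 \<Longrightarrow> n \<ge> N1 \<Longrightarrow> form_Q \<omega> (X m - X n) (X m - X n) < \<epsilon> / 2"
      using cau [of "\<epsilon> / 2"] e by auto
    obtain N2 where N2: "\<And>m n. m \<ge> N2 \<Longrightarrow> n \<ge> N2 \<Longrightarrow> dist (X m) (X n) < sqrt (\<epsilon> / 2)"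
      using LIMSEQ_imp_Cauchy [OF X] e unfolding Cauchy_def by (metis half_gt_zero real_sqrt_gt_zero)
    have "(\<integral>\<^sup>+ x. ennreal ((norm (ivec \<omega> (X m) x - ivec \<omega> (X n) x))\<^sup>2) \<partial>lborel) \<le> ennreal \<epsilon>"
      if "m \<ge> max N1 N2" "n \<ge> max N1 N2" for m n
    proof -
      have "norm (X m - X n) \<le> sqrt (\<epsilon> / 2)" using N2 [of m n] that by (simp add: dist_norm)
      then have "(norm (X m - X n))\<^sup>2 \<le> (sqrt (\<epsilon> / 2))\<^sup>2" by (intro power_mono) auto
      then show ?thesis
        unfolding form_Q_plus_norm [OF XE XE] using N1 [of m n] that e by (intro ennreal_leI) simp
    qed
    then show ?thesis by blast
  qed
  obtain g r where gr: "g \<in> borel_measurable lborel" "strict_mono r"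
    "AE x in lborel. (\<lambda>k. ivec \<omega> (X (r k)) x) \<longlonglongrightarrow> g x"
    "(\<lambda>n. \<integral>\<^sup>+ x. ennreal ((norm (ivec \<omega> (X n) x - g x))\<^sup>2) \<partial>lborel) \<longlonglongrightarrow> 0"
  proof (rule riesz_fischer_L2 [of "\<lambda>n. ivec \<omega> (X n)" lborel])
    show "\<And>n. ivec \<omega> (X n) \<in> borel_measurable lborel" by measurable
  qed (use cau' in blast)+
  have gm [measurable]: "g \<in> borel_measurable borel" using gr(1) by simp
  define V where "V x = fst (snd (g x))" for x
  have [measurable]: "V \<in> borel_measurable borel"
  proof -
    have "continuous_on UNIV (\<lambda>y::real \<times> (real^2) \<times> real. fst (snd y))" by (intro continuous_intros)
    then show ?thesis unfolding V_def by (intro measurable_compose [OF gm] borel_measurable_continuous_onI)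
  qed
  have fstm [measurable]: "(\<lambda>x. fst (h x)) \<in> borel_measurable borel"
    if "h \<in> borel_measurable borel" for h :: "real^2 \<Rightarrow> real \<times> (real^2) \<times> real"
    using that by (rule measurable_compose) (intro borel_measurable_continuous_onI continuous_intros)
  \<comment> \<open>The difference \<open>D\<close> does not involve \<open>n\<close>, while its
    square integral is bounded by errors that tend to zero, one from the limit of the energy vectors
    and one from the limit in the Hilbert space.\<close>
  have first: "AE x in lborel. fst (g x) = sqrt (conf x) * chart f x"
  proof -
    define D where "D x = fst (g x) - sqrt (conf x) * chart f x" for x
    have [measurable]: "D \<in> borel_measurable borel" unfolding D_def using fstm [OF gm] by measurable
    have b: "(\<integral>\<^sup>+ x. ennreal ((D x)\<^sup>2) \<partial>lborel) \<le>
        2 * (\<integral>\<^sup>+ x. ennreal ((norm (ivec \<omega> (X n) x - g x))\<^sup>2) \<partial>lborel) + 2 * ennreal ((norm (X n - f))\<^sup>2)" for n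
    proof -
      have "AE x in lborel. ennreal ((D x)\<^sup>2) \<le>
          2 * ennreal ((norm (ivec \<omega> (X n) x - g x))\<^sup>2) + 2 * ennreal (conf x * (chart (X n - f) x)\<^sup>2)"
        using chart_lincomb [of 1 "X n" "-1" f]
      proof eventually_elim
        case (elim x)
        have f1: "fst (ivec \<omega> (X n) x) = sqrt (conf x) * chart (X n) x" by (simp add: ivec_def fvec_def)
        have nf: "norm (fst z) \<le> norm z" for z :: "real \<times> (real^2) \<times> real"
          by (metis norm_fst_le prod.collapse)
        have "D x = (fst (g x) - fst (ivec \<omega> (X n) x)) + sqrt (conf x) * chart (X n - f) x"
          using elim by (simp add: D_def f1 right_diff_distrib)
        then have "(D x)\<^sup>2 \<le> 2 * (fst (g x) - fst (ivec \<omega> (X n) x))\<^sup>2 + 2 * (sqrt (conf x) * chart (X n - f) x)\<^sup>2"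
          using norm_add_sq_le [of "fst (g x) - fst (ivec \<omega> (X n) x)" "sqrt (conf x) * chart (X n - f) x"] by simp
        also have "(fst (g x) - fst (ivec \<omega> (X n) x))\<^sup>2 \<le> (norm (ivec \<omega> (X n) x - g x))\<^sup>2"
          using nf [of "ivec \<omega> (X n) x - g x"]
          by (simp add: abs_le_square_iff [symmetric] abs_minus_commute)
        also have "(sqrt (conf x) * chart (X n - f) x)\<^sup>2 = conf x * (chart (X n - f) x)\<^sup>2"
          using conf_pos [of x] by (simp add: power_mult_distrib)
        finally have "(D x)\<^sup>2 \<le> 2 * (norm (ivec \<omega> (X n) x - g x))\<^sup>2 + 2 * (conf x * (chart (X n - f) x)\<^sup>2)"
          by simp
        then show ?case
          using conf_pos [of x] by (simp add: ennreal_leI less_imp_le flip: ennreal_mult ennreal_plus ennreal_numeral)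
      qed
      then have "(\<integral>\<^sup>+ x. ennreal ((D x)\<^sup>2) \<partial>lborel) \<le>
          (\<integral>\<^sup>+ x. 2 * ennreal ((norm (ivec \<omega> (X n) x - g x))\<^sup>2) + 2 * ennreal (conf x * (chart (X n - f) x)\<^sup>2) \<partial>lborel)"
        by (rule nn_integral_mono_AE)
      also have "\<dots> = 2 * (\<integral>\<^sup>+ x. ennreal ((norm (ivec \<omega> (X n) x - g x))\<^sup>2) \<partial>lborel)
          + 2 * (\<integral>\<^sup>+ x. ennreal (conf x * (chart (X n - f) x)\<^sup>2) \<partial>lborel)"
        by (simp add: nn_integral_add nn_integral_cmult)
      also have "(\<integral>\<^sup>+ x. ennreal (conf x * (chart (X n - f) x)\<^sup>2) \<partial>lborel) = ennreal ((norm (X n - f))\<^sup>2)"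
        unfolding norm_chart using conf_pos
        by (intro nn_integral_eq_integral integrable_chart_sq) (simp add: less_imp_le)
      finally show ?thesis .
    qed
    have "(\<lambda>n. (norm (X n - f))\<^sup>2) \<longlonglongrightarrow> (norm (f - f))\<^sup>2" by (intro tendsto_intros X)
    then have n0: "(\<lambda>n. ennreal ((norm (X n - f))\<^sup>2)) \<longlonglongrightarrow> ennreal 0" by (intro tendsto_ennrealI) simp
    have "(\<lambda>n. 2 * (\<integral>\<^sup>+ x. ennreal ((norm (ivec \<omega> (X n) x - g x))\<^sup>2) \<partial>lborel) + 2 * ennreal ((norm (X n - f))\<^sup>2))
        \<longlonglongrightarrow> 2 * 0 + 2 * ennreal 0"
      by (intro tendsto_add ennreal_tendsto_cmult gr(4) n0) auto
    then have "(\<integral>\<^sup>+ x. ennreal ((D x)\<^sup>2) \<partial>lborel) \<le> 2 * 0 + 2 * ennreal 0"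
      by (rule LIMSEQ_le_const) (use b in blast)
    then have "(\<integral>\<^sup>+ x. ennreal ((D x)\<^sup>2) \<partial>lborel) = 0" by simp
    then have "AE x in lborel. D x = 0" by (subst (asm) nn_integral_0_iff_AE) auto
    then show ?thesis by eventually_elim (simp add: D_def)
  qed
  \<comment> \<open>The third component is a fixed multiple of the first for each member of the
    sequence, a relation that passes to the pointwise limit along the subsequence; the second
    component defines \<open>V\<close>.\<close>
  have "AE x in lborel. g x = fvec \<omega> (chart f) V x"
    using first gr(3)
  proof eventually_elim
    case (elim x)
    have "(\<lambda>k. \<omega> * norm x * fst (ivec \<omega> (X (r k)) x)) \<longlonglongrightarrow> \<omega> * norm x * fst (g x)"
      by (intro tendsto_intros elim(2))
    moreover have "(\<lambda>k. snd (snd (ivec \<omega> (X (r k)) x))) \<longlonglongrightarrow> snd (snd (g x))"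
      by (intro tendsto_intros elim(2))
    moreover have "snd (snd (ivec \<omega> (X (r k)) x)) = \<omega> * norm x * fst (ivec \<omega> (X (r k)) x)" for k
      by (simp add: ivec_def fvec_def)
    ultimately have "snd (snd (g x)) = \<omega> * norm x * fst (g x)" using LIMSEQ_unique by simp
    then show ?case using elim(1) by (simp add: fvec_def V_def prod_eq_iff)
  qed
  then have "(\<integral>\<^sup>+ x. ennreal ((norm (ivec \<omega> (X n) x - fvec \<omega> (chart f) V x))\<^sup>2) \<partial>lborel)
      = (\<integral>\<^sup>+ x. ennreal ((norm (ivec \<omega> (X n) x - g x))\<^sup>2) \<partial>lborel)" for n
    by (intro nn_integral_cong_AE) (elim eventually_mono, simp)
  then have lim: "(\<lambda>n. \<integral>\<^sup>+ x. ennreal ((norm (ivec \<omega> (X n) x - fvec \<omega> (chart f) V x))\<^sup>2) \<partial>lborel) \<longlonglongrightarrow> 0"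
    using gr(4) by simp
  have "nice \<omega> (chart (X n)) (wgrad (X n))" for n
  proof -
    obtain W where W: "nice \<omega> (chart (X n)) W" using nice by blast
    have w: "weak_gradient (chart (X n)) W" using W by (simp add: nice_def)
    have "AE x in lborel. W x = wgrad (X n) x"
      using weak_gradient_unique [OF w form_domain_wgrad(1) [OF XE]] .
    note [measurable] = weak_gradient_measurable(2) [OF w] weak_gradient_measurable(2) [OF form_domain_wgrad(1) [OF XE]]
    show ?thesis
    \<comment> \<open>The limit of a constant sequence: it exchanges the gradient \<open>W\<close>
      for \<open>wgrad (X n)\<close>, which is equal to it almost everywhere.\<close>
    proof (rule nice_limit [where U = "\<lambda>_. chart (X n)" and V = "\<lambda>_. W"])
      have "(\<integral>\<^sup>+ x. ennreal ((norm (fvec \<omega> (chart (X n)) W x - fvec \<omega> (chart (X n)) (wgrad (X n)) x))\<^sup>2) \<partial>lborel)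
          = (\<integral>\<^sup>+ x. 0 \<partial>(lborel :: (real^2) measure))"
        by (rule nn_integral_cong_AE, use \<open>AE x in lborel. W x = wgrad (X n) x\<close> in eventually_elim)
          (simp add: fvec_def)
      then show "(\<lambda>na. \<integral>\<^sup>+ x. ennreal ((norm (fvec \<omega> (chart (X n)) W x - fvec \<omega> (chart (X n)) (wgrad (X n)) x))\<^sup>2) \<partial>lborel)
          \<longlonglongrightarrow> 0" by simp
    qed (use W in auto)
  qed
  then have nf: "nice \<omega> (chart f) V"
    by (rule nice_limit) (use lim in \<open>auto simp: ivec_def\<close>)
  then have fE: "f \<in> form_domain \<omega>" by (rule nice_imp_form_domain)
  have Vw: "AE x in lborel. V x = wgrad f x"
    using nf weak_gradient_unique [OF _ form_domain_wgrad(1) [OF fE]] by (simp add: nice_def)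
  have eq: "(\<integral>\<^sup>+ x. ennreal ((norm (ivec \<omega> (X n) x - fvec \<omega> (chart f) V x))\<^sup>2) \<partial>lborel)
      = ennreal (form_Q \<omega> (X n - f) (X n - f) + (norm (X n - f))\<^sup>2)" for n
    unfolding form_Q_plus_norm [OF XE fE, symmetric]
    by (rule nn_integral_cong_AE, use Vw in eventually_elim) (simp add: ivec_def fvec_def)
  have dE: "X n - f \<in> form_domain \<omega>" for n using XE fE subspace_form_domain by (simp add: subspace_diff)
  have "(\<lambda>n. ennreal (form_Q \<omega> (X n - f) (X n - f))) \<longlonglongrightarrow> 0"
  proof (rule tendsto_sandwich [OF always_eventually always_eventually tendsto_const lim])
    have "ennreal (form_Q \<omega> (X n - f) (X n - f))
        \<le> (\<integral>\<^sup>+ x. ennreal ((norm (ivec \<omega> (X n) x - fvec \<omega> (chart f) V x))\<^sup>2) \<partial>lborel)" for n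
      unfolding eq by (intro ennreal_leI) simp
    then show "\<forall>n. ennreal (form_Q \<omega> (X n - f) (X n - f))
        \<le> (\<integral>\<^sup>+ x. ennreal ((norm (ivec \<omega> (X n) x - fvec \<omega> (chart f) V x))\<^sup>2) \<partial>lborel)" by blast
  qed simp
  then have "(\<lambda>n. ennreal (form_Q \<omega> (X n - f) (X n - f))) \<longlonglongrightarrow> ennreal 0" by (simp only: ennreal_0)
  then have "(\<lambda>n. form_Q \<omega> (X n - f) (X n - f)) \<longlonglongrightarrow> 0"
    by (rule tendsto_ennreal_iff [THEN iffD1, rotated -1]) (simp_all add: form_Q_nonneg dE)
  with fE show ?thesis by blast
qed

subsection \<open>The basis of eigenfunctions\<close>

text \<open>The excluded triples are those whose eigenfunction is identically zero.\<close>

definition eidx :: "(nat \<times> nat \<times> bool) set" where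
  "eidx = {(m, n, \<sigma>). n = 0 \<longrightarrow> \<not> \<sigma>}"

definition enorm :: "real \<Rightarrow> nat \<times> nat \<times> bool \<Rightarrow> real" where
  "enorm \<omega> = (\<lambda>(m, n, \<sigma>). sqrt (\<integral>x. conf x * (ef \<omega> n \<sigma> m x)\<^sup>2 \<partial>lborel))"

definition evec :: "real \<Rightarrow> nat \<times> nat \<times> bool \<Rightarrow> L2_S2" where
  "evec \<omega> = (\<lambda>(m, n, \<sigma>). cls (\<lambda>x. (1 / enorm \<omega> (m, n, \<sigma>)) * ef \<omega> n \<sigma> m x))"

lemma chart_evec: "AE x in lborel. chart (evec \<omega> (m, n, \<sigma>)) x = (1 / enorm \<omega> (m, n, \<sigma>)) * ef \<omega> n \<sigma> m x"
  unfolding evec_def prod.case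
proof (rule chart_cls)
  show "integrable lborel (\<lambda>x. conf x * ((1 / enorm \<omega> (m, n, \<sigma>)) * ef \<omega> n \<sigma> m x)\<^sup>2)"
    using integrable_mult_right [OF integrable_conf_ef_sq [of \<omega> n \<sigma> m], of "(1 / enorm \<omega> (m, n, \<sigma>))\<^sup>2"]
    unfolding power_mult_distrib by (simp only: mult.left_commute)
qed measurable

lemma inner_evec:
  "f \<bullet> evec \<omega> (m, n, \<sigma>) = (\<integral>x. conf x * (chart f x * ef \<omega> n \<sigma> m x) \<partial>lborel) / enorm \<omega> (m, n, \<sigma>)"
proof -
  have "f \<bullet> evec \<omega> (m, n, \<sigma>) = (\<integral>x. conf x * (chart f x * ef \<omega> n \<sigma> m x) / enorm \<omega> (m, n, \<sigma>) \<partial>lborel)"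
    unfolding inner_chart
  proof (rule integral_cong_AE)
    show "AE x in lborel. conf x * (chart f x * chart (evec \<omega> (m, n, \<sigma>)) x)
        = conf x * (chart f x * ef \<omega> n \<sigma> m x) / enorm \<omega> (m, n, \<sigma>)"
      using chart_evec [of \<omega> m n \<sigma>] by eventually_elim simp
  qed measurable
  then show ?thesis by simp
qed

lemma inner_evec_evec: "evec \<omega> (m, n, \<sigma>) \<bullet> evec \<omega> (m', n', \<sigma>') =
    (\<integral>x. conf x * (ef \<omega> n \<sigma> m x * ef \<omega> n' \<sigma>' m' x) \<partial>lborel) / (enorm \<omega> (m, n, \<sigma>) * enorm \<omega> (m', n', \<sigma>'))"
proof -
  have "(\<integral>x. conf x * (chart (evec \<omega> (m, n, \<sigma>)) x * ef \<omega> n' \<sigma>' m' x) \<partial>lborel)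
      = (\<integral>x. conf x * (ef \<omega> n \<sigma> m x * ef \<omega> n' \<sigma>' m' x) / enorm \<omega> (m, n, \<sigma>) \<partial>lborel)"
  proof (rule integral_cong_AE)
    show "AE x in lborel. conf x * (chart (evec \<omega> (m, n, \<sigma>)) x * ef \<omega> n' \<sigma>' m' x)
        = conf x * (ef \<omega> n \<sigma> m x * ef \<omega> n' \<sigma>' m' x) / enorm \<omega> (m, n, \<sigma>)"
      using chart_evec [of \<omega> m n \<sigma>] by eventually_elim simp
  qed measurable
  then show ?thesis unfolding inner_evec by simp
qed

lemma enorm_pos: "(m, n, \<sigma>) \<in> eidx \<Longrightarrow> 0 < enorm \<omega> (m, n, \<sigma>)"
  using ef_norm_pos [of n \<sigma>] by (simp add: enorm_def eidx_def)

lemma hilbert_basis_evec: "hilbert_basis (evec \<omega>) eidx"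
proof
  fix i j assume ij: "i \<in> eidx" "j \<in> eidx"
  obtain m n \<sigma> m' n' \<sigma>' where i: "i = (m, n, \<sigma>)" and j: "j = (m', n', \<sigma>')" by (metis prod_cases3)
  show "evec \<omega> i \<bullet> evec \<omega> j = (if i = j then 1 else 0)"
  proof (cases "i = j")
    case True
    have "(\<integral>x. conf x * (ef \<omega> n \<sigma> m x * ef \<omega> n \<sigma> m x) \<partial>lborel) = enorm \<omega> i * enorm \<omega> i"
      using ef_norm_pos [of n \<sigma> \<omega> m] ij(1) unfolding enorm_def i prod.case
      by (subst real_sqrt_mult_self) (simp add: eidx_def power2_eq_square)
    then show ?thesis
      using enorm_pos [of m n \<sigma> \<omega>] ij(1) True j unfolding i by (simp add: inner_evec_evec)
  next
    case False
    then show ?thesis using ij ef_orthogonal [of m n \<sigma> m' n' \<sigma>'] by (simp add: i j inner_evec_evec eidx_def)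
  qed
next
  fix f assume f: "\<And>i. i \<in> eidx \<Longrightarrow> f \<bullet> evec \<omega> i = 0"
  have "orthogonal_to_ef \<omega> (chart f)"
  proof
    show "(\<integral>x. conf x * (chart f x * ef \<omega> n \<sigma> m x) \<partial>lborel) = 0" for n \<sigma> m
    proof (cases "(m, n, \<sigma>) \<in> eidx")
      case True
      then show ?thesis using f [OF True] enorm_pos [OF True, of \<omega>] by (simp add: inner_evec)
    next
      case False
      then show ?thesis by (simp add: eidx_def ef_def harm_0)
    qed
  qed (simp_all add: integrable_chart_sq)
  then have "AE x in lborel. chart f x = 0" by (rule orthogonal_to_ef.AE_F_eq_0)
  moreover have "AE x in lborel. chart 0 x = 0" using chart_lincomb [of 0 0 0 0] by eventually_elim simp
  ultimately have "AE x in lborel. chart f x = chart 0 x" by eventually_elim simp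
  then show "f = 0" by (rule L2_S2_eqI)
qed

lemma nice_evec:
  "nice \<omega> (chart (evec \<omega> (m, n, \<sigma>))) (\<lambda>x. (1 / enorm \<omega> (m, n, \<sigma>)) *\<^sub>R grad (ef \<omega> n \<sigma> m) x)"
proof (rule nice_cong_AE)
  show "nice \<omega> (\<lambda>x. (1 / enorm \<omega> (m, n, \<sigma>)) * ef \<omega> n \<sigma> m x) (\<lambda>x. (1 / enorm \<omega> (m, n, \<sigma>)) *\<^sub>R grad (ef \<omega> n \<sigma> m) x)"
    using nice_lincomb [OF nice_ef [of \<omega> n \<sigma> m] nice_ef [of \<omega> n \<sigma> m], of "1 / enorm \<omega> (m, n, \<sigma>)" 0] by simp
  show "AE x in lborel. (1 / enorm \<omega> (m, n, \<sigma>)) * ef \<omega> n \<sigma> m x = chart (evec \<omega> (m, n, \<sigma>)) x"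
    using chart_evec [of \<omega> m n \<sigma>] by eventually_elim simp
qed measurable

lemma nice_span: "f \<in> span (range (evec \<omega>)) \<Longrightarrow> \<exists>V. nice \<omega> (chart f) V"
proof (induction rule: span_induct_alt)
  case base
  then show ?case using nice_chart_lincomb [OF nice_evec [of \<omega> 0 0 False] nice_evec [of \<omega> 0 0 False], of 0 0] by auto
next
  case (step c f g)
  then obtain i V where i: "f = evec \<omega> i" and V: "nice \<omega> (chart g) V" by blast
  obtain m n \<sigma> where "i = (m, n, \<sigma>)" by (metis prod_cases3)
  with nice_chart_lincomb [OF nice_evec [of \<omega> m n \<sigma>] V, of c 1] show ?case by (auto simp: i)
qed

lemma form_Q_evec:
  assumes f: "f \<in> form_domain \<omega>"
  shows "form_Q \<omega> f (evec \<omega> (m, n, \<sigma>)) = eigval \<omega> m n * (f \<bullet> evec \<omega> (m, n, \<sigma>))"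
proof -
  let ?e = "ef \<omega> n \<sigma> m" and ?c = "1 / enorm \<omega> (m, n, \<sigma>)"
  note w = form_domain_wgrad [OF f]
  have we: "weak_gradient (chart (evec \<omega> (m, n, \<sigma>))) (\<lambda>x. ?c *\<^sub>R grad ?e x)"
    using nice_evec by (simp add: nice_def)
  note [measurable] = weak_gradient_measurable(2) [OF w(1)] weak_gradient_measurable(2) [OF we]
    weak_gradient_measurable(2) [OF weak_gradient_ef]
  have "form_Q \<omega> f (evec \<omega> (m, n, \<sigma>)) =
      (\<integral>x. ?c * (wgrad f x \<bullet> grad ?e x + \<omega>\<^sup>2 * (norm x)\<^sup>2 * conf x * (chart f x * ?e x)) \<partial>lborel)"
    unfolding form_Q_eq [OF w(1) we]
  proof (rule integral_cong_AE)
    show "AE x in lborel. wgrad f x \<bullet> (?c *\<^sub>R grad ?e x)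
        + \<omega>\<^sup>2 * (norm x)\<^sup>2 * conf x * (chart f x * chart (evec \<omega> (m, n, \<sigma>)) x)
        = ?c * (wgrad f x \<bullet> grad ?e x + \<omega>\<^sup>2 * (norm x)\<^sup>2 * conf x * (chart f x * ?e x))"
      using chart_evec [of \<omega> m n \<sigma>]
    proof eventually_elim
      case (elim x)
      show ?case unfolding elim by (simp add: distrib_left)
    qed
  qed measurable
  also have "\<dots> = ?c * (eigval \<omega> m n * (\<integral>x. conf x * (chart f x * ?e x) \<partial>lborel))"
    unfolding integral_mult_right_zero
      weak_eigen_equation(1) [OF w(1) w(3) [unfolded ivec_def]] by (rule refl)
  finally show ?thesis by (simp add: inner_evec)
qed

lemma (in hilbert_basis) reindex: "bij_betw p J K \<Longrightarrow> hilbert_basis (\<lambda>i. e (p i)) J"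
proof
  assume p: "bij_betw p J K"
  show "e (p i) \<bullet> e (p j) = (if i = j then 1 else 0)" if "i \<in> J" "j \<in> J" for i j
    using p that orthonormal [of "p i" "p j"] by (auto simp: bij_betw_def inj_on_def)
  show "f = 0" if "\<And>i. i \<in> J \<Longrightarrow> f \<bullet> e (p i) = 0" for f
    using p that by (intro total) (auto simp: bij_betw_def)
qed

text \<open>The basis is enumerated by the natural numbers so that the partial sums of an expansion
  form a sequence, to which closedness applies.\<close>

lemma form_basis_evec:
  assumes p: "bij_betw p UNIV eidx"
  shows "form_basis (\<lambda>i. evec \<omega> (p i)) (\<lambda>i. case p i of (m, n, \<sigma>) \<Rightarrow> eigval \<omega> m n) (form_domain \<omega>) (form_Q \<omega>)"
proof -
  have E: "evec \<omega> i \<in> form_domain \<omega>" for i by (cases i) (simp add: nice_imp_form_domain [OF nice_evec])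
  interpret hilbert_basis "\<lambda>i. evec \<omega> (p i)" UNIV by (rule hilbert_basis.reindex [OF hilbert_basis_evec p])
  show ?thesis
  proof
    show "subspace (form_domain \<omega>)" by (rule subspace_form_domain)
    show "evec \<omega> (p i) \<in> form_domain \<omega>" for i by (rule E)
    fix f assume f: "f \<in> form_domain \<omega>"
    show "0 \<le> form_Q \<omega> f f" by (rule form_Q_nonneg [OF f])
    show "form_Q \<omega> f (evec \<omega> (p i)) = (case p i of (m, n, \<sigma>) \<Rightarrow> eigval \<omega> m n) * (f \<bullet> evec \<omega> (p i))" for i
      by (cases "p i") (simp add: form_Q_evec [OF f])
    fix g assume g: "g \<in> form_domain \<omega>"
    show "form_Q \<omega> f g = form_Q \<omega> g f"
      unfolding form_Q_ivec [OF f g] form_Q_ivec [OF g f] by (simp only: inner_commute)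
    show "form_Q \<omega> f (r *\<^sub>R g) = r * form_Q \<omega> f g" for r
      using form_Q_lincomb [OF f g g, of r 0] by simp
    show "form_Q \<omega> f (g + h) = form_Q \<omega> f g + form_Q \<omega> f h" if "h \<in> form_domain \<omega>" for h
      using form_Q_lincomb [OF f g that, of 1 1] by simp
  next
    fix X f assume X: "\<And>n. X n \<in> span (range (\<lambda>i. evec \<omega> (p i)))" "X \<longlonglongrightarrow> f"
      "\<And>\<epsilon>. \<epsilon> > 0 \<Longrightarrow> \<exists>N::nat. \<forall>m\<ge>N. \<forall>n\<ge>N. form_Q \<omega> (X m - X n) (X m - X n) < \<epsilon>"
    have "X n \<in> span (range (evec \<omega>))" for n
      using X(1) span_mono [of "range (\<lambda>i. evec \<omega> (p i))" "range (evec \<omega>)"] by blast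
    then show "f \<in> form_domain \<omega> \<and> (\<lambda>n. form_Q \<omega> (X n - f) (X n - f)) \<longlonglongrightarrow> 0"
      using X(2,3) by (intro form_closed nice_span) 
  qed
qed

lemma (in hilbert_basis) summable_shift:
  assumes "(\<lambda>i. (l i)\<^sup>2 * (f \<bullet> e i)\<^sup>2) summable_on K"
  shows "(\<lambda>i. (l i + c)\<^sup>2 * (f \<bullet> e i)\<^sup>2) summable_on K"
proof (rule summable_on_comparison_test)
  show "(\<lambda>i. 2 * ((l i)\<^sup>2 * (f \<bullet> e i)\<^sup>2) + 2 * c\<^sup>2 * (f \<bullet> e i)\<^sup>2) summable_on K"
    using assms by (intro summable_on_add summable_on_cmult_right summable_coeffs)
  show "(l i + c)\<^sup>2 * (f \<bullet> e i)\<^sup>2 \<le> 2 * ((l i)\<^sup>2 * (f \<bullet> e i)\<^sup>2) + 2 * c\<^sup>2 * (f \<bullet> e i)\<^sup>2" for i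
    using mult_right_mono [of "(l i + c)\<^sup>2" "2 * (l i)\<^sup>2 + 2 * c\<^sup>2" "(f \<bullet> e i)\<^sup>2"]
      norm_add_sq_le [of "l i" c] by (simp add: distrib_right mult.assoc)
qed auto

lemma countable_eidx: obtains p where "bij_betw p (UNIV :: nat set) eidx"
proof -
  have "(\<lambda>m. (m, 0, False)) ` UNIV \<subseteq> eidx" by (auto simp: eidx_def)
  moreover have "inj (\<lambda>m::nat. (m, 0::nat, False))" by (simp add: inj_on_def)
  ultimately have "infinite eidx" by (meson infinite_UNIV_nat infinite_super finite_imageD)
  then show thesis using that bij_betw_from_nat_into [of eidx] by blast
qed

subsection \<open>Summation of the eigenvalues\<close>

text \<open>\<open>aexp \<omega> n\<close> is at least \<omega>, so the product in
  \<open>eigval_aexp\<close> is at least \<omega> (\<omega> + 1), from which \<omega>^2 is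
  subtracted.\<close>

lemma eigval_ge: "\<omega> \<ge> 0 \<Longrightarrow> \<omega> \<le> eigval \<omega> m n"
proof -
  assume \<omega>: "\<omega> \<ge> 0"
  have "sqrt (4 * \<omega>\<^sup>2) \<le> sqrt ((real n)\<^sup>2 + 4 * \<omega>\<^sup>2)" by (intro real_sqrt_le_mono) simp
  then have "\<omega> \<le> aexp \<omega> n" using \<omega> by (simp add: aexp_def real_sqrt_mult)
  then have "\<omega> * (\<omega> + 1) \<le> (aexp \<omega> n + real m) * (aexp \<omega> n + real m + 1)"
    using \<omega> by (intro mult_mono) auto
  then show ?thesis unfolding eigval_aexp by (simp add: power2_eq_square distrib_left)
qed

lemma eigval_0: "\<omega> \<ge> 0 \<Longrightarrow> eigval \<omega> 0 0 = \<omega>"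
  unfolding eigval_aexp by (simp add: aexp_def real_sqrt_mult power2_eq_square algebra_simps)

lemma has_sum_eidx:
  assumes f: "\<And>m n. 0 \<le> f m n" and s: "((\<lambda>(m, n). eigmult m n * f m n) has_sum S) UNIV"
  shows "((\<lambda>(m, n, \<sigma>). f m n) has_sum S) eidx"
proof -
  define B where "B = (\<lambda>(m::nat, n::nat). if n = 0 then {False} else UNIV)"
  have b: "((\<lambda>\<sigma>. (\<lambda>((m, n), \<sigma>). f m n) (x, \<sigma>)) has_sum (\<lambda>(m, n). eigmult m n * f m n) x) (B x)" for x
    by (cases x) (auto simp: B_def eigmult_def UNIV_bool intro!: has_sum_finiteI)
  have "((\<lambda>((m, n), \<sigma>). f m n) has_sum S) (Sigma UNIV B)"
  proof (rule has_sum_SigmaI [OF b s])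
    show "(\<lambda>((m, n), \<sigma>). f m n) summable_on Sigma UNIV B"
      by (rule summable_on_SigmaI [OF b]) (use s f in \<open>auto simp: summable_on_def\<close>)
  qed
  then have 1: "((\<lambda>x. (\<lambda>(m, n, \<sigma>). f m n) ((\<lambda>((m, n), \<sigma>). (m, n, \<sigma>)) x)) has_sum S) (Sigma UNIV B)"
    by (rule has_sum_cong [THEN iffD1, rotated]) auto
  have "bij_betw (\<lambda>((m, n), \<sigma>). (m, n, \<sigma>)) (Sigma UNIV B) eidx"
    by (rule bij_betwI [of _ _ _ "\<lambda>(m, n, \<sigma>). ((m, n), \<sigma>)"]) (auto simp: B_def eidx_def split: if_splits)
  from has_sum_reindex_bij_betw [OF this, THEN iffD1, OF 1] show ?thesis .
qed

lemma summable_on_geometric_prod: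
  fixes r :: real
  assumes "0 \<le> r" "r < 1"
  shows "(\<lambda>(m, n). r ^ m * r ^ n) summable_on (UNIV :: (nat \<times> nat) set)"
proof -
  have g: "((\<lambda>n. r ^ n) has_sum (1 / (1 - r))) UNIV"
    using assms geometric_sums [of r] by (intro sums_nonneg_imp_has_sum) auto
  have "(\<lambda>(m, n). r ^ m * r ^ n) summable_on (UNIV \<times> UNIV :: (nat \<times> nat) set)"
  proof (rule summable_on_SigmaI)
    show "((\<lambda>n. case (m, n) of (m, n) \<Rightarrow> r ^ m * r ^ n) has_sum r ^ m * (1 / (1 - r))) UNIV" for m
      using has_sum_cmult_right [OF g] by simp
    show "(\<lambda>m. r ^ m * (1 / (1 - r))) summable_on UNIV"
      using g by (intro summable_on_cmult_left) (auto simp: summable_on_def)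
  qed (use assms in auto)
  then show ?thesis by simp
qed

lemma summable_on_theta:
  assumes t: "t > 0"
  shows "(\<lambda>(m, n). eigmult m n * exp (- t * (real m + (real n + 1 + sqrt ((real n)\<^sup>2 + 4 * \<omega>\<^sup>2)) / 2)\<^sup>2))
      summable_on UNIV"
proof (rule summable_on_comparison_test)
  show "(\<lambda>x. 2 * (case x of (m, n) \<Rightarrow> exp (- t) ^ m * exp (- t) ^ n)) summable_on UNIV"
    using t by (intro summable_on_cmult_right summable_on_geometric_prod) auto
  have "eigmult m n * exp (- t * (real m + (real n + 1 + sqrt ((real n)\<^sup>2 + 4 * \<omega>\<^sup>2)) / 2)\<^sup>2)
      \<le> 2 * (exp (- t) ^ m * exp (- t) ^ n)" for m n
  proof (rule mult_mono)
    let ?x = "real m + (real n + 1 + sqrt ((real n)\<^sup>2 + 4 * \<omega>\<^sup>2)) / 2"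
    \<comment> \<open>The 1/2 outweighs the 1/4 lost in x <= x^2 + 1/4. A square is thereby at least
      m + n, and a product of two geometric series is a majorant.\<close>
    have "real m + real n + 1 / 2 \<le> ?x" using aexp_ge [of n \<omega>] unfolding aexp_def by (simp add: field_simps)
    moreover have "x \<le> x\<^sup>2 + 1 / 4" for x :: real
      using zero_le_power2 [of "x - 1 / 2"] by (simp add: power2_eq_square algebra_simps)
    note this [of ?x]
    ultimately have "real m + real n \<le> ?x\<^sup>2" by linarith
    then have "exp (- t * ?x\<^sup>2) \<le> exp (- t * (real m + real n))" using t by simp
    also have "\<dots> = exp (- t) ^ m * exp (- t) ^ n"
      by (simp add: exp_of_nat_mult [symmetric] exp_add [symmetric] algebra_simps)
    finally show "exp (- t * ?x\<^sup>2) \<le> exp (- t) ^ m * exp (- t) ^ n" .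
  qed (auto simp: eigmult_def)
  then show "(case x of (m, n) \<Rightarrow> eigmult m n * exp (- t * (real m + (real n + 1 + sqrt ((real n)\<^sup>2 + 4 * \<omega>\<^sup>2)) / 2)\<^sup>2))
      \<le> 2 * (case x of (m, n) \<Rightarrow> exp (- t) ^ m * exp (- t) ^ n)" for x
    by (cases x) simp
qed (auto simp: eigmult_def)

text \<open>The constants complete a square: \<omega>^2 + 1/4 from the eigenvalue and \<omega> from
  the shift add up to (\<omega> + 1/2)^2.\<close>

lemma exp_eigval: "exp (- t * (eigval \<omega> m n - \<omega>)) = exp (t * (\<omega> + 1 / 2)\<^sup>2) *
    exp (- t * (real m + (real n + 1 + sqrt ((real n)\<^sup>2 + 4 * \<omega>\<^sup>2)) / 2)\<^sup>2)"
proof -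
  have "eigval \<omega> m n - \<omega> = (real m + (real n + 1 + sqrt ((real n)\<^sup>2 + 4 * \<omega>\<^sup>2)) / 2)\<^sup>2 - (\<omega> + 1 / 2)\<^sup>2"
    unfolding eigval_def power2_sum [of \<omega>] by (simp add: power2_eq_square)
  then show ?thesis unfolding mult_exp_exp by (simp only: right_diff_distrib) simp
qed

theorem mainTheorem2:
  fixes \<omega> t :: real
  assumes "\<omega> \<ge> 0" and "t > 0"
  shows "is_ground_state_energy (L_domain \<omega>) (L_op \<omega>) \<omega> \<and>
    (\<lambda>(m, n). eigmult m n * exp (- t * (eigval \<omega> m n - \<omega>))) summable_on UNIV \<and>
    (\<lambda>(m, n). eigmult m n * exp (- t * (real m + (real n + 1 + sqrt ((real n)\<^sup>2 + 4 * \<omega>\<^sup>2)) / 2)\<^sup>2))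
      summable_on UNIV \<and>
    (\<exists>!T. is_function_of_operator (L_domain \<omega>) (\<lambda>f. L_op \<omega> f - \<omega> *\<^sub>R f) (\<lambda>s. exp (- t * s)) T) \<and>
    (\<forall>T. is_function_of_operator (L_domain \<omega>) (\<lambda>f. L_op \<omega> f - \<omega> *\<^sub>R f) (\<lambda>s. exp (- t * s)) T \<longrightarrow>
       has_trace T (\<Sum>\<^sub>\<infinity>(m, n). eigmult m n * exp (- t * (eigval \<omega> m n - \<omega>)))) \<and>
    (\<Sum>\<^sub>\<infinity>(m, n). eigmult m n * exp (- t * (eigval \<omega> m n - \<omega>))) =
      exp (t * (\<omega> + 1 / 2)\<^sup>2) *
      (\<Sum>\<^sub>\<infinity>(m, n). eigmult m n *
         exp (- t * (real m + (real n + 1 + sqrt ((real n)\<^sup>2 + 4 * \<omega>\<^sup>2)) / 2)\<^sup>2))"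
proof -
  let ?f = "\<lambda>(m, n). eigmult m n * exp (- t * (eigval \<omega> m n - \<omega>))"
  let ?g = "\<lambda>(m, n). eigmult m n * exp (- t * (real m + (real n + 1 + sqrt ((real n)\<^sup>2 + 4 * \<omega>\<^sup>2)) / 2)\<^sup>2)"
  have fg: "?f = (\<lambda>x. exp (t * (\<omega> + 1 / 2)\<^sup>2) * ?g x)"
    unfolding exp_eigval by (simp only: fun_eq_iff split_paired_All prod.case mult.left_commute simp_thms)
  have g: "?g summable_on UNIV" by (rule summable_on_theta [OF assms(2)])
  have f: "?f summable_on UNIV" unfolding fg by (intro summable_on_cmult_right g)
  have eq: "infsum ?f UNIV = exp (t * (\<omega> + 1 / 2)\<^sup>2) * infsum ?g UNIV"
    unfolding fg by (rule infsum_cmult_right')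
  obtain p where p: "bij_betw p (UNIV :: nat set) eidx" by (rule countable_eidx)
  define e where "e i = evec \<omega> (p i)" for i
  define l where "l i = (case p i of (m, n, \<sigma>) \<Rightarrow> eigval \<omega> m n)" for i
  interpret fb: form_basis e l "form_domain \<omega>" "form_Q \<omega>"
    using form_basis_evec [OF p, of \<omega>] unfolding e_def [abs_def] l_def [abs_def] .
  have D: "fb.D = L_domain \<omega>" by (simp add: fb.D_def L_domain_def)
  have L: "fb.L = L_op \<omega>" by (simp add: fun_eq_iff fb.L_def L_op_def)
  have dom: "L_domain \<omega> = {g. (\<lambda>i. (l i)\<^sup>2 * (g \<bullet> e i)\<^sup>2) summable_on UNIV}"
    using fb.D_eq unfolding D .
  have coeff: "L_op \<omega> g \<bullet> e i = l i * (g \<bullet> e i)" if "g \<in> L_domain \<omega>" for g i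
    using fb.inner_L [of g i] that unfolding D L .
  have l_ge: "\<omega> \<le> l i" for i using assms(1) by (cases "p i") (simp add: l_def eigval_ge)
  \<comment> \<open>The functional calculus concerns the shifted operator, with eigenvalues
    \<open>l i - \<omega>\<close>; the shift leaves the domain as it is.\<close>
  interpret sb: spectral_basis e UNIV "\<lambda>i. l i - \<omega>" by unfold_locales
  have dom': "L_domain \<omega> = {f. (\<lambda>i. (l i - \<omega>)\<^sup>2 * (f \<bullet> e i)\<^sup>2) summable_on UNIV}"
  proof -
    have "(\<lambda>i. (l i - \<omega>)\<^sup>2 * (f \<bullet> e i)\<^sup>2) summable_on UNIV \<longleftrightarrow> (\<lambda>i. (l i)\<^sup>2 * (f \<bullet> e i)\<^sup>2) summable_on UNIV" for f
      using fb.summable_shift [of l f "- \<omega>"] fb.summable_shift [of "\<lambda>i. l i - \<omega>" f \<omega>] by auto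
    then show ?thesis unfolding dom by simp
  qed
  have coeff': "(L_op \<omega> f - \<omega> *\<^sub>R f) \<bullet> e i = (l i - \<omega>) * (f \<bullet> e i)" if "f \<in> L_domain \<omega>" for f i
    using coeff [OF that] by (simp add: inner_diff_left left_diff_distrib)
  \<comment> \<open>The exponential is unbounded on the real line but at most 1 on the eigenvalues,
    because none of them lies below \<omega>.\<close>
  have \<phi>: "(\<lambda>s. exp (- t * s)) \<in> borel_measurable borel" "\<bar>exp (- t * (l i - \<omega>))\<bar> \<le> 1" for i
    using l_ge assms(2) by auto
  have basis_dom: "e i \<in> L_domain \<omega>" for i
    by (rule sb.basis_in_domain [OF dom' coeff' \<phi>]) simp_all
  have basis: "T (e i) = exp (- t * (l i - \<omega>)) *\<^sub>R e i"
    if "is_function_of_operator (L_domain \<omega>) (\<lambda>f. L_op \<omega> f - \<omega> *\<^sub>R f) (\<lambda>s. exp (- t * s)) T" for T i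
    by (rule sb.function_of_operator_basis [OF dom' coeff' \<phi> that]) simp_all
  have ex1: "\<exists>!T. is_function_of_operator (L_domain \<omega>) (\<lambda>f. L_op \<omega> f - \<omega> *\<^sub>R f) (\<lambda>s. exp (- t * s)) T"
    by (rule sb.ex1_function_of_operator [OF dom' coeff' \<phi>]) simp_all
  have "((\<lambda>(m, n, \<sigma>). exp (- t * (eigval \<omega> m n - \<omega>))) has_sum infsum ?f UNIV) eidx"
    by (rule has_sum_eidx) (use f in \<open>simp_all only: has_sum_infsum exp_ge_zero\<close>)
  then have "((\<lambda>i. (\<lambda>(m, n, \<sigma>). exp (- t * (eigval \<omega> m n - \<omega>))) (p i)) has_sum infsum ?f UNIV) UNIV"
    by (subst has_sum_reindex_bij_betw [OF p])
  then have sum: "((\<lambda>i. exp (- t * (l i - \<omega>))) has_sum infsum ?f UNIV) UNIV"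
    by (rule has_sum_cong [THEN iffD1, rotated]) (simp add: l_def split: prod.split)
  have trace: "has_trace T (infsum ?f UNIV)"
    if "is_function_of_operator (L_domain \<omega>) (\<lambda>f. L_op \<omega> f - \<omega> *\<^sub>R f) (\<lambda>s. exp (- t * s)) T" for T
    by (rule fb.has_trace_diag [OF basis [OF that] _ sum]) simp
  have "is_ground_state_energy (L_domain \<omega>) (L_op \<omega>) \<omega>"
    unfolding is_ground_state_energy_def is_eigenvalue_def
  proof (intro conjI allI impI)
    have "(0, 0, False) \<in> eidx" by (simp add: eidx_def)
    then obtain i where i: "p i = (0, 0, False)" using p by (metis bij_betw_def imageE)
    have "L_op \<omega> (e i) = \<omega> *\<^sub>R e i"
    proof (rule fb.eqI)
      show "L_op \<omega> (e i) \<bullet> e j = \<omega> *\<^sub>R e i \<bullet> e j" for j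
        using i assms(1) by (cases "i = j") (simp_all add: coeff basis_dom fb.orthonormal l_def eigval_0)
    qed
    moreover have "e i \<noteq> 0" using fb.orthonormal [of i i] by auto
    ultimately show "\<exists>f\<in>L_domain \<omega>. f \<noteq> 0 \<and> L_op \<omega> f = \<omega> *\<^sub>R f" using basis_dom by blast
  next
    fix \<nu> assume "\<exists>f\<in>L_domain \<omega>. f \<noteq> 0 \<and> L_op \<omega> f = \<nu> *\<^sub>R f"
    then obtain f where f: "f \<in> L_domain \<omega>" "f \<noteq> 0" "L_op \<omega> f = \<nu> *\<^sub>R f" by blast
    obtain i where "f \<bullet> e i \<noteq> 0" using f(2) fb.total [of f] by blast
    then have "\<nu> = l i" using coeff [OF f(1), of i] by (simp add: f(3))
    then show "\<omega> \<le> \<nu>" using l_ge by simp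
  qed
  with f g eq ex1 trace show ?thesis by blast
qed

end
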